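(* Let $(\mathcal{G},\mu)$ be a p.m.p. groupoid and let $\Omega$ be a generating subset of $I_{\mathcal{G}}$. Then $s(\mathcal{G})=s(\Omega)$ and $\underline{s}(\mathcal{G})=\underline{s}(\Omega)$.
   Context: A discrete measurable groupoid is a groupoid $\mathcal{G}$ (source map $\mathfrak{s}$, range map $\mathfrak{r}$, unit space $\mathcal{G}^0$; $xy$ is defined when $\mathfrak{s}(x)=\mathfrak{r}(y)$) with the structure of a standard Borel space such that $\mathcal{G}^0$ is Borel, the source, range, multiplication and inversion maps are Borel, and $\mathfrak{s}^{-1}(x)$ is countable for every $x\in\mathcal{G}^0$. A probability-measure-preserving (p.m.p.) groupoid is a discrete measurable groupoid together with a Borel probability measure $\mu$ on $\mathcal{G}^0$ such that $\int_{\mathcal{G}^0}|\mathfrak{s}^{-1}(x)\cap B|\,d\mu(x)=\int_{\mathcal{G}^0}|\mathfrak{r}^{-1}(x)\cap B|\,d\mu(x)$ for every Borel $B\subseteq\mathcal{G}$; this common value defines a $\sigma$-finite Borel measure on $\mathcal{G}$, again denoted $\mu$. For a Borel set $B\subseteq\mathcal{G}$ on which $\mathfrak{s}$ and $\mathfrak{r}$ are injective, $s_B$ is the partial isometry on $L^2(\mathcal{G},\mu)$ given by $s_B\xi(x)=\xi(y^{-1})$ if $y$ is the element of $\mathfrak{r}^{-1}(\mathfrak{s}(x))$ with $xy\in B$, and $s_B\xi(x)=0$ if there is no such $y$. $I_{\mathcal{G}}$ is the set of all such $s_B$; it is an inverse semigroup with inverse $s\mapsto s^*$ (its elements may be identified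 with characteristic functions $1_B$ modulo $\mu$-a.e. equality). $\mathrm{VN}(\mathcal{G})$ is the von Neumann algebra generated by $I_{\mathcal{G}}$, with trace $\tau(a)=\langle a1_{\mathcal{G}^0},1_{\mathcal{G}^0}\rangle$ and $\|a\|_2=\tau(a^*a)^{1/2}$. $I_d$ is the set of partial permutation matrices in $M_d=M_d(\mathbb{C})$ (partial isometries with all entries $0$ or $1$), $\mathrm{tr}$ is the normalized trace on $M_d$, and $\|a\|_2=\mathrm{tr}(a^*a)^{1/2}$ on $M_d$. For $\Omega\subseteq I_{\mathcal{G}}$: $\Omega^*=\{s^*:s\in\Omega\}$; $\Omega^n$ is the set of products $s_1\cdots s_n$ with $s_i\in\Omega$; $\Omega^{\le n}=\bigcup_{k=1}^n\Omega^k$; $[\Omega]$ is the linear span of $\Omega$ in $\mathrm{VN}(\mathcal{G})$; $I(\Omega)$ is the set of elements of $I_{\mathcal{G}}$ that can be written as a finite sum of elements of $\Omega$. $\Omega$ is generating if $I(\bigcup_{n=1}^\infty(\Omega\cup\Omega^* )^n)$ is $\|\cdot\|_2$-dense in $I_{\mathcal{G}}$ and contains the orthogonal complement of each of its projections (possible inclusion of the zero element being disregarded). For a finite set $F\subseteq I_{\mathcal{G}}$, $n,d\in\mathbb{N}$ and $\delta>0$, $\mathrm{SA}(F,n,\delta,d)$ is the set of all linear maps $\varphi:[I_{\mathcal{G}}]\to M_d$ such that (1) $\|\varphi(s_1\cdots s_k)-\varphi(s_1)\cdots\varphi(s_k)\|_2<\delta$ for all $k=1,\dots,n$ and $s_1,\dots,s_k\in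 F\cup F^*$, (2) $\varphi((F\cup F^* )^{\le n})\subseteq I_d$, (3) $|\mathrm{tr}\circ\varphi(s)-\tau(s)|<\delta$ for all $s\in(F\cup F^* )^{\le n}$. For a set $\mathcal{Y}$ of maps, $|\mathcal{Y}|_E$ denotes the cardinality of the set of restrictions $\{\varphi|_E:\varphi\in\mathcal{Y}\}$. For $\Omega\subseteq I_{\mathcal{G}}$ and finite $E,F\subseteq I_{\mathcal{G}}$ set $s_E(F,n,\delta)=\limsup_{d\to\infty}\frac{1}{d\log d}\log|\mathrm{SA}(F,n,\delta,d)|_E$, $s_E(F,n)=\inf_{\delta>0}s_E(F,n,\delta)$, $s_E(F)=\inf_{n\in\mathbb{N}}s_E(F,n)$, $s_E(\Omega)=\inf_F s_E(F)$, $s(\Omega)=\sup_E s_E(\Omega)$, where in the last two $F$ and $E$ range over finite subsets of $\Omega$. The quantities $\underline{s}_E(F,n,\delta)$, ..., $\underline{s}(\Omega)$ are defined the same way with $\liminf$ in place of $\limsup$. Here $\log 0=-\infty$ (so $s_E(F,n,\delta)=-\infty$ if $\mathrm{SA}(F,n,\delta,d)$ is empty for all large $d$, and $\underline{s}_E(F,n,\delta)=-\infty$ if it is empty for arbitrarily large $d$). The sofic dimension is $s(\mathcal{G})=s(I_{\mathcal{G}})$ and the lower sofic dimension is $\underline{s}(\mathcal{G})=\underline{s}(I_{\mathcal{G}})$. *)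

theory Defs
  imports "HOL-Probability.Probability_Measure" "Jordan_Normal_Form.Schur_Decomposition"
begin

section \<open>Discrete measurable groupoids and p.m.p. groupoids\<close>

text \<open>Only \<^term>\<open>space M\<close> and \<^term>\<open>sets M\<close> matter here: \<^term>\<open>M\<close> serves as a measurable space.\<close>

definition standard_borel :: "'a measure \<Rightarrow> bool" where
  "standard_borel M \<longleftrightarrow>
     (\<exists>X. completely_metrizable_space X \<and> second_countable X \<and> topspace X = space M \<and>
          sets M = sigma_sets (space M) {U. openin X U})"

text \<open>The set of arrows is the space of the measurable space \<open>gbor\<close>; the measure stored in
  \<open>gbor\<close> is irrelevant. The product \<open>gmult G x y\<close> is meaningful when \<open>gsrc G x = grng G y\<close>.\<close>

record 'g mgroupoid =
  gbor :: "'g measure"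
  gunits :: "'g set"
  gsrc :: "'g \<Rightarrow> 'g"
  grng :: "'g \<Rightarrow> 'g"
  gmult :: "'g \<Rightarrow> 'g \<Rightarrow> 'g"
  ginv :: "'g \<Rightarrow> 'g"

abbreviation arrows :: "'g mgroupoid \<Rightarrow> 'g set" where
  "arrows G \<equiv> space (gbor G)"

definition composable :: "'g mgroupoid \<Rightarrow> ('g \<times> 'g) set" where
  "composable G = {(x, y). x \<in> arrows G \<and> y \<in> arrows G \<and> gsrc G x = grng G y}"

locale groupoid =
  fixes G :: "'g mgroupoid"
  assumes units_subset: "gunits G \<subseteq> arrows G"
    and src_closed: "x \<in> arrows G \<Longrightarrow> gsrc G x \<in> gunits G"
    and rng_closed: "x \<in> arrows G \<Longrightarrow> grng G x \<in> gunits G"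
    and src_unit: "u \<in> gunits G \<Longrightarrow> gsrc G u = u"
    and rng_unit: "u \<in> gunits G \<Longrightarrow> grng G u = u"
    and mult_closed: "(x, y) \<in> composable G \<Longrightarrow> gmult G x y \<in> arrows G"
    and src_mult: "(x, y) \<in> composable G \<Longrightarrow> gsrc G (gmult G x y) = gsrc G y"
    and rng_mult: "(x, y) \<in> composable G \<Longrightarrow> grng G (gmult G x y) = grng G x"
    and mult_assoc: "(x, y) \<in> composable G \<Longrightarrow> (y, z) \<in> composable G \<Longrightarrow>
      gmult G (gmult G x y) z = gmult G x (gmult G y z)"
    and mult_src: "x \<in> arrows G \<Longrightarrow> gmult G x (gsrc G x) = x"
    and rng_mult_id: "x \<in> arrows G \<Longrightarrow> gmult G (grng G x) x = x"
    and inv_closed: "x \<in> arrows G \<Longrightarrow> ginv G x \<in> arrows G"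
    and src_inv: "x \<in> arrows G \<Longrightarrow> gsrc G (ginv G x) = grng G x"
    and rng_inv: "x \<in> arrows G \<Longrightarrow> grng G (ginv G x) = gsrc G x"
    and mult_inv: "x \<in> arrows G \<Longrightarrow> gmult G x (ginv G x) = grng G x"
    and inv_mult: "x \<in> arrows G \<Longrightarrow> gmult G (ginv G x) x = gsrc G x"

locale discrete_measurable_groupoid = groupoid G for G :: "'g mgroupoid" +
  assumes standard_borel: "standard_borel (gbor G)"
    and units_borel: "gunits G \<in> sets (gbor G)"
    and src_borel: "gsrc G \<in> gbor G \<rightarrow>\<^sub>M gbor G"
    and rng_borel: "grng G \<in> gbor G \<rightarrow>\<^sub>M gbor G"
    and mult_borel: "(\<lambda>(x, y). gmult G x y)
      \<in> restrict_space (gbor G \<Otimes>\<^sub>M gbor G) (composable G) \<rightarrow>\<^sub>M gbor G"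
    and inv_borel: "ginv G \<in> gbor G \<rightarrow>\<^sub>M gbor G"
    and countable_fibres: "u \<in> gunits G \<Longrightarrow> countable {x \<in> arrows G. gsrc G x = u}"

text \<open>\<^term>\<open>emeasure (count_space UNIV)\<close> is cardinality with values in the extended
  nonnegative reals (\<open>\<infinity>\<close> on infinite sets).\<close>

definition src_count :: "'g mgroupoid \<Rightarrow> 'g measure \<Rightarrow> 'g set \<Rightarrow> ennreal" where
  "src_count G \<mu> B = (\<integral>\<^sup>+u. emeasure (count_space UNIV) {x \<in> B. gsrc G x = u} \<partial>\<mu>)"

definition rng_count :: "'g mgroupoid \<Rightarrow> 'g measure \<Rightarrow> 'g set \<Rightarrow> ennreal" where
  "rng_count G \<mu> B = (\<integral>\<^sup>+u. emeasure (count_space UNIV) {x \<in> B. grng G x = u} \<partial>\<mu>)"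

locale pmp_groupoid = discrete_measurable_groupoid G + prob_space \<mu>
  for G :: "'g mgroupoid" and \<mu> :: "'g measure" +
  assumes sets_unit_measure: "sets \<mu> = sets (restrict_space (gbor G) (gunits G))"
    and preserving: "B \<in> sets (gbor G) \<Longrightarrow> src_count G \<mu> B = rng_count G \<mu> B"

text \<open>The measure on the groupoid, also called \<open>\<mu>\<close> in the mathematical text.\<close>

definition arrow_measure :: "'g mgroupoid \<Rightarrow> 'g measure \<Rightarrow> 'g measure" where
  "arrow_measure G \<mu> = measure_of (arrows G) (sets (gbor G)) (src_count G \<mu>)"


section \<open>The Hilbert space \<open>L\<^sup>2\<close> and operators on it\<close>

text \<open>Vectors are classes modulo a.e. equality. Operators are functions on \<open>L2 N\<close> that
  are \<open>undefined\<close> elsewhere, so that equality of operators is equality in HOL.\<close>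

definition l2_fun :: "'a measure \<Rightarrow> ('a \<Rightarrow> complex) set" where
  "l2_fun N = {f \<in> borel_measurable N. integrable N (\<lambda>x. (cmod (f x))\<^sup>2)}"

definition l2_rel :: "'a measure \<Rightarrow> (('a \<Rightarrow> complex) \<times> ('a \<Rightarrow> complex)) set" where
  "l2_rel N = {(f, g). f \<in> l2_fun N \<and> g \<in> l2_fun N \<and> (AE x in N. f x = g x)}"

definition L2 :: "'a measure \<Rightarrow> ('a \<Rightarrow> complex) set set" where
  "L2 N = l2_fun N // l2_rel N"

definition l2_class :: "'a measure \<Rightarrow> ('a \<Rightarrow> complex) \<Rightarrow> ('a \<Rightarrow> complex) set" where
  "l2_class N f = l2_rel N `` {f}"

definition l2_rep :: "('a \<Rightarrow> complex) set \<Rightarrow> 'a \<Rightarrow> complex" where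
  "l2_rep \<xi> = (SOME f. f \<in> \<xi>)"

definition l2_add :: "'a measure \<Rightarrow> ('a \<Rightarrow> complex) set \<Rightarrow> ('a \<Rightarrow> complex) set \<Rightarrow> ('a \<Rightarrow> complex) set" where
  "l2_add N \<xi> \<eta> = l2_class N (\<lambda>x. l2_rep \<xi> x + l2_rep \<eta> x)"

definition l2_scale :: "'a measure \<Rightarrow> complex \<Rightarrow> ('a \<Rightarrow> complex) set \<Rightarrow> ('a \<Rightarrow> complex) set" where
  "l2_scale N c \<xi> = l2_class N (\<lambda>x. c * l2_rep \<xi> x)"

definition l2_inner :: "'a measure \<Rightarrow> ('a \<Rightarrow> complex) set \<Rightarrow> ('a \<Rightarrow> complex) set \<Rightarrow> complex" where
  "l2_inner N \<xi> \<eta> = (\<integral>x. l2_rep \<xi> x * cnj (l2_rep \<eta> x) \<partial>N)"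

type_synonym 'a l2_op = "('a \<Rightarrow> complex) set \<Rightarrow> ('a \<Rightarrow> complex) set"

definition op_zero :: "'a measure \<Rightarrow> 'a l2_op" where
  "op_zero N = (\<lambda>\<xi>\<in>L2 N. l2_class N (\<lambda>_. 0))"

definition op_one :: "'a measure \<Rightarrow> 'a l2_op" where
  "op_one N = (\<lambda>\<xi>\<in>L2 N. \<xi>)"

definition op_add :: "'a measure \<Rightarrow> 'a l2_op \<Rightarrow> 'a l2_op \<Rightarrow> 'a l2_op" where
  "op_add N S T = (\<lambda>\<xi>\<in>L2 N. l2_add N (S \<xi>) (T \<xi>))"

definition op_scale :: "'a measure \<Rightarrow> complex \<Rightarrow> 'a l2_op \<Rightarrow> 'a l2_op" where
  "op_scale N c T = (\<lambda>\<xi>\<in>L2 N. l2_scale N c (T \<xi>))"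

definition op_diff :: "'a measure \<Rightarrow> 'a l2_op \<Rightarrow> 'a l2_op \<Rightarrow> 'a l2_op" where
  "op_diff N S T = op_add N S (op_scale N (- 1) T)"

definition op_mult :: "'a measure \<Rightarrow> 'a l2_op \<Rightarrow> 'a l2_op \<Rightarrow> 'a l2_op" where
  "op_mult N S T = compose (L2 N) S T"

definition op_adj :: "'a measure \<Rightarrow> 'a l2_op \<Rightarrow> 'a l2_op" where
  "op_adj N T = (THE S. S \<in> L2 N \<rightarrow>\<^sub>E L2 N \<and>
     (\<forall>\<xi>\<in>L2 N. \<forall>\<eta>\<in>L2 N. l2_inner N (T \<xi>) \<eta> = l2_inner N \<xi> (S \<eta>)))"

definition op_sum :: "'a measure \<Rightarrow> 'a l2_op list \<Rightarrow> 'a l2_op" where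
  "op_sum N ts = foldr (op_add N) ts (op_zero N)"

definition op_prod :: "'a measure \<Rightarrow> 'a l2_op list \<Rightarrow> 'a l2_op" where
  "op_prod N ts = foldr (op_mult N) ts (op_one N)"

definition is_projection :: "'a measure \<Rightarrow> 'a l2_op \<Rightarrow> bool" where
  "is_projection N p \<longleftrightarrow> op_mult N p p = p \<and> op_adj N p = p"


section \<open>The inverse semigroup of a p.m.p. groupoid\<close>

definition partial_iso_fun :: "'g mgroupoid \<Rightarrow> 'g set \<Rightarrow> ('g \<Rightarrow> complex) \<Rightarrow> 'g \<Rightarrow> complex" where
  "partial_iso_fun G B \<xi> x =
     (if \<exists>y\<in>arrows G. grng G y = gsrc G x \<and> gmult G x y \<in> B
      then \<xi> (ginv G (THE y. y \<in> arrows G \<and> grng G y = gsrc G x \<and> gmult G x y \<in> B))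
      else 0)"

definition partial_iso :: "'g mgroupoid \<Rightarrow> 'g measure \<Rightarrow> 'g set \<Rightarrow> 'g l2_op" where
  "partial_iso G \<mu> B = (let N = arrow_measure G \<mu> in
     (\<lambda>\<xi>\<in>L2 N. l2_class N (partial_iso_fun G B (l2_rep \<xi>))))"

definition inv_semigroup :: "'g mgroupoid \<Rightarrow> 'g measure \<Rightarrow> 'g l2_op set" where
  "inv_semigroup G \<mu> = {partial_iso G \<mu> B | B.
     B \<in> sets (gbor G) \<and> inj_on (gsrc G) B \<and> inj_on (grng G) B}"

definition unit_vec :: "'g mgroupoid \<Rightarrow> 'g measure \<Rightarrow> ('g \<Rightarrow> complex) set" where
  "unit_vec G \<mu> = l2_class (arrow_measure G \<mu>) (indicator (gunits G))"

text \<open>The trace and the 2-norm of the von Neumann algebra are given by vector-state formulas;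
  they are stated for arbitrary operators on \<open>L\<^sup>2\<close>.\<close>

definition vn_trace :: "'g mgroupoid \<Rightarrow> 'g measure \<Rightarrow> 'g l2_op \<Rightarrow> complex" where
  "vn_trace G \<mu> a = l2_inner (arrow_measure G \<mu>) (a (unit_vec G \<mu>)) (unit_vec G \<mu>)"

definition vn_norm2 :: "'g mgroupoid \<Rightarrow> 'g measure \<Rightarrow> 'g l2_op \<Rightarrow> real" where
  "vn_norm2 G \<mu> a = (let N = arrow_measure G \<mu> in
     sqrt (Re (vn_trace G \<mu> (op_mult N (op_adj N a) a))))"

text \<open>\<open>\<Omega> \<union> \<Omega>\<^sup>*\<close>, then \<open>\<Omega>\<^sup>n\<close> and \<open>\<Omega>\<^bsup>\<le>n\<^esup>\<close>, then \<open>[\<Omega>]\<close> and \<open>I(\<Omega>)\<close>.\<close>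

definition sym_set :: "'g mgroupoid \<Rightarrow> 'g measure \<Rightarrow> 'g l2_op set \<Rightarrow> 'g l2_op set" where
  "sym_set G \<mu> \<Omega> = \<Omega> \<union> op_adj (arrow_measure G \<mu>) ` \<Omega>"

definition set_pow :: "'g mgroupoid \<Rightarrow> 'g measure \<Rightarrow> 'g l2_op set \<Rightarrow> nat \<Rightarrow> 'g l2_op set" where
  "set_pow G \<mu> \<Omega> n = {op_prod (arrow_measure G \<mu>) ss | ss. length ss = n \<and> set ss \<subseteq> \<Omega>}"

definition set_pow_upto :: "'g mgroupoid \<Rightarrow> 'g measure \<Rightarrow> 'g l2_op set \<Rightarrow> nat \<Rightarrow> 'g l2_op set" where
  "set_pow_upto G \<mu> \<Omega> n = (\<Union>k\<in>{1..n}. set_pow G \<mu> \<Omega> k)"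

text \<open>The linear span inside the von Neumann algebra is the linear span inside all operators.\<close>

definition lin_span :: "'g mgroupoid \<Rightarrow> 'g measure \<Rightarrow> 'g l2_op set \<Rightarrow> 'g l2_op set" where
  "lin_span G \<mu> \<Omega> = (let N = arrow_measure G \<mu> in
     {op_sum N (map (\<lambda>(c, s). op_scale N c s) cs) | cs. snd ` set cs \<subseteq> \<Omega>})"

definition sum_set :: "'g mgroupoid \<Rightarrow> 'g measure \<Rightarrow> 'g l2_op set \<Rightarrow> 'g l2_op set" where
  "sum_set G \<mu> \<Omega> =
     {a \<in> inv_semigroup G \<mu>. \<exists>ss. set ss \<subseteq> \<Omega> \<and> a = op_sum (arrow_measure G \<mu>) ss}"

text \<open>The zero element is disregarded: the complement of a zero projection is not required to
  belong to \<open>J\<close>. (Conversely the empty sum puts zero, the complement of the identity, into \<open>J\<close>.)\<close>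

definition generating :: "'g mgroupoid \<Rightarrow> 'g measure \<Rightarrow> 'g l2_op set \<Rightarrow> bool" where
  "generating G \<mu> \<Omega> \<longleftrightarrow> \<Omega> \<subseteq> inv_semigroup G \<mu> \<and>
     (let N = arrow_measure G \<mu>;
          J = sum_set G \<mu> (\<Union>n\<in>{1..}. set_pow G \<mu> (sym_set G \<mu> \<Omega>) n)
      in (\<forall>s\<in>inv_semigroup G \<mu>. \<forall>\<epsilon>>0. \<exists>t\<in>J. vn_norm2 G \<mu> (op_diff N s t) < \<epsilon>) \<and>
         (\<forall>p\<in>J. is_projection N p \<and> p \<noteq> op_zero N \<longrightarrow> op_diff N (op_one N) p \<in> J))"


section \<open>Partial permutation matrices\<close>

definition ntr :: "complex mat \<Rightarrow> complex" where
  "ntr A = (\<Sum>i<dim_row A. A $$ (i, i)) / of_nat (dim_row A)"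

definition mat_norm2 :: "complex mat \<Rightarrow> real" where
  "mat_norm2 A = sqrt (Re (ntr (mat_adjoint A * A)))"

definition mat_prod :: "nat \<Rightarrow> complex mat list \<Rightarrow> complex mat" where
  "mat_prod d As = foldr (*) As (1\<^sub>m d)"

definition partial_perm_mats :: "nat \<Rightarrow> complex mat set" where
  "partial_perm_mats d = {A \<in> carrier_mat d d.
     A * mat_adjoint A * A = A \<and> (\<forall>i<d. \<forall>j<d. A $$ (i, j) \<in> {0, 1})}"


section \<open>Sofic approximations and sofic dimension\<close>

definition linear_maps :: "'g mgroupoid \<Rightarrow> 'g measure \<Rightarrow> nat \<Rightarrow> ('g l2_op \<Rightarrow> complex mat) set" where
  "linear_maps G \<mu> d = (let N = arrow_measure G \<mu>; V = lin_span G \<mu> (inv_semigroup G \<mu>) in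
     {\<phi> \<in> V \<rightarrow>\<^sub>E carrier_mat d d.
        (\<forall>a\<in>V. \<forall>b\<in>V. \<phi> (op_add N a b) = \<phi> a + \<phi> b) \<and>
        (\<forall>c. \<forall>a\<in>V. \<phi> (op_scale N c a) = c \<cdot>\<^sub>m \<phi> a)})"

definition SA :: "'g mgroupoid \<Rightarrow> 'g measure \<Rightarrow> 'g l2_op set \<Rightarrow> nat \<Rightarrow> real \<Rightarrow> nat
    \<Rightarrow> ('g l2_op \<Rightarrow> complex mat) set" where
  "SA G \<mu> F n \<delta> d = {\<phi> \<in> linear_maps G \<mu> d.
     (\<forall>ss. length ss \<in> {1..n} \<and> set ss \<subseteq> sym_set G \<mu> F \<longrightarrow>
        mat_norm2 (\<phi> (op_prod (arrow_measure G \<mu>) ss) - mat_prod d (map \<phi> ss)) < \<delta>) \<and>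
     \<phi> ` set_pow_upto G \<mu> (sym_set G \<mu> F) n \<subseteq> partial_perm_mats d \<and>
     (\<forall>s\<in>set_pow_upto G \<mu> (sym_set G \<mu> F) n. cmod (ntr (\<phi> s) - vn_trace G \<mu> s) < \<delta>)}"

text \<open>The number of restrictions can be infinite when \<open>E\<close> is not controlled by \<open>F\<close>, hence the
  case distinction: \<^const>\<open>card\<close> is \<open>0\<close> on infinite sets.\<close>

definition log_card :: "'b set \<Rightarrow> ereal" where
  "log_card A = (if infinite A then \<infinity> else if A = {} then - \<infinity> else ereal (ln (real (card A))))"

definition restrictions :: "('b \<Rightarrow> 'c) set \<Rightarrow> 'b set \<Rightarrow> ('b \<Rightarrow> 'c) set" where
  "restrictions Y E = (\<lambda>\<phi>. restrict \<phi> E) ` Y"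

text \<open>\<open>L\<close> is \<^const>\<open>limsup\<close> for the sofic dimension and \<^const>\<open>liminf\<close> for the lower one.\<close>

definition sdim_E_F_n_delta :: "((nat \<Rightarrow> ereal) \<Rightarrow> ereal) \<Rightarrow> 'g mgroupoid \<Rightarrow> 'g measure
    \<Rightarrow> 'g l2_op set \<Rightarrow> 'g l2_op set \<Rightarrow> nat \<Rightarrow> real \<Rightarrow> ereal" where
  "sdim_E_F_n_delta L G \<mu> E F n \<delta> =
     L (\<lambda>d. log_card (restrictions (SA G \<mu> F n \<delta> d) E) / ereal (real d * ln (real d)))"

definition sdim_E_F_n :: "((nat \<Rightarrow> ereal) \<Rightarrow> ereal) \<Rightarrow> 'g mgroupoid \<Rightarrow> 'g measure
    \<Rightarrow> 'g l2_op set \<Rightarrow> 'g l2_op set \<Rightarrow> nat \<Rightarrow> ereal" where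
  "sdim_E_F_n L G \<mu> E F n = (INF \<delta>\<in>{0<..}. sdim_E_F_n_delta L G \<mu> E F n \<delta>)"

definition sdim_E_F :: "((nat \<Rightarrow> ereal) \<Rightarrow> ereal) \<Rightarrow> 'g mgroupoid \<Rightarrow> 'g measure
    \<Rightarrow> 'g l2_op set \<Rightarrow> 'g l2_op set \<Rightarrow> ereal" where
  "sdim_E_F L G \<mu> E F = (INF n\<in>{1..}. sdim_E_F_n L G \<mu> E F n)"

definition sdim_E :: "((nat \<Rightarrow> ereal) \<Rightarrow> ereal) \<Rightarrow> 'g mgroupoid \<Rightarrow> 'g measure
    \<Rightarrow> 'g l2_op set \<Rightarrow> 'g l2_op set \<Rightarrow> ereal" where
  "sdim_E L G \<mu> E \<Omega> = (INF F\<in>{F. finite F \<and> F \<subseteq> \<Omega>}. sdim_E_F L G \<mu> E F)"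

definition sdim :: "((nat \<Rightarrow> ereal) \<Rightarrow> ereal) \<Rightarrow> 'g mgroupoid \<Rightarrow> 'g measure
    \<Rightarrow> 'g l2_op set \<Rightarrow> ereal" where
  "sdim L G \<mu> \<Omega> = (SUP E\<in>{E. finite E \<and> E \<subseteq> \<Omega>}. sdim_E L G \<mu> E \<Omega>)"

definition upper_sdim :: "'g mgroupoid \<Rightarrow> 'g measure \<Rightarrow> 'g l2_op set \<Rightarrow> ereal" where
  "upper_sdim = sdim limsup"

definition lower_sdim :: "'g mgroupoid \<Rightarrow> 'g measure \<Rightarrow> 'g l2_op set \<Rightarrow> ereal" where
  "lower_sdim = sdim liminf"

definition sofic_dimension :: "'g mgroupoid \<Rightarrow> 'g measure \<Rightarrow> ereal" where
  "sofic_dimension G \<mu> = upper_sdim G \<mu> (inv_semigroup G \<mu>)"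

definition lower_sofic_dimension :: "'g mgroupoid \<Rightarrow> 'g measure \<Rightarrow> ereal" where
  "lower_sofic_dimension G \<mu> = lower_sdim G \<mu> (inv_semigroup G \<mu>)"

end

theory Submission
  imports Defs
begin

text \<open>
  Let \<open>\<Omega>\<close> be generating, and let a pair \<open>(d, \<phi>)\<close> run through the sofic approximations of \<open>\<Omega>\<close> along the filter
  \<open>SAf \<Omega>\<close> that is generated by the sets of all \<open>\<phi>\<close> in \<open>SA F n \<delta> d\<close>. Along this filter \<open>\<phi>\<close> behaves like a
  trace-preserving \<open>*\<close>-homomorphism on the finite sums of words in the letters of \<open>\<Omega>\<close> and their adjoints:
  products hold asymptotically by definition of \<open>SA\<close>, adjoints because a word satisfies \<open>t t\<^sup>* t = t\<close> and a
  quasi-inverse of a partial permutation matrix is close to its transpose (\<open>ppm_quasi_inverse\<close>), and traces by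
  definition again. Consequently the norm of a combination of images tends to the \<open>L\<^sup>2\<close> norm of the
  corresponding combination of indicator functions of bisections (\<open>wsum_nrm_sq\<close>); every estimate below is an
  instance of this limit, that is, of a computation with measures of sets of arrows.

  Two sofic dimensions are compared by counting (\<open>sdim_E_le\<close>). Suppose that from each approximation \<open>\<phi>\<close> of
  one set one obtains an approximation \<open>\<psi>\<close> of the other, and that \<open>\<psi>\<close> on a finite set \<open>E2\<close> determines each
  matrix \<open>\<phi> e\<close>, for \<open>e\<close> in a finite set \<open>E1\<close>, up to an error less than \<open>\<kappa>\<close>. A ball of radius \<open>\<kappa>\<close> contains at
  most \<open>exp (12 \<kappa>\<^sup>2 d ln d)\<close> partial permutation matrices (\<open>partial_perm_ball\<close>), so at the scale \<open>d ln d\<close> the two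
  logarithmic counts differ by a constant that vanishes with \<open>\<kappa>\<close>.

  For the bound of the dimension of the full semigroup by that of \<open>\<Omega>\<close> (\<open>sofic_le_generating\<close>) take \<open>\<psi> = \<phi>\<close>: every
  element of the semigroup is close to a sum of words in \<open>\<Omega>\<close>, and its image is therefore close to the same
  polynomial expression in the images of finitely many letters.

  The converse bound (\<open>generating_le_sofic\<close>) needs an approximation \<open>\<psi>\<close> of a finite set \<open>F\<close> of arbitrary
  elements, built from an approximation \<open>\<phi>\<close> of \<open>\<Omega>\<close> and close to \<open>\<phi>\<close> on \<open>\<Omega>\<close> (\<open>sofic_model\<close>). Let \<open>K\<close> be the finite
  set of products of length at most \<open>n\<close> of letters from \<open>F\<close>. The bisections of \<open>K\<close> are unions of the finitely many
  cells of the Boolean algebra that they generate. Each cell is close to a sum of words in \<open>\<Omega>\<close>; the image of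
  this sum is a matrix with natural number entries that almost satisfies \<open>M M\<^sup>T M = M\<close>, and keeping its isolated entries
  gives a nearby partial permutation matrix (\<open>nrm_rnd\<close>). Two cells of one bisection have disjoint sources and
  disjoint ranges, so deleting the few entries in shared rows and columns makes the sums over the cells of each
  element of \<open>K\<close> partial permutation matrices (\<open>nrm_separate\<close>, \<open>ppm_sum_separate\<close>). Finally \<open>\<psi>\<close> has to be linear on the span
  of the whole semigroup: it sends \<open>a\<close> to the sum of the cell matrices weighted with the mean of \<open>a 1\<close> over the
  cell (\<open>psi\<close>), which for \<open>s \<in> K\<close> is the sum over the cells of \<open>s\<close>.

  The elements of the semigroup multiply like their bisections only if products, domains and ranges of Borel
  bisections are Borel. These are injective images of Borel sets, and the theorem of Lusin and Souslin
  (\<open>injective_image_measurable\<close>) applies to them.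
\<close>

section \<open>Injective images of Borel sets\<close>

definition agree :: "nat \<Rightarrow> (nat \<Rightarrow> nat) \<Rightarrow> (nat \<Rightarrow> nat) \<Rightarrow> bool" where
  "agree k v w \<longleftrightarrow> (\<forall>i<k. v i = w i)"

definition seq_closed :: "(nat \<Rightarrow> nat) set \<Rightarrow> bool" where
  "seq_closed F \<longleftrightarrow> (\<forall>w. (\<forall>k. \<exists>v\<in>F. agree k v w) \<longrightarrow> w \<in> F)"

text \<open>
  The restriction of \<open>h\<close> to \<open>F\<close> is continuous in the topology generated by the sets of \<open>\<U>\<close> and their complements:
  finitely many coordinates of the argument settle the membership of the value in one set of \<open>\<U>\<close>.
\<close>
definition decides :: "'a set set \<Rightarrow> (nat \<Rightarrow> nat) set \<Rightarrow> ((nat \<Rightarrow> nat) \<Rightarrow> 'a) \<Rightarrow> bool" where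
  "decides \<U> F h \<longleftrightarrow> (\<forall>w\<in>F. \<forall>U\<in>\<U>. \<exists>k. \<forall>v\<in>F. agree k v w \<longrightarrow> (h v \<in> U \<longleftrightarrow> h w \<in> U))"

definition separating :: "'a set set \<Rightarrow> 'a set \<Rightarrow> bool" where
  "separating \<U> A \<longleftrightarrow> (\<forall>x\<in>A. \<forall>y\<in>A. (\<forall>U\<in>\<U>. x \<in> U \<longleftrightarrow> y \<in> U) \<longrightarrow> x = y)"

text \<open>
  A continuous bijective image of a closed subset of Baire space. Recording a bijection, and
  not just a surjection, makes the notion describe Borel sets and not analytic sets.
\<close>
definition representable :: "'a set set \<Rightarrow> 'a set \<Rightarrow> bool" where
  "representable \<U> A \<longleftrightarrow> (\<exists>F h. seq_closed F \<and> bij_betw h F A \<and> decides \<U> F h)"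

lemma agree_mono: "agree k v w \<Longrightarrow> l \<le> k \<Longrightarrow> agree l v w"
  by (auto simp: agree_def)

lemma seq_closedD: "seq_closed F \<Longrightarrow> (\<And>k. \<exists>v\<in>F. agree k v w) \<Longrightarrow> w \<in> F"
  by (auto simp: seq_closed_def)

lemma separatingD:
  "separating \<U> A \<Longrightarrow> x \<in> A \<Longrightarrow> y \<in> A \<Longrightarrow> (\<And>U. U \<in> \<U> \<Longrightarrow> x \<in> U \<longleftrightarrow> y \<in> U) \<Longrightarrow> x = y"
  by (auto simp: separating_def)

lemma decidesD:
  "decides \<U> F h \<Longrightarrow> w \<in> F \<Longrightarrow> U \<in> \<U> \<Longrightarrow> \<exists>k. \<forall>v\<in>F. agree k v w \<longrightarrow> (h v \<in> U \<longleftrightarrow> h w \<in> U)"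
  by (auto simp: decides_def)

text \<open>
  Prepending the index of the set to the code of a point gives a code in the union; disjointness keeps it
  unique.
\<close>
lemma representable_disjoint_UN:
  fixes A :: "nat \<Rightarrow> 'a set"
  assumes rep: "\<And>n. representable \<U> (A n)" and dis: "disjoint_family A"
  shows "representable (\<U> \<union> range A) (\<Union>n. A n)"
proof -
  from rep have "\<forall>n. \<exists>F h. seq_closed F \<and> bij_betw h F (A n) \<and> decides \<U> F h"
    by (auto simp: representable_def)
  then obtain F h where F: "\<And>n. seq_closed (F n)" and h: "\<And>n. bij_betw (h n) (F n) (A n)"
    and c: "\<And>n. decides \<U> (F n) (h n)" by metis
  define tail where "tail = (\<lambda>w :: nat \<Rightarrow> nat. \<lambda>i. w (Suc i))"
  \<comment> \<open>the first entry of a code names the set, the others are the code in it\<close>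
  define F' where "F' = {w. tail w \<in> F (w 0)}"
  define h' where "h' = (\<lambda>w. h (w 0) (tail w))"
  have agree_tail: "agree k (tail v) (tail w) \<and> v 0 = w 0" if "agree (Suc k) v w" for k v w
    using that by (auto simp: agree_def tail_def)
  have hA: "h n w \<in> A n" if "w \<in> F n" for n w using h[of n] that by (auto simp: bij_betw_def)
  have "seq_closed F'"
    unfolding seq_closed_def
  proof (intro allI impI)
    fix w assume w: "\<forall>k. \<exists>v\<in>F'. agree k v w"
    have "tail w \<in> F (w 0)"
    proof (rule seq_closedD[OF F])
      fix k
      from w obtain v where "v \<in> F'" "agree (Suc k) v w" by blast
      then show "\<exists>v\<in>F (w 0). agree k v (tail w)"
        using agree_tail unfolding F'_def by (metis mem_Collect_eq)
    qed
    then show "w \<in> F'" by (simp add: F'_def)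
  qed
  moreover have "bij_betw h' F' (\<Union>n. A n)"
  proof (rule bij_betwI')
    fix v w assume v: "v \<in> F'" and w: "w \<in> F'"
    show "(h' v = h' w) = (v = w)"
    proof
      assume e: "h' v = h' w"
      have "h' v \<in> A (v 0)" "h' w \<in> A (w 0)" using v w hA by (auto simp: F'_def h'_def)
      with e dis have 0: "v 0 = w 0" unfolding disjoint_family_on_def by (metis IntI UNIV_I empty_iff)
      have "tail v = tail w"
        using h[of "v 0"] e v w 0 unfolding h'_def F'_def bij_betw_def inj_on_def by auto
      then have "v i = w i" for i using 0 by (cases i) (auto simp: tail_def dest: fun_cong)
      then show "v = w" by auto
    qed auto
  next
    fix w assume "w \<in> F'" then show "h' w \<in> (\<Union>n. A n)" using hA by (auto simp: F'_def h'_def)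
  next
    fix y assume "y \<in> (\<Union>n. A n)"
    then obtain n where "y \<in> A n" by auto
    then obtain w where w: "w \<in> F n" "h n w = y" using bij_betw_imp_surj_on[OF h[of n]] by (metis imageE)
    have "tail (case_nat n w) = w" by (auto simp: tail_def)
    then show "\<exists>x\<in>F'. y = h' x" using w by (intro bexI[of _ "case_nat n w"]) (auto simp: F'_def h'_def)
  qed
  moreover have "decides (\<U> \<union> range A) F' h'"
    unfolding decides_def
  proof (intro ballI)
    fix w U assume w: "w \<in> F'" and U: "U \<in> \<U> \<union> range A"
    show "\<exists>k. \<forall>v\<in>F'. agree k v w \<longrightarrow> (h' v \<in> U) = (h' w \<in> U)"
    proof (cases "U \<in> \<U>")
      case True
      obtain k where k: "\<forall>v\<in>F (w 0). agree k v (tail w) \<longrightarrow> (h (w 0) v \<in> U) = (h (w 0) (tail w) \<in> U)"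
        using decidesD[OF c[of "w 0"] _ True, of "tail w"] w by (auto simp: F'_def)
      show ?thesis
        by (rule exI[of _ "Suc k"])
          (use k agree_tail in \<open>unfold F'_def h'_def, metis mem_Collect_eq\<close>)
    next
      case False
      then obtain n where n: "U = A n" using U by auto
      have "h' v \<in> A n \<longleftrightarrow> v 0 = n" if "v \<in> F'" for v
      proof -
        have "h' v \<in> A (v 0)" using that hA by (auto simp: F'_def h'_def)
        then show ?thesis using dis unfolding disjoint_family_on_def by (metis IntI UNIV_I empty_iff)
      qed
      then show ?thesis using w n by (intro exI[of _ "Suc 0"]) (auto simp: agree_def)
    qed
  qed
  ultimately show ?thesis unfolding representable_def by blast
qed

text \<open>
  A point of the intersection is coded by the interleaving of its codes in all the sets. The codes that
  fit together form a closed set since the separating sets detect any discrepancy at a finite stage.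
\<close>
lemma representable_INT:
  fixes A :: "nat \<Rightarrow> 'a set"
  assumes rep: "\<And>n. representable (\<U> n) (A n)" and sep: "\<And>n. separating (\<U> n) UNIV"
    and sub: "\<And>n. \<U> 0 \<subseteq> \<U> n"
  shows "representable (\<Union>n. \<U> n) (\<Inter>n. A n)"
proof -
  from rep have "\<forall>n. \<exists>F h. seq_closed F \<and> bij_betw h F (A n) \<and> decides (\<U> n) F h"
    by (auto simp: representable_def)
  then obtain F h where F: "\<And>n. seq_closed (F n)" and h: "\<And>n. bij_betw (h n) (F n) (A n)"
    and c: "\<And>n. decides (\<U> n) (F n) (h n)" by metis
  define row where "row = (\<lambda>n (w :: nat \<Rightarrow> nat) i. w (prod_encode (n, i)))"
  \<comment> \<open>row \<open>n\<close> of the code is a code in \<open>A n\<close>, and all rows code one point\<close>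
  define F' where "F' = {w. \<forall>n. row n w \<in> F n \<and> h n (row n w) = h 0 (row 0 w)}"
  have agree_row: "\<exists>l. \<forall>v w. agree l v w \<longrightarrow> agree k (row n v) (row n w)" for k n
  proof (intro exI allI impI)
    fix v w :: "nat \<Rightarrow> nat" assume "agree (Suc (Max ((\<lambda>i. prod_encode (n, i)) ` {..k}))) v w"
    then show "agree k (row n v) (row n w)"
      unfolding agree_def row_def by (auto simp: less_Suc_eq_le intro!: Max_ge)
  qed
  have "seq_closed F'"
    unfolding seq_closed_def
  proof (intro allI impI)
    fix w assume w: "\<forall>k. \<exists>v\<in>F'. agree k v w"
    have row_in: "row n w \<in> F n" for n
    proof (rule seq_closedD[OF F])
      fix k
      obtain l where "\<forall>v w. agree l v w \<longrightarrow> agree k (row n v) (row n w)" using agree_row by blast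
      moreover from w obtain v where "v \<in> F'" "agree l v w" by blast
      ultimately show "\<exists>v\<in>F n. agree k v (row n w)" unfolding F'_def by blast
    qed
    have "h n (row n w) = h 0 (row 0 w)" for n
    proof (rule ccontr)
      assume ne: "h n (row n w) \<noteq> h 0 (row 0 w)"
      then obtain U where U: "U \<in> \<U> 0" "(h n (row n w) \<in> U) \<noteq> (h 0 (row 0 w) \<in> U)"
        using sep[of 0] unfolding separating_def by blast
      obtain k where k: "\<forall>v\<in>F n. agree k v (row n w) \<longrightarrow> (h n v \<in> U) = (h n (row n w) \<in> U)"
        using decidesD[OF c row_in, of U n] U sub by blast
      obtain j where j: "\<forall>v\<in>F 0. agree j v (row 0 w) \<longrightarrow> (h 0 v \<in> U) = (h 0 (row 0 w) \<in> U)"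
        using decidesD[OF c row_in, of U 0] U by blast
      obtain k' where k': "\<forall>v w. agree k' v w \<longrightarrow> agree k (row n v) (row n w)" using agree_row by blast
      obtain j' where j': "\<forall>v w. agree j' v w \<longrightarrow> agree j (row 0 v) (row 0 w)" using agree_row by blast
      from w obtain v where v: "v \<in> F'" "agree (max j' k') v w" by blast
      then have "agree k' v w" "agree j' v w" using agree_mono by auto
      then have "agree k (row n v) (row n w)" "agree j (row 0 v) (row 0 w)" using k' j' by auto
      moreover have "row n v \<in> F n" "row 0 v \<in> F 0" "h n (row n v) = h 0 (row 0 v)"
        using v(1) by (simp_all add: F'_def)
      ultimately show False using k j U(2) by metis
    qed
    with row_in show "w \<in> F'" by (auto simp: F'_def)
  qed
  moreover have "bij_betw (\<lambda>w. h 0 (row 0 w)) F' (\<Inter>n. A n)"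
  proof (rule bij_betwI')
    fix v w assume v: "v \<in> F'" and w: "w \<in> F'"
    show "(h 0 (row 0 v) = h 0 (row 0 w)) = (v = w)"
    proof
      assume e: "h 0 (row 0 v) = h 0 (row 0 w)"
      have "row n v = row n w" for n
      proof -
        have "h n (row n v) = h n (row n w)" "row n v \<in> F n" "row n w \<in> F n"
          using v w e unfolding F'_def by (simp_all, metis)
        then show ?thesis using h[of n] unfolding bij_betw_def inj_on_def by blast
      qed
      then have "v i = w i" for i
        unfolding row_def by (metis prod.collapse prod_decode_inverse)
      then show "v = w" by auto
    qed auto
  next
    fix w assume "w \<in> F'" then show "h 0 (row 0 w) \<in> (\<Inter>n. A n)"
      using bij_betw_apply[OF h] unfolding F'_def by (simp, metis)
  next
    fix y assume y: "y \<in> (\<Inter>n. A n)"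
    have "\<exists>w. w \<in> F n \<and> h n w = y" for n
    proof -
      have "y \<in> h n ` F n" using y bij_betw_imp_surj_on[OF h[of n]] by simp
      then show ?thesis by blast
    qed
    then have "\<exists>W. \<forall>n. W n \<in> F n \<and> h n (W n) = y" by (intro choice allI)
    then obtain W where W: "\<And>n. W n \<in> F n \<and> h n (W n) = y" by blast
    define w where "w = (\<lambda>m. case prod_decode m of (n, i) \<Rightarrow> W n i)"
    have "row n w = W n" for n by (auto simp: row_def w_def)
    then show "\<exists>x\<in>F'. y = h 0 (row 0 x)" using W by (intro bexI[of _ w]) (auto simp: F'_def)
  qed
  moreover have "decides (\<Union>n. \<U> n) F' (\<lambda>w. h 0 (row 0 w))"
    unfolding decides_def
  proof (intro ballI)
    fix w U assume w: "w \<in> F'" and U: "U \<in> (\<Union>n. \<U> n)"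
    then obtain n where n: "U \<in> \<U> n" by auto
    obtain k where k: "\<forall>v\<in>F n. agree k v (row n w) \<longrightarrow> (h n v \<in> U) = (h n (row n w) \<in> U)"
      using decidesD[OF c _ n, of "row n w"] w unfolding F'_def by auto
    obtain l where l: "\<forall>v w. agree l v w \<longrightarrow> agree k (row n v) (row n w)" using agree_row by blast
    have "(h 0 (row 0 v) \<in> U) = (h 0 (row 0 w) \<in> U)" if "v \<in> F'" "agree l v w" for v
    proof -
      have "row n v \<in> F n" "h n (row n v) = h 0 (row 0 v)" "h n (row n w) = h 0 (row 0 w)"
        using that(1) w unfolding F'_def by blast+
      then show ?thesis using k l that(2) by metis
    qed
    then show "\<exists>k. \<forall>v\<in>F'. agree k v w \<longrightarrow> (h 0 (row 0 v) \<in> U) = (h 0 (row 0 w) \<in> U)" by blast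
  qed
  ultimately show ?thesis unfolding representable_def by blast
qed

lemma representable_mono: "representable \<U> A \<Longrightarrow> \<V> \<subseteq> \<U> \<Longrightarrow> representable \<V> A"
  unfolding representable_def decides_def by (meson subsetD)

lemma representable_empty: "representable \<U> {}"
  unfolding representable_def seq_closed_def decides_def
  by (intro exI[of _ "{}"] exI[of _ undefined]) (auto simp: bij_betw_def)

text \<open>
  The sets that are representable together with their complements form a \<open>\<sigma>\<close>-algebra: a
  countable union is made disjoint by intersecting with complements, and its complement is an intersection.
\<close>
lemma representable_sigma_sets:
  assumes sep: "separating \<U> UNIV" and U: "\<And>U. U \<in> \<U> \<Longrightarrow> representable \<U> U \<and> representable \<U> (- U)"
    and UNIV: "representable \<U> UNIV" and A: "A \<in> sigma_sets UNIV \<U>"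
  shows "representable \<U> A \<and> representable \<U> (- A)"
  using A
proof (induction rule: sigma_sets.induct)
  case (Basic a) then show ?case using U by blast
next
  case Empty then show ?case using UNIV representable_empty by auto
next
  case (Compl a) then show ?case by (simp add: Compl_eq_Diff_UNIV[symmetric])
next
  case (Union a)
  have INT: "representable \<U> (\<Inter>n. B n)" if "\<And>n. representable \<U> (B n)" for B :: "nat \<Rightarrow> 'a set"
    using representable_INT[of "\<lambda>_. \<U>" B] that sep by simp
  have "representable \<U> (disjointed a n)" for n
  proof -
    have "disjointed a n = (\<Inter>k. (if k < n then - a k else a n))"
    proof (rule Set.set_eqI)
      fix x
      show "x \<in> disjointed a n \<longleftrightarrow> x \<in> (\<Inter>k. (if k < n then - a k else a n))"
      proof
        assume R: "x \<in> (\<Inter>k. (if k < n then - a k else a n))"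
        have "x \<in> (if k < n then - a k else a n)" for k using R by (rule INT_D) simp
        from this[of n] this have "x \<in> a n" "\<And>k. k < n \<Longrightarrow> x \<notin> a k" by (simp, metis ComplD)
        then show "x \<in> disjointed a n" by (auto simp: disjointed_def)
      qed (auto simp: disjointed_def)
    qed
    moreover have "representable \<U> \<dots>" by (rule INT) (use Union in auto)
    ultimately show ?thesis by simp
  qed
  then have "representable \<U> (\<Union>n. disjointed a n)"
    by (rule representable_mono[OF representable_disjoint_UN[OF _ disjoint_family_disjointed]]) auto
  moreover have "representable \<U> (\<Inter>n. - a n)" by (rule INT) (use Union in auto)
  ultimately show ?case by (simp add: UN_disjointed_eq)
qed

text \<open>
  Passing to a finer topology with further Borel sets made clopen: a point is coded together with its codes
  in the side of each \<open>W n\<close> on which it lies.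
\<close>
lemma representable_refine:
  fixes W :: "nat \<Rightarrow> 'a set"
  assumes sep: "separating \<U> UNIV" and U: "\<And>U. U \<in> \<U> \<Longrightarrow> representable \<U> U \<and> representable \<U> (- U)"
    and UNIV: "representable \<U> UNIV" and A: "A \<in> sigma_sets UNIV \<U>"
    and W: "\<And>n. W n \<in> sigma_sets UNIV \<U>"
  shows "representable (range W) A"
proof -
  have *: "representable (insert (W n) \<U>) UNIV" for n
  proof -
    define D where "D = (\<lambda>i::nat. if i = 0 then W n else if i = 1 then - W n else {})"
    have "representable \<U> (D i)" for i
      using representable_sigma_sets[OF sep U UNIV W[of n]] representable_empty by (auto simp: D_def)
    moreover have "disjoint_family D" by (auto simp: D_def disjoint_family_on_def)
    ultimately have "representable (\<U> \<union> range D) (\<Union>i. D i)" by (rule representable_disjoint_UN)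
    moreover have "(\<Union>i. D i) = UNIV" 
    proof -
      have "D 0 \<union> D 1 = UNIV" by (auto simp: D_def)
      moreover have "D i \<subseteq> (\<Union>i. D i)" for i by (rule UN_upper) simp
      ultimately show ?thesis by (metis Un_least top.extremum_uniqueI)
    qed
    moreover have "W n \<in> range D" by (rule image_eqI[of _ _ 0]) (auto simp: D_def)
    ultimately show ?thesis by (auto elim!: representable_mono)
  qed
  define \<U>' where "\<U>' = (\<lambda>n. case n of 0 \<Rightarrow> \<U> | Suc m \<Rightarrow> insert (W m) \<U>)"
  define A' where "A' = (\<lambda>n::nat. case n of 0 \<Rightarrow> A | Suc m \<Rightarrow> UNIV)"
  have "representable (\<Union>n. \<U>' n) (\<Inter>n. A' n)"
  proof (rule representable_INT)
    fix n show "representable (\<U>' n) (A' n)"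
      using * representable_sigma_sets[OF sep U UNIV A] by (auto simp: \<U>'_def A'_def split: nat.split)
    show "separating (\<U>' n) UNIV"
      unfolding separating_def
    proof (intro ballI impI)
      fix x y :: 'a assume "\<forall>U\<in>\<U>' n. (x \<in> U) = (y \<in> U)"
      moreover have "\<U> \<subseteq> \<U>' n" by (auto simp: \<U>'_def split: nat.split)
      ultimately show "x = y" by (intro separatingD[OF sep]) auto
    qed
    show "\<U>' 0 \<subseteq> \<U>' n" by (auto simp: \<U>'_def split: nat.split)
  qed
  moreover have "(\<Inter>n. A' n) = A"
  proof -
    have "A' 0 = A" "A' n = A \<or> A' n = UNIV" for n by (auto simp: A'_def split: nat.splits)
    then show ?thesis by blast
  qed
  moreover have "range W \<subseteq> (\<Union>n. \<U>' n)"
  proof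
    fix x assume "x \<in> range W"
    then obtain m where "x = W m" by auto
    then have "x \<in> \<U>' (Suc m)" by (auto simp: \<U>'_def)
    then show "x \<in> (\<Union>n. \<U>' n)" by blast
  qed
  ultimately show ?thesis by (auto elim: representable_mono)
qed

definition coord :: "nat \<Rightarrow> (nat \<Rightarrow> bool) set" where "coord n = {z. z n}"

text \<open>
  In the Cantor space a point is its own code, so the sets \<open>coord n\<close> meet the hypotheses of the two
  preceding lemmas.
\<close>
lemma representable_cantor:
  fixes W :: "nat \<Rightarrow> (nat \<Rightarrow> bool) set"
  assumes A: "A \<in> sigma_sets UNIV (range coord)" and W: "\<And>n. W n \<in> sigma_sets UNIV (range coord)"
  shows "representable (range W) A"
proof (rule representable_refine[OF _ _ _ A W])
  show "separating (range coord) UNIV" by (auto simp: separating_def coord_def)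
  have *: "representable (range coord) {z. \<forall>i. P i (z i)}" for P :: "nat \<Rightarrow> bool \<Rightarrow> bool"
  proof -
    define F where "F = {w :: nat \<Rightarrow> nat. \<forall>i. w i \<le> 1 \<and> P i (w i = 1)}"
    define h where "h = (\<lambda>(w :: nat \<Rightarrow> nat) i. w i = 1)"
    have "seq_closed F"
      unfolding seq_closed_def
    proof (intro allI impI)
      fix w assume w: "\<forall>k. \<exists>v\<in>F. agree k v w"
      have "w i \<le> 1 \<and> P i (w i = 1)" for i
      proof -
        obtain v where "v \<in> F" "agree (Suc i) v w" using w by blast
        then have "v i = w i" "v i \<le> 1 \<and> P i (v i = 1)" unfolding F_def agree_def by blast+
        then show ?thesis by simp
      qed
      then show "w \<in> F" by (auto simp: F_def)
    qed
    moreover have "bij_betw h F {z. \<forall>i. P i (z i)}"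
    proof (rule bij_betwI')
      fix v w assume v: "v \<in> F" and w: "w \<in> F"
      have "v = w" if "h v = h w"
      proof
        fix i
        have "v i = 1 \<longleftrightarrow> w i = 1" using fun_cong[OF that, of i] by (simp add: h_def)
        moreover have "v i \<le> 1" "w i \<le> 1" using v w by (auto simp: F_def)
        ultimately show "v i = w i" by linarith
      qed
      then show "(h v = h w) = (v = w)" by auto
    next
      fix y assume "y \<in> {z. \<forall>i. P i (z i)}"
      then show "\<exists>x\<in>F. y = h x"
      proof (intro bexI[of _ "\<lambda>i. if y i then 1 else 0"])
        have Py: "P i (y i)" for i using \<open>y \<in> {z. \<forall>i. P i (z i)}\<close> by simp
        have "P i ((if y i then 1 else 0) = (1::nat))" for i using Py[of i] by (cases "y i") simp_all
        then show "(\<lambda>i. if y i then 1 else 0) \<in> F" unfolding F_def by simp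
      qed (auto simp: h_def)
    qed (auto simp: F_def h_def)
    moreover have "decides (range coord) F h"
      unfolding decides_def
    proof (intro ballI)
      fix w U assume "U \<in> range coord"
      then obtain n where "U = coord n" by auto
      then show "\<exists>k. \<forall>v\<in>F. agree k v w \<longrightarrow> (h v \<in> U) = (h w \<in> U)"
        by (intro exI[of _ "Suc n"]) (auto simp: coord_def h_def agree_def)
    qed
    ultimately show ?thesis unfolding representable_def by blast
  qed
  show "representable (range coord) UNIV" using *[of "\<lambda>_ _. True"] by simp
  fix U assume "U \<in> range coord"
  then obtain n where n: "U = coord n" by auto
  have "coord n = {z. \<forall>i. i = n \<longrightarrow> z i}" "- coord n = {z. \<forall>i. i = n \<longrightarrow> \<not> z i}"
    by (auto simp: coord_def)
  then show "representable (range coord) U \<and> representable (range coord) (- U)"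
    using *[of "\<lambda>i b. i = n \<longrightarrow> b"] *[of "\<lambda>i b. i = n \<longrightarrow> \<not> b"] n by simp
qed

text \<open>
  If every pair of one-step extensions, with entries \<open>i\<close> and \<open>j\<close>, were separated by a set \<open>S i j\<close>, then
  the union over \<open>i\<close> of the intersections over \<open>j\<close> of these sets would separate the original pair of cylinders.
\<close>
lemma insep_step:
  assumes sub: "f ` F \<subseteq> space M" "g ` F' \<subseteq> space M"
    and ins: "\<not> (\<exists>S\<in>sets M. f ` {u\<in>F. agree k u w} \<subseteq> S \<and> S \<inter> g ` {u\<in>F'. agree k u v} = {})"
  shows "\<exists>w' v'. agree k w w' \<and> agree k v v' \<and>
    \<not> (\<exists>S\<in>sets M. f ` {u\<in>F. agree (Suc k) u w'} \<subseteq> S \<and> S \<inter> g ` {u\<in>F'. agree (Suc k) u v'} = {})"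
proof (rule ccontr)
  assume no: "\<not> ?thesis"
  have "\<exists>S\<in>sets M. f ` {u\<in>F. agree (Suc k) u (w(k := i))} \<subseteq> S \<and>
      S \<inter> g ` {u\<in>F'. agree (Suc k) u (v(k := j))} = {}" for i j
  proof -
    have "agree k w (w(k := i))" "agree k v (v(k := j))" by (auto simp: agree_def)
    with no show ?thesis by meson
  qed
  then have ex: "\<exists>S. S \<in> sets M \<and> f ` {u\<in>F. agree (Suc k) u (w(k := i))} \<subseteq> S \<and>
      S \<inter> g ` {u\<in>F'. agree (Suc k) u (v(k := j))} = {}" for i j by (simp only: Bex_def)
  define S where "S = (\<lambda>i j. SOME S. S \<in> sets M \<and> f ` {u\<in>F. agree (Suc k) u (w(k := i))} \<subseteq> S \<and>
      S \<inter> g ` {u\<in>F'. agree (Suc k) u (v(k := j))} = {})"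
  have S: "S i j \<in> sets M" "f ` {u\<in>F. agree (Suc k) u (w(k := i))} \<subseteq> S i j"
      "S i j \<inter> g ` {u\<in>F'. agree (Suc k) u (v(k := j))} = {}" for i j
    using someI_ex[OF ex[of i j]] unfolding S_def by simp_all
  have *: "agree (Suc k) u (w(k := u k))" if "agree k u w" for u w
    using that by (auto simp: agree_def less_Suc_eq)
  have "(\<Union>i::nat. \<Inter>j::nat. S i j) \<in> sets M" using S(1) by (intro sets.countable_UN sets.countable_INT) auto
  moreover have "f ` {u\<in>F. agree k u w} \<subseteq> (\<Union>i. \<Inter>j. S i j)"
  proof (rule image_subsetI)
    fix u assume u: "u \<in> {u\<in>F. agree k u w}"
    then have "f u \<in> f ` {x\<in>F. agree (Suc k) x (w(k := u k))}" using *[of u w] by simp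
    then have "f u \<in> S (u k) j" for j using S(2) by (rule rev_subsetD)
    then show "f u \<in> (\<Union>i. \<Inter>j. S i j)" by simp blast
  qed
  moreover have "(\<Union>i. \<Inter>j. S i j) \<inter> g ` {u\<in>F'. agree k u v} = {}"
  proof -
    have "g u \<notin> S i (u k)" if "u \<in> F'" "agree k u v" for u i
    proof
      assume "g u \<in> S i (u k)"
      moreover have "g u \<in> g ` {x\<in>F'. agree (Suc k) x (v(k := u k))}" using *[OF that(2)] that(1) by simp
      ultimately show False using S(3)[of i "u k"] by blast
    qed
    then show ?thesis by blast
  qed
  ultimately show False using ins by meson
qed

text \<open>
  Inseparability passes to smaller and smaller cylinders, hence to a pair of points \<open>w\<close> and \<open>v\<close>. Their
  images are different, so some \<open>V n\<close> tells them apart, and it already separates the images of small cylinders around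
  them.
\<close>
lemma lusin_separation:
  fixes V :: "nat \<Rightarrow> 'b set"
  assumes F: "seq_closed F" "decides (range V) F f" "f ` F \<subseteq> space M"
    and F': "seq_closed F'" "decides (range V) F' g" "g ` F' \<subseteq> space M"
    and sep: "separating (range V) (space M)" and V: "\<And>n. V n \<in> sets M"
    and dis: "f ` F \<inter> g ` F' = {}"
  shows "\<exists>S\<in>sets M. f ` F \<subseteq> S \<and> S \<inter> g ` F' = {}"
proof (rule ccontr)
  assume no: "\<not> ?thesis"
  define ins where "ins = (\<lambda>k (p :: (nat \<Rightarrow> nat) \<times> (nat \<Rightarrow> nat)). \<not> (\<exists>S\<in>sets M. f ` {u\<in>F. agree k u (fst p)} \<subseteq> S \<and>
    S \<inter> g ` {u\<in>F'. agree k u (snd p)} = {}))"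
  have "\<exists>p. \<forall>n. ins n (p n) \<and> (agree n (fst (p n)) (fst (p (Suc n))) \<and> agree n (snd (p n)) (snd (p (Suc n))))"
  proof (rule dependent_nat_choice)
    show "\<exists>x. ins 0 x" using no by (auto simp: ins_def agree_def)
    show "\<exists>y. ins (Suc n) y \<and> agree n (fst x) (fst y) \<and> agree n (snd x) (snd y)" if "ins n x" for x n
    proof -
      from insep_step[OF F(3) F'(3) that[unfolded ins_def]] obtain w' v' where
        "agree n (fst x) w'" "agree n (snd x) v'" "ins (Suc n) (w', v')"
        unfolding ins_def fst_conv snd_conv by (elim exE conjE)
      then show ?thesis by (intro exI[of _ "(w', v')"]) simp
    qed
  qed
  then obtain p where p: "\<And>n. ins n (p n)"
    and ag: "\<And>n. agree n (fst (p n)) (fst (p (Suc n)))" "\<And>n. agree n (snd (p n)) (snd (p (Suc n)))" by blast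
  have lim: "agree n (q n) (\<lambda>i. q (Suc i) i)" if "\<And>n. agree n (q n) (q (Suc n))" for q :: "nat \<Rightarrow> nat \<Rightarrow> nat" and n
    unfolding agree_def
  proof (intro allI impI)
    fix i assume "i < n"
    have "q (Suc i + j) i = q (Suc i) i" for j
    proof (induction j)
      case (Suc j)
      then show ?case using that[of "Suc i + j"] by (auto simp: agree_def)
    qed simp
    from this[of "n - Suc i"] show "q n i = q (Suc i) i" using \<open>i < n\<close> by simp
  qed
  \<comment> \<open>the limits of the sequences of nested inseparable cylinders\<close>
  define w where "w = (\<lambda>i. fst (p (Suc i)) i)"
  define v where "v = (\<lambda>i. snd (p (Suc i)) i)"
  have w: "agree n (fst (p n)) w" and v: "agree n (snd (p n)) v" for n
    unfolding w_def v_def by (rule lim[of "\<lambda>n. fst (p n)", OF ag(1)], rule lim[of "\<lambda>n. snd (p n)", OF ag(2)])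
  have ins: "\<not> (f ` {u\<in>F. agree n u w} \<subseteq> S \<and> S \<inter> g ` {u\<in>F'. agree n u v} = {})" if "S \<in> sets M" for n S
  proof -
    have "agree n u (fst (p n)) = agree n u w" "agree n u (snd (p n)) = agree n u v" for u
      using w v by (auto simp: agree_def)
    then show ?thesis using p[of n] that unfolding ins_def by auto
  qed
  have "w \<in> F"
  proof (rule seq_closedD[OF F(1)])
    show "\<exists>u\<in>F. agree k u w" for k using ins[of "{}" k] by auto
  qed
  have "v \<in> F'"
  proof (rule seq_closedD[OF F'(1)])
    show "\<exists>u\<in>F'. agree k u v" for k using ins[of "space M" k] F(3) by auto
  qed
  have "f w \<noteq> g v" using dis \<open>w \<in> F\<close> \<open>v \<in> F'\<close> by blast
  then obtain n where n: "(f w \<in> V n) \<noteq> (g v \<in> V n)"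
    using sep F(3) F'(3) \<open>w \<in> F\<close> \<open>v \<in> F'\<close> unfolding separating_def by blast
  obtain k where k: "\<forall>u\<in>F. agree k u w \<longrightarrow> (f u \<in> V n) = (f w \<in> V n)"
    using decidesD[OF F(2) \<open>w \<in> F\<close>] by blast
  obtain j where j: "\<forall>u\<in>F'. agree j u v \<longrightarrow> (g u \<in> V n) = (g v \<in> V n)"
    using decidesD[OF F'(2) \<open>v \<in> F'\<close>] by blast
  have ag': "agree k u z \<and> agree j u z" if "agree (max k j) u z" for u z
    using agree_mono[OF that] by auto
  show False
  proof (cases "f w \<in> V n")
    case True
    have "f ` {u\<in>F. agree (max k j) u w} \<subseteq> V n" using ag' k True by auto
    moreover have "V n \<inter> g ` {u\<in>F'. agree (max k j) u v} = {}" using ag' j n True by auto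
    ultimately show ?thesis using ins[OF V[of n], of "max k j"] by simp
  next
    case False
    have "f ` {u\<in>F. agree (max k j) u w} \<subseteq> space M - V n" using ag' k False F(3) by auto
    moreover have "(space M - V n) \<inter> g ` {u\<in>F'. agree (max k j) u v} = {}" using ag' j n False by auto
    moreover have "space M - V n \<in> sets M" using V by auto
    ultimately show ?thesis using ins[of "space M - V n" "max k j"] by simp
  qed
qed

lemma seq_closed_cylinder: "seq_closed F \<Longrightarrow> seq_closed {u\<in>F. \<forall>i<length s. u i = s ! i}"
  unfolding seq_closed_def
proof (intro allI impI)
  fix w assume F: "\<forall>w. (\<forall>k. \<exists>v\<in>F. agree k v w) \<longrightarrow> w \<in> F"
    and w: "\<forall>k. \<exists>v\<in>{u \<in> F. \<forall>i<length s. u i = s ! i}. agree k v w"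
  from w obtain v where "\<forall>i<length s. v i = s ! i" "agree (length s) v w" by blast
  then have "\<forall>i<length s. w i = s ! i" by (auto simp: agree_def)
  moreover have "w \<in> F" using F w by blast
  ultimately show "w \<in> {u \<in> F. \<forall>i<length s. u i = s ! i}" by blast
qed

lemma decides_subset: "decides \<U> F h \<Longrightarrow> F' \<subseteq> F \<Longrightarrow> decides \<U> F' h"
  unfolding decides_def by (meson subsetD)

text \<open>
  The images of disjoint cylinders are disjoint by injectivity, and hence have Borel hulls that are
  disjoint among words of equal length and can be chosen decreasing along prefixes. A point that
  lies in some hull of each length follows one branch, whose image it must be; so the image is the intersection over the
  lengths of countable unions of hulls.
\<close>
lemma lusin_souslin_sequences:
  fixes V :: "nat \<Rightarrow> 'b set"
  assumes F: "seq_closed F" "decides (range V) F f" "f ` F \<subseteq> space M" and inj: "inj_on f F"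
    and sep: "separating (range V) (space M)" and V: "\<And>n. V n \<in> sets M"
  shows "f ` F \<in> sets M"
proof -
  define cyl where "cyl = (\<lambda>s. {u\<in>F. \<forall>i<length s. u i = s ! i})"
  have cyl_F: "cyl s \<subseteq> F" for s by (auto simp: cyl_def)
  have "\<exists>S\<in>sets M. f ` cyl s \<subseteq> S \<and> S \<inter> f ` cyl t = {}" if st: "length s = length t" "s \<noteq> t" for s t
  proof (rule lusin_separation)
    show "seq_closed (cyl s)" "seq_closed (cyl t)" using seq_closed_cylinder[OF F(1)] by (auto simp: cyl_def)
    show "decides (range V) (cyl s) f" "decides (range V) (cyl t) f" using decides_subset[OF F(2) cyl_F] by auto
    show "f ` cyl s \<subseteq> space M" "f ` cyl t \<subseteq> space M" using F(3) cyl_F by auto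
    have "cyl s \<inter> cyl t = {}" using st nth_equalityI[of s t] by (auto simp: cyl_def)
    then show "f ` cyl s \<inter> f ` cyl t = {}" using inj cyl_F by (auto simp: inj_on_def) blast
  qed (use sep V in auto)
  then obtain Sep where Sep: "\<And>s t. length s = length t \<Longrightarrow> s \<noteq> t \<Longrightarrow>
      Sep s t \<in> sets M \<and> f ` cyl s \<subseteq> Sep s t \<and> Sep s t \<inter> f ` cyl t = {}"
    by metis
  \<comment> \<open>\<open>D s t\<close> contains the image of the cylinder \<open>s\<close> and is disjoint from \<open>D t s\<close>\<close>
  define D where "D = (\<lambda>s t. if length s = length t \<and> s \<noteq> t then Sep s t - Sep t s else space M)"
  have D: "D s t \<in> sets M" "f ` cyl s \<subseteq> D s t" for s t
  proof (atomize (full), cases "length s = length t \<and> s \<noteq> t")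
    case True
    then have "D s t = Sep s t - Sep t s" by (simp add: D_def)
    then show "D s t \<in> sets M \<and> f ` cyl s \<subseteq> D s t"
      using Sep[of s t] Sep[of t s] True by (simp add: sets.Diff) blast
  next
    case False
    moreover have "f ` cyl s \<subseteq> space M" using F(3) image_mono[OF cyl_F[of s]] by (rule order_trans[rotated])
    ultimately show "D s t \<in> sets M \<and> f ` cyl s \<subseteq> D s t" unfolding D_def by (simp only: if_False) simp
  qed
  \<comment> \<open>points in the hull of \<open>s\<close> agree with the image of the cylinder on every \<open>V n\<close> that this image decides\<close>
  define H where "H = (\<lambda>s n. (if f ` cyl s \<subseteq> V n then V n else space M) \<inter>
      (if f ` cyl s \<inter> V n = {} then space M - V n else space M))"
  have H: "H s n \<in> sets M" "f ` cyl s \<subseteq> H s n" for s n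
    using V[of n] F(3) cyl_F[of s] by (auto simp: H_def)
  define B where "B = (\<lambda>s. (\<Inter>t. D s t) \<inter> (\<Inter>n. H s n))"
  have B: "B s \<in> sets M" "f ` cyl s \<subseteq> B s" for s
  proof -
    have "(\<Inter>t. D s t) \<in> sets M" by (rule sets.countable_INT'[OF countableI_type]) (use D in auto)
    moreover have "(\<Inter>n. H s n) \<in> sets M" by (rule sets.countable_INT'[OF countableI_type]) (use H in auto)
    ultimately show "B s \<in> sets M" by (simp add: B_def)
    show "f ` cyl s \<subseteq> B s" unfolding B_def by (intro Int_greatest INT_greatest D(2) H(2))
  qed
  have B_dis: "s = t" if "y \<in> B s" "y \<in> B t" "length s = length t" for s t y
  proof (rule ccontr)
    assume "s \<noteq> t"
    moreover have "y \<in> D s t" "y \<in> D t s" using that by (auto simp: B_def)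
    ultimately show False using that by (auto simp: D_def)
  qed
  define B' where "B' = (\<lambda>s. \<Inter>k\<in>{..length s}. B (take k s))"
  have B': "B' s \<in> sets M" "f ` cyl s \<subseteq> B' s" for s
  proof -
    show "B' s \<in> sets M" unfolding B'_def by (intro sets.finite_INT B) auto
    have "cyl s \<subseteq> cyl (take k s)" for k by (auto simp: cyl_def)
    then show "f ` cyl s \<subseteq> B' s" using B(2) unfolding B'_def by blast
  qed
  have "f ` F = (\<Inter>k. \<Union>s\<in>{s. length s = k}. B' s)" (is "_ = ?R")
  proof (intro equalityI subsetI)
    fix y assume "y \<in> f ` F"
    then obtain w where w: "w \<in> F" "y = f w" by auto
    have "w \<in> cyl (map w [0..<k])" for k using w by (auto simp: cyl_def)
    then have "y \<in> B' (map w [0..<k])" for k using B'(2) w by blast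
    then have "\<exists>s. length s = k \<and> y \<in> B' s" for k by (intro exI[of _ "map w [0..<k]"]) simp
    then show "y \<in> ?R" by blast
  next
    fix y assume "y \<in> ?R"
    then have "\<forall>k. \<exists>s. length s = k \<and> y \<in> B' s" by auto
    then obtain s where len: "\<And>k. length (s k) = k" and yB': "\<And>k. y \<in> B' (s k)" by metis
    have yB: "y \<in> B (take k (s l))" if "k \<le> l" for k l
      using yB'[of l] that len unfolding B'_def by auto
    have take: "take k (s l) = s k" if "k \<le> l" for k l
    proof (rule B_dis[OF yB[OF that]])
      show "y \<in> B (s k)" using yB[of k k] len[of k] by simp
      show "length (take k (s l)) = length (s k)" using len that by simp
    qed
    define w where "w = (\<lambda>i. s (Suc i) ! i)"
    have w: "s k ! i = w i" if "i < k" for i k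
    proof -
      have "s (Suc i) ! i = take (Suc i) (s k) ! i" using take[of "Suc i" k] that by simp
      then show ?thesis by (simp add: w_def)
    qed
    have cyl_eq: "cyl (s k) = {u\<in>F. agree k u w}" for k
      unfolding cyl_def agree_def using w len by (intro Collect_cong conj_cong refl) simp
    have yH: "y \<in> H (s k) n" for k n using yB[of k k] len[of k] by (auto simp: B_def)
    have "cyl (s k) \<noteq> {}" for k
    proof
      assume "cyl (s k) = {}"
      with yH[of k 0] show False by (simp add: H_def)
    qed
    then have "\<exists>u\<in>F. agree k u w" for k using cyl_eq[of k] by auto
    then have "w \<in> F" by (rule seq_closedD[OF F(1)])
    have "y \<in> space M" using subsetD[OF sets.sets_into_space[OF H(1)] yH[of 0 0]] .
    have "y \<in> V n \<longleftrightarrow> f w \<in> V n" for n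
    proof -
      obtain k where k: "\<forall>u\<in>F. agree k u w \<longrightarrow> (f u \<in> V n) = (f w \<in> V n)"
        using decidesD[OF F(2) \<open>w \<in> F\<close>] by blast
      show ?thesis
      proof (cases "f w \<in> V n")
        case True
        then have "f ` cyl (s k) \<subseteq> V n" using k by (auto simp: cyl_eq)
        then show ?thesis using yH[of k n] True by (simp add: H_def)
      next
        case False
        then have "f ` cyl (s k) \<inter> V n = {}" using k by (auto simp: cyl_eq)
        then show ?thesis using yH[of k n] False by (simp add: H_def)
      qed
    qed
    then have V_iff: "y \<in> U \<longleftrightarrow> f w \<in> U" if "U \<in> range V" for U using that by (elim rangeE) simp
    have fw: "f w \<in> space M" by (rule subsetD[OF F(3) imageI[OF \<open>w \<in> F\<close>]])
    have "y = f w" by (rule separatingD[OF sep \<open>y \<in> space M\<close> fw V_iff])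
    then show "y \<in> f ` F" using \<open>w \<in> F\<close> by simp
  qed
  moreover have "?R \<in> sets M"
  proof (rule sets.countable_INT'[OF countableI_type])
    have "(\<Union>s\<in>{s. length s = k}. B' s) \<in> sets M" for k
      by (rule sets.countable_UN'[OF countableI_type]) (use B' in auto)
    then show "range (\<lambda>k. \<Union>s\<in>{s. length s = k}. B' s) \<subseteq> sets M" by blast
  qed auto
  ultimately show ?thesis by simp
qed

text \<open>
  Once the whole space has a Borel image under the coordinate map, the image of every Borel set is the
  trace of a Borel set on it.
\<close>
lemma sets_via_coordinates:
  fixes U :: "nat \<Rightarrow> 'a set"
  assumes sets: "sets M = sigma_sets (space M) (range U)" and U: "\<And>n. U n \<subseteq> space M"
    and Z: "(\<lambda>x n. x \<in> U n) ` space M \<in> sigma_sets UNIV (range coord)" and A: "A \<in> sets M"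
  shows "(\<lambda>x n. x \<in> U n) ` A \<in> sigma_sets UNIV (range coord)"
proof -
  interpret sigma_algebra UNIV "sigma_sets UNIV (range coord)" by (rule sigma_algebra_sigma_sets) auto
  let ?b = "\<lambda>x n. x \<in> U n"
  have "\<exists>C\<in>sigma_sets UNIV (range coord). A = {x\<in>space M. ?b x \<in> C}"
    using A unfolding sets
  proof (induction rule: sigma_sets.induct)
    case (Basic a)
    then obtain n where n: "a = U n" by auto
    then show ?case using U[of n] by (intro bexI[of _ "coord n"]) (auto simp: coord_def)
  next
    case Empty then show ?case by (intro bexI[of _ "{}"]) auto
  next
    case (Compl a)
    then obtain C where "C \<in> sigma_sets UNIV (range coord)" "a = {x\<in>space M. ?b x \<in> C}" by blast
    then show ?case by (intro bexI[of _ "UNIV - C"]) auto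
  next
    case (Union a)
    then have "\<forall>i. \<exists>C. C \<in> sigma_sets UNIV (range coord) \<and> a i = {x\<in>space M. ?b x \<in> C}" by blast
    from choice[OF this] obtain C where C: "\<forall>i. C i \<in> sigma_sets UNIV (range coord) \<and> a i = {x\<in>space M. ?b x \<in> C i}" ..
    have "(\<Union>i. a i) = {x\<in>space M. ?b x \<in> (\<Union>i. C i)}" using C by simp blast
    moreover have "(\<Union>i. C i) \<in> sigma_sets UNIV (range coord)" using C by (intro sigma_sets.Union) simp
    ultimately show ?case by (rule bexI)
  qed
  then obtain C where C: "C \<in> sigma_sets UNIV (range coord)" "A = {x\<in>space M. ?b x \<in> C}" by blast
  have "?b ` A = ?b ` space M \<inter> C" using C by auto
  then show ?thesis using C Z by auto
qed

text \<open>
  In a complete separable metric space the set of indices of basic open sets around a point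
  is characterized by countably many conditions: arbitrarily small sets occur, any two of them meet, and the
  indices are exactly those whose set contains the closure of an occurring one. Completeness provides the point.
\<close>
lemma (in Metric_space) coordinates_range:
  fixes U :: "nat \<Rightarrow> 'a set"
  assumes complete: mcomplete and U: "\<And>n. openin mtopology (U n)"
    and base: "\<And>W x. openin mtopology W \<Longrightarrow> x \<in> W \<Longrightarrow> \<exists>n. x \<in> U n \<and> U n \<subseteq> W"
  shows "(\<lambda>x n. x \<in> U n) ` M = {z. (\<forall>k. \<exists>n. z n \<and> (\<forall>x\<in>U n. \<forall>y\<in>U n. d x y < 1 / real (Suc k))) \<and>
      (\<forall>n m. z n \<and> z m \<longrightarrow> U n \<inter> U m \<noteq> {}) \<and> (\<forall>n. z n \<longleftrightarrow> (\<exists>m. z m \<and> mtopology closure_of U m \<subseteq> U n))}"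
    (is "?b ` M = ?Z")
proof (intro equalityI subsetI)
  have UM: "U n \<subseteq> M" for n using openin_subset[OF U[of n]] by simp
  {
    fix z assume "z \<in> ?b ` M"
    then obtain x where x: "x \<in> M" and z: "z = ?b x" by blast
    have near: "\<exists>n. x \<in> U n \<and> U n \<subseteq> mball x r" if "r > 0" for r
      using base[OF openin_mball] x that by simp
    have "\<exists>n. z n \<and> (\<forall>x\<in>U n. \<forall>y\<in>U n. d x y < 1 / real (Suc k))" for k
    proof -
      obtain n where n: "x \<in> U n" "U n \<subseteq> mball x (1 / (2 * real (Suc k)))" using near[of "1 / (2 * real (Suc k))"] by auto
      have "d a b < 1 / real (Suc k)" if "a \<in> U n" "b \<in> U n" for a b
      proof -
        have a: "a \<in> M" "b \<in> M" using that UM by auto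
        have "d x a < 1 / (2 * real (Suc k))" "d x b < 1 / (2 * real (Suc k))" using that n(2) by auto
        moreover have "d a b \<le> d x a + d x b" using triangle[OF a(1) x a(2)] commute[of a x] by simp
        ultimately have "d a b < 1 / (2 * real (Suc k)) + 1 / (2 * real (Suc k))" by (rule add_strict_mono[THEN le_less_trans[rotated]])
        also have "\<dots> = 1 / real (Suc k)" by (simp add: field_simps)
        finally show ?thesis .
      qed
      then show ?thesis using n(1) unfolding z by auto
    qed
    moreover have "U n \<inter> U m \<noteq> {}" if "z n" "z m" for n m using that unfolding z by blast
    moreover have "z n \<longleftrightarrow> (\<exists>m. z m \<and> mtopology closure_of U m \<subseteq> U n)" for n
    proof
      assume "z n"
      then have "x \<in> U n" by (simp add: z)
      then obtain r where r: "r > 0" "mball x r \<subseteq> U n" using U[of n] unfolding openin_mtopology by auto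
      obtain m where m: "x \<in> U m" "U m \<subseteq> mball x (r / 2)" using near[of "r / 2"] r by auto
      have "mtopology closure_of U m \<subseteq> U n"
        unfolding inside_def
      proof
        fix y assume "y \<in> mtopology closure_of U m"
        then obtain y' where y: "y \<in> M" "y' \<in> U m" "y' \<in> mball y (r / 2)"
          using half_gt_zero[OF r(1)] unfolding metric_closure_of by blast
        have y': "y' \<in> M" "d x y' < r / 2" using m(2) y(2) by auto
        have "d x y \<le> d x y' + d y' y" using triangle x y y' by simp
        also have "d y' y < r / 2" using y(3) by (simp add: commute)
        finally have "d x y < r" using y' by simp
        then show "y \<in> U n" using r(2) x y(1) by auto
      qed
      then show "\<exists>m. z m \<and> mtopology closure_of U m \<subseteq> U n" using m(1) z by blast
    next
      assume "\<exists>m. z m \<and> mtopology closure_of U m \<subseteq> U n"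
      then obtain m where "x \<in> U m" "mtopology closure_of U m \<subseteq> U n" by (auto simp: z inside_def)
      moreover have "U m \<subseteq> mtopology closure_of U m" using UM by (intro closure_of_subset) simp
      ultimately show "z n" by (auto simp: z)
    qed
    ultimately show "z \<in> ?Z" by blast
  next
    fix z assume "z \<in> ?Z"
    then have Z: "(\<forall>k. \<exists>n. z n \<and> (\<forall>x\<in>U n. \<forall>y\<in>U n. d x y < 1 / real (Suc k))) \<and>
      (\<forall>n m. z n \<and> z m \<longrightarrow> U n \<inter> U m \<noteq> {}) \<and> (\<forall>n. z n \<longleftrightarrow> (\<exists>m. z m \<and> mtopology closure_of U m \<subseteq> U n))"
      by (rule CollectD)
    have s: "\<forall>k. \<exists>n. z n \<and> (\<forall>x\<in>U n. \<forall>y\<in>U n. d x y < 1 / real (Suc k))" by (rule conjunct1[OF Z])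
    have meet: "\<And>n m. z n \<Longrightarrow> z m \<Longrightarrow> U n \<inter> U m \<noteq> {}"
      by (rule mp[OF spec[OF spec[OF conjunct1[OF conjunct2[OF Z]]]] conjI])
    have ins: "\<And>n. z n \<longleftrightarrow> (\<exists>m. z m \<and> mtopology closure_of U m \<subseteq> U n)" for n
      by (rule spec[OF conjunct2[OF conjunct2[OF Z]]])
    from choice[OF s] obtain n where n: "\<And>k. z (n k) \<and> (\<forall>x\<in>U (n k). \<forall>y\<in>U (n k). d x y < 1 / real (Suc k))" by blast
    have "\<forall>k. \<exists>p. p \<in> U (n k)" using meet n by blast
    from choice[OF this] obtain p where p: "\<And>k. p k \<in> U (n k)" by blast
    have pM: "p k \<in> M" for k using p UM by blast
    have d1: "d q (p k) < 1 / real (Suc k)" if "q \<in> U (n k)" for q k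
      using n[of k] p[of k] that by blast
    have "MCauchy p"
      unfolding MCauchy_def
    proof (intro conjI allI impI)
      show "range p \<subseteq> M" using pM by blast
      fix e :: real assume "e > 0"
      then obtain N where N: "1 / real (Suc N) < e / 2" using nat_approx_posE[of "e / 2"] by auto
      have "d (p k) (p l) < e" if "N \<le> k" "N \<le> l" for k l
      proof -
        obtain q where q: "q \<in> U (n k)" "q \<in> U (n l)" using meet[of "n k" "n l"] n by blast
        have "d (p k) (p l) \<le> d q (p k) + d q (p l)"
          using triangle[of "p k" q "p l"] pM q UM commute[of "p k" q] by auto
        also have "\<dots> < 1 / real (Suc k) + 1 / real (Suc l)" using d1 q by (intro add_strict_mono) auto
        also have "\<dots> \<le> 1 / real (Suc N) + 1 / real (Suc N)"
          using that by (intro add_mono divide_left_mono) auto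
        finally show ?thesis using N by simp
      qed
      then show "\<exists>N. \<forall>k l. N \<le> k \<longrightarrow> N \<le> l \<longrightarrow> d (p k) (p l) < e" by blast
    qed
    then obtain x where lim: "limitin mtopology p x sequentially" using complete unfolding mcomplete_def by blast
    then have x: "x \<in> M" by (rule limitin_mspace)
    have dp: "\<exists>K. \<forall>k\<ge>K. d (p k) x < e" if "e > 0" for e
      using lim that unfolding limitin_metric eventually_sequentially by blast
    have cl: "x \<in> mtopology closure_of U m" if zm: "z m" for m
      unfolding metric_closure_of
    proof (intro CollectI conjI x allI impI)
      fix r :: real assume r: "r > 0"
      obtain K where K: "\<forall>k\<ge>K. d (p k) x < r / 2" using dp[of "r / 2"] r by auto
      obtain N where N: "1 / real (Suc N) < r / 2" using nat_approx_posE[of "r / 2"] r by auto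
      define k where "k = max K N"
      obtain q where q: "q \<in> U m" "q \<in> U (n k)" using meet[OF zm, of "n k"] n[of k] by blast
      have "d x q \<le> d (p k) x + d q (p k)"
        using triangle[of x "p k" q] x pM q UM commute[of x "p k"] commute[of "p k" q] by auto
      also have "\<dots> < r / 2 + 1 / real (Suc k)" using K d1[OF q(2)] by (intro add_strict_mono) (auto simp: k_def)
      also have "1 / real (Suc k) \<le> 1 / real (Suc N)" by (intro divide_left_mono) (auto simp: k_def)
      finally have "d x q < r" using N by simp
      then show "\<exists>y\<in>U m. y \<in> mball x r" using q(1) UM x by auto
    qed
    have "z i \<longleftrightarrow> x \<in> U i" for i
    proof
      assume "z i"
      then show "x \<in> U i" using ins[of i] cl unfolding inside_def by blast
    next
      assume "x \<in> U i"
      then obtain r where r: "r > 0" "mball x r \<subseteq> U i" using U[of i] unfolding openin_mtopology by auto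
      obtain k where k: "1 / real (Suc k) < r / 3" using nat_approx_posE[of "r / 3"] r(1) by auto
      have near: "\<exists>a\<in>U (n k). d y a < r / 3" if "y \<in> mtopology closure_of U (n k)" for y
      proof -
        have "\<forall>r>0. \<exists>a\<in>U (n k). a \<in> mball y r" using that unfolding metric_closure_of by blast
        moreover have "0 < r / 3" using r(1) by simp
        ultimately have "\<exists>a\<in>U (n k). a \<in> mball y (r / 3)" by blast
        then show ?thesis by (auto simp: in_mball)
      qed
      have "mtopology closure_of U (n k) \<subseteq> U i"
        unfolding inside_def
      proof
        fix y assume y: "y \<in> mtopology closure_of U (n k)"
        then have yM: "y \<in> M" unfolding metric_closure_of by blast
        obtain a where a: "a \<in> U (n k)" "d y a < r / 3" using near[OF y] by blast
        obtain b where b: "b \<in> U (n k)" "d x b < r / 3" using near[OF cl[OF conjunct1[OF n]]] by blast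
        have M: "a \<in> M" "b \<in> M" using a b UM by auto
        have "d x y \<le> d x b + d b y" using triangle x M yM by simp
        also have "d b y \<le> d b a + d y a" using triangle[OF M(2) M(1) yM] commute[of a y] by simp
        also have "d b a < r / 3" using n[of k] a(1) b(1) k by fastforce
        finally have "d x y < r" using a(2) b(2) by simp
        then show "y \<in> U i" using r(2) x yM by auto
      qed
      then show "z i" using ins[of i] n[of k] by blast
    qed
    then have "z = ?b x" by auto
    then show "z \<in> ?b ` M" using x by blast
  }
qed

lemma standard_borel_coordinates:
  assumes "standard_borel N"
  obtains U :: "nat \<Rightarrow> 'a set" where "sets N = sigma_sets (space N) (range U)" "\<And>n. U n \<subseteq> space N"
    "separating (range U) (space N)" "(\<lambda>x n. x \<in> U n) ` space N \<in> sigma_sets UNIV (range coord)"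
proof -
  from assms obtain X where X: "completely_metrizable_space X" "second_countable X" "topspace X = space N"
    and sets: "sets N = sigma_sets (space N) {U. openin X U}" unfolding standard_borel_def by blast
  from X(1) obtain M d where "Metric_space M d" and complete: "Metric_space.mcomplete M d"
    and Xd: "X = Metric_space.mtopology M d" unfolding completely_metrizable_space_def by blast
  then interpret Metric_space M d by simp
  have M: "M = space N" using X(3) Xd by simp
  obtain \<B> where B: "countable \<B>" "\<And>V. V \<in> \<B> \<Longrightarrow> openin X V"
    "\<And>W x. openin X W \<Longrightarrow> x \<in> W \<Longrightarrow> \<exists>V\<in>\<B>. x \<in> V \<and> V \<subseteq> W" using X(2) unfolding second_countable_def by metis
  define U where "U = from_nat_into (insert {} \<B>)"
  have rU: "range U = insert {} \<B>" unfolding U_def using B(1) by (intro range_from_nat_into) auto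
  have op: "openin X (U n)" for n using B(2) rU rangeI[of U n] by auto
  have base: "\<exists>n. x \<in> U n \<and> U n \<subseteq> W" if W: "openin X W" "x \<in> W" for W x
  proof -
    obtain V where V: "V \<in> \<B>" "x \<in> V" "V \<subseteq> W" using B(3)[OF W] by blast
    then have "V \<in> range U" using rU by simp
    then show ?thesis using V by (elim rangeE) blast
  qed
  have sub: "U n \<subseteq> space N" for n using openin_subset[OF op[of n]] X(3) by simp
  show ?thesis
  proof
    show "sets N = sigma_sets (space N) (range U)"
      unfolding sets
    proof (rule sigma_sets_eqI)
      fix a assume "a \<in> {U. openin X U}"
      then have a: "openin X a" by simp
      have "a = (\<Union>n\<in>{n. U n \<subseteq> a}. U n)" using base[OF a] by blast
      moreover have "(\<Union>n\<in>{n. U n \<subseteq> a}. U n) \<in> sigma_sets (space N) (range U)"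
        by (intro sigma_sets_UNION countable_image countableI_type) (auto intro: sigma_sets.Basic)
      ultimately show "a \<in> sigma_sets (space N) (range U)" by simp
    next
      fix b assume "b \<in> range U"
      then show "b \<in> sigma_sets (space N) {U. openin X U}" using op by (auto intro: sigma_sets.Basic)
    qed
    show "U n \<subseteq> space N" for n by (rule sub)
    show "separating (range U) (space N)"
      unfolding separating_def
    proof (intro ballI impI)
      fix x y assume xy: "x \<in> space N" "y \<in> space N" "\<forall>V\<in>range U. (x \<in> V) = (y \<in> V)"
      show "x = y"
      proof (rule ccontr)
        assume "x \<noteq> y"
        then have "0 < d x y" using xy M by simp
        moreover have "\<exists>n. x \<in> U n \<and> U n \<subseteq> mball x (d x y)"
        proof (rule base)
          show "openin X (mball x (d x y))" unfolding Xd by (rule openin_mball)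
          have "x \<in> M" unfolding M by (rule xy(1))
          then show "x \<in> mball x (d x y)" using \<open>0 < d x y\<close> by simp
        qed
        ultimately obtain n where "x \<in> U n" "U n \<subseteq> mball x (d x y)" by blast
        then have "y \<in> mball x (d x y)" using xy(3) by blast
        then show False by simp
      qed
    qed
    interpret S: sigma_algebra UNIV "sigma_sets UNIV (range coord)" by (rule sigma_algebra_sigma_sets) auto
    define Cs where "Cs = sigma (UNIV :: (nat \<Rightarrow> bool) set) (range coord)"
    have Cs: "space Cs = UNIV" "sets Cs = sigma_sets UNIV (range coord)" unfolding Cs_def by auto
    have [measurable]: "Measurable.pred Cs (\<lambda>z. z n)" for n
    proof -
      have "{z \<in> space Cs. z n} = coord n" by (simp add: Cs coord_def)
      moreover have "coord n \<in> sets Cs" unfolding Cs by (auto intro: sigma_sets.Basic)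
      ultimately show ?thesis by (simp add: pred_def)
    qed
    have "{z \<in> space Cs. (\<forall>k. \<exists>n. z n \<and> (\<forall>x\<in>U n. \<forall>y\<in>U n. d x y < 1 / real (Suc k))) \<and>
      (\<forall>n m. z n \<and> z m \<longrightarrow> U n \<inter> U m \<noteq> {}) \<and> (\<forall>n. z n \<longleftrightarrow> (\<exists>m. z m \<and> mtopology closure_of U m \<subseteq> U n))} \<in> sets Cs"
      by measurable
    then show "(\<lambda>x n. x \<in> U n) ` space N \<in> sigma_sets UNIV (range coord)"
      using coordinates_range[OF complete, of U] op base by (simp only: M[symmetric] Xd Cs Collect_conj_eq Int_UNIV_left UNIV_I simp_thms)
  qed
qed

text \<open>
  The theorem of Lusin and Souslin. The coordinate map transports \<open>A\<close> to a Borel subset of Cantor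
  space, which has a closed set of codes; refining the coding so that it decides the preimages of a separating
  sequence of the target reduces the claim to sequences.
\<close>
theorem injective_image_measurable:
  fixes N :: "'a measure" and N' :: "'b measure"
  assumes "standard_borel N" "standard_borel N'" and f: "f \<in> N \<rightarrow>\<^sub>M N'" and A: "A \<in> sets N" and inj: "inj_on f A"
  shows "f ` A \<in> sets N'"
proof -
  obtain U where U: "sets N = sigma_sets (space N) (range U)" "\<And>n. U n \<subseteq> space N"
    "separating (range U) (space N)" "(\<lambda>x n. x \<in> U n) ` space N \<in> sigma_sets UNIV (range coord)"
    by (rule standard_borel_coordinates[OF assms(1)]) (rule that)
  obtain V :: "nat \<Rightarrow> 'b set" where V: "sets N' = sigma_sets (space N') (range V)" "\<And>n. V n \<subseteq> space N'" "separating (range V) (space N')"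
    by (rule standard_borel_coordinates[OF assms(2)]) (rule that)
  have Vs: "V n \<in> sets N'" for n unfolding V(1) by (auto intro: sigma_sets.Basic)
  define b where "b = (\<lambda>x n. x \<in> U n)"
  define W where "W = (\<lambda>n. b ` (A \<inter> (f -` V n \<inter> space N)))"
  have img: "b ` B \<in> sigma_sets UNIV (range coord)" if "B \<in> sets N" for B
    using sets_via_coordinates[OF U(1,2,4) that] by (simp add: b_def)
  have AN: "A \<subseteq> space N" using A sets.sets_into_space by blast
  have inj_b: "inj_on b A"
  proof (rule inj_onI)
    fix x y assume xy: "x \<in> A" "y \<in> A" "b x = b y"
    show "x = y"
    proof (rule separatingD[OF U(3)])
      show "x \<in> space N" "y \<in> space N" using xy AN by auto
      show "x \<in> V \<longleftrightarrow> y \<in> V" if "V \<in> range U" for V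
        using that fun_cong[OF xy(3)] by (elim rangeE) (simp add: b_def)
    qed
  qed
  have "representable (range W) (b ` A)"
  proof (rule representable_cantor)
    show "b ` A \<in> sigma_sets UNIV (range coord)" using img A by blast
    show "W n \<in> sigma_sets UNIV (range coord)" for n
      unfolding W_def by (rule img) (use A measurable_sets[OF f Vs] in auto)
  qed
  then obtain F h where F: "seq_closed F" and h: "bij_betw h F (b ` A)" and dec: "decides (range W) F h"
    unfolding representable_def by blast
  define a where "a = (\<lambda>w. inv_into A b (h w))"
  have a: "a w \<in> A" "b (a w) = h w" if "w \<in> F" for w
    using bij_betw_apply[OF h that] by (simp_all add: a_def inv_into_into f_inv_into_f)
  have inj_a: "inj_on a F"
  proof (rule inj_onI)
    fix v w assume "v \<in> F" "w \<in> F" "a v = a w"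
    then show "v = w" using a h unfolding bij_betw_def inj_on_def by metis
  qed
  have "a ` F = A"
  proof (intro equalityI subsetI)
    fix x assume x: "x \<in> A"
    then obtain w where w: "w \<in> F" "h w = b x" using bij_betw_imp_surj_on[OF h] by (metis imageE imageI)
    then have "a w = x" unfolding a_def using inj_b x by simp
    then show "x \<in> a ` F" using w(1) by blast
  qed (use a in auto)
  moreover have "(f \<circ> a) ` F \<in> sets N'"
  proof (rule lusin_souslin_sequences[OF F _ _ _ V(3) Vs])
    show "inj_on (f \<circ> a) F" using comp_inj_on[OF inj_a] inj \<open>a ` F = A\<close> by simp
    show "(f \<circ> a) ` F \<subseteq> space N'" using a(1) AN measurable_space[OF f] by auto
    show "decides (range V) F (f \<circ> a)"
      unfolding decides_def
    proof (intro ballI)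
      fix w B assume w: "w \<in> F" and "B \<in> range V"
      then obtain n where n: "B = V n" by blast
      have *: "(f \<circ> a) v \<in> V n \<longleftrightarrow> h v \<in> W n" if v: "v \<in> F" for v
      proof
        assume "(f \<circ> a) v \<in> V n"
        then have "a v \<in> A \<inter> (f -` V n \<inter> space N)" using a(1)[OF v] AN by auto
        then show "h v \<in> W n" unfolding W_def using a(2)[OF v] by (metis imageI)
      next
        assume "h v \<in> W n"
        then obtain x where x: "x \<in> A" "f x \<in> V n" "b x = b (a v)" unfolding W_def using a(2)[OF v] by auto
        then have "x = a v" using inj_onD[OF inj_b] a(1)[OF v] by simp
        then show "(f \<circ> a) v \<in> V n" using x by simp
      qed
      obtain k where "\<forall>v\<in>F. agree k v w \<longrightarrow> (h v \<in> W n) = (h w \<in> W n)" using decidesD[OF dec w] by blast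
      then show "\<exists>k. \<forall>v\<in>F. agree k v w \<longrightarrow> ((f \<circ> a) v \<in> B) = ((f \<circ> a) w \<in> B)"
        unfolding n using * w by (intro exI[of _ k]) simp
    qed
  qed
  moreover have "(f \<circ> a) ` F = f ` a ` F" by (simp add: image_comp)
  ultimately show ?thesis by simp
qed

section \<open>Operators given by transformations of square-integrable functions\<close>

lemma l2_funD: "f \<in> l2_fun N \<Longrightarrow> f \<in> borel_measurable N" "f \<in> l2_fun N \<Longrightarrow> integrable N (\<lambda>x. (cmod (f x))\<^sup>2)"
  by (auto simp: l2_fun_def)

lemma l2_fun_dominated:
  assumes f: "f \<in> borel_measurable N" and h: "integrable N h" and le: "\<And>x. x \<in> space N \<Longrightarrow> (cmod (f x))\<^sup>2 \<le> h x"
  shows "f \<in> l2_fun N"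
proof -
  have "integrable N (\<lambda>x. (cmod (f x))\<^sup>2)"
  proof (rule Bochner_Integration.integrable_bound[OF h])
    show "(\<lambda>x. (cmod (f x))\<^sup>2) \<in> borel_measurable N" using f by measurable
    show "AE x in N. norm ((cmod (f x))\<^sup>2) \<le> norm (h x)"
    proof (rule AE_I2)
      fix x assume "x \<in> space N"
      from le[OF this] show "norm ((cmod (f x))\<^sup>2) \<le> norm (h x)" by simp
    qed
  qed
  with f show ?thesis by (simp add: l2_fun_def)
qed

lemma norm_add_sq_le: "(cmod (a + b))\<^sup>2 \<le> 2 * (cmod a)\<^sup>2 + 2 * (cmod b)\<^sup>2"
proof -
  have "(cmod (a + b))\<^sup>2 \<le> (cmod a + cmod b)\<^sup>2" by (intro power_mono norm_triangle_ineq) simp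
  also have "\<dots> = 2 * (cmod a)\<^sup>2 + 2 * (cmod b)\<^sup>2 - (cmod a - cmod b)\<^sup>2" by (simp add: power2_eq_square algebra_simps)
  also have "\<dots> \<le> 2 * (cmod a)\<^sup>2 + 2 * (cmod b)\<^sup>2" by simp
  finally show ?thesis .
qed

lemma l2_fun_add: "f \<in> l2_fun N \<Longrightarrow> g \<in> l2_fun N \<Longrightarrow> (\<lambda>x. f x + g x) \<in> l2_fun N"
  by (rule l2_fun_dominated[where h = "\<lambda>x. 2 * (cmod (f x))\<^sup>2 + 2 * (cmod (g x))\<^sup>2"])
    (auto intro!: borel_measurable_add norm_add_sq_le Bochner_Integration.integrable_add integrable_mult_right dest: l2_funD)

lemma l2_fun_scale: "f \<in> l2_fun N \<Longrightarrow> (\<lambda>x. c * f x) \<in> l2_fun N"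
  by (rule l2_fun_dominated[where h = "\<lambda>x. (cmod c)\<^sup>2 * (cmod (f x))\<^sup>2"])
    (auto simp: norm_mult power_mult_distrib dest: l2_funD)

lemma l2_fun_zero: "(\<lambda>x. 0) \<in> l2_fun N"
  by (auto simp: l2_fun_def)

lemma integrable_l2_mult:
  assumes "f \<in> l2_fun N" "g \<in> l2_fun N" shows "integrable N (\<lambda>x. f x * cnj (g x))"
proof (rule Bochner_Integration.integrable_bound)
  show "integrable N (\<lambda>x. (cmod (f x))\<^sup>2 + (cmod (g x))\<^sup>2)" using assms by (intro Bochner_Integration.integrable_add l2_funD)
  have [measurable]: "f \<in> borel_measurable N" "g \<in> borel_measurable N" using assms by (auto dest: l2_funD)
  have "(\<lambda>x. cnj (g x)) \<in> borel_measurable N"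
    by (rule measurable_compose[of g N borel, OF _ borel_measurable_continuous_onI]) (auto intro!: continuous_intros)
  then show "(\<lambda>x. f x * cnj (g x)) \<in> borel_measurable N" by (intro borel_measurable_times) simp_all
  show "AE x in N. norm (f x * cnj (g x)) \<le> norm ((cmod (f x))\<^sup>2 + (cmod (g x))\<^sup>2)"
  proof (rule AE_I2)
    fix x
    have "0 \<le> (cmod (f x) - cmod (g x))\<^sup>2" "0 \<le> (cmod (f x))\<^sup>2" "0 \<le> (cmod (g x))\<^sup>2" by auto
    then have "2 * (cmod (f x) * cmod (g x)) \<le> (cmod (f x))\<^sup>2 + (cmod (g x))\<^sup>2"
      by (simp add: power2_diff mult.assoc)
    moreover have "0 \<le> cmod (f x) * cmod (g x)" by simp
    ultimately have "cmod (f x) * cmod (g x) \<le> (cmod (f x))\<^sup>2 + (cmod (g x))\<^sup>2" by linarith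
    then show "norm (f x * cnj (g x)) \<le> norm ((cmod (f x))\<^sup>2 + (cmod (g x))\<^sup>2)"
      by (simp add: norm_mult)
  qed
qed

lemma equiv_l2: "equiv (l2_fun N) (l2_rel N)"
proof (rule equivI)
  show "l2_rel N \<subseteq> l2_fun N \<times> l2_fun N" by (auto simp: l2_rel_def)
  show "refl_on (l2_fun N) (l2_rel N)" by (auto simp: refl_on_def l2_rel_def)
  show "sym (l2_rel N)"
  proof (rule symI)
    fix f g assume "(f, g) \<in> l2_rel N"
    then have fg: "f \<in> l2_fun N" "g \<in> l2_fun N" "AE x in N. f x = g x" by (auto simp: l2_rel_def)
    from fg(3) have "AE x in N. g x = f x" by eventually_elim simp
    then show "(g, f) \<in> l2_rel N" using fg by (simp add: l2_rel_def)
  qed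
  show "trans (l2_rel N)"
  proof (rule transI)
    fix f g h assume "(f, g) \<in> l2_rel N" "(g, h) \<in> l2_rel N"
    then have fg: "f \<in> l2_fun N" "h \<in> l2_fun N" "AE x in N. f x = g x" "AE x in N. g x = h x" by (auto simp: l2_rel_def)
    from fg(3,4) have "AE x in N. f x = h x" by eventually_elim simp
    then show "(f, h) \<in> l2_rel N" using fg by (simp add: l2_rel_def)
  qed
qed

lemma l2_class_in: "f \<in> l2_fun N \<Longrightarrow> l2_class N f \<in> L2 N"
  by (simp add: L2_def l2_class_def quotientI)

lemma l2_class_eq_iff: "f \<in> l2_fun N \<Longrightarrow> g \<in> l2_fun N \<Longrightarrow> l2_class N f = l2_class N g \<longleftrightarrow> (AE x in N. f x = g x)"
  unfolding l2_class_def by (subst eq_equiv_class_iff[OF equiv_l2]) (auto simp: l2_rel_def)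

lemma L2_cases: assumes "\<xi> \<in> L2 N" obtains f where "f \<in> l2_fun N" "\<xi> = l2_class N f"
proof -
  from assms obtain f where "f \<in> l2_fun N" "\<xi> = l2_rel N `` {f}" unfolding L2_def by (rule quotientE)
  then show ?thesis by (intro that[of f]) (simp_all add: l2_class_def)
qed

lemma l2_rep_class:
  assumes "f \<in> l2_fun N"
  shows "l2_rep (l2_class N f) \<in> l2_fun N" "AE x in N. l2_rep (l2_class N f) x = f x"
proof -
  have "f \<in> l2_class N f" using assms by (auto simp: l2_class_def l2_rel_def)
  then have "l2_rep (l2_class N f) \<in> l2_class N f" unfolding l2_rep_def by (rule someI[of "\<lambda>g. g \<in> l2_class N f"])
  then have r: "l2_rep (l2_class N f) \<in> l2_fun N" "AE x in N. f x = l2_rep (l2_class N f) x"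
    by (auto simp: l2_class_def l2_rel_def)
  show "l2_rep (l2_class N f) \<in> l2_fun N" by (rule r)
  show "AE x in N. l2_rep (l2_class N f) x = f x" using r(2) by eventually_elim simp
qed

lemma l2_add_class:
  assumes "f \<in> l2_fun N" "g \<in> l2_fun N"
  shows "l2_add N (l2_class N f) (l2_class N g) = l2_class N (\<lambda>x. f x + g x)"
proof -
  have "AE x in N. l2_rep (l2_class N f) x + l2_rep (l2_class N g) x = f x + g x"
    using l2_rep_class(2)[OF assms(1)] l2_rep_class(2)[OF assms(2)] by eventually_elim simp
  then show ?thesis unfolding l2_add_def using assms by (simp add: l2_class_eq_iff l2_fun_add l2_rep_class(1))
qed

lemma l2_scale_class:
  assumes "f \<in> l2_fun N" shows "l2_scale N c (l2_class N f) = l2_class N (\<lambda>x. c * f x)"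
proof -
  have "AE x in N. c * l2_rep (l2_class N f) x = c * f x" using l2_rep_class(2)[OF assms(1)] by eventually_elim simp
  then show ?thesis unfolding l2_scale_def using assms by (simp add: l2_class_eq_iff l2_fun_scale l2_rep_class(1))
qed

lemma l2_inner_class:
  assumes "f \<in> l2_fun N" "g \<in> l2_fun N"
  shows "l2_inner N (l2_class N f) (l2_class N g) = (\<integral>x. f x * cnj (g x) \<partial>N)"
  unfolding l2_inner_def
proof (rule integral_cong_AE)
  show "(\<lambda>x. l2_rep (l2_class N f) x * cnj (l2_rep (l2_class N g) x)) \<in> borel_measurable N"
    using assms by (intro borel_measurable_integrable integrable_l2_mult l2_rep_class(1))
  show "(\<lambda>x. f x * cnj (g x)) \<in> borel_measurable N"
    using assms by (intro borel_measurable_integrable integrable_l2_mult)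
  show "AE x in N. l2_rep (l2_class N f) x * cnj (l2_rep (l2_class N g) x) = f x * cnj (g x)"
    using l2_rep_class(2)[OF assms(1)] l2_rep_class(2)[OF assms(2)] by eventually_elim simp
qed

lemma l2_fun_eqI:
  assumes "f \<in> l2_fun N" "g \<in> l2_fun N" and inner: "\<And>h. h \<in> l2_fun N \<Longrightarrow> (\<integral>x. h x * cnj (f x) \<partial>N) = (\<integral>x. h x * cnj (g x) \<partial>N)"
  shows "AE x in N. f x = g x"
proof -
  define h where "h = (\<lambda>x. f x + (- 1) * g x)"
  have h: "h \<in> l2_fun N" unfolding h_def by (intro l2_fun_add l2_fun_scale assms)
  have "(\<integral>x. h x * cnj (h x) \<partial>N) = (\<integral>x. h x * cnj (f x) - h x * cnj (g x) \<partial>N)"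
    by (intro Bochner_Integration.integral_cong) (auto simp: h_def algebra_simps)
  also have "\<dots> = 0" using inner[OF h] assms h by (simp add: integrable_l2_mult)
  finally have "complex_of_real (\<integral>x. (cmod (h x))\<^sup>2 \<partial>N) = 0"
    by (simp add: complex_norm_square[symmetric] flip: integral_complex_of_real of_real_power)
  then have "(\<integral>x. (cmod (h x))\<^sup>2 \<partial>N) = 0" by simp
  then have "AE x in N. (cmod (h x))\<^sup>2 = 0"
    by (subst (asm) integral_nonneg_eq_0_iff_AE) (use h in \<open>auto dest: l2_funD\<close>)
  then show ?thesis by eventually_elim (simp add: h_def)
qed

text \<open>
  The operators are defined on classes of functions modulo null sets. All calculations are done with a
  transformation \<open>F\<close> of representatives that induces the operator \<open>a\<close>.
\<close>
definition lifts :: "'a measure \<Rightarrow> 'a l2_op \<Rightarrow> (('a \<Rightarrow> complex) \<Rightarrow> 'a \<Rightarrow> complex) \<Rightarrow> bool" where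
  "lifts N a F \<longleftrightarrow> a \<in> extensional (L2 N) \<and>
     (\<forall>f\<in>l2_fun N. F f \<in> l2_fun N \<and> a (l2_class N f) = l2_class N (F f))"

lemma liftsD: "lifts N a F \<Longrightarrow> f \<in> l2_fun N \<Longrightarrow> F f \<in> l2_fun N"
  "lifts N a F \<Longrightarrow> f \<in> l2_fun N \<Longrightarrow> a (l2_class N f) = l2_class N (F f)"
  by (auto simp: lifts_def)

lemma lifts_maps: "lifts N a F \<Longrightarrow> a \<in> L2 N \<rightarrow>\<^sub>E L2 N"
proof (rule PiE_I)
  assume a: "lifts N a F"
  show "a \<xi> \<in> L2 N" if "\<xi> \<in> L2 N" for \<xi>
    using that by (rule L2_cases) (simp add: liftsD[OF a] l2_class_in)
  show "a \<xi> = undefined" if "\<xi> \<notin> L2 N" for \<xi>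
    using a that by (simp add: lifts_def extensional_def)
qed

lemma lifts_eqI:
  assumes "lifts N a F" "lifts N b F'" and eq: "\<And>f. f \<in> l2_fun N \<Longrightarrow> AE x in N. F f x = F' f x"
  shows "a = b"
proof (rule extensionalityI)
  show "a \<in> extensional (L2 N)" "b \<in> extensional (L2 N)" using assms by (auto simp: lifts_def)
  fix \<xi> assume "\<xi> \<in> L2 N"
  then obtain f where f: "f \<in> l2_fun N" "\<xi> = l2_class N f" by (rule L2_cases)
  then show "a \<xi> = b \<xi>" using liftsD[OF assms(1) f(1)] liftsD[OF assms(2) f(1)] eq[OF f(1)]
    by (simp add: l2_class_eq_iff)
qed

lemma lifts_restrict:
  assumes "\<And>f. f \<in> l2_fun N \<Longrightarrow> F f \<in> l2_fun N"
    and "\<And>f. f \<in> l2_fun N \<Longrightarrow> a (l2_class N f) = l2_class N (F f)"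
  shows "lifts N (\<lambda>\<xi>\<in>L2 N. a \<xi>) F"
  using assms by (auto simp: lifts_def l2_class_in)

lemma lifts_zero: "lifts N (op_zero N) (\<lambda>f x. 0)"
  unfolding op_zero_def by (rule lifts_restrict) (auto simp: l2_fun_zero)

lemma lifts_add: "lifts N a F \<Longrightarrow> lifts N b F' \<Longrightarrow> lifts N (op_add N a b) (\<lambda>f x. F f x + F' f x)"
  unfolding op_add_def by (rule lifts_restrict) (auto simp: l2_fun_add liftsD l2_add_class)

lemma lifts_scale: "lifts N a F \<Longrightarrow> lifts N (op_scale N c a) (\<lambda>f x. c * F f x)"
  unfolding op_scale_def by (rule lifts_restrict) (auto simp: l2_fun_scale liftsD l2_scale_class)

lemma lifts_mult: "lifts N a F \<Longrightarrow> lifts N b F' \<Longrightarrow> lifts N (op_mult N a b) (\<lambda>f. F (F' f))"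
  unfolding op_mult_def compose_def by (rule lifts_restrict) (auto simp: liftsD)

lemma lifts_sum:
  assumes "\<And>i. i \<in> set is \<Longrightarrow> lifts N (a i) (F i)"
  shows "lifts N (op_sum N (map a is)) (\<lambda>f x. \<Sum>i\<leftarrow>is. F i f x)"
  using assms
proof (induction "is")
  case Nil then show ?case using lifts_zero by (simp add: op_sum_def)
next
  case (Cons i js)
  have "lifts N (op_add N (a i) (op_sum N (map a js))) (\<lambda>f x. F i f x + (\<Sum>i\<leftarrow>js. F i f x))"
    by (intro lifts_add Cons) (auto intro: Cons)
  then show ?case by (simp add: op_sum_def)
qed

text \<open>
  The inner product is nondegenerate, so at most one operator has the defining property of the adjoint, and
  \<open>b\<close> has it.
\<close>
lemma lifts_adjoint:
  assumes a: "lifts N a F" and b: "lifts N b F'"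
    and adj: "\<And>f g. f \<in> l2_fun N \<Longrightarrow> g \<in> l2_fun N \<Longrightarrow> (\<integral>x. F f x * cnj (g x) \<partial>N) = (\<integral>x. f x * cnj (F' g x) \<partial>N)"
  shows "op_adj N a = b"
  unfolding op_adj_def
proof (rule the_equality)
  have "l2_inner N (a \<xi>) \<eta> = l2_inner N \<xi> (b \<eta>)" if in_L2: "\<xi> \<in> L2 N" "\<eta> \<in> L2 N" for \<xi> \<eta>
  proof -
    obtain f where f: "f \<in> l2_fun N" "\<xi> = l2_class N f" by (rule L2_cases[OF in_L2(1)])
    obtain g where g: "g \<in> l2_fun N" "\<eta> = l2_class N g" by (rule L2_cases[OF in_L2(2)])
    show ?thesis using f g adj[OF f(1) g(1)] by (simp add: liftsD[OF a f(1)] liftsD[OF b g(1)] l2_inner_class)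
  qed
  then show *: "b \<in> L2 N \<rightarrow>\<^sub>E L2 N \<and> (\<forall>\<xi>\<in>L2 N. \<forall>\<eta>\<in>L2 N. l2_inner N (a \<xi>) \<eta> = l2_inner N \<xi> (b \<eta>))"
    using lifts_maps[OF b] by blast
  fix S assume S: "S \<in> L2 N \<rightarrow>\<^sub>E L2 N \<and> (\<forall>\<xi>\<in>L2 N. \<forall>\<eta>\<in>L2 N. l2_inner N (a \<xi>) \<eta> = l2_inner N \<xi> (S \<eta>))"
  show "S = b"
  proof (rule extensionalityI)
    show "S \<in> extensional (L2 N)" using S by (simp add: PiE_def)
    show "b \<in> extensional (L2 N)" using * by (simp add: PiE_def)
    fix \<eta> assume \<eta>: "\<eta> \<in> L2 N"
    have "S \<eta> \<in> L2 N" "b \<eta> \<in> L2 N" using S * \<eta> by auto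
    then obtain f g where f: "f \<in> l2_fun N" "S \<eta> = l2_class N f" and g: "g \<in> l2_fun N" "b \<eta> = l2_class N g"
      by (metis L2_cases)
    have "AE x in N. f x = g x"
    proof (rule l2_fun_eqI[OF f(1) g(1)])
      fix h assume h: "h \<in> l2_fun N"
      have "l2_inner N (l2_class N h) (S \<eta>) = l2_inner N (l2_class N h) (b \<eta>)"
        using S * \<eta> l2_class_in[OF h] by metis
      then show "(\<integral>x. h x * cnj (f x) \<partial>N) = (\<integral>x. h x * cnj (g x) \<partial>N)"
        using f g h by (simp add: l2_inner_class)
    qed
    then show "S \<eta> = b \<eta>" using f g by (simp add: l2_class_eq_iff)
  qed
qed

section \<open>Bisections\<close>

context groupoid
begin

lemma unit_arrow: "u \<in> gunits G \<Longrightarrow> u \<in> arrows G"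
  using units_subset by blast

lemma composableI: "x \<in> arrows G \<Longrightarrow> y \<in> arrows G \<Longrightarrow> gsrc G x = grng G y \<Longrightarrow> (x, y) \<in> composable G"
  by (simp add: composable_def)

lemma inv_mult_cancel:
  assumes "x \<in> arrows G" "y \<in> arrows G" "gsrc G x = grng G y"
  shows "gmult G (ginv G x) (gmult G x y) = y"
proof -
  have "gmult G (gmult G (ginv G x) x) y = gmult G (ginv G x) (gmult G x y)"
    using assms by (intro mult_assoc composableI) (auto simp: inv_closed src_inv)
  then show ?thesis using assms by (simp add: inv_mult rng_mult_id)
qed

lemma right_inverse_unique:
  assumes "x \<in> arrows G" "y \<in> arrows G" "gsrc G x = grng G y" "gmult G x y = grng G x"
  shows "y = ginv G x"
proof -
  have "y = gmult G (ginv G x) (gmult G x y)" using inv_mult_cancel[OF assms(1-3)] by simp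
  also have "\<dots> = gmult G (ginv G x) (gsrc G (ginv G x))" using assms by (simp add: src_inv)
  also have "\<dots> = ginv G x" using assms by (intro mult_src inv_closed)
  finally show ?thesis .
qed

lemma inv_inv: "x \<in> arrows G \<Longrightarrow> ginv G (ginv G x) = x"
  by (rule right_inverse_unique[symmetric]) (simp_all add: inv_closed src_inv rng_inv inv_mult)

lemma mult_inv_cancel:
  assumes "x \<in> arrows G" "y \<in> arrows G" "grng G x = grng G y"
  shows "gmult G x (gmult G (ginv G x) y) = y"
  using inv_mult_cancel[of "ginv G x" y] assms by (simp add: inv_inv inv_closed src_inv)

lemma inv_of_mult:
  assumes "x \<in> arrows G" "y \<in> arrows G" "gsrc G x = grng G y"
  shows "ginv G (gmult G x y) = gmult G (ginv G y) (ginv G x)"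
proof (rule right_inverse_unique[symmetric])
  have xy: "(x, y) \<in> composable G" using assms by (intro composableI)
  have yx: "(ginv G y, ginv G x) \<in> composable G" using assms by (intro composableI) (auto simp: inv_closed src_inv rng_inv)
  show "gmult G x y \<in> arrows G" "gmult G (ginv G y) (ginv G x) \<in> arrows G" using xy yx by (auto intro: mult_closed)
  show "gsrc G (gmult G x y) = grng G (gmult G (ginv G y) (ginv G x))"
    using assms xy yx by (simp add: src_mult rng_mult rng_inv)
  have "gmult G (gmult G x y) (gmult G (ginv G y) (ginv G x)) = gmult G x (gmult G y (gmult G (ginv G y) (ginv G x)))"
    using assms xy yx by (intro mult_assoc) (auto simp: composable_def rng_mult rng_inv intro: mult_closed)
  also have "gmult G y (gmult G (ginv G y) (ginv G x)) = ginv G x"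
    using assms by (intro mult_inv_cancel) (auto simp: inv_closed rng_inv)
  also have "gmult G x (ginv G x) = grng G (gmult G x y)" using assms xy by (simp add: mult_inv rng_mult)
  finally show "gmult G (gmult G x y) (gmult G (ginv G y) (ginv G x)) = grng G (gmult G x y)" .
qed

end

definition bisection :: "'g mgroupoid \<Rightarrow> 'g set \<Rightarrow> bool" where
  "bisection G B \<longleftrightarrow> B \<in> sets (gbor G) \<and> inj_on (gsrc G) B \<and> inj_on (grng G) B"

definition binv :: "'g mgroupoid \<Rightarrow> 'g set \<Rightarrow> 'g set" where
  "binv G B = ginv G ` B"

definition bprod :: "'g mgroupoid \<Rightarrow> 'g set \<Rightarrow> 'g set \<Rightarrow> 'g set" where
  "bprod G B C = {gmult G x y |x y. x \<in> B \<and> y \<in> C \<and> gsrc G x = grng G y}"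

text \<open>
  The element of \<open>B\<close> with a given range.
\<close>
definition bsel :: "'g mgroupoid \<Rightarrow> 'g set \<Rightarrow> 'g \<Rightarrow> 'g" where
  "bsel G B = inv_into B (grng G)"

definition bdom :: "'g mgroupoid \<Rightarrow> 'g set \<Rightarrow> 'g set" where
  "bdom G B = {x \<in> arrows G. grng G x \<in> grng G ` B}"

text \<open>
  The partial isometry of \<open>B\<close> is composition with the map that sends \<open>x\<close> to \<open>b\<inverse> x\<close>, where \<open>b\<close> is the element of
  \<open>B\<close> with the range of \<open>x\<close>. Outside of \<open>bdom G B\<close> the map is completed by the identity to be a total measurable
  map.
\<close>
definition btrans :: "'g mgroupoid \<Rightarrow> 'g set \<Rightarrow> 'g \<Rightarrow> 'g" where
  "btrans G B x = (if x \<in> bdom G B then gmult G (ginv G (bsel G B (grng G x))) x else x)"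

context discrete_measurable_groupoid
begin

lemma bisection_arrows: "bisection G B \<Longrightarrow> x \<in> B \<Longrightarrow> x \<in> arrows G"
  using sets.sets_into_space by (auto simp: bisection_def)

lemma rng_image: "bisection G B \<Longrightarrow> A \<in> sets (gbor G) \<Longrightarrow> A \<subseteq> B \<Longrightarrow> grng G ` A \<in> sets (gbor G)"
  by (rule injective_image_measurable[OF standard_borel standard_borel rng_borel])
    (auto simp: bisection_def intro: inj_on_subset)

lemma src_image: "bisection G B \<Longrightarrow> A \<in> sets (gbor G) \<Longrightarrow> A \<subseteq> B \<Longrightarrow> gsrc G ` A \<in> sets (gbor G)"
  by (rule injective_image_measurable[OF standard_borel standard_borel src_borel])
    (auto simp: bisection_def intro: inj_on_subset)

lemma bisection_subset: "bisection G B \<Longrightarrow> A \<in> sets (gbor G) \<Longrightarrow> A \<subseteq> B \<Longrightarrow> bisection G A"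
  by (auto simp: bisection_def intro: inj_on_subset)

lemma bisection_units: "bisection G (gunits G)"
  unfolding bisection_def
proof (intro conjI units_borel)
  show "inj_on (gsrc G) (gunits G)" by (rule inj_onI) (simp add: src_unit)
  show "inj_on (grng G) (gunits G)" by (rule inj_onI) (simp add: rng_unit)
qed

lemma bsel: assumes B: "bisection G B" and u: "u \<in> grng G ` B"
  shows "bsel G B u \<in> B" "grng G (bsel G B u) = u"
  unfolding bsel_def by (rule inv_into_into[OF u], rule f_inv_into_f[OF u])

lemma bsel_rng: "bisection G B \<Longrightarrow> b \<in> B \<Longrightarrow> bsel G B (grng G b) = b"
  by (simp add: bsel_def bisection_def)

lemma bsel_eqI: "bisection G B \<Longrightarrow> b \<in> B \<Longrightarrow> grng G b = u \<Longrightarrow> bsel G B u = b"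
  using bsel_rng by blast

lemma binv_vimage: assumes "B \<in> sets (gbor G)" shows "binv G B = ginv G -` B \<inter> arrows G"
proof -
  have B: "B \<subseteq> arrows G" using assms sets.sets_into_space by blast
  show ?thesis
  proof (intro equalityI subsetI)
    fix x assume "x \<in> binv G B" then show "x \<in> ginv G -` B \<inter> arrows G" using B by (auto simp: binv_def inv_inv inv_closed)
  next
    fix x assume "x \<in> ginv G -` B \<inter> arrows G"
    then have "ginv G x \<in> B" "x = ginv G (ginv G x)" by (auto simp: inv_inv)
    then show "x \<in> binv G B" unfolding binv_def by (rule rev_image_eqI)
  qed
qed

lemma binv_sets: "B \<in> sets (gbor G) \<Longrightarrow> binv G B \<in> sets (gbor G)"
  by (simp add: binv_vimage measurable_sets[OF inv_borel])

lemma bisection_binv: assumes B: "bisection G B" shows "bisection G (binv G B)"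
  unfolding bisection_def
proof (intro conjI)
  show "binv G B \<in> sets (gbor G)" using B by (intro binv_sets) (simp add: bisection_def)
  show "inj_on (gsrc G) (binv G B)"
  proof (rule inj_onI)
    fix x y assume "x \<in> binv G B" "y \<in> binv G B" and e: "gsrc G x = gsrc G y"
    then obtain a b where ab: "a \<in> B" "b \<in> B" "x = ginv G a" "y = ginv G b" by (auto simp: binv_def)
    then have "grng G a = grng G b" using e bisection_arrows[OF B] by (simp add: src_inv)
    then show "x = y" using ab B by (auto simp: bisection_def inj_on_def)
  qed
  show "inj_on (grng G) (binv G B)"
  proof (rule inj_onI)
    fix x y assume "x \<in> binv G B" "y \<in> binv G B" and e: "grng G x = grng G y"
    then obtain a b where ab: "a \<in> B" "b \<in> B" "x = ginv G a" "y = ginv G b" by (auto simp: binv_def)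
    then have "gsrc G a = gsrc G b" using e bisection_arrows[OF B] by (simp add: rng_inv)
    then show "x = y" using ab B by (auto simp: bisection_def inj_on_def)
  qed
qed

lemma binv_binv: assumes "bisection G B" shows "binv G (binv G B) = B"
proof -
  have "ginv G ` ginv G ` B = (\<lambda>x. x) ` B"
    unfolding image_image by (intro image_cong refl) (simp add: inv_inv bisection_arrows[OF assms])
  then show ?thesis by (simp add: binv_def)
qed

lemma bdom_sets: assumes B: "bisection G B" shows "bdom G B \<in> sets (gbor G)"
proof -
  have "bdom G B = grng G -` (grng G ` B) \<inter> arrows G" by (auto simp: bdom_def)
  moreover have "grng G ` B \<in> sets (gbor G)" by (rule rng_image[OF B]) (use B in \<open>auto simp: bisection_def\<close>)
  ultimately show ?thesis using measurable_sets[OF rng_borel] by simp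
qed

lemma btrans_dom:
  assumes B: "bisection G B" and x: "x \<in> bdom G B"
  obtains b where "b \<in> B" "b \<in> arrows G" "grng G b = grng G x" "btrans G B x = gmult G (ginv G b) x" "x \<in> arrows G"
proof -
  have r: "grng G x \<in> grng G ` B" "x \<in> arrows G" using x by (auto simp: bdom_def)
  show ?thesis
    by (rule that[of "bsel G B (grng G x)"])
      (use bsel[OF B r(1)] bisection_arrows[OF B] r x in \<open>auto simp: btrans_def\<close>)
qed

lemma btrans_eqI:
  assumes B: "bisection G B" and b: "b \<in> B" and x: "x \<in> arrows G" "grng G b = grng G x"
  shows "x \<in> bdom G B" "btrans G B x = gmult G (ginv G b) x"
proof -
  show d: "x \<in> bdom G B" using b x by (metis (mono_tags, lifting) bdom_def imageI mem_Collect_eq)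
  show "btrans G B x = gmult G (ginv G b) x" using d bsel_eqI[OF B b x(2)] by (simp add: btrans_def)
qed

lemma btrans_props:
  assumes B: "bisection G B" and x: "x \<in> bdom G B"
  shows "btrans G B x \<in> bdom G (binv G B)" "gsrc G (btrans G B x) = gsrc G x"
    "btrans G (binv G B) (btrans G B x) = x"
proof -
  obtain b where b: "b \<in> B" "b \<in> arrows G" "grng G b = grng G x" "btrans G B x = gmult G (ginv G b) x" "x \<in> arrows G"
    by (rule btrans_dom[OF B x])
  have c: "(ginv G b, x) \<in> composable G" using b by (intro composableI) (auto simp: inv_closed src_inv)
  have y: "btrans G B x \<in> arrows G" "gsrc G (btrans G B x) = gsrc G x" "grng G (btrans G B x) = gsrc G b"
    using b c by (simp_all add: mult_closed src_mult rng_mult rng_inv)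
  show "gsrc G (btrans G B x) = gsrc G x" by (rule y)
  have ib: "ginv G b \<in> binv G B" using b(1) by (simp add: binv_def)
  have r: "grng G (ginv G b) = grng G (btrans G B x)" using y b by (simp add: rng_inv)
  show "btrans G B x \<in> bdom G (binv G B)" by (rule btrans_eqI(1)[OF bisection_binv[OF B] ib y(1) r])
  have "btrans G (binv G B) (btrans G B x) = gmult G (ginv G (ginv G b)) (btrans G B x)"
    by (rule btrans_eqI(2)[OF bisection_binv[OF B] ib y(1) r])
  also have "\<dots> = gmult G b (gmult G (ginv G b) x)" using b by (simp add: inv_inv)
  also have "\<dots> = x" using b by (intro mult_inv_cancel)
  finally show "btrans G (binv G B) (btrans G B x) = x" .
qed

lemma bdom_arrows: "x \<in> bdom G B \<Longrightarrow> x \<in> arrows G"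
  by (simp add: bdom_def)

lemma btrans_measurable:
  assumes B: "bisection G B" shows "btrans G B \<in> gbor G \<rightarrow>\<^sub>M gbor G"
proof -
  define c where "c = (\<lambda>x. if x \<in> bdom G B then ginv G (bsel G B (grng G x)) else grng G x)"
  have c_dom: "\<exists>b\<in>B. c x = ginv G b \<and> grng G b = grng G x" if "x \<in> bdom G B" for x
  proof -
    have "grng G x \<in> grng G ` B" using that by (simp add: bdom_def)
    from bsel[OF B this] show ?thesis using that by (auto simp: c_def)
  qed
  have c: "c \<in> gbor G \<rightarrow>\<^sub>M gbor G"
  proof (rule measurableI)
    fix x assume x: "x \<in> arrows G"
    show "c x \<in> arrows G"
    proof (cases "x \<in> bdom G B")
      case True then show ?thesis using c_dom[OF True] bisection_arrows[OF B] inv_closed by auto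
    next
      case False then show ?thesis using x by (simp add: c_def rng_closed unit_arrow)
    qed
  next
    fix A assume A: "A \<in> sets (gbor G)"
    define A' where "A' = B \<inter> (ginv G -` A \<inter> arrows G)"
    have A': "A' \<in> sets (gbor G)" unfolding A'_def using B
      by (intro sets.Int[OF _ measurable_sets[OF inv_borel A]]) (simp add: bisection_def)
    have "c -` A \<inter> arrows G = (grng G -` (grng G ` A') \<inter> arrows G) \<union> ((grng G -` A \<inter> arrows G) - bdom G B)"
    proof (intro equalityI subsetI)
      fix x assume x: "x \<in> c -` A \<inter> arrows G"
      show "x \<in> (grng G -` (grng G ` A') \<inter> arrows G) \<union> ((grng G -` A \<inter> arrows G) - bdom G B)"
      proof (cases "x \<in> bdom G B")
        case True
        then obtain b where b: "b \<in> B" "c x = ginv G b" "grng G b = grng G x" using c_dom by blast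
        then have "b \<in> A'" using x bisection_arrows[OF B] by (auto simp: A'_def)
        then have "grng G x \<in> grng G ` A'" using b(3) by (metis imageI)
        then show ?thesis using x by blast
      next
        case False then show ?thesis using x by (simp add: c_def)
      qed
    next
      fix x assume "x \<in> (grng G -` (grng G ` A') \<inter> arrows G) \<union> ((grng G -` A \<inter> arrows G) - bdom G B)"
      then show "x \<in> c -` A \<inter> arrows G"
      proof
        assume x: "x \<in> grng G -` (grng G ` A') \<inter> arrows G"
        then obtain b where b: "b \<in> A'" "grng G x = grng G b" by auto
        then have "b \<in> B" by (simp add: A'_def)
        then have "c x = ginv G b" using btrans_eqI(1)[OF B \<open>b \<in> B\<close>, of x] bsel_rng[OF B \<open>b \<in> B\<close>] b x by (simp add: c_def)
        then show ?thesis using b x by (simp add: A'_def)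
      next
        assume "x \<in> (grng G -` A \<inter> arrows G) - bdom G B"
        then show ?thesis by (simp add: c_def)
      qed
    qed
    also have "\<dots> \<in> sets (gbor G)"
      using measurable_sets[OF rng_borel rng_image[OF B A']] measurable_sets[OF rng_borel A] bdom_sets[OF B]
      by (intro sets.Un sets.Diff) (auto simp: A'_def)
    finally show "c -` A \<inter> arrows G \<in> sets (gbor G)" .
  qed
  have cx: "(\<lambda>x. (c x, x)) \<in> gbor G \<rightarrow>\<^sub>M restrict_space (gbor G \<Otimes>\<^sub>M gbor G) (composable G)"
  proof (rule measurable_restrict_space2)
    show "(\<lambda>x. (c x, x)) \<in> gbor G \<rightarrow>\<^sub>M gbor G \<Otimes>\<^sub>M gbor G" by (intro measurable_Pair c) simp
    show "(\<lambda>x. (c x, x)) \<in> space (gbor G) \<rightarrow> composable G"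
    proof
      fix x assume x: "x \<in> arrows G"
      have "gsrc G (c x) = grng G x"
      proof (cases "x \<in> bdom G B")
        case True then show ?thesis using c_dom[OF True] bisection_arrows[OF B] by (auto simp: src_inv)
      next
        case False then show ?thesis using x by (simp add: c_def src_unit rng_closed)
      qed
      then show "(c x, x) \<in> composable G" using x measurable_space[OF c x] by (intro composableI)
    qed
  qed
  have "(\<lambda>x. gmult G (c x) x) \<in> gbor G \<rightarrow>\<^sub>M gbor G"
    using measurable_compose[OF cx mult_borel] by simp
  then show ?thesis
    by (rule measurable_cong[THEN iffD1, rotated]) (simp add: btrans_def c_def rng_mult_id)
qed

lemma partial_iso_fun_eq:
  assumes B: "bisection G B" and x: "x \<in> arrows G"
  shows "partial_iso_fun G B \<xi> x = (if x \<in> bdom G B then \<xi> (btrans G B x) else 0)"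
proof -
  let ?P = "\<lambda>y. y \<in> arrows G \<and> grng G y = gsrc G x \<and> gmult G x y \<in> B"
  have comp: "(x, y) \<in> composable G" if "?P y" for y using that x by (intro composableI) auto
  show ?thesis
  proof (cases "x \<in> bdom G B")
    case True
    then obtain b where b: "b \<in> B" "b \<in> arrows G" "grng G b = grng G x" "btrans G B x = gmult G (ginv G b) x"
      by (rule btrans_dom[OF B])
    define y where "y = gmult G (ginv G x) b"
    have c: "(ginv G x, b) \<in> composable G" using b x by (intro composableI) (auto simp: inv_closed src_inv)
    have y: "?P y" using b x c by (simp add: y_def mult_closed rng_mult rng_inv mult_inv_cancel)
    have uniq: "y' = y" if y': "?P y'" for y'
    proof -
      have "grng G (gmult G x y') = grng G b" using comp[OF y'] b by (simp add: rng_mult)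
      then have "gmult G x y' = b" using b(1) y' B by (simp add: bisection_def inj_on_def)
      then show ?thesis using inv_mult_cancel[of x y'] x y' by (simp add: y_def)
    qed
    have "(THE y. ?P y) = y" by (rule the_equality[where P = ?P, OF y]) (rule uniq)
    moreover have "ginv G y = btrans G B x"
      using b x by (simp add: y_def inv_of_mult inv_closed src_inv inv_inv)
    moreover have "\<exists>y\<in>arrows G. grng G y = gsrc G x \<and> gmult G x y \<in> B" using y by blast
    ultimately show ?thesis using True by (simp add: partial_iso_fun_def)
  next
    case False
    have "\<not> ?P y" for y
    proof
      assume y: "?P y"
      then have "grng G (gmult G x y) = grng G x" using comp[OF y] by (simp add: rng_mult)
      then show False using False x y btrans_eqI(1)[OF B] by blast
    qed
    then have "\<not> (\<exists>y\<in>arrows G. grng G y = gsrc G x \<and> gmult G x y \<in> B)" by blast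
    then show ?thesis using False by (simp only: partial_iso_fun_def if_False)
  qed
qed

text \<open>
  The product set is the injective image of a Borel set of composable pairs, so it is Borel by the theorem of
  Lusin and Souslin.
\<close>
lemma bprod_bisection:
  assumes B: "bisection G B" and C: "bisection G C" shows "bisection G (bprod G B C)"
proof -
  have eq: "bprod G B C = bdom G B \<inter> (btrans G B -` C \<inter> arrows G)"
  proof (intro equalityI subsetI)
    fix z assume "z \<in> bprod G B C"
    then obtain x y where xy: "x \<in> B" "y \<in> C" "gsrc G x = grng G y" "z = gmult G x y" unfolding bprod_def by blast
    have a: "x \<in> arrows G" "y \<in> arrows G" using xy bisection_arrows B C by auto
    have c: "(x, y) \<in> composable G" using a xy by (intro composableI)
    have z: "z \<in> arrows G" "grng G x = grng G z" using xy c by (simp_all add: mult_closed rng_mult)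
    have "btrans G B z = y" using btrans_eqI(2)[OF B xy(1) z] inv_mult_cancel[OF a xy(3)] xy(4) by simp
    then show "z \<in> bdom G B \<inter> (btrans G B -` C \<inter> arrows G)" using btrans_eqI(1)[OF B xy(1) z] xy(2) z(1) by simp
  next
    fix z assume z: "z \<in> bdom G B \<inter> (btrans G B -` C \<inter> arrows G)"
    then have zd: "z \<in> bdom G B" by simp
    obtain b where b: "b \<in> B" "b \<in> arrows G" "grng G b = grng G z" "btrans G B z = gmult G (ginv G b) z" "z \<in> arrows G"
      by (rule btrans_dom[OF B zd])
    have c: "(ginv G b, z) \<in> composable G" using b by (intro composableI) (auto simp: inv_closed src_inv)
    have "gmult G b (btrans G B z) = z" using b by (simp add: mult_inv_cancel)
    moreover have "gsrc G b = grng G (btrans G B z)" using b c by (simp add: rng_mult rng_inv)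
    ultimately show "z \<in> bprod G B C" using z b(1) unfolding bprod_def by (intro CollectI exI[of _ b] exI[of _ "btrans G B z"]) auto
  qed
  have *: "\<exists>x y. x \<in> B \<and> y \<in> C \<and> gsrc G x = grng G y \<and> z = gmult G x y \<and> grng G z = grng G x \<and> gsrc G z = gsrc G y"
    if "z \<in> bprod G B C" for z
  proof -
    obtain x y where xy: "x \<in> B" "y \<in> C" "gsrc G x = grng G y" "z = gmult G x y" using \<open>z \<in> bprod G B C\<close> unfolding bprod_def by blast
    have "(x, y) \<in> composable G" using xy bisection_arrows B C by (intro composableI) auto
    then show ?thesis using xy by (intro exI[of _ x] exI[of _ y]) (simp add: rng_mult src_mult)
  qed
  show ?thesis
    unfolding bisection_def
  proof (intro conjI)
    show "bprod G B C \<in> sets (gbor G)" unfolding eq using C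
      by (intro sets.Int bdom_sets[OF B] measurable_sets[OF btrans_measurable[OF B]]) (auto simp: bisection_def)
    show "inj_on (gsrc G) (bprod G B C)"
    proof (rule inj_onI)
      fix z w assume z: "z \<in> bprod G B C" and w: "w \<in> bprod G B C" and e: "gsrc G z = gsrc G w"
      from *[OF z] obtain x y where
        1: "x \<in> B" "y \<in> C" "gsrc G x = grng G y" "z = gmult G x y" "gsrc G z = gsrc G y" by blast
      from *[OF w] obtain x' y' where
        2: "x' \<in> B" "y' \<in> C" "gsrc G x' = grng G y'" "w = gmult G x' y'" "gsrc G w = gsrc G y'" by blast
      have "y = y'" using 1 2 e C by (simp add: bisection_def inj_on_def)
      moreover have "x = x'" using 1 2 \<open>y = y'\<close> B by (simp add: bisection_def inj_on_def)
      ultimately show "z = w" using 1 2 by simp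
    qed
    show "inj_on (grng G) (bprod G B C)"
    proof (rule inj_onI)
      fix z w assume z: "z \<in> bprod G B C" and w: "w \<in> bprod G B C" and e: "grng G z = grng G w"
      from *[OF z] obtain x y where
        1: "x \<in> B" "y \<in> C" "gsrc G x = grng G y" "z = gmult G x y" "grng G z = grng G x" by blast
      from *[OF w] obtain x' y' where
        2: "x' \<in> B" "y' \<in> C" "gsrc G x' = grng G y'" "w = gmult G x' y'" "grng G w = grng G x'" by blast
      have "x = x'" using 1 2 e B by (simp add: bisection_def inj_on_def)
      moreover have "y = y'" using 1 2 \<open>x = x'\<close> C by (simp add: bisection_def inj_on_def)
      ultimately show "z = w" using 1 2 by simp
    qed
  qed
qed

lemma btrans_bprod:
  assumes B: "bisection G B" and C: "bisection G C" and x: "x \<in> arrows G"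
  shows "x \<in> bdom G (bprod G B C) \<longleftrightarrow> x \<in> bdom G B \<and> btrans G B x \<in> bdom G C"
    "x \<in> bdom G (bprod G B C) \<Longrightarrow> btrans G (bprod G B C) x = btrans G C (btrans G B x)"
proof -
  have fwd: "x \<in> bdom G B \<and> btrans G B x \<in> bdom G C \<and> btrans G (bprod G B C) x = btrans G C (btrans G B x)"
    if "b \<in> B" "c \<in> C" "gsrc G b = grng G c" "grng G b = grng G x" for b c
  proof -
    have a: "b \<in> arrows G" "c \<in> arrows G" using that bisection_arrows B C by auto
    have bc: "(b, c) \<in> composable G" using a that by (intro composableI)
    have bx: "(ginv G b, x) \<in> composable G" using a that x by (intro composableI) (auto simp: inv_closed src_inv)
    have 1: "x \<in> bdom G B" "btrans G B x = gmult G (ginv G b) x" by (rule btrans_eqI[OF B that(1) x that(4)])+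
    have y: "btrans G B x \<in> arrows G" "grng G c = grng G (btrans G B x)" using 1 bx a that by (simp_all add: mult_closed rng_mult rng_inv)
    have 2: "btrans G B x \<in> bdom G C" "btrans G C (btrans G B x) = gmult G (ginv G c) (btrans G B x)" by (rule btrans_eqI[OF C that(2) y])+
    have "gmult G b c \<in> bprod G B C" using that unfolding bprod_def by blast
    moreover have "grng G (gmult G b c) = grng G x" using bc that by (simp add: rng_mult)
    ultimately have "btrans G (bprod G B C) x = gmult G (ginv G (gmult G b c)) x" by (rule btrans_eqI(2)[OF bprod_bisection[OF B C] _ x])
    also have "\<dots> = gmult G (gmult G (ginv G c) (ginv G b)) x" using a that by (simp add: inv_of_mult)
    also have "\<dots> = gmult G (ginv G c) (gmult G (ginv G b) x)"
      using a that x bx by (intro mult_assoc composableI) (auto simp: inv_closed src_inv rng_inv)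
    finally show ?thesis using 1 2 by simp
  qed
  have ex: "\<exists>b c. b \<in> B \<and> c \<in> C \<and> gsrc G b = grng G c \<and> grng G b = grng G x" if d: "x \<in> bdom G (bprod G B C)"
  proof -
    obtain z where z: "z \<in> bprod G B C" "grng G x = grng G z" using d by (auto simp: bdom_def)
    then obtain b c where bc: "b \<in> B" "c \<in> C" "gsrc G b = grng G c" "z = gmult G b c" unfolding bprod_def by blast
    have "(b, c) \<in> composable G" using bc bisection_arrows B C by (intro composableI) auto
    then show ?thesis using bc z by (intro exI[of _ b] exI[of _ c]) (simp add: rng_mult)
  qed
  have bwd: "x \<in> bdom G (bprod G B C)" if d: "x \<in> bdom G B" "btrans G B x \<in> bdom G C"
  proof -
    obtain b where b: "b \<in> B" "b \<in> arrows G" "grng G b = grng G x" "btrans G B x = gmult G (ginv G b) x" "x \<in> arrows G"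
      by (rule btrans_dom[OF B d(1)])
    obtain c where c: "c \<in> C" "c \<in> arrows G" "grng G c = grng G (btrans G B x)" by (rule btrans_dom[OF C d(2)])
    have "(ginv G b, x) \<in> composable G" using b by (intro composableI) (auto simp: inv_closed src_inv)
    then have e: "gsrc G b = grng G c" using b c by (simp add: rng_mult rng_inv)
    then have "gmult G b c \<in> bprod G B C" using b c unfolding bprod_def by blast
    moreover have "grng G (gmult G b c) = grng G x" using b c e composableI[of b c] by (simp add: rng_mult)
    ultimately show ?thesis by (rule btrans_eqI(1)[OF bprod_bisection[OF B C] _ x])
  qed
  show "x \<in> bdom G (bprod G B C) \<longleftrightarrow> x \<in> bdom G B \<and> btrans G B x \<in> bdom G C" using fwd ex bwd by blast
  show "btrans G (bprod G B C) x = btrans G C (btrans G B x)" if "x \<in> bdom G (bprod G B C)" using fwd ex[OF that] by blast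
qed

text \<open>
  The arrow \<open>b\<inverse> x\<close> is a unit exactly when \<open>x = b\<close>. Hence the partial isometry of \<open>B\<close> sends the
  indicator function of the units to that of \<open>B\<close>.
\<close>
lemma btrans_unit_iff:
  assumes B: "bisection G B" and x: "x \<in> arrows G"
  shows "x \<in> bdom G B \<and> btrans G B x \<in> gunits G \<longleftrightarrow> x \<in> B"
proof
  assume "x \<in> bdom G B \<and> btrans G B x \<in> gunits G"
  then have d: "x \<in> bdom G B" and u: "btrans G B x \<in> gunits G" by auto
  obtain b where b: "b \<in> B" "b \<in> arrows G" "grng G b = grng G x" "btrans G B x = gmult G (ginv G b) x"
    by (rule btrans_dom[OF B d])
  have "(ginv G b, x) \<in> composable G" using b x by (intro composableI) (auto simp: inv_closed src_inv)
  then have "grng G (btrans G B x) = gsrc G b" using b by (simp add: rng_mult rng_inv)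
  then have "btrans G B x = gsrc G b" using u by (simp add: rng_unit)
  then have 1: "gmult G b (gmult G (ginv G b) x) = b" using b by (simp add: mult_src)
  have "gmult G b (gmult G (ginv G b) x) = x" by (rule mult_inv_cancel[OF b(2) x b(3)])
  from trans[OF sym[OF this] 1] show "x \<in> B" using b(1) by (rule ssubst)
next
  assume "x \<in> B"
  from btrans_eqI[OF B this x refl] show "x \<in> bdom G B \<and> btrans G B x \<in> gunits G"
    using x by (simp add: inv_mult src_closed)
qed

end

section \<open>The partial isometry of a bisection\<close>

lemma count_bij_eq:
  assumes "bij_betw f S T"
  shows "emeasure (count_space UNIV) S = emeasure (count_space UNIV) T"
  using bij_betw_finite[OF assms] bij_betw_same_card[OF assms] by (simp add: emeasure_count_space)

context pmp_groupoid
begin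

abbreviation N :: "'g measure" where "N \<equiv> arrow_measure G \<mu>"

abbreviation pis :: "'g set \<Rightarrow> 'g l2_op" where "pis \<equiv> partial_iso G \<mu>"

lemma space_N [simp]: "space N = arrows G"
  by (simp add: arrow_measure_def space_measure_of_conv)

lemma sets_N [simp]: "sets N = sets (gbor G)"
  unfolding arrow_measure_def using sets.space_closed by (simp add: sets.sigma_sets_eq)

text \<open>
  The measure on the arrows is introduced by an extension construct whose value is the set function
  \<open>src_count\<close> if this is countably additive, and zero otherwise. Writing the measure as a multiple of \<open>src_count\<close>
  with factor 0 or 1 allows one to treat both cases at once.
\<close>
definition mass :: ennreal where
  "mass = (if measure_space (arrows G) (sets (gbor G)) (src_count G \<mu>) then 1 else 0)"

lemma emeasure_N: assumes "A \<in> sets (gbor G)" shows "emeasure N A = mass * src_count G \<mu> A"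
  unfolding arrow_measure_def mass_def
  using assms by (simp add: emeasure_measure_of_conv sets.sigma_sets_eq)

lemma mass_le_1: "mass \<le> 1"
  by (simp add: mass_def)

lemma unit_sets: "A \<in> sets (gbor G) \<Longrightarrow> A \<subseteq> gunits G \<Longrightarrow> A \<in> sets \<mu>"
  unfolding sets_unit_measure using units_borel units_subset
  by (subst sets_restrict_space_iff) (simp_all add: inf.absorb1)

lemma count_fibre:
  assumes "inj_on f B" shows "emeasure (count_space UNIV) {x \<in> B. f x = u} = indicator (f ` B) u"
proof (cases "u \<in> f ` B")
  case True
  then obtain b where b: "b \<in> B" "f b = u" by auto
  then have "{x \<in> B. f x = u} = {b}" using assms by (auto simp: inj_on_def)
  then show ?thesis using True by simp
next
  case False
  then have e: "{x \<in> B. f x = u} = {}" by auto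
  show ?thesis unfolding e using False by simp
qed

lemma src_count_bisection:
  assumes B: "bisection G B" shows "src_count G \<mu> B = emeasure \<mu> (gsrc G ` B)"
proof -
  have "gsrc G ` B \<in> sets (gbor G)" by (rule src_image[OF B]) (use B in \<open>auto simp: bisection_def\<close>)
  moreover have "gsrc G ` B \<subseteq> gunits G" using bisection_arrows[OF B] src_closed by auto
  ultimately have "gsrc G ` B \<in> sets \<mu>" by (rule unit_sets)
  then show ?thesis using B by (simp add: src_count_def count_fibre bisection_def)
qed

lemma rng_count_bisection:
  assumes B: "bisection G B" shows "rng_count G \<mu> B = emeasure \<mu> (grng G ` B)"
proof -
  have "grng G ` B \<in> sets (gbor G)" by (rule rng_image[OF B]) (use B in \<open>auto simp: bisection_def\<close>)
  moreover have "grng G ` B \<subseteq> gunits G" using bisection_arrows[OF B] rng_closed by auto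
  ultimately have "grng G ` B \<in> sets \<mu>" by (rule unit_sets)
  then show ?thesis using B by (simp add: rng_count_def count_fibre bisection_def)
qed

lemma bisection_sets: "bisection G B \<Longrightarrow> B \<in> sets (gbor G)"
  by (simp add: bisection_def)

lemma emeasure_bisection_src: "bisection G B \<Longrightarrow> emeasure N B = mass * emeasure \<mu> (gsrc G ` B)"
  by (simp add: emeasure_N bisection_sets src_count_bisection)

lemma emeasure_bisection_rng: "bisection G B \<Longrightarrow> emeasure N B = mass * emeasure \<mu> (grng G ` B)"
  by (simp add: emeasure_N bisection_sets preserving rng_count_bisection)

lemma emeasure_bisection_le: assumes "bisection G B" shows "emeasure N B \<le> 1"
proof -
  have "emeasure N B \<le> 1 * 1"
    unfolding emeasure_bisection_src[OF assms] by (intro mult_mono mass_le_1 emeasure_le_1) auto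
  then show ?thesis by simp
qed

lemma emeasure_bisection_finite: "bisection G B \<Longrightarrow> emeasure N B < \<infinity>"
  by (rule le_less_trans[OF emeasure_bisection_le]) simp_all

text \<open>
  Inversion interchanges the counts of source and range fibres, whose integrals agree by
  invariance of \<open>\<mu>\<close>.
\<close>
lemma emeasure_binv: assumes B: "B \<in> sets (gbor G)" shows "emeasure N (binv G B) = emeasure N B"
proof -
  have BA: "B \<subseteq> arrows G" using B sets.sets_into_space by blast
  have "emeasure (count_space UNIV) {x \<in> binv G B. gsrc G x = u} = emeasure (count_space UNIV) {x \<in> B. grng G x = u}" for u
  proof (rule count_bij_eq)
    show "bij_betw (ginv G) {x \<in> binv G B. gsrc G x = u} {x \<in> B. grng G x = u}"
    proof (rule bij_betw_byWitness[where f' = "ginv G"])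
      show "\<forall>a\<in>{x \<in> binv G B. gsrc G x = u}. ginv G (ginv G a) = a" using BA by (auto simp: binv_def inv_inv)
      show "\<forall>a'\<in>{x \<in> B. grng G x = u}. ginv G (ginv G a') = a'" using BA by (auto simp: inv_inv)
      show "ginv G ` {x \<in> binv G B. gsrc G x = u} \<subseteq> {x \<in> B. grng G x = u}" using BA by (auto simp: binv_def inv_inv src_inv)
      show "ginv G ` {x \<in> B. grng G x = u} \<subseteq> {x \<in> binv G B. gsrc G x = u}" using BA by (auto simp: binv_def src_inv)
    qed
  qed
  then have "src_count G \<mu> (binv G B) = rng_count G \<mu> B" by (simp add: src_count_def rng_count_def)
  then show ?thesis using B by (simp add: emeasure_N binv_sets preserving)
qed

text \<open>
  Left translation preserves the source of an arrow and is injective, so it preserves the number of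
  elements of a set in each source fibre.
\<close>
lemma emeasure_btrans:
  assumes B: "bisection G B" and A: "A \<in> sets (gbor G)"
  shows "emeasure N (bdom G B \<inter> (btrans G B -` A \<inter> arrows G)) = emeasure N (bdom G (binv G B) \<inter> A)"
proof -
  let ?S = "bdom G B \<inter> (btrans G B -` A \<inter> arrows G)" and ?T = "bdom G (binv G B) \<inter> A"
  have B': "bisection G (binv G B)" by (rule bisection_binv[OF B])
  have AA: "A \<subseteq> arrows G" using A sets.sets_into_space by blast
  have "emeasure (count_space UNIV) {x \<in> ?S. gsrc G x = u} = emeasure (count_space UNIV) {x \<in> ?T. gsrc G x = u}" for u
  proof (rule count_bij_eq, rule bij_betw_byWitness[where f = "btrans G B" and f' = "btrans G (binv G B)"])
    show "\<forall>a\<in>{x \<in> ?S. gsrc G x = u}. btrans G (binv G B) (btrans G B a) = a" using btrans_props[OF B] by auto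
    show "\<forall>a'\<in>{x \<in> ?T. gsrc G x = u}. btrans G B (btrans G (binv G B) a') = a'"
      using btrans_props(3)[OF B'] by (auto simp: binv_binv[OF B])
    show "btrans G B ` {x \<in> ?S. gsrc G x = u} \<subseteq> {x \<in> ?T. gsrc G x = u}"
      using btrans_props(1,2)[OF B] by auto
    show "btrans G (binv G B) ` {x \<in> ?T. gsrc G x = u} \<subseteq> {x \<in> ?S. gsrc G x = u}"
      using btrans_props[OF B'] bdom_arrows[OF btrans_props(1)[OF B']] by (auto simp: binv_binv[OF B])
  qed
  then have "src_count G \<mu> ?S = src_count G \<mu> ?T" by (simp add: src_count_def)
  moreover have "?S \<in> sets (gbor G)" "?T \<in> sets (gbor G)"
    using measurable_sets[OF btrans_measurable[OF B] A] bdom_sets[OF B] bdom_sets[OF B'] A by (auto intro: sets.Int)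
  ultimately show ?thesis by (simp add: emeasure_N)
qed

lemma btrans_measurable_N: "bisection G B \<Longrightarrow> btrans G B \<in> N \<rightarrow>\<^sub>M N"
  using btrans_measurable[of B] by (simp cong: measurable_cong_sets)

lemma bdom_sets_N: "bisection G B \<Longrightarrow> bdom G B \<in> sets N"
  by (simp add: bdom_sets)

lemma distr_btrans:
  assumes B: "bisection G B"
  shows "distr (density N (\<lambda>x. ennreal (indicator (bdom G B) x))) N (btrans G B) =
    density N (\<lambda>x. ennreal (indicator (bdom G (binv G B)) x))"
proof (rule measure_eqI)
  fix A assume "A \<in> sets (distr (density N (\<lambda>x. ennreal (indicator (bdom G B) x))) N (btrans G B))"
  then have A: "A \<in> sets (gbor G)" "A \<in> sets N" by simp_all
  have T: "btrans G B \<in> density N (\<lambda>x. ennreal (indicator (bdom G B) x)) \<rightarrow>\<^sub>M N"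
    using btrans_measurable_N[OF B] by (simp cong: measurable_cong_sets)
  have V: "btrans G B -` A \<inter> arrows G \<in> sets N" using measurable_sets[OF btrans_measurable_N[OF B] A(2)] by simp
  have 1: "emeasure (density N (\<lambda>x. ennreal (indicator D x))) C = emeasure N (D \<inter> C)"
    if "D \<in> sets N" "C \<in> sets N" for D C
  proof -
    have "emeasure (density N (\<lambda>x. ennreal (indicator D x))) C = (\<integral>\<^sup>+x. indicator (D \<inter> C) x \<partial>N)"
    proof (subst emeasure_density[OF _ that(2)])
      show "(\<lambda>x. ennreal (indicator D x)) \<in> borel_measurable N"
        by (intro measurable_compose[OF borel_measurable_indicator[OF that(1)]]) simp
      show "(\<integral>\<^sup>+x. ennreal (indicator D x) * indicator C x \<partial>N) = (\<integral>\<^sup>+x. indicator (D \<inter> C) x \<partial>N)"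
        by (intro nn_integral_cong) (simp split: split_indicator)
    qed
    also have "\<dots> = emeasure N (D \<inter> C)" using that by (intro nn_integral_indicator sets.Int)
    finally show ?thesis .
  qed
  have "emeasure (distr (density N (\<lambda>x. ennreal (indicator (bdom G B) x))) N (btrans G B)) A
      = emeasure (density N (\<lambda>x. ennreal (indicator (bdom G B) x))) (btrans G B -` A \<inter> arrows G)"
    using emeasure_distr[OF T A(2)] by simp
  also have "\<dots> = emeasure N (bdom G B \<inter> (btrans G B -` A \<inter> arrows G))"
    by (rule 1[OF bdom_sets_N[OF B] V])
  also have "\<dots> = emeasure N (bdom G (binv G B) \<inter> A)" by (rule emeasure_btrans[OF B A(1)])
  also have "\<dots> = emeasure (density N (\<lambda>x. ennreal (indicator (bdom G (binv G B)) x))) A"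
    by (rule 1[OF bdom_sets_N[OF bisection_binv[OF B]] A(2), symmetric])
  finally show "emeasure (distr (density N (\<lambda>x. ennreal (indicator (bdom G B) x))) N (btrans G B)) A =
     emeasure (density N (\<lambda>x. ennreal (indicator (bdom G (binv G B)) x))) A" .
qed simp

lemma nn_integral_btrans:
  assumes B: "bisection G B" and g: "g \<in> borel_measurable N"
  shows "(\<integral>\<^sup>+x. ennreal (indicator (bdom G B) x) * g (btrans G B x) \<partial>N) =
    (\<integral>\<^sup>+x. ennreal (indicator (bdom G (binv G B)) x) * g x \<partial>N)"
proof -
  let ?d = "\<lambda>x. ennreal (indicator (bdom G B) x)"
  have T: "btrans G B \<in> density N ?d \<rightarrow>\<^sub>M N" using btrans_measurable_N[OF B] by (simp cong: measurable_cong_sets)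
  have gT: "(\<lambda>x. g (btrans G B x)) \<in> borel_measurable N" by (rule measurable_compose[OF btrans_measurable_N[OF B] g])
  have "(\<integral>\<^sup>+x. ?d x * g (btrans G B x) \<partial>N) = (\<integral>\<^sup>+x. g (btrans G B x) \<partial>density N ?d)"
    using gT by (intro nn_integral_density[symmetric] measurable_compose[OF borel_measurable_indicator[OF bdom_sets_N[OF B]]]) auto
  also have "\<dots> = (\<integral>\<^sup>+x. g x \<partial>distr (density N ?d) N (btrans G B))"
    using g by (intro nn_integral_distr[OF T, symmetric]) simp
  also have "\<dots> = (\<integral>\<^sup>+x. ennreal (indicator (bdom G (binv G B)) x) * g x \<partial>N)"
    unfolding distr_btrans[OF B] using g by (intro nn_integral_density measurable_compose[OF borel_measurable_indicator[OF bdom_sets_N[OF bisection_binv[OF B]]]]) auto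
  finally show ?thesis .
qed

lemma integral_btrans:
  fixes g :: "'g \<Rightarrow> complex"
  assumes B: "bisection G B" and g: "g \<in> borel_measurable N"
  shows "(\<integral>x. indicator (bdom G B) x *\<^sub>R g (btrans G B x) \<partial>N) = (\<integral>x. indicator (bdom G (binv G B)) x *\<^sub>R g x \<partial>N)"
proof -
  let ?d = "\<lambda>x. ennreal (indicator (bdom G B) x)"
  have T: "btrans G B \<in> density N ?d \<rightarrow>\<^sub>M N" using btrans_measurable_N[OF B] by (simp cong: measurable_cong_sets)
  have gT: "(\<lambda>x. g (btrans G B x)) \<in> borel_measurable N" by (rule measurable_compose[OF btrans_measurable_N[OF B] g])
  have "(\<integral>x. indicator (bdom G B) x *\<^sub>R g (btrans G B x) \<partial>N) = (\<integral>x. g (btrans G B x) \<partial>density N ?d)"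
    using gT by (intro integral_density[symmetric] borel_measurable_indicator[OF bdom_sets_N[OF B]]) auto
  also have "\<dots> = (\<integral>x. g x \<partial>distr (density N ?d) N (btrans G B))"
    by (rule integral_distr[OF T g, symmetric])
  also have "\<dots> = (\<integral>x. indicator (bdom G (binv G B)) x *\<^sub>R g x \<partial>N)"
    unfolding distr_btrans[OF B] using g by (intro integral_density borel_measurable_indicator[OF bdom_sets_N[OF bisection_binv[OF B]]]) auto
  finally show ?thesis .
qed

lemma partial_iso_fun_measurable:
  assumes B: "bisection G B" and f: "f \<in> borel_measurable N"
  shows "partial_iso_fun G B f \<in> borel_measurable N"
proof -
  have "(\<lambda>x. if x \<in> bdom G B then f (btrans G B x) else 0) \<in> borel_measurable N"
    using bdom_sets_N[OF B] measurable_compose[OF btrans_measurable_N[OF B] f]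
    by (intro measurable_If_set) (auto simp: sets.Int_space_eq2)
  then show ?thesis
    by (rule measurable_cong[THEN iffD1, rotated]) (simp add: partial_iso_fun_eq[OF B])
qed

lemma partial_iso_fun_l2:
  assumes B: "bisection G B" and f: "f \<in> l2_fun N"
  shows "partial_iso_fun G B f \<in> l2_fun N"
proof -
  have fm: "f \<in> borel_measurable N" using f by (simp add: l2_fun_def)
  note m = partial_iso_fun_measurable[OF B fm]
  have gm: "(\<lambda>x. ennreal ((cmod (f x))\<^sup>2)) \<in> borel_measurable N" using fm by measurable
  have "(\<integral>\<^sup>+x. ennreal (norm ((cmod (partial_iso_fun G B f x))\<^sup>2)) \<partial>N)
      = (\<integral>\<^sup>+x. ennreal (indicator (bdom G B) x) * ennreal ((cmod (f (btrans G B x)))\<^sup>2) \<partial>N)"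
    by (intro nn_integral_cong) (simp add: partial_iso_fun_eq[OF B])
  also have "\<dots> = (\<integral>\<^sup>+x. ennreal (indicator (bdom G (binv G B)) x) * ennreal ((cmod (f x))\<^sup>2) \<partial>N)"
    by (rule nn_integral_btrans[OF B gm])
  also have "\<dots> \<le> (\<integral>\<^sup>+x. ennreal (norm ((cmod (f x))\<^sup>2)) \<partial>N)"
    by (intro nn_integral_mono) (simp split: split_indicator)
  also have "\<dots> < \<infinity>" using f by (simp add: l2_fun_def integrable_iff_bounded)
  finally have "integrable N (\<lambda>x. (cmod (partial_iso_fun G B f x))\<^sup>2)"
    using m by (intro integrableI_bounded) auto
  then show ?thesis using m by (simp add: l2_fun_def)
qed

lemma partial_iso_fun_AE:
  assumes B: "bisection G B" and AE: "AE x in N. f x = g x"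
  shows "AE x in N. partial_iso_fun G B f x = partial_iso_fun G B g x"
proof -
  obtain Z where Z: "Z \<in> sets N" "emeasure N Z = 0" "{x \<in> space N. f x \<noteq> g x} \<subseteq> Z"
    using AE by (rule AE_E) (auto intro: that)
  let ?Y = "bdom G B \<inter> (btrans G B -` Z \<inter> arrows G)"
  have Zs: "Z \<in> sets (gbor G)" using Z(1) by simp
  have "emeasure N ?Y = emeasure N (bdom G (binv G B) \<inter> Z)" by (rule emeasure_btrans[OF B Zs])
  also have "\<dots> \<le> emeasure N Z" using Z(1) by (intro emeasure_mono) auto
  finally have "emeasure N ?Y = 0" using Z(2) by simp
  moreover have "?Y \<in> sets N"
    using measurable_sets[OF btrans_measurable_N[OF B] Z(1)] bdom_sets_N[OF B] by (auto intro: sets.Int)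
  ultimately have "?Y \<in> null_sets N" by (simp add: null_sets_def)
  then have "AE x in N. x \<notin> ?Y" by (rule AE_not_in)
  then show ?thesis
  proof (rule AE_mp, intro AE_I2 impI)
    fix x assume x: "x \<in> space N" "x \<notin> ?Y"
    then have xa: "x \<in> arrows G" by simp
    show "partial_iso_fun G B f x = partial_iso_fun G B g x"
    proof (cases "x \<in> bdom G B")
      case True
      then have "btrans G B x \<notin> Z" using x xa by simp
      moreover have "btrans G B x \<in> space N" using measurable_space[OF btrans_measurable[OF B] xa] by simp
      ultimately have "f (btrans G B x) = g (btrans G B x)" using Z(3) by blast
      then show ?thesis by (simp add: partial_iso_fun_eq[OF B xa])
    qed (simp add: partial_iso_fun_eq[OF B xa])
  qed
qed

lemma lifts_pis: assumes B: "bisection G B" shows "lifts N (pis B) (partial_iso_fun G B)"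
  unfolding partial_iso_def Let_def
proof (rule lifts_restrict)
  fix f assume f: "f \<in> l2_fun N"
  show "partial_iso_fun G B f \<in> l2_fun N" by (rule partial_iso_fun_l2[OF B f])
  show "l2_class N (partial_iso_fun G B (l2_rep (l2_class N f))) = l2_class N (partial_iso_fun G B f)"
    using f by (subst l2_class_eq_iff) (auto intro: partial_iso_fun_l2[OF B] partial_iso_fun_AE[OF B] l2_rep_class)
qed

lemma pis_mult:
  assumes B: "bisection G B" and C: "bisection G C" shows "op_mult N (pis B) (pis C) = pis (bprod G B C)"
proof (rule lifts_eqI[OF lifts_mult[OF lifts_pis[OF B] lifts_pis[OF C]] lifts_pis[OF bprod_bisection[OF B C]]])
  fix f :: "'g \<Rightarrow> complex"
  show "AE x in N. partial_iso_fun G B (partial_iso_fun G C f) x = partial_iso_fun G (bprod G B C) f x"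
  proof (rule AE_I2)
    fix x assume "x \<in> space N"
    then have x: "x \<in> arrows G" by simp
    have "btrans G B x \<in> arrows G" using measurable_space[OF btrans_measurable[OF B] x] .
    then show "partial_iso_fun G B (partial_iso_fun G C f) x = partial_iso_fun G (bprod G B C) f x"
      using btrans_bprod[OF B C x] x by (simp add: partial_iso_fun_eq B C bprod_bisection)
  qed
qed

lemma partial_iso_fun_adjoint:
  assumes B: "bisection G B" and f: "f \<in> l2_fun N" and g: "g \<in> l2_fun N"
  shows "(\<integral>x. partial_iso_fun G B f x * cnj (g x) \<partial>N) = (\<integral>x. f x * cnj (partial_iso_fun G (binv G B) g x) \<partial>N)"
proof -
  have B': "bisection G (binv G B)" by (rule bisection_binv[OF B])
  let ?h = "\<lambda>x. f x * cnj (partial_iso_fun G (binv G B) g x)"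
  have h: "?h \<in> borel_measurable N"
    by (intro borel_measurable_integrable integrable_l2_mult f partial_iso_fun_l2[OF B'] g)
  have "(\<integral>x. partial_iso_fun G B f x * cnj (g x) \<partial>N) = (\<integral>x. indicator (bdom G B) x *\<^sub>R ?h (btrans G B x) \<partial>N)"
  proof (rule Bochner_Integration.integral_cong[OF refl])
    fix x assume "x \<in> space N"
    then have x: "x \<in> arrows G" by simp
    have y: "btrans G B x \<in> arrows G" using measurable_space[OF btrans_measurable[OF B] x] .
    show "partial_iso_fun G B f x * cnj (g x) = indicator (bdom G B) x *\<^sub>R ?h (btrans G B x)"
    proof (cases "x \<in> bdom G B")
      case True then show ?thesis
        using btrans_props[OF B True] by (simp add: partial_iso_fun_eq[OF B x] partial_iso_fun_eq[OF B' y])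
    qed (simp add: partial_iso_fun_eq[OF B x])
  qed
  also have "\<dots> = (\<integral>x. indicator (bdom G (binv G B)) x *\<^sub>R ?h x \<partial>N)" by (rule integral_btrans[OF B h])
  also have "\<dots> = (\<integral>x. ?h x \<partial>N)"
    by (intro Bochner_Integration.integral_cong refl) (simp add: partial_iso_fun_eq[OF B'])
  finally show ?thesis .
qed

lemma pis_adj: assumes B: "bisection G B" shows "op_adj N (pis B) = pis (binv G B)"
  by (rule lifts_adjoint[OF lifts_pis[OF B] lifts_pis[OF bisection_binv[OF B]] partial_iso_fun_adjoint[OF B]])

lemma l2_indicator: assumes B: "bisection G B" shows "indicator B \<in> l2_fun N"
proof (rule l2_fun_dominated[where h = "indicator B"])
  have s: "B \<in> sets N" using bisection_sets[OF B] by simp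
  show "indicator B \<in> borel_measurable N" by (rule borel_measurable_indicator[OF s])
  show "integrable N (indicator B :: _ \<Rightarrow> real)" using s emeasure_bisection_finite[OF B] by (simp add: integrable_indicator_iff)
qed (simp split: split_indicator)

lemma pis_fun_unit:
  assumes "bisection G B" "x \<in> arrows G" shows "partial_iso_fun G B (indicator (gunits G)) x = indicator B x"
  using btrans_unit_iff[OF assms] by (auto simp: partial_iso_fun_eq[OF assms] split: split_indicator)

lemma integral_indicator_mult:
  assumes B: "bisection G B" and C: "bisection G C"
  shows "(\<integral>x. indicator B x * cnj (indicator C x) \<partial>N) = complex_of_real (measure N (B \<inter> C))"
proof -
  have "(\<integral>x. indicator B x * cnj (indicator C x) \<partial>N) = (\<integral>x. complex_of_real (indicator (B \<inter> C) x) \<partial>N)"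
    by (intro Bochner_Integration.integral_cong refl) (simp split: split_indicator)
  also have "\<dots> = complex_of_real (\<integral>x. indicator (B \<inter> C) x \<partial>N)" by (rule integral_complex_of_real)
  also have "\<dots> = complex_of_real (measure N (B \<inter> C))"
    using sets.Int_space_eq2[OF sets.Int[of B N C]] bisection_sets[OF B] bisection_sets[OF C] by simp
  finally show ?thesis .
qed

lemma inner_lift:
  assumes a: "lifts N a F" and C: "bisection G C"
  shows "l2_inner N (a (unit_vec G \<mu>)) (l2_class N (indicator C)) = (\<integral>x. F (indicator (gunits G)) x * cnj (indicator C x) \<partial>N)"
  unfolding unit_vec_def
  using l2_indicator[OF C] l2_indicator[OF bisection_units]
  by (simp add: liftsD[OF a] l2_inner_class)

lemma inner_pis:
  assumes B: "bisection G B" and C: "bisection G C"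
  shows "l2_inner N (pis B (unit_vec G \<mu>)) (l2_class N (indicator C)) = complex_of_real (measure N (B \<inter> C))"
proof -
  have "(\<integral>x. partial_iso_fun G B (indicator (gunits G)) x * cnj (indicator C x) \<partial>N) = (\<integral>x. indicator B x * cnj (indicator C x) \<partial>N)"
    by (intro Bochner_Integration.integral_cong refl) (simp add: pis_fun_unit[OF B])
  then show ?thesis using integral_indicator_mult[OF B C] by (simp add: inner_lift[OF lifts_pis[OF B] C])
qed

lemma trace_pis: "bisection G B \<Longrightarrow> vn_trace G \<mu> (pis B) = complex_of_real (measure N (B \<inter> gunits G))"
  unfolding vn_trace_def using inner_pis[OF _ bisection_units] by (simp add: unit_vec_def)

text \<open>
  The squared distance of two partial isometries in the norm \<open>vn_norm2\<close>; see \<open>norm2_diff\<close>.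
\<close>
definition bdist :: "'g set \<Rightarrow> 'g set \<Rightarrow> real" where
  "bdist B C = measure N ((B - C) \<union> (C - B))"

lemma norm2_lift:
  assumes a: "lifts N a F" and b: "lifts N b F'"
    and adj: "\<And>f g. f \<in> l2_fun N \<Longrightarrow> g \<in> l2_fun N \<Longrightarrow> (\<integral>x. F f x * cnj (g x) \<partial>N) = (\<integral>x. f x * cnj (F' g x) \<partial>N)"
  shows "vn_norm2 G \<mu> a = sqrt (\<integral>x. (cmod (F (indicator (gunits G)) x))\<^sup>2 \<partial>N)"
proof -
  let ?u = "indicator (gunits G) :: _ \<Rightarrow> complex"
  have u: "?u \<in> l2_fun N" by (rule l2_indicator[OF bisection_units])
  have adj_a: "op_adj N a = b" by (rule lifts_adjoint[OF a b adj])
  have Fu: "F ?u \<in> l2_fun N" by (rule liftsD(1)[OF a u])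
  have "vn_trace G \<mu> (op_mult N (op_adj N a) a) = (\<integral>x. F' (F ?u) x * cnj (?u x) \<partial>N)"
    unfolding adj_a vn_trace_def
    using inner_lift[OF lifts_mult[OF b a] bisection_units] by (simp add: unit_vec_def)
  also have "\<dots> = (\<integral>x. cnj (?u x * cnj (F' (F ?u) x)) \<partial>N)" by (intro Bochner_Integration.integral_cong refl) simp
  also have "\<dots> = cnj (\<integral>x. ?u x * cnj (F' (F ?u) x) \<partial>N)" by (rule Bochner_Integration.integral_cnj)
  also have "\<dots> = cnj (\<integral>x. F ?u x * cnj (F ?u x) \<partial>N)" by (simp only: adj[OF u Fu])
  also have "(\<integral>x. F ?u x * cnj (F ?u x) \<partial>N) = (\<integral>x. complex_of_real ((cmod (F ?u x))\<^sup>2) \<partial>N)"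
    by (intro Bochner_Integration.integral_cong refl) (simp only: complex_norm_square)
  also have "\<dots> = complex_of_real (\<integral>x. (cmod (F ?u x))\<^sup>2 \<partial>N)" by (rule integral_complex_of_real)
  finally show ?thesis by (simp add: vn_norm2_def Let_def)
qed

lemma norm2_diff:
  assumes B: "bisection G B" and C: "bisection G C"
  shows "vn_norm2 G \<mu> (op_diff N (pis B) (pis C)) = sqrt (bdist B C)"
proof -
  let ?F = "\<lambda>B C f x. partial_iso_fun G B f x + (- 1) * partial_iso_fun G C f x"
  let ?u = "indicator (gunits G) :: _ \<Rightarrow> complex"
  have B': "bisection G (binv G B)" and C': "bisection G (binv G C)" using B C bisection_binv by auto
  have L: "lifts N (op_diff N (pis B) (pis C)) (?F B C)"
    unfolding op_diff_def by (intro lifts_add lifts_scale lifts_pis B C)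
  have L': "lifts N (op_diff N (pis (binv G B)) (pis (binv G C))) (?F (binv G B) (binv G C))"
    unfolding op_diff_def by (intro lifts_add lifts_scale lifts_pis B' C')
  have adj: "(\<integral>x. ?F B C f x * cnj (g x) \<partial>N) = (\<integral>x. f x * cnj (?F (binv G B) (binv G C) g x) \<partial>N)"
    if f: "f \<in> l2_fun N" and g: "g \<in> l2_fun N" for f g
  proof -
    have i: "integrable N (\<lambda>x. partial_iso_fun G B f x * cnj (g x))" "integrable N (\<lambda>x. partial_iso_fun G C f x * cnj (g x))"
      "integrable N (\<lambda>x. f x * cnj (partial_iso_fun G (binv G B) g x))" "integrable N (\<lambda>x. f x * cnj (partial_iso_fun G (binv G C) g x))"
      by (intro integrable_l2_mult partial_iso_fun_l2 B C B' C' f g)+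
    have "(\<integral>x. ?F B C f x * cnj (g x) \<partial>N) = (\<integral>x. partial_iso_fun G B f x * cnj (g x) - partial_iso_fun G C f x * cnj (g x) \<partial>N)"
      by (intro Bochner_Integration.integral_cong refl) (simp add: algebra_simps)
    also have "\<dots> = (\<integral>x. f x * cnj (partial_iso_fun G (binv G B) g x) - f x * cnj (partial_iso_fun G (binv G C) g x) \<partial>N)"
      using i by (simp add: partial_iso_fun_adjoint[OF B f g] partial_iso_fun_adjoint[OF C f g])
    also have "\<dots> = (\<integral>x. f x * cnj (?F (binv G B) (binv G C) g x) \<partial>N)"
      by (intro Bochner_Integration.integral_cong refl) (simp add: algebra_simps)
    finally show ?thesis .
  qed
  have "(\<integral>x. (cmod (?F B C ?u x))\<^sup>2 \<partial>N) = (\<integral>x. indicator ((B - C) \<union> (C - B)) x \<partial>N)"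
    by (intro Bochner_Integration.integral_cong refl) (simp add: pis_fun_unit B C split: split_indicator)
  also have "\<dots> = bdist B C"
    using sets.sets_into_space[of "(B - C) \<union> (C - B)" N] bisection_sets[OF B] bisection_sets[OF C]
    by (simp add: bdist_def Int_absorb1 Int_absorb2 sets.Diff sets.Un)
  finally show ?thesis by (simp add: norm2_lift[OF L L' adj])
qed

lemma measurable_diff_sets: "bisection G B \<Longrightarrow> bisection G C \<Longrightarrow> (B - C) \<union> (C - B) \<in> sets N"
  by (simp add: bisection_sets sets.Diff sets.Un)

lemma bisection_diff: "bisection G B \<Longrightarrow> bisection G C \<Longrightarrow> bisection G (B - C)"
  by (rule bisection_subset[of B]) (auto simp: bisection_sets)

lemma bdist_eq:
  assumes B: "bisection G B" and C: "bisection G C"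
  shows "bdist B C = measure N (B - C) + measure N (C - B)"
  unfolding bdist_def
proof (rule measure_Union)
  show "emeasure N (B - C) \<noteq> \<infinity>" "emeasure N (C - B) \<noteq> \<infinity>"
    using emeasure_bisection_finite[OF bisection_diff[OF B C]] emeasure_bisection_finite[OF bisection_diff[OF C B]] by auto
qed (use B C in \<open>auto simp: bisection_sets\<close>)

lemma fmeasurable_bisection: "bisection G B \<Longrightarrow> B \<in> fmeasurable N"
  using emeasure_bisection_finite[of B] bisection_sets[of B] by (simp add: fmeasurable_def)

text \<open>
  An element of a product has the range of its left and the source of its right factor, and the measure of a
  bisection is the measure of its set of sources and that of its set of ranges.
\<close>
lemma measure_bprod_le:
  assumes B: "bisection G B" and C: "bisection G C"
  shows "measure N (bprod G B C) \<le> measure N B" "measure N (bprod G B C) \<le> measure N C"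
proof -
  have P: "bisection G (bprod G B C)" by (rule bprod_bisection[OF B C])
  have *: "\<exists>x y. x \<in> B \<and> y \<in> C \<and> grng G z = grng G x \<and> gsrc G z = gsrc G y" if "z \<in> bprod G B C" for z
  proof -
    obtain x y where xy: "x \<in> B" "y \<in> C" "gsrc G x = grng G y" "z = gmult G x y"
      using \<open>z \<in> bprod G B C\<close> unfolding bprod_def by blast
    have "(x, y) \<in> composable G" using xy bisection_arrows B C by (intro composableI) auto
    then show ?thesis using xy by (intro exI[of _ x] exI[of _ y]) (simp add: rng_mult src_mult)
  qed
  have sub: "grng G ` bprod G B C \<subseteq> grng G ` B" "gsrc G ` bprod G B C \<subseteq> gsrc G ` C"
  proof -
    show "grng G ` bprod G B C \<subseteq> grng G ` B" using * by (auto simp: image_iff)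
    show "gsrc G ` bprod G B C \<subseteq> gsrc G ` C" using * by (auto simp: image_iff)
  qed
  have rB: "grng G ` B \<in> sets \<mu>" using bisection_arrows[OF B] rng_closed
    by (intro unit_sets rng_image[OF B bisection_sets[OF B]]) auto
  have sC: "gsrc G ` C \<in> sets \<mu>" using bisection_arrows[OF C] src_closed
    by (intro unit_sets src_image[OF C bisection_sets[OF C]]) auto
  have "emeasure N (bprod G B C) \<le> emeasure N B"
    unfolding emeasure_bisection_rng[OF P] emeasure_bisection_rng[OF B]
    by (intro mult_left_mono emeasure_mono sub rB) simp
  moreover have "emeasure N (bprod G B C) \<le> emeasure N C"
    unfolding emeasure_bisection_src[OF P] emeasure_bisection_src[OF C]
    by (intro mult_left_mono emeasure_mono sub sC) simp
  ultimately show "measure N (bprod G B C) \<le> measure N B" "measure N (bprod G B C) \<le> measure N C"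
    unfolding measure_def using emeasure_bisection_finite[OF B] emeasure_bisection_finite[OF C] by (auto intro!: enn2real_mono)
qed

lemma measure_bprod_diff:
  assumes B: "bisection G B" and C: "bisection G C" and B': "bisection G B'" and C': "bisection G C'"
  shows "measure N (bprod G B C - bprod G B' C') \<le> measure N (B - B') + measure N (C - C')"
proof -
  have b: "bisection G (B - B')" "bisection G (C - C')" using assms bisection_diff by auto
  have P: "bisection G (bprod G (B - B') C)" "bisection G (bprod G B (C - C'))" using assms b bprod_bisection by auto
  have "measure N (bprod G B C - bprod G B' C') \<le> measure N (bprod G (B - B') C \<union> bprod G B (C - C'))"
  proof (rule measure_mono_fmeasurable)
    show "bprod G B C - bprod G B' C' \<subseteq> bprod G (B - B') C \<union> bprod G B (C - C')" unfolding bprod_def by blast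
    show "bprod G B C - bprod G B' C' \<in> sets N" using assms by (simp add: bisection_sets bprod_bisection sets.Diff)
    show "bprod G (B - B') C \<union> bprod G B (C - C') \<in> fmeasurable N"
      using P by (intro fmeasurable.Un fmeasurable_bisection)
  qed
  also have "\<dots> \<le> measure N (bprod G (B - B') C) + measure N (bprod G B (C - C'))"
    using P by (intro measure_Un_le) (simp_all add: bisection_sets)
  also have "\<dots> \<le> measure N (B - B') + measure N (C - C')"
    using measure_bprod_le[OF b(1) C] measure_bprod_le[OF B b(2)] by (intro add_mono) auto
  finally show ?thesis .
qed

lemma bdist_bprod:
  assumes "bisection G B" "bisection G C" "bisection G B'" "bisection G C'"
  shows "bdist (bprod G B C) (bprod G B' C') \<le> bdist B B' + bdist C C'"
  using measure_bprod_diff[of B C B' C'] measure_bprod_diff[of B' C' B C] assms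
  by (simp add: bdist_eq bprod_bisection)

lemma measure_binv: "B \<in> sets (gbor G) \<Longrightarrow> measure N (binv G B) = measure N B"
  by (simp add: measure_def emeasure_binv)

lemma bdist_binv:
  assumes B: "bisection G B" and C: "bisection G C" shows "bdist (binv G B) (binv G C) = bdist B C"
proof -
  have s: "B \<in> sets (gbor G)" "C \<in> sets (gbor G)" using B C by (auto simp: bisection_sets)
  have "(binv G B - binv G C) \<union> (binv G C - binv G B) = binv G ((B - C) \<union> (C - B))"
    using s by (auto simp: binv_vimage sets.Diff sets.Un)
  then show ?thesis unfolding bdist_def using s by (simp add: measure_binv sets.Diff sets.Un)
qed

end

section \<open>Words and sums of words\<close>

lemma integral_sum_list:
  fixes f :: "'i \<Rightarrow> 'a \<Rightarrow> complex"
  assumes "\<And>i. i \<in> set is \<Longrightarrow> integrable M (f i)"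
  shows "integrable M (\<lambda>x. \<Sum>i\<leftarrow>is. f i x) \<and> (\<integral>x. (\<Sum>i\<leftarrow>is. f i x) \<partial>M) = (\<Sum>i\<leftarrow>is. \<integral>x. f i x \<partial>M)"
  using assms by (induction "is") auto

lemma sum_list_product:
  fixes f :: "'a \<Rightarrow> 'b \<Rightarrow> 'c::comm_monoid_add"
  shows "(\<Sum>p\<leftarrow>List.product xs ys. f (fst p) (snd p)) = (\<Sum>x\<leftarrow>xs. \<Sum>y\<leftarrow>ys. f x y)"
  by (induction xs) (simp_all add: o_def)

lemma op_mult_assoc:
  assumes "c \<in> L2 M \<rightarrow>\<^sub>E L2 M" shows "op_mult M (op_mult M a b) c = op_mult M a (op_mult M b c)"
  unfolding op_mult_def using assms by (intro ext) (auto simp: compose_def PiE_def Pi_def)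

lemma op_mult_one_left: "c \<in> L2 M \<rightarrow>\<^sub>E L2 M \<Longrightarrow> op_mult M (op_one M) c = c"
  unfolding op_mult_def op_one_def by (intro ext) (auto simp: compose_def PiE_def Pi_def extensional_def)

lemma op_mult_one_right: "c \<in> L2 M \<rightarrow>\<^sub>E L2 M \<Longrightarrow> op_mult M c (op_one M) = c"
  unfolding op_mult_def op_one_def by (intro ext) (auto simp: compose_def PiE_def Pi_def extensional_def)

lemma op_mult_maps: "a \<in> L2 M \<rightarrow>\<^sub>E L2 M \<Longrightarrow> b \<in> L2 M \<rightarrow>\<^sub>E L2 M \<Longrightarrow> op_mult M a b \<in> L2 M \<rightarrow>\<^sub>E L2 M"
  unfolding op_mult_def by (auto simp: compose_def PiE_def Pi_def extensional_def)

lemma op_one_maps: "op_one M \<in> L2 M \<rightarrow>\<^sub>E L2 M"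
  unfolding op_one_def by auto

lemma op_prod_simps [simp]: "op_prod M [] = op_one M" "op_prod M (s # ss) = op_mult M s (op_prod M ss)"
  by (simp_all add: op_prod_def)

lemma op_sum_simps [simp]: "op_sum M [] = op_zero M" "op_sum M (s # ss) = op_add M s (op_sum M ss)"
  by (simp_all add: op_sum_def)

lemma op_prod_maps: "set ss \<subseteq> L2 M \<rightarrow>\<^sub>E L2 M \<Longrightarrow> op_prod M ss \<in> L2 M \<rightarrow>\<^sub>E L2 M"
  by (induction ss) (simp_all add: op_one_maps op_mult_maps)

lemma op_prod_append:
  "set ss \<subseteq> L2 M \<rightarrow>\<^sub>E L2 M \<Longrightarrow> set ts \<subseteq> L2 M \<rightarrow>\<^sub>E L2 M \<Longrightarrow> op_prod M (ss @ ts) = op_mult M (op_prod M ss) (op_prod M ts)"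
  by (induction ss) (simp_all add: op_prod_maps op_mult_assoc op_mult_one_left)

context pmp_groupoid
begin

abbreviation IG :: "'g l2_op set" where "IG \<equiv> inv_semigroup G \<mu>"

lemma IG_I: "bisection G B \<Longrightarrow> pis B \<in> IG"
  by (auto simp: inv_semigroup_def bisection_def)

lemma IG_E: assumes "s \<in> IG" obtains B where "bisection G B" "s = pis B"
  using assms by (auto simp: inv_semigroup_def bisection_def)

text \<open>
  Two bisections that differ by a null set have the same partial isometry, so a bisection has to be chosen.
\<close>
definition bis :: "'g l2_op \<Rightarrow> 'g set" where
  "bis s = (SOME B. bisection G B \<and> pis B = s)"

lemma bis: assumes "s \<in> IG" shows "bisection G (bis s)" "pis (bis s) = s"
proof -
  obtain B where "bisection G B" "s = pis B" using assms by (rule IG_E)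
  then have "\<exists>B. bisection G B \<and> pis B = s" by blast
  from someI_ex[OF this] show "bisection G (bis s)" "pis (bis s) = s" by (simp_all add: bis_def)
qed

lemma IG_mult: "s \<in> IG \<Longrightarrow> t \<in> IG \<Longrightarrow> op_mult N s t \<in> IG"
  by (elim IG_E) (simp add: pis_mult IG_I bprod_bisection)

lemma IG_adj: "s \<in> IG \<Longrightarrow> op_adj N s \<in> IG"
  by (elim IG_E) (simp add: pis_adj IG_I bisection_binv)

lemma adj_adj: "s \<in> IG \<Longrightarrow> op_adj N (op_adj N s) = s"
  by (elim IG_E) (simp add: pis_adj bisection_binv binv_binv)

lemma IG_lifts: "s \<in> IG \<Longrightarrow> lifts N s (partial_iso_fun G (bis s))"
  using lifts_pis[OF bis(1)] bis(2) by metis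

lemma IG_maps: "s \<in> IG \<Longrightarrow> s \<in> L2 N \<rightarrow>\<^sub>E L2 N"
  by (rule lifts_maps[OF IG_lifts])

lemma binv_bprod: assumes B: "bisection G B" and C: "bisection G C"
  shows "binv G (bprod G B C) = bprod G (binv G C) (binv G B)"
proof (intro equalityI subsetI)
  fix z assume "z \<in> binv G (bprod G B C)"
  then obtain x y where xy: "x \<in> B" "y \<in> C" "gsrc G x = grng G y" "z = ginv G (gmult G x y)"
    unfolding binv_def bprod_def by blast
  have a: "x \<in> arrows G" "y \<in> arrows G" using xy bisection_arrows B C by auto
  then have "z = gmult G (ginv G y) (ginv G x)" "gsrc G (ginv G y) = grng G (ginv G x)"
    using xy by (simp_all add: inv_of_mult src_inv rng_inv)
  then show "z \<in> bprod G (binv G C) (binv G B)" using xy unfolding binv_def bprod_def by blast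
next
  fix z assume "z \<in> bprod G (binv G C) (binv G B)"
  then obtain x y where xy: "x \<in> B" "y \<in> C" "gsrc G (ginv G y) = grng G (ginv G x)" "z = gmult G (ginv G y) (ginv G x)"
    unfolding binv_def bprod_def by blast
  have a: "x \<in> arrows G" "y \<in> arrows G" using xy bisection_arrows B C by auto
  then have e: "gsrc G x = grng G y" using xy by (simp add: src_inv rng_inv)
  then have "z = ginv G (gmult G x y)" using xy a by (simp add: inv_of_mult)
  then show "z \<in> binv G (bprod G B C)" using xy e unfolding binv_def bprod_def by blast
qed

lemma bprod_triple: assumes B: "bisection G B" shows "bprod G B (bprod G (binv G B) B) = B"
proof (intro equalityI subsetI)
  fix z assume "z \<in> bprod G B (bprod G (binv G B) B)"
  then obtain x y w where h: "x \<in> B" "y \<in> B" "w \<in> B" "gsrc G (ginv G y) = grng G w"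
    "gsrc G x = grng G (gmult G (ginv G y) w)" "z = gmult G x (gmult G (ginv G y) w)"
    unfolding binv_def bprod_def by blast
  have a: "x \<in> arrows G" "y \<in> arrows G" "w \<in> arrows G" using h bisection_arrows[OF B] by auto
  have c: "(ginv G y, w) \<in> composable G" using a h by (intro composableI) (auto simp: inv_closed)
  have "grng G y = grng G w" using h a by (simp add: src_inv)
  then have yw: "y = w" using h B by (auto simp: bisection_def inj_on_def)
  have "gsrc G x = gsrc G y" using h(5) c a by (simp add: rng_mult rng_inv)
  then have xy: "x = y" using h B by (auto simp: bisection_def inj_on_def)
  show "z \<in> B" using h(6) a h(1) by (simp add: yw[symmetric] xy inv_mult mult_src)
next
  fix z assume z: "z \<in> B"
  then have a: "z \<in> arrows G" using bisection_arrows[OF B] by simp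
  have 1: "gmult G (ginv G z) z \<in> bprod G (binv G B) B" unfolding binv_def bprod_def
    by (intro CollectI exI[of _ "ginv G z"] exI[of _ z]) (use z a in \<open>simp add: src_inv\<close>)
  have 2: "gsrc G z = grng G (gmult G (ginv G z) z)" "z = gmult G z (gmult G (ginv G z) z)"
    using a by (simp_all add: inv_mult mult_src rng_unit src_closed)
  show "z \<in> bprod G B (bprod G (binv G B) B)" using z 1 2 unfolding bprod_def[of G B "bprod G (binv G B) B"] by blast
qed

lemma adj_mult: "s \<in> IG \<Longrightarrow> t \<in> IG \<Longrightarrow> op_adj N (op_mult N s t) = op_mult N (op_adj N t) (op_adj N s)"
  by (elim IG_E) (simp add: pis_mult pis_adj bprod_bisection bisection_binv binv_bprod)

lemma IG_triple: "s \<in> IG \<Longrightarrow> op_mult N s (op_mult N (op_adj N s) s) = s"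
  by (elim IG_E) (simp add: pis_mult pis_adj bprod_bisection bisection_binv bprod_triple)

text \<open>
  \<open>c\<inverse> b\<close> is a unit only for \<open>b = c\<close>, and \<open>b\<close> and \<open>b\<inverse> b\<close> have the same source.
\<close>
lemma measure_bprod_units:
  assumes B: "bisection G B" and C: "bisection G C"
  shows "measure N (bprod G (binv G C) B \<inter> gunits G) = measure N (B \<inter> C)"
proof -
  have BC: "bisection G (B \<inter> C)" by (rule bisection_subset[OF B]) (use B C in \<open>auto simp: bisection_sets\<close>)
  have eq: "bprod G (binv G C) B \<inter> gunits G = gsrc G ` (B \<inter> C)"
  proof (intro equalityI subsetI)
    fix z assume z: "z \<in> bprod G (binv G C) B \<inter> gunits G"
    then obtain x y where xy: "x \<in> B" "y \<in> C" "gsrc G (ginv G y) = grng G x" "z = gmult G (ginv G y) x"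
      unfolding binv_def bprod_def by blast
    have a: "x \<in> arrows G" "y \<in> arrows G" using xy bisection_arrows B C by auto
    have c: "(ginv G y, x) \<in> composable G" using a xy by (intro composableI) (auto simp: inv_closed)
    have r: "grng G y = grng G x" using xy a by (simp add: src_inv)
    have "gmult G y z = x" using xy(4) mult_inv_cancel[OF a(2,1) r] by simp
    moreover have "z = gsrc G y" using z c a xy(4) rng_unit[of z] by (simp add: rng_mult rng_inv)
    ultimately have "x = y" using a by (simp add: mult_src)
    then show "z \<in> gsrc G ` (B \<inter> C)" using xy a by (auto simp: inv_mult)
  next
    fix z assume "z \<in> gsrc G ` (B \<inter> C)"
    then obtain x where x: "x \<in> B" "x \<in> C" "z = gsrc G x" by blast
    have a: "x \<in> arrows G" using x bisection_arrows[OF B] by simp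
    have "z = gmult G (ginv G x) x" "gsrc G (ginv G x) = grng G x" using x a by (simp_all add: inv_mult src_inv)
    then have "z \<in> bprod G (binv G C) B" unfolding binv_def bprod_def
      by (intro CollectI exI[of _ "ginv G x"] exI[of _ x]) (simp add: x(1,2))
    then show "z \<in> bprod G (binv G C) B \<inter> gunits G" using x(3) src_closed[OF a] by simp
  qed
  let ?U = "gsrc G ` (B \<inter> C)"
  have Us: "?U \<in> sets (gbor G)" "?U \<subseteq> gunits G"
    using src_image[OF BC bisection_sets[OF BC] subset_refl] bisection_arrows[OF BC] src_closed by auto
  have U: "bisection G ?U" by (rule bisection_subset[OF bisection_units Us])
  have "gsrc G ` ?U = (\<lambda>x. x) ` ?U" by (rule image_cong[OF refl]) (use Us(2) in \<open>auto simp: src_unit\<close>)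
  then have "gsrc G ` ?U = ?U" by simp
  then have "emeasure N ?U = emeasure N (B \<inter> C)"
    by (simp add: emeasure_bisection_src[OF U] emeasure_bisection_src[OF BC])
  then show ?thesis by (simp add: eq measure_def)
qed

lemma trace_adj_mult:
  assumes "s \<in> IG" "t \<in> IG"
  shows "vn_trace G \<mu> (op_mult N (op_adj N t) s) = complex_of_real (measure N (bis s \<inter> bis t))"
proof -
  note s = bis[OF assms(1)] and t = bis[OF assms(2)]
  have "op_mult N (op_adj N t) s = pis (bprod G (binv G (bis t)) (bis s))"
    using pis_mult[OF bisection_binv[OF t(1)] s(1)] pis_adj[OF t(1)] s(2) t(2) by simp
  then show ?thesis
    using trace_pis[OF bprod_bisection[OF bisection_binv[OF t(1)] s(1)]] measure_bprod_units[OF s(1) t(1)] by simp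
qed

lemma lifts_op_sum: assumes "set ts \<subseteq> IG"
  shows "lifts N (op_sum N ts) (\<lambda>f x. \<Sum>t\<leftarrow>ts. partial_iso_fun G (bis t) f x)"
  using lifts_sum[of ts N "\<lambda>t. t" "\<lambda>t. partial_iso_fun G (bis t)"] IG_lifts assms by (simp add: subset_iff)

lemma partial_iso_fun_sum_list:
  assumes "bisection G B" "x \<in> arrows G"
  shows "partial_iso_fun G B (\<lambda>y. \<Sum>i\<leftarrow>is. f i y) x = (\<Sum>i\<leftarrow>is. partial_iso_fun G B (f i) x)"
  by (simp add: partial_iso_fun_eq[OF assms])

lemma op_mult_sums:
  assumes ss: "set ss \<subseteq> IG" and ts: "set ts \<subseteq> IG"
  shows "op_mult N (op_sum N ss) (op_sum N ts) = op_sum N (map (\<lambda>p. op_mult N (fst p) (snd p)) (List.product ss ts))"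
proof (rule lifts_eqI[OF lifts_mult[OF lifts_op_sum[OF ss] lifts_op_sum[OF ts]]])
  show "lifts N (op_sum N (map (\<lambda>p. op_mult N (fst p) (snd p)) (List.product ss ts)))
     (\<lambda>f x. \<Sum>p\<leftarrow>List.product ss ts. partial_iso_fun G (bis (fst p)) (partial_iso_fun G (bis (snd p)) f) x)"
  proof (rule lifts_sum)
    fix p assume "p \<in> set (List.product ss ts)"
    then have "fst p \<in> IG" "snd p \<in> IG" using ss ts by auto
    then show "lifts N (op_mult N (fst p) (snd p)) (\<lambda>f. partial_iso_fun G (bis (fst p)) (partial_iso_fun G (bis (snd p)) f))"
      by (intro lifts_mult[OF IG_lifts IG_lifts])
  qed
  fix f :: "'g \<Rightarrow> complex"
  show "AE x in N. (\<Sum>t\<leftarrow>ss. partial_iso_fun G (bis t) (\<lambda>x. \<Sum>t\<leftarrow>ts. partial_iso_fun G (bis t) f x) x) =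
    (\<Sum>p\<leftarrow>List.product ss ts. partial_iso_fun G (bis (fst p)) (partial_iso_fun G (bis (snd p)) f) x)"
  proof (rule AE_I2)
    fix x assume "x \<in> space N"
    then have x: "x \<in> arrows G" by simp
    have "(\<Sum>t\<leftarrow>ss. partial_iso_fun G (bis t) (\<lambda>x. \<Sum>t\<leftarrow>ts. partial_iso_fun G (bis t) f x) x) =
      (\<Sum>s\<leftarrow>ss. \<Sum>t\<leftarrow>ts. partial_iso_fun G (bis s) (partial_iso_fun G (bis t) f) x)"
      by (intro arg_cong[where f = sum_list] map_cong refl partial_iso_fun_sum_list bis x) (use ss in auto)
    then show "(\<Sum>t\<leftarrow>ss. partial_iso_fun G (bis t) (\<lambda>x. \<Sum>t\<leftarrow>ts. partial_iso_fun G (bis t) f x) x) =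
      (\<Sum>p\<leftarrow>List.product ss ts. partial_iso_fun G (bis (fst p)) (partial_iso_fun G (bis (snd p)) f) x)"
      using sum_list_product[where f = "\<lambda>s t. partial_iso_fun G (bis s) (partial_iso_fun G (bis t) f) x" and xs = ss and ys = ts] by simp
  qed
qed

lemma op_adj_sum:
  assumes ss: "set ss \<subseteq> IG" shows "op_adj N (op_sum N ss) = op_sum N (map (op_adj N) ss)"
proof (rule lifts_adjoint[OF lifts_op_sum[OF ss]])
  show "lifts N (op_sum N (map (op_adj N) ss)) (\<lambda>f x. \<Sum>s\<leftarrow>ss. partial_iso_fun G (binv G (bis s)) f x)"
  proof (rule lifts_sum)
    fix s assume "s \<in> set ss"
    then have "s \<in> IG" using ss by auto
    from lifts_pis[OF bisection_binv[OF bis(1)[OF this]]] pis_adj[OF bis(1)[OF this]] bis(2)[OF this]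
    show "lifts N (op_adj N s) (partial_iso_fun G (binv G (bis s)))" by simp
  qed
  fix f g assume f: "f \<in> l2_fun N" and g: "g \<in> l2_fun N"
  have b: "bisection G (bis s)" "bisection G (binv G (bis s))" if "s \<in> set ss" for s using bis ss that bisection_binv by auto
  have i1: "integrable N (\<lambda>x. partial_iso_fun G (bis s) f x * cnj (g x))" if "s \<in> set ss" for s
    by (intro integrable_l2_mult partial_iso_fun_l2 b that f g)
  have i2: "integrable N (\<lambda>x. f x * cnj (partial_iso_fun G (binv G (bis s)) g x))" if "s \<in> set ss" for s
    by (intro integrable_l2_mult partial_iso_fun_l2 b that f g)
  have "(\<integral>x. (\<Sum>s\<leftarrow>ss. partial_iso_fun G (bis s) f x) * cnj (g x) \<partial>N) = (\<integral>x. (\<Sum>s\<leftarrow>ss. partial_iso_fun G (bis s) f x * cnj (g x)) \<partial>N)"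
    by (simp add: sum_list_mult_const)
  also have "\<dots> = (\<Sum>s\<leftarrow>ss. \<integral>x. partial_iso_fun G (bis s) f x * cnj (g x) \<partial>N)" using i1 by (intro conjunct2[OF integral_sum_list])
  also have "\<dots> = (\<Sum>s\<leftarrow>ss. \<integral>x. f x * cnj (partial_iso_fun G (binv G (bis s)) g x) \<partial>N)"
    by (intro arg_cong[where f = sum_list] map_cong refl partial_iso_fun_adjoint b f g)
  also have "\<dots> = (\<integral>x. (\<Sum>s\<leftarrow>ss. f x * cnj (partial_iso_fun G (binv G (bis s)) g x)) \<partial>N)" using i2 by (intro conjunct2[OF integral_sum_list, symmetric])
  also have "\<dots> = (\<integral>x. f x * cnj (\<Sum>s\<leftarrow>ss. partial_iso_fun G (binv G (bis s)) g x) \<partial>N)"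
  proof (intro Bochner_Integration.integral_cong refl)
    fix x show "(\<Sum>s\<leftarrow>ss. f x * cnj (partial_iso_fun G (binv G (bis s)) g x)) = f x * cnj (\<Sum>s\<leftarrow>ss. partial_iso_fun G (binv G (bis s)) g x)"
      by (induction ss) (simp_all add: algebra_simps)
  qed
  finally show "(\<integral>x. (\<Sum>s\<leftarrow>ss. partial_iso_fun G (bis s) f x) * cnj (g x) \<partial>N) =
    (\<integral>x. f x * cnj (\<Sum>s\<leftarrow>ss. partial_iso_fun G (binv G (bis s)) g x) \<partial>N)" .
qed

lemma trace_sum:
  assumes ss: "set ss \<subseteq> IG" shows "vn_trace G \<mu> (op_sum N ss) = (\<Sum>s\<leftarrow>ss. vn_trace G \<mu> s)"
proof -
  let ?u = "indicator (gunits G) :: 'g \<Rightarrow> complex"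
  have t: "vn_trace G \<mu> a = (\<integral>x. F ?u x * cnj (?u x) \<partial>N)" if "lifts N a F" for a F
    using inner_lift[OF that bisection_units] by (simp only: vn_trace_def unit_vec_def)
  have i: "integrable N (\<lambda>x. partial_iso_fun G (bis s) ?u x * cnj (?u x))" if "s \<in> set ss" for s
    using ss that by (intro integrable_l2_mult partial_iso_fun_l2 bis l2_indicator bisection_units) auto
  have "vn_trace G \<mu> (op_sum N ss) = (\<integral>x. (\<Sum>s\<leftarrow>ss. partial_iso_fun G (bis s) ?u x * cnj (?u x)) \<partial>N)"
    unfolding t[OF lifts_op_sum[OF ss]] sum_list_mult_const ..
  also have "\<dots> = (\<Sum>s\<leftarrow>ss. \<integral>x. partial_iso_fun G (bis s) ?u x * cnj (?u x) \<partial>N)" using i by (intro conjunct2[OF integral_sum_list])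
  also have "\<dots> = (\<Sum>s\<leftarrow>ss. vn_trace G \<mu> s)"
    by (intro arg_cong[where f = sum_list] map_cong refl t[symmetric] IG_lifts) (use ss in auto)
  finally show ?thesis .
qed

abbreviation V :: "'g l2_op set" where "V \<equiv> lin_span G \<mu> IG"

lemma op_scale_1: "s \<in> IG \<Longrightarrow> op_scale N 1 s = s"
  by (rule lifts_eqI[OF lifts_scale[OF IG_lifts] IG_lifts]) auto

lemma op_sum_single: "s \<in> IG \<Longrightarrow> op_sum N [s] = s"
  unfolding op_sum_simps by (rule lifts_eqI[OF lifts_add[OF IG_lifts lifts_zero] IG_lifts]) auto

lemma op_prod_single: "s \<in> IG \<Longrightarrow> op_prod N [s] = s"
  by (simp add: op_mult_one_right IG_maps)

lemma op_sum_V: assumes "set ts \<subseteq> IG" shows "op_sum N ts \<in> V"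
proof -
  have "map (\<lambda>(c, s). op_scale N c s) (map (\<lambda>s. (1, s)) ts) = map (\<lambda>t. t) ts"
    unfolding map_map by (rule map_cong[OF refl]) (use assms in \<open>auto simp: op_scale_1\<close>)
  then have "op_sum N ts = op_sum N (map (\<lambda>(c, s). op_scale N c s) (map (\<lambda>s. (1, s)) ts))" by simp
  moreover have "snd ` set (map (\<lambda>s. (1 :: complex, s)) ts) \<subseteq> IG" using assms by auto
  ultimately show ?thesis unfolding lin_span_def Let_def by blast
qed

lemma IG_V: "s \<in> IG \<Longrightarrow> s \<in> V"
  using op_sum_V[of "[s]"] op_sum_single[of s] by simp

lemma V_lifts: assumes "a \<in> V" shows "\<exists>F. lifts N a F"
proof -
  obtain cs where a: "a = op_sum N (map (\<lambda>(c, s). op_scale N c s) cs)" and cs: "snd ` set cs \<subseteq> IG"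
    using assms unfolding lin_span_def Let_def by blast
  have "lifts N a (\<lambda>f x. \<Sum>p\<leftarrow>cs. fst p * partial_iso_fun G (bis (snd p)) f x)"
    unfolding a by (rule lifts_sum) (use cs in \<open>auto intro!: lifts_scale IG_lifts split: prod.split\<close>)
  then show ?thesis by blast
qed

lemma linear_mapsD:
  assumes "\<phi> \<in> linear_maps G \<mu> d"
  shows "a \<in> V \<Longrightarrow> \<phi> a \<in> carrier_mat d d"
    and "a \<in> V \<Longrightarrow> b \<in> V \<Longrightarrow> \<phi> (op_add N a b) = \<phi> a + \<phi> b"
  using assms unfolding linear_maps_def Let_def by auto

lemma linear_map_sum:
  assumes \<phi>: "\<phi> \<in> linear_maps G \<mu> d" and ts: "set ts \<subseteq> IG" and ij: "i < d" "j < d"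
  shows "\<phi> (op_sum N ts) $$ (i, j) = (\<Sum>t\<leftarrow>ts. \<phi> t $$ (i, j))"
  using ts
proof (induction ts)
  case Nil
  have z: "op_zero N \<in> V" using op_sum_V[of "[]"] by simp
  have "op_add N (op_zero N) (op_zero N) = op_zero N"
    by (rule lifts_eqI[OF lifts_add[OF lifts_zero lifts_zero] lifts_zero]) auto
  then have "\<phi> (op_zero N) = \<phi> (op_zero N) + \<phi> (op_zero N)" using linear_mapsD(2)[OF \<phi> z z] by simp
  then have "\<phi> (op_zero N) $$ (i, j) = (\<phi> (op_zero N) + \<phi> (op_zero N)) $$ (i, j)" by (rule arg_cong)
  also have "\<dots> = \<phi> (op_zero N) $$ (i, j) + \<phi> (op_zero N) $$ (i, j)"
    using linear_mapsD(1)[OF \<phi> z] ij by simp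
  finally show ?case by simp
next
  case (Cons t ts)
  have t: "t \<in> V" and ts: "op_sum N ts \<in> V" using Cons.prems by (auto intro: IG_V op_sum_V)
  have "\<phi> (op_sum N (t # ts)) $$ (i, j) = (\<phi> t + \<phi> (op_sum N ts)) $$ (i, j)"
    using linear_mapsD(2)[OF \<phi> t ts] by simp
  also have "\<dots> = \<phi> t $$ (i, j) + \<phi> (op_sum N ts) $$ (i, j)"
    using linear_mapsD(1)[OF \<phi> ts] ij by simp
  finally show ?case using Cons by simp
qed

text \<open>
  The empty product is excluded because the unit need not be a word in \<open>\<Omega>\<close>.
\<close>
definition words :: "'g l2_op set \<Rightarrow> 'g l2_op set" where
  "words \<Omega> = {op_prod N ss | ss. ss \<noteq> [] \<and> set ss \<subseteq> sym_set G \<mu> \<Omega>}"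

abbreviation wsums :: "'g l2_op set \<Rightarrow> 'g l2_op set" where
  "wsums \<Omega> \<equiv> sum_set G \<mu> (words \<Omega>)"

lemma words_eq: "(\<Union>n\<in>{1..}. set_pow G \<mu> (sym_set G \<mu> \<Omega>) n) = words \<Omega>"
proof (intro equalityI subsetI)
  fix t assume "t \<in> (\<Union>n\<in>{1..}. set_pow G \<mu> (sym_set G \<mu> \<Omega>) n)"
  then obtain n ss where "1 \<le> n" "t = op_prod N ss" "length ss = n" "set ss \<subseteq> sym_set G \<mu> \<Omega>"
    unfolding set_pow_def by auto
  then show "t \<in> words \<Omega>" unfolding words_def by (intro CollectI exI[of _ ss]) auto
next
  fix t assume "t \<in> words \<Omega>"
  then obtain ss where ss: "t = op_prod N ss" "ss \<noteq> []" "set ss \<subseteq> sym_set G \<mu> \<Omega>" unfolding words_def by blast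
  then have "t \<in> set_pow G \<mu> (sym_set G \<mu> \<Omega>) (length ss)" unfolding set_pow_def by blast
  moreover have "length ss \<in> {1..}" using ss(2) by (simp add: Suc_le_eq)
  ultimately show "t \<in> (\<Union>n\<in>{1..}. set_pow G \<mu> (sym_set G \<mu> \<Omega>) n)" by blast
qed

lemma sym_set_mono: "F \<subseteq> \<Omega> \<Longrightarrow> sym_set G \<mu> F \<subseteq> sym_set G \<mu> \<Omega>"
  unfolding sym_set_def by blast

lemma sym_set_IG: "\<Omega> \<subseteq> IG \<Longrightarrow> sym_set G \<mu> \<Omega> \<subseteq> IG"
  unfolding sym_set_def by (auto intro: IG_adj)

lemma sym_set_adj: "\<Omega> \<subseteq> IG \<Longrightarrow> s \<in> sym_set G \<mu> \<Omega> \<Longrightarrow> op_adj N s \<in> sym_set G \<mu> \<Omega>"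
  unfolding sym_set_def by (auto simp: adj_adj subset_iff)

lemma op_prod_IG: "set ss \<subseteq> IG \<Longrightarrow> ss \<noteq> [] \<Longrightarrow> op_prod N ss \<in> IG"
proof (induction ss)
  case (Cons s ss)
  then show ?case by (cases "ss = []") (auto simp: op_mult_one_right IG_maps intro: IG_mult)
qed simp

lemma op_adj_prod: "set ss \<subseteq> IG \<Longrightarrow> ss \<noteq> [] \<Longrightarrow> op_adj N (op_prod N ss) = op_prod N (rev (map (op_adj N) ss))"
proof (induction ss)
  case (Cons s ss)
  show ?case
  proof (cases "ss = []")
    case True then show ?thesis using Cons.prems by (simp add: op_mult_one_right IG_maps IG_adj)
  next
    case False
    have s: "s \<in> IG" "set ss \<subseteq> IG" using Cons.prems by auto
    have p: "op_prod N ss \<in> IG" by (rule op_prod_IG[OF s(2) False])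
    have "op_adj N (op_prod N (s # ss)) = op_mult N (op_adj N (op_prod N ss)) (op_adj N s)"
      unfolding op_prod_simps by (rule adj_mult[OF s(1) p])
    also have "\<dots> = op_mult N (op_prod N (rev (map (op_adj N) ss))) (op_prod N [op_adj N s])"
      unfolding Cons.IH[OF s(2) False] op_prod_single[OF IG_adj[OF s(1)]] ..
    also have "\<dots> = op_prod N (rev (map (op_adj N) ss) @ [op_adj N s])"
      using s by (intro op_prod_append[symmetric]) (auto intro!: IG_maps IG_adj)
    finally show ?thesis by simp
  qed
qed simp

lemma words_IG: "\<Omega> \<subseteq> IG \<Longrightarrow> words \<Omega> \<subseteq> IG"
  unfolding words_def using sym_set_IG[of \<Omega>] by (auto intro!: op_prod_IG)

lemma words_mult:
  assumes \<Omega>: "\<Omega> \<subseteq> IG" and s: "s \<in> words \<Omega>" and t: "t \<in> words \<Omega>" shows "op_mult N s t \<in> words \<Omega>"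
proof -
  obtain ss where ss: "s = op_prod N ss" "ss \<noteq> []" "set ss \<subseteq> sym_set G \<mu> \<Omega>" using s unfolding words_def by blast
  obtain ts where ts: "t = op_prod N ts" "ts \<noteq> []" "set ts \<subseteq> sym_set G \<mu> \<Omega>" using t unfolding words_def by blast
  have m: "sym_set G \<mu> \<Omega> \<subseteq> L2 N \<rightarrow>\<^sub>E L2 N" using IG_maps sym_set_IG[OF \<Omega>] by blast
  have "op_mult N s t = op_prod N (ss @ ts)"
    unfolding ss(1) ts(1) by (rule op_prod_append[symmetric]) (use ss ts m in auto)
  moreover have "ss @ ts \<noteq> []" "set (ss @ ts) \<subseteq> sym_set G \<mu> \<Omega>" using ss ts by auto
  ultimately show ?thesis unfolding words_def by blast
qed

lemma words_adj:
  assumes \<Omega>: "\<Omega> \<subseteq> IG" and s: "s \<in> words \<Omega>" shows "op_adj N s \<in> words \<Omega>"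
proof -
  obtain ss where ss: "s = op_prod N ss" "ss \<noteq> []" "set ss \<subseteq> sym_set G \<mu> \<Omega>" using s unfolding words_def by blast
  have "op_adj N s = op_prod N (rev (map (op_adj N) ss))"
    unfolding ss(1) by (rule op_adj_prod) (use ss sym_set_IG[OF \<Omega>] in auto)
  moreover have "rev (map (op_adj N) ss) \<noteq> []" "set (rev (map (op_adj N) ss)) \<subseteq> sym_set G \<mu> \<Omega>"
    using ss sym_set_adj[OF \<Omega>] by auto
  ultimately show ?thesis unfolding words_def by blast
qed

lemma wsumsE:
  assumes "D \<in> wsums \<Omega>" obtains ts where "D \<in> IG" "D = op_sum N ts" "set ts \<subseteq> words \<Omega>"
  using assms unfolding sum_set_def by blast

lemma wsumsI: "D \<in> IG \<Longrightarrow> D = op_sum N ts \<Longrightarrow> set ts \<subseteq> words \<Omega> \<Longrightarrow> D \<in> wsums \<Omega>"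
  unfolding sum_set_def by blast

lemma words_wsums: assumes \<Omega>: "\<Omega> \<subseteq> IG" and s: "s \<in> words \<Omega>" shows "s \<in> wsums \<Omega>"
proof -
  have "s \<in> IG" using words_IG[OF \<Omega>] s by blast
  then show ?thesis using s by (intro wsumsI[of _ "[s]"]) (simp_all only: op_sum_single, auto)
qed

lemma wsums_mult:
  assumes \<Omega>: "\<Omega> \<subseteq> IG" and D: "D \<in> wsums \<Omega>" and E: "E \<in> wsums \<Omega>" shows "op_mult N D E \<in> wsums \<Omega>"
proof -
  obtain ss where ss: "D \<in> IG" "D = op_sum N ss" "set ss \<subseteq> words \<Omega>" by (rule wsumsE[OF D])
  obtain ts where ts: "E \<in> IG" "E = op_sum N ts" "set ts \<subseteq> words \<Omega>" by (rule wsumsE[OF E])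
  show ?thesis
  proof (rule wsumsI)
    show "op_mult N D E \<in> IG" by (rule IG_mult[OF ss(1) ts(1)])
    show "op_mult N D E = op_sum N (map (\<lambda>p. op_mult N (fst p) (snd p)) (List.product ss ts))"
      unfolding ss(2) ts(2) by (rule op_mult_sums) (use ss ts words_IG[OF \<Omega>] in auto)
    show "set (map (\<lambda>p. op_mult N (fst p) (snd p)) (List.product ss ts)) \<subseteq> words \<Omega>"
      by (auto dest!: subsetD[OF ss(3)] subsetD[OF ts(3)] intro: words_mult[OF \<Omega>])
  qed
qed

lemma wsums_adj:
  assumes \<Omega>: "\<Omega> \<subseteq> IG" and D: "D \<in> wsums \<Omega>" shows "op_adj N D \<in> wsums \<Omega>"
proof -
  obtain ss where ss: "D \<in> IG" "D = op_sum N ss" "set ss \<subseteq> words \<Omega>" by (rule wsumsE[OF D])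
  show ?thesis
  proof (rule wsumsI)
    show "op_adj N D \<in> IG" by (rule IG_adj[OF ss(1)])
    show "op_adj N D = op_sum N (map (op_adj N) ss)"
      unfolding ss(2) by (rule op_adj_sum) (use ss words_IG[OF \<Omega>] in auto)
    show "set (map (op_adj N) ss) \<subseteq> words \<Omega>" using ss words_adj[OF \<Omega>] by auto
  qed
qed

lemma IG_words: "s \<in> IG \<Longrightarrow> s \<in> words IG"
  unfolding words_def by (intro CollectI exI[of _ "[s]"]) (simp only: op_prod_single, auto simp: sym_set_def)

lemma subset_words: "\<Omega> \<subseteq> IG \<Longrightarrow> s \<in> \<Omega> \<Longrightarrow> s \<in> words \<Omega>"
  unfolding words_def by (intro CollectI exI[of _ "[s]"]) (simp only: op_prod_single subset_iff, auto simp: sym_set_def)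

end

section \<open>Real matrices in the normalized Hilbert-Schmidt norm\<close>

definition mm :: "nat \<Rightarrow> (nat \<Rightarrow> nat \<Rightarrow> real) \<Rightarrow> (nat \<Rightarrow> nat \<Rightarrow> real) \<Rightarrow> nat \<Rightarrow> nat \<Rightarrow> real" where
  "mm d f g i j = (\<Sum>k<d. f i k * g k j)"

definition tp :: "(nat \<Rightarrow> nat \<Rightarrow> real) \<Rightarrow> nat \<Rightarrow> nat \<Rightarrow> real" where "tp f i j = f j i"

definition tr :: "nat \<Rightarrow> (nat \<Rightarrow> nat \<Rightarrow> real) \<Rightarrow> real" where "tr d f = (\<Sum>i<d. f i i) / real d"

definition ip :: "nat \<Rightarrow> (nat \<Rightarrow> nat \<Rightarrow> real) \<Rightarrow> (nat \<Rightarrow> nat \<Rightarrow> real) \<Rightarrow> real" where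
  "ip d f g = (\<Sum>i<d. \<Sum>j<d. f i j * g i j) / real d"

definition nrm :: "nat \<Rightarrow> (nat \<Rightarrow> nat \<Rightarrow> real) \<Rightarrow> real" where
  "nrm d f = sqrt ((\<Sum>i<d. \<Sum>j<d. (f i j)\<^sup>2) / real d)"

text \<open>
  The entry function of a partial permutation matrix: zeros and ones with at most a single one in each row and
  column.
\<close>
definition ppm :: "nat \<Rightarrow> (nat \<Rightarrow> nat \<Rightarrow> real) \<Rightarrow> bool" where
  "ppm d f \<longleftrightarrow> (\<forall>i<d. \<forall>j<d. f i j = 0 \<or> f i j = 1) \<and>
     (\<forall>i<d. \<forall>j<d. \<forall>k<d. f i j = 1 \<and> f i k = 1 \<longrightarrow> j = k) \<and>
     (\<forall>i<d. \<forall>j<d. \<forall>k<d. f i j = 1 \<and> f k j = 1 \<longrightarrow> i = k)"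

lemma nrm_nonneg [simp]: "0 \<le> nrm d f"
  by (simp add: nrm_def sum_nonneg)

lemma nrm_sq: "(nrm d f)\<^sup>2 = ip d f f"
  by (simp add: nrm_def ip_def sum_nonneg power2_eq_square)

lemma nrm_cong: "(\<And>i j. i < d \<Longrightarrow> j < d \<Longrightarrow> f i j = g i j) \<Longrightarrow> nrm d f = nrm d g"
  unfolding nrm_def by (intro arg_cong[where f = sqrt] arg_cong2[where f = "(/)"] sum.cong refl) auto

lemma nrm_mono: "(\<And>i j. i < d \<Longrightarrow> j < d \<Longrightarrow> \<bar>f i j\<bar> \<le> \<bar>g i j\<bar>) \<Longrightarrow> nrm d f \<le> nrm d g"
  unfolding nrm_def by (intro real_sqrt_le_mono divide_right_mono sum_mono) (auto simp: abs_le_square_iff)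

lemma nrm_L2: "nrm d f = L2_set (\<lambda>p. f (fst p) (snd p)) ({..<d} \<times> {..<d}) / sqrt (real d)"
  unfolding nrm_def L2_set_def by (simp add: real_sqrt_divide sum.cartesian_product case_prod_beta)

lemma nrm_triangle: "nrm d (\<lambda>i j. f i j + g i j) \<le> nrm d f + nrm d g"
proof -
  have "L2_set (\<lambda>p. f (fst p) (snd p) + g (fst p) (snd p)) ({..<d} \<times> {..<d})
    \<le> L2_set (\<lambda>p. f (fst p) (snd p)) ({..<d} \<times> {..<d}) + L2_set (\<lambda>p. g (fst p) (snd p)) ({..<d} \<times> {..<d})"
    by (rule L2_set_triangle_ineq)
  then show ?thesis unfolding nrm_L2 by (simp add: add_divide_distrib[symmetric] divide_right_mono)
qed

lemma nrm_minus: "nrm d (\<lambda>i j. f i j - g i j) = nrm d (\<lambda>i j. g i j - f i j)"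
  by (simp add: nrm_def power2_commute)

lemma nrm_dist_triangle: "nrm d (\<lambda>i j. f i j - h i j) \<le> nrm d (\<lambda>i j. f i j - g i j) + nrm d (\<lambda>i j. g i j - h i j)"
  using nrm_triangle[of d "\<lambda>i j. f i j - g i j" "\<lambda>i j. g i j - h i j"] by simp

lemma nrm_scale: "nrm d (\<lambda>i j. c * f i j) = \<bar>c\<bar> * nrm d f"
  by (simp add: nrm_def power_mult_distrib sum_distrib_left[symmetric] real_sqrt_mult flip: times_divide_eq_right)

lemma nrm_zero [simp]: "nrm d (\<lambda>i j. 0) = 0"
  by (simp add: nrm_def)

lemma nrm_sum: "finite A \<Longrightarrow> nrm d (\<lambda>i j. \<Sum>a\<in>A. f a i j) \<le> (\<Sum>a\<in>A. nrm d (f a))"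
proof (induction A rule: finite_induct)
  case (insert x A)
  have "nrm d (\<lambda>i j. f x i j + (\<Sum>a\<in>A. f a i j)) \<le> nrm d (f x) + nrm d (\<lambda>i j. \<Sum>a\<in>A. f a i j)" by (rule nrm_triangle)
  then show ?case using insert by simp
qed simp

lemma nrm_tp: "nrm d (tp f) = nrm d f"
  unfolding nrm_def tp_def by (subst sum.swap) simp

lemma ip_cauchy: "\<bar>ip d f g\<bar> \<le> nrm d f * nrm d g"
proof (cases "d = 0")
  case False
  let ?P = "{..<d} \<times> {..<d}"
  have "\<bar>\<Sum>p\<in>?P. f (fst p) (snd p) * g (fst p) (snd p)\<bar> \<le> (\<Sum>p\<in>?P. \<bar>f (fst p) (snd p)\<bar> * \<bar>g (fst p) (snd p)\<bar>)"
    by (intro order_trans[OF sum_abs]) (simp add: abs_mult)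
  also have "\<dots> \<le> L2_set (\<lambda>p. f (fst p) (snd p)) ?P * L2_set (\<lambda>p. g (fst p) (snd p)) ?P"
    by (rule L2_set_mult_ineq)
  finally have *: "\<bar>\<Sum>i<d. \<Sum>j<d. f i j * g i j\<bar> \<le> L2_set (\<lambda>p. f (fst p) (snd p)) ?P * L2_set (\<lambda>p. g (fst p) (snd p)) ?P"
    by (simp add: sum.cartesian_product case_prod_beta)
  have "\<bar>ip d f g\<bar> = \<bar>\<Sum>i<d. \<Sum>j<d. f i j * g i j\<bar> / real d" by (simp add: ip_def)
  also have "\<dots> \<le> (L2_set (\<lambda>p. f (fst p) (snd p)) ?P * L2_set (\<lambda>p. g (fst p) (snd p)) ?P) / real d"
    by (intro divide_right_mono *) simp
  also have "\<dots> = nrm d f * nrm d g" unfolding nrm_L2 by simp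
  finally show ?thesis .
qed (simp add: ip_def)

lemma tr_le_nrm: "\<bar>tr d f\<bar> \<le> nrm d f"
proof (cases "d = 0")
  case False
  define e where "e = (\<lambda>i j::nat. if i = j then 1 else 0 :: real)"
  have "ip d e f = tr d f"
    unfolding ip_def tr_def e_def by (intro arg_cong2[where f = "(/)"] sum.cong refl) (simp add: if_distrib[of "\<lambda>x. x * _"] sum.delta' cong: if_cong)
  moreover have "nrm d e = 1"
  proof -
    have "(\<Sum>i<d. \<Sum>j<d. (e i j)\<^sup>2) = (\<Sum>i<d. 1)"
      unfolding e_def by (intro sum.cong refl) (simp add: if_distrib[of "\<lambda>x. x\<^sup>2"] sum.delta' cong: if_cong)
    then show ?thesis using False by (simp add: nrm_def)
  qed
  ultimately show ?thesis using ip_cauchy[of d e f] by simp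
qed (simp add: tr_def)

lemma mm_assoc: "mm d (mm d f g) h = mm d f (mm d g h)"
proof (intro ext)
  fix i j
  have "mm d (mm d f g) h i j = (\<Sum>k<d. \<Sum>l<d. f i l * g l k * h k j)" by (simp add: mm_def sum_distrib_right)
  also have "\<dots> = (\<Sum>l<d. \<Sum>k<d. f i l * g l k * h k j)" by (rule sum.swap)
  also have "\<dots> = mm d f (mm d g h) i j" by (simp add: mm_def sum_distrib_left mult.assoc)
  finally show "mm d (mm d f g) h i j = mm d f (mm d g h) i j" .
qed

lemma mm_cong: "(\<And>k. k < d \<Longrightarrow> f i k = f' i k) \<Longrightarrow> (\<And>k. k < d \<Longrightarrow> g k j = g' k j) \<Longrightarrow> mm d f g i j = mm d f' g' i j"
  unfolding mm_def by (intro sum.cong refl) simp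

lemma tp_tp [simp]: "tp (tp f) = f"
  by (intro ext) (simp add: tp_def)

lemma tp_mm: "tp (mm d f g) = mm d (tp g) (tp f)"
  by (intro ext) (simp add: tp_def mm_def mult.commute)

lemma mm_diff_left: "mm d (\<lambda>i j. f i j - g i j) h = (\<lambda>i j. mm d f h i j - mm d g h i j)"
  by (intro ext) (simp add: mm_def left_diff_distrib sum_subtractf)

lemma mm_diff_right: "mm d h (\<lambda>i j. f i j - g i j) = (\<lambda>i j. mm d h f i j - mm d h g i j)"
  by (intro ext) (simp add: mm_def right_diff_distrib sum_subtractf)

lemma mm_sum_left: "mm d (\<lambda>i j. \<Sum>a\<in>A. f a i j) h = (\<lambda>i j. \<Sum>a\<in>A. mm d (f a) h i j)"
proof (intro ext)
  fix i j
  have "mm d (\<lambda>i j. \<Sum>a\<in>A. f a i j) h i j = (\<Sum>k<d. \<Sum>a\<in>A. f a i k * h k j)" by (simp add: mm_def sum_distrib_right)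
  also have "\<dots> = (\<Sum>a\<in>A. mm d (f a) h i j)" unfolding mm_def by (rule sum.swap)
  finally show "mm d (\<lambda>i j. \<Sum>a\<in>A. f a i j) h i j = (\<Sum>a\<in>A. mm d (f a) h i j)" .
qed

lemma tp_sum: "tp (\<lambda>i j. \<Sum>a\<in>A. f a i j) = (\<lambda>i j. \<Sum>a\<in>A. tp (f a) i j)"
  by (intro ext) (simp add: tp_def)

lemma mm_sum_right: "mm d h (\<lambda>i j. \<Sum>a\<in>A. f a i j) = (\<lambda>i j. \<Sum>a\<in>A. mm d h (f a) i j)"
proof (intro ext)
  fix i j
  have "mm d h (\<lambda>i j. \<Sum>a\<in>A. f a i j) i j = (\<Sum>k<d. \<Sum>a\<in>A. h i k * f a k j)" by (simp add: mm_def sum_distrib_left)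
  also have "\<dots> = (\<Sum>a\<in>A. mm d h (f a) i j)" unfolding mm_def by (rule sum.swap)
  finally show "mm d h (\<lambda>i j. \<Sum>a\<in>A. f a i j) i j = (\<Sum>a\<in>A. mm d h (f a) i j)" .
qed

lemma tr_mm_commute: "tr d (mm d f g) = tr d (mm d g f)"
proof -
  have "(\<Sum>i<d. \<Sum>k<d. f i k * g k i) = (\<Sum>k<d. \<Sum>i<d. g k i * f i k)"
    by (subst sum.swap) (simp add: mult.commute)
  then show ?thesis by (simp add: tr_def mm_def)
qed

lemma tr_tp_mm: "tr d (mm d (tp f) g) = ip d f g"
  unfolding tr_def mm_def tp_def ip_def by (subst sum.swap) simp

lemma tr_cong: "(\<And>i. i < d \<Longrightarrow> f i i = g i i) \<Longrightarrow> tr d f = tr d g"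
  by (simp add: tr_def)

lemma ppmD:
  assumes "ppm d f"
  shows "i < d \<Longrightarrow> j < d \<Longrightarrow> f i j = 0 \<or> f i j = 1"
    and "i < d \<Longrightarrow> j < d \<Longrightarrow> k < d \<Longrightarrow> f i j = 1 \<Longrightarrow> f i k = 1 \<Longrightarrow> j = k"
    and "i < d \<Longrightarrow> j < d \<Longrightarrow> k < d \<Longrightarrow> f i j = 1 \<Longrightarrow> f k j = 1 \<Longrightarrow> i = k"
  using assms unfolding ppm_def by blast+

lemma ppm_tp: "ppm d f \<Longrightarrow> ppm d (tp f)"
  unfolding ppm_def tp_def by meson

lemma ppm_row_sum:
  assumes "ppm d f" "i < d"
  shows "(\<exists>k<d. f i k = 1 \<and> (\<forall>g. (\<Sum>j<d. f i j * g j) = g k)) \<or> ((\<forall>j<d. f i j = 0) \<and> (\<forall>g. (\<Sum>j<d. f i j * g j) = 0))"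
proof (cases "\<exists>k<d. f i k = 1")
  case True
  then obtain k where k: "k < d" "f i k = 1" by blast
  have "f i j = (if j = k then 1 else 0)" if "j < d" for j
  proof (cases "j = k")
    case False
    then have "f i j \<noteq> 1" using ppmD(2)[OF assms(1,2) that k(1) _ k(2)] by blast
    then show ?thesis using ppmD(1)[OF assms(1,2) that] False by simp
  qed (simp add: k)
  then have "(\<Sum>j<d. f i j * g j) = (\<Sum>j<d. if j = k then g j else 0)" for g by (intro sum.cong) auto
  then show ?thesis using k by auto
next
  case False
  then have "\<forall>j<d. f i j = 0" using ppmD(1)[OF assms] by blast
  then show ?thesis by simp
qed

lemma ppm_row_sum_le:
  assumes "ppm d f" "i < d" shows "(\<Sum>j<d. f i j) \<le> 1"
  using ppm_row_sum[OF assms]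
proof
  assume "\<exists>k<d. f i k = 1 \<and> (\<forall>g. (\<Sum>j<d. f i j * g j) = g k)"
  then obtain k where "\<forall>g. (\<Sum>j<d. f i j * g j) = g k" by blast
  from spec[OF this, of "\<lambda>_. 1"] show ?thesis by simp
qed simp

text \<open>
  The rows of the product are rows of \<open>g\<close>, none of them repeated, or zero.
\<close>
lemma nrm_mm_ppm:
  assumes f: "ppm d f" shows "nrm d (mm d f g) \<le> nrm d g"
proof -
  have col: "(\<Sum>i<d. (mm d f g i j)\<^sup>2) \<le> (\<Sum>k<d. (g k j)\<^sup>2)" for j
  proof -
    have sq: "(mm d f g i j)\<^sup>2 = (\<Sum>k<d. f i k * (g k j)\<^sup>2)" if i: "i < d" for i
    proof -
      from ppm_row_sum[OF f i] show ?thesis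
      proof
        assume "\<exists>k<d. f i k = 1 \<and> (\<forall>g. (\<Sum>j<d. f i j * g j) = g k)"
        then obtain k where "\<And>h. (\<Sum>j<d. f i j * h j) = h k" by blast
        then show ?thesis by (simp add: mm_def)
      next
        assume "(\<forall>j<d. f i j = 0) \<and> (\<forall>g. (\<Sum>j<d. f i j * g j) = 0)"
        then show ?thesis by (simp add: mm_def)
      qed
    qed
    have "(\<Sum>i<d. (mm d f g i j)\<^sup>2) = (\<Sum>i<d. \<Sum>k<d. f i k * (g k j)\<^sup>2)" using sq by (intro sum.cong) auto
    also have "\<dots> = (\<Sum>k<d. (\<Sum>i<d. f i k) * (g k j)\<^sup>2)" by (subst sum.swap) (simp add: sum_distrib_right)
    also have "\<dots> \<le> (\<Sum>k<d. 1 * (g k j)\<^sup>2)"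
    proof (intro sum_mono mult_right_mono)
      fix k assume "k \<in> {..<d}"
      then have k: "k < d" by simp
      show "(\<Sum>i<d. f i k) \<le> 1" using ppm_row_sum_le[OF ppm_tp[OF f] k] by (simp add: tp_def)
    qed simp
    finally show ?thesis by simp
  qed
  have "(\<Sum>i<d. \<Sum>j<d. (mm d f g i j)\<^sup>2) \<le> (\<Sum>i<d. \<Sum>j<d. (g i j)\<^sup>2)"
    by (subst (1 2) sum.swap) (intro sum_mono col)
  then show ?thesis unfolding nrm_def by (intro real_sqrt_le_mono divide_right_mono) auto
qed

lemma nrm_mm_ppm_right:
  assumes "ppm d f" shows "nrm d (mm d g f) \<le> nrm d g"
  using nrm_mm_ppm[OF ppm_tp[OF assms], of "tp g"] by (simp add: tp_mm[symmetric] nrm_tp)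

lemma nrm_ppm_le_1: assumes f: "ppm d f" shows "nrm d f \<le> 1"
proof -
  have "(\<Sum>j<d. (f i j)\<^sup>2) \<le> 1" if i: "i < d" for i
  proof -
    have "(\<Sum>j<d. (f i j)\<^sup>2) = (\<Sum>j<d. f i j)"
    proof (intro sum.cong refl)
      fix j assume "j \<in> {..<d}"
      then have "f i j = 0 \<or> f i j = 1" using ppmD(1)[OF f i] by simp
      then show "(f i j)\<^sup>2 = f i j" by auto
    qed
    also have "\<dots> \<le> 1" by (rule ppm_row_sum_le[OF f i])
    finally show ?thesis .
  qed
  then have "(\<Sum>i<d. \<Sum>j<d. (f i j)\<^sup>2) \<le> (\<Sum>i<d. 1)" by (intro sum_mono) simp
  then have "(\<Sum>i<d. \<Sum>j<d. (f i j)\<^sup>2) / real d \<le> 1" by (simp add: divide_le_eq)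
  then show ?thesis by (simp add: nrm_def)
qed

lemma ppm_mm: assumes f: "ppm d f" and g: "ppm d g" shows "ppm d (mm d f g)"
proof -
  have one: "(\<exists>k<d. f i k = 1 \<and> g k j = 1) \<and> mm d f g i j = 1 \<or> mm d f g i j = 0" if ij: "i < d" "j < d" for i j
    using ppm_row_sum[OF f ij(1)]
  proof
    assume "\<exists>k<d. f i k = 1 \<and> (\<forall>g. (\<Sum>j<d. f i j * g j) = g k)"
    then obtain k where k: "k < d" "f i k = 1" "\<And>h. (\<Sum>j<d. f i j * h j) = h k" by blast
    then have "mm d f g i j = g k j" by (simp add: mm_def)
    then show ?thesis using ppmD(1)[OF g k(1) ij(2)] k by auto
  qed (simp add: mm_def)
  show ?thesis
    unfolding ppm_def
  proof (intro conjI allI impI)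
    show "mm d f g i j = 0 \<or> mm d f g i j = 1" if "i < d" "j < d" for i j using one[OF that] by auto
    fix i j k assume i: "i < d" and j: "j < d" and k: "k < d"
    show "j = k" if H: "mm d f g i j = 1 \<and> mm d f g i k = 1"
    proof -
      obtain a b where "a < d" "f i a = 1" "g a j = 1" "b < d" "f i b = 1" "g b k = 1"
        using one[OF i j] one[OF i k] H by auto
      then show ?thesis using ppmD(2)[OF f i] ppmD(2)[OF g _ j k] by metis
    qed
    show "i = k" if H: "mm d f g i j = 1 \<and> mm d f g k j = 1"
    proof -
      obtain a b where "a < d" "f i a = 1" "g a j = 1" "b < d" "f k b = 1" "g b j = 1"
        using one[OF i j] one[OF k j] H by auto
      then show ?thesis using ppmD(3)[OF f i _ k] ppmD(3)[OF g _ j] by metis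
    qed
  qed
qed

lemma ppm_triple:
  assumes f: "ppm d f" and ij: "i < d" "j < d" shows "mm d (mm d f (tp f)) f i j = f i j"
proof -
  have "mm d (mm d f (tp f)) f i j = (\<Sum>k<d. f i k * (\<Sum>l<d. tp f k l * f l j))"
    unfolding mm_assoc by (simp add: mm_def)
  also have "\<dots> = f i j" using ppm_row_sum[OF f ij(1)]
  proof
    assume "\<exists>k<d. f i k = 1 \<and> (\<forall>g. (\<Sum>j<d. f i j * g j) = g k)"
    then obtain k where k: "k < d" "f i k = 1" "\<And>h. (\<Sum>j<d. f i j * h j) = h k" by blast
    have t: "tp f k i = 1" using k by (simp add: tp_def)
    from ppm_row_sum[OF ppm_tp[OF f] k(1)] show ?thesis
    proof
      assume "\<exists>i'<d. tp f k i' = 1 \<and> (\<forall>g. (\<Sum>j<d. tp f k j * g j) = g i')"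
      then obtain i' where i': "i' < d" "tp f k i' = 1" "\<And>h. (\<Sum>j<d. tp f k j * h j) = h i'" by blast
      then have "i' = i" using ppmD(2)[OF ppm_tp[OF f] k(1) i'(1) ij(1)] t by simp
      then show ?thesis using k(3) i'(3) by simp
    next
      assume "(\<forall>j<d. tp f k j = 0) \<and> (\<forall>g. (\<Sum>j<d. tp f k j * g j) = 0)"
      then show ?thesis using t ij(1) by simp
    qed
  next
    assume "(\<forall>j<d. f i j = 0) \<and> (\<forall>g. (\<Sum>j<d. f i j * g j) = 0)"
    then show ?thesis using ij(2) by simp
  qed
  finally show ?thesis .
qed

lemma ip_diff_right: "ip d f (\<lambda>i j. g i j - h i j) = ip d f g - ip d f h"
  by (simp add: ip_def right_diff_distrib sum_subtractf diff_divide_distrib)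

lemma ip_commute: "ip d f g = ip d g f"
  by (simp add: ip_def mult.commute)

lemma nrm_diff_sq: "(nrm d (\<lambda>i j. f i j - g i j))\<^sup>2 = ip d f f + ip d g g - 2 * ip d f g"
  unfolding nrm_sq ip_def by (simp add: algebra_simps sum.distrib sum_subtractf add_divide_distrib diff_divide_distrib flip: sum_distrib_left)

text \<open>
  The left-hand side is \<open>\<parallel>A\<parallel>\<^sup>2 + \<parallel>B\<parallel>\<^sup>2 - 2 tr (A B)\<close>. As \<open>A = A A\<^sup>T A\<close> and \<open>\<parallel>A\<parallel> \<le> 1\<close>, the trace of \<open>A B\<close> differs
  from \<open>\<parallel>A\<parallel>\<^sup>2\<close> by at most \<open>\<parallel>A B A - A\<parallel>\<close>, and likewise for \<open>B\<close>.
\<close>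
lemma ppm_quasi_inverse:
  assumes A: "ppm d A" and B: "ppm d B"
  shows "(nrm d (\<lambda>i j. B i j - tp A i j))\<^sup>2 \<le> nrm d (\<lambda>i j. mm d (mm d A B) A i j - A i j) + nrm d (\<lambda>i j. mm d (mm d B A) B i j - B i j)"
proof -
  have *: "ip d A A - tr d (mm d A B) \<le> nrm d (\<lambda>i j. mm d (mm d A B) A i j - A i j)" if A: "ppm d A" for A B
  proof -
    have "tr d (mm d A B) = tr d (mm d (mm d (mm d A (tp A)) A) B)"
      by (intro tr_cong mm_cong) (auto simp: ppm_triple[OF A])
    also have "\<dots> = tr d (mm d A (mm d (tp A) (mm d A B)))" by (simp add: mm_assoc)
    also have "\<dots> = tr d (mm d (mm d (tp A) (mm d A B)) A)" by (rule tr_mm_commute)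
    also have "\<dots> = ip d A (mm d (mm d A B) A)" by (simp add: mm_assoc tr_tp_mm)
    finally have "ip d A A - tr d (mm d A B) = ip d A (\<lambda>i j. A i j - mm d (mm d A B) A i j)" by (simp add: ip_diff_right)
    also have "\<dots> \<le> nrm d A * nrm d (\<lambda>i j. A i j - mm d (mm d A B) A i j)" using ip_cauchy abs_le_D1 by blast
    also have "\<dots> \<le> 1 * nrm d (\<lambda>i j. A i j - mm d (mm d A B) A i j)" by (intro mult_right_mono nrm_ppm_le_1 A) simp
    finally show ?thesis by (subst nrm_minus) simp
  qed
  have 1: "ip d B (tp A) = tr d (mm d A B)"
    by (subst ip_commute, subst tr_tp_mm[symmetric]) simp
  have 2: "ip d (tp A) (tp A) = ip d A A" unfolding ip_def tp_def by (subst sum.swap) simp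
  have "(nrm d (\<lambda>i j. B i j - tp A i j))\<^sup>2 = (ip d A A - tr d (mm d A B)) + (ip d B B - tr d (mm d B A))"
    unfolding nrm_diff_sq 1 2 tr_mm_commute[of d B A] by simp
  then show ?thesis using *[OF A, of B] *[OF B, of A] by simp
qed

definition natmat :: "nat \<Rightarrow> (nat \<Rightarrow> nat \<Rightarrow> real) \<Rightarrow> bool" where
  "natmat d M \<longleftrightarrow> (\<forall>i<d. \<forall>j<d. M i j \<in> \<nat>)"

lemma natmat_cases: assumes "natmat d M" "i < d" "j < d" shows "M i j = 0 \<or> M i j \<ge> 1"
proof -
  have "M i j \<in> \<nat>" using assms by (simp add: natmat_def)
  then obtain n where "M i j = real n" by (rule Nats_cases)
  then show ?thesis by (cases n) auto
qed

lemma natmat_nonneg: "natmat d M \<Longrightarrow> i < d \<Longrightarrow> j < d \<Longrightarrow> 0 \<le> M i j"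
  using natmat_cases[of d M i j] by auto

lemma sum_in_Nats: "(\<And>k. k < d \<Longrightarrow> F k \<in> \<nat>) \<Longrightarrow> (\<Sum>k<d::nat. F k) \<in> (\<nat> :: real set)"
  by (induction d) auto

lemma natmat_mm: "natmat d f \<Longrightarrow> natmat d g \<Longrightarrow> natmat d (mm d f g)"
  unfolding natmat_def mm_def by (intro allI impI sum_in_Nats Nats_mult) auto

lemma natmat_tp: "natmat d f \<Longrightarrow> natmat d (tp f)"
  by (simp add: natmat_def tp_def)

lemma natmat_ppm: "ppm d f \<Longrightarrow> natmat d f"
  unfolding natmat_def using ppmD(1) by (metis Nats_0 Nats_1)

definition isolated :: "nat \<Rightarrow> (nat \<Rightarrow> nat \<Rightarrow> real) \<Rightarrow> nat \<Rightarrow> nat \<Rightarrow> bool" where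
  "isolated d M i j \<longleftrightarrow> M i j = 1 \<and> (\<forall>k<d. k \<noteq> j \<longrightarrow> M i k = 0) \<and> (\<forall>k<d. k \<noteq> i \<longrightarrow> M k j = 0)"

text \<open>
  The entry of \<open>M M\<^sup>T M\<close> is a sum of nonnegative terms, among them \<open>x\<^sup>3\<close> for the entry \<open>x\<close> of \<open>M\<close>. This
  suffices for \<open>x \<ge> 2\<close>. For \<open>x = 1\<close> a further nonzero entry in the row or column gives a second
  term that is at least 1.
\<close>
lemma not_isolated_triple:
  assumes M: "natmat d M" and ij: "i < d" "j < d" and nz: "M i j \<noteq> 0" and bad: "\<not> isolated d M i j"
  shows "2 * M i j \<le> mm d (mm d M (tp M)) M i j"
proof -
  define x where "x = M i j"
  have x: "1 \<le> x" using natmat_cases[OF M ij] nz by (simp add: x_def)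
  define T where "T = (\<lambda>p. M i (fst p) * M (snd p) (fst p) * M (snd p) j)"
  let ?S = "{..<d} \<times> {..<d}"
  have T0: "0 \<le> T p" if "p \<in> ?S" for p
    using that ij natmat_nonneg[OF M] by (auto simp: T_def intro!: mult_nonneg_nonneg)
  have "mm d (mm d M (tp M)) M i j = (\<Sum>k<d. \<Sum>l<d. T (k, l))"
    unfolding mm_assoc by (simp add: mm_def tp_def T_def sum_distrib_left mult.assoc)
  then have sum: "mm d (mm d M (tp M)) M i j = (\<Sum>p\<in>?S. T p)" by (simp add: sum.cartesian_product)
  have T1: "T (j, i) = x ^ 3" by (simp add: T_def x_def power3_eq_cube)
  have x3: "x \<le> x ^ 3" using x self_le_power[of x 3] by simp
  show ?thesis
  proof (cases "x = 1")
    case False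
    have "2 \<le> x"
    proof -
      have "M i j \<in> \<nat>" using M ij by (simp add: natmat_def)
      then obtain n where n: "x = real n" unfolding x_def by (rule Nats_cases)
      then show ?thesis using x False by (cases n) (auto simp: Suc_le_eq)
    qed
    then have "2 * x \<le> x * x" by simp
    also have "\<dots> \<le> x * x * x" using x by (simp add: mult_le_cancel_left1)
    also have "\<dots> = (\<Sum>p\<in>{(j, i)}. T p)" using T1 by (simp add: power3_eq_cube)
    also have "\<dots> \<le> (\<Sum>p\<in>?S. T p)" using ij T0 by (intro sum_mono2) auto
    finally show ?thesis using sum by (simp add: x_def)
  next
    case True
    then have "(\<exists>k<d. k \<noteq> j \<and> M i k \<noteq> 0) \<or> (\<exists>k<d. k \<noteq> i \<and> M k j \<noteq> 0)"
      using bad by (auto simp: isolated_def x_def)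
    then obtain p where p: "p \<in> ?S" "p \<noteq> (j, i)" "T p \<ge> 1"
    proof
      assume "\<exists>k<d. k \<noteq> j \<and> M i k \<noteq> 0"
      then obtain k where k: "k < d" "k \<noteq> j" "M i k \<noteq> 0" by blast
      then have "1 \<le> M i k" using natmat_cases[OF M ij(1) k(1)] by simp
      then have "1 \<le> M i k * M i k" using mult_mono[of 1 "M i k" 1 "M i k"] by simp
      then have "T (k, i) \<ge> 1" using True by (simp add: T_def x_def)
      then show ?thesis using k ij by (intro that[of "(k, i)"]) auto
    next
      assume "\<exists>k<d. k \<noteq> i \<and> M k j \<noteq> 0"
      then obtain k where k: "k < d" "k \<noteq> i" "M k j \<noteq> 0" by blast
      then have "1 \<le> M k j" using natmat_cases[OF M k(1) ij(2)] by simp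
      then have "1 \<le> M k j * M k j" using mult_mono[of 1 "M k j" 1 "M k j"] by simp
      then have "T (j, k) \<ge> 1" using True by (simp add: T_def x_def)
      then show ?thesis using k ij by (intro that[of "(j, k)"]) auto
    qed
    have "2 * x \<le> (\<Sum>p\<in>{(j, i), p}. T p)" using p(2,3) T1 True by simp
    also have "\<dots> \<le> (\<Sum>p\<in>?S. T p)" using ij T0 p(1) by (intro sum_mono2) auto
    finally show ?thesis using sum by (simp add: x_def)
  qed
qed

definition rnd :: "nat \<Rightarrow> (nat \<Rightarrow> nat \<Rightarrow> real) \<Rightarrow> nat \<Rightarrow> nat \<Rightarrow> real" where
  "rnd d M i j = (if isolated d M i j then 1 else 0)"

lemma ppm_rnd: "ppm d (rnd d M)"
  unfolding ppm_def rnd_def by (auto simp: isolated_def)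

text \<open>
  The rounding changes \<open>M\<close> only in entries that are not isolated, and there \<open>M M\<^sup>T M\<close> exceeds \<open>M\<close> by at
  least \<open>M\<close>.
\<close>
lemma nrm_rnd:
  assumes M: "natmat d M"
  shows "nrm d (\<lambda>i j. rnd d M i j - M i j) \<le> nrm d (\<lambda>i j. mm d (mm d M (tp M)) M i j - M i j)"
proof (rule nrm_mono)
  fix i j assume ij: "i < d" "j < d"
  show "\<bar>rnd d M i j - M i j\<bar> \<le> \<bar>mm d (mm d M (tp M)) M i j - M i j\<bar>"
  proof (cases "isolated d M i j \<or> M i j = 0")
    case True
    then have "rnd d M i j = M i j" by (auto simp: rnd_def isolated_def)
    then show ?thesis by simp
  next
    case False
    then have "2 * M i j \<le> mm d (mm d M (tp M)) M i j" using not_isolated_triple[OF M ij] by simp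
    then show ?thesis using False natmat_nonneg[OF M ij] by (simp add: rnd_def)
  qed
qed

lemma ppm_iff_triple:
  assumes e: "\<And>i j. i < d \<Longrightarrow> j < d \<Longrightarrow> M i j = 0 \<or> M i j = 1"
    and t: "\<And>i j. i < d \<Longrightarrow> j < d \<Longrightarrow> mm d (mm d M (tp M)) M i j = M i j"
  shows "ppm d M"
proof -
  have M: "natmat d M" unfolding natmat_def using e by (metis Nats_0 Nats_1)
  have iso: "isolated d M i j" if ij: "i < d" "j < d" "M i j = 1" for i j
  proof (rule ccontr)
    assume "\<not> isolated d M i j"
    from not_isolated_triple[OF M ij(1,2) _ this] show False using t[OF ij(1,2)] ij(3) by simp
  qed
  show ?thesis
    unfolding ppm_def
  proof (intro conjI allI impI)
    show "M i j = 0 \<or> M i j = 1" if "i < d" "j < d" for i j by (rule e[OF that])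
    show "j = k" if "i < d" "j < d" "k < d" "M i j = 1 \<and> M i k = 1" for i j k
      using iso[of i j] that by (auto simp: isolated_def)
    show "i = k" if "i < d" "j < d" "k < d" "M i j = 1 \<and> M k j = 1" for i j k
      using iso[of i j] that by (auto simp: isolated_def)
  qed
qed

text \<open>
  The entries of \<open>R \<sigma>\<close> whose row and column are not met by any \<open>R \<tau>\<close> with \<open>\<tau> \<in> Q\<close>.
\<close>
definition separate :: "nat \<Rightarrow> ('s \<Rightarrow> nat \<Rightarrow> nat \<Rightarrow> real) \<Rightarrow> 's set \<Rightarrow> 's \<Rightarrow> nat \<Rightarrow> nat \<Rightarrow> real" where
  "separate d R Q \<sigma> i j = (if R \<sigma> i j = 1 \<and> (\<forall>\<tau>\<in>Q. (\<forall>k<d. R \<tau> i k = 0) \<and> (\<forall>k<d. R \<tau> k j = 0)) then 1 else 0)"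

lemma nat_le_square: "x \<in> \<nat> \<Longrightarrow> (x::real) \<le> x\<^sup>2"
  by (erule Nats_cases) (simp add: power2_eq_square flip: of_nat_mult)

text \<open>
  A deleted entry lies in a row or column that is met by some \<open>R \<tau>\<close>, so it contributes an entry 1 to
  \<open>R \<sigma>\<^sup>T R \<tau>\<close> or to \<open>R \<sigma> R \<tau>\<^sup>T\<close>.
\<close>
lemma nrm_separate:
  assumes Q: "finite Q" and R: "ppm d (R \<sigma>)" "\<And>\<tau>. \<tau> \<in> Q \<Longrightarrow> ppm d (R \<tau>)"
  shows "(nrm d (\<lambda>i j. separate d R Q \<sigma> i j - R \<sigma> i j))\<^sup>2
    \<le> (\<Sum>\<tau>\<in>Q. (nrm d (mm d (tp (R \<sigma>)) (R \<tau>)))\<^sup>2 + (nrm d (mm d (R \<sigma>) (tp (R \<tau>))))\<^sup>2)"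
proof -
  define X where "X = (\<lambda>\<tau> i j. \<Sum>k<d. R \<sigma> i j * R \<tau> i k)"
  define Y where "Y = (\<lambda>\<tau> i j. \<Sum>k<d. R \<sigma> i j * R \<tau> k j)"
  have R01: "0 \<le> R \<tau> i j" if "\<tau> \<in> Q" "i < d" "j < d" for \<tau> i j using ppmD(1)[OF R(2)[OF that(1)] that(2,3)] by auto
  have S01: "0 \<le> R \<sigma> i j" if "i < d" "j < d" for i j using ppmD(1)[OF R(1) that] by auto
  have X0: "0 \<le> X \<tau> i j" "0 \<le> Y \<tau> i j" if "\<tau> \<in> Q" "i < d" "j < d" for \<tau> i j
    using that R01 S01 by (auto simp: X_def Y_def intro!: sum_nonneg)
  have pt: "(separate d R Q \<sigma> i j - R \<sigma> i j)\<^sup>2 \<le> (\<Sum>\<tau>\<in>Q. X \<tau> i j + Y \<tau> i j)" if ij: "i < d" "j < d" for i j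
  proof (cases "R \<sigma> i j = 0 \<or> separate d R Q \<sigma> i j = 1")
    case True
    then have "separate d R Q \<sigma> i j = R \<sigma> i j" by (auto simp: separate_def split: if_splits)
    then show ?thesis using X0[OF _ ij] by (simp add: sum_nonneg)
  next
    case False
    then have 1: "R \<sigma> i j = 1" using ppmD(1)[OF R(1) ij] by simp
    with False obtain \<tau> where \<tau>: "\<tau> \<in> Q" "(\<exists>k<d. R \<tau> i k \<noteq> 0) \<or> (\<exists>k<d. R \<tau> k j \<noteq> 0)"
      by (auto simp: separate_def split: if_splits)
    have "1 \<le> X \<tau> i j + Y \<tau> i j"
      using \<tau>(2)
    proof
      assume "\<exists>k<d. R \<tau> i k \<noteq> 0"
      then obtain k where k: "k < d" "R \<tau> i k = 1" using ppmD(1)[OF R(2)[OF \<tau>(1)] ij(1)] by blast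
      have "(\<Sum>k\<in>{k}. R \<sigma> i j * R \<tau> i k) \<le> X \<tau> i j" unfolding X_def
        using k R01[OF \<tau>(1) ij(1)] 1 by (intro sum_mono2) auto
      then show ?thesis using X0(2)[OF \<tau>(1) ij] k 1 by simp
    next
      assume "\<exists>k<d. R \<tau> k j \<noteq> 0"
      then obtain k where k: "k < d" "R \<tau> k j = 1" using ppmD(1)[OF R(2)[OF \<tau>(1)] _ ij(2)] by blast
      have "(\<Sum>k\<in>{k}. R \<sigma> i j * R \<tau> k j) \<le> Y \<tau> i j" unfolding Y_def
        using k R01[OF \<tau>(1) _ ij(2)] 1 by (intro sum_mono2) auto
      then show ?thesis using X0(1)[OF \<tau>(1) ij] k 1 by simp
    qed
    also have "\<dots> = (\<Sum>\<tau>\<in>{\<tau>}. X \<tau> i j + Y \<tau> i j)" by simp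
    also have "\<dots> \<le> (\<Sum>\<tau>\<in>Q. X \<tau> i j + Y \<tau> i j)"
      using Q \<tau>(1) X0[OF _ ij] by (intro sum_mono2) (auto intro: add_nonneg_nonneg)
    finally have "1 \<le> (\<Sum>\<tau>\<in>Q. X \<tau> i j + Y \<tau> i j)" .
    moreover have "separate d R Q \<sigma> i j = 0" using False by (auto simp: separate_def split: if_splits)
    ultimately show ?thesis using 1 by simp
  qed
  have "(\<Sum>i<d. \<Sum>j<d. (separate d R Q \<sigma> i j - R \<sigma> i j)\<^sup>2) \<le> (\<Sum>i<d. \<Sum>j<d. \<Sum>\<tau>\<in>Q. X \<tau> i j + Y \<tau> i j)"
    by (intro sum_mono pt) auto
  also have "\<dots> = (\<Sum>\<tau>\<in>Q. (\<Sum>i<d. \<Sum>j<d. X \<tau> i j) + (\<Sum>i<d. \<Sum>j<d. Y \<tau> i j))"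
    by (simp add: sum.swap[of _ Q] sum.distrib)
  also have "\<dots> \<le> (\<Sum>\<tau>\<in>Q. (\<Sum>i<d. \<Sum>j<d. (mm d (tp (R \<sigma>)) (R \<tau>) i j)\<^sup>2) + (\<Sum>i<d. \<Sum>j<d. (mm d (R \<sigma>) (tp (R \<tau>)) i j)\<^sup>2))"
  proof (rule sum_mono, rule add_mono)
    fix \<tau> assume \<tau>: "\<tau> \<in> Q"
    note n = natmat_ppm[OF R(1)] natmat_ppm[OF R(2)[OF \<tau>]]
    have "(\<Sum>i<d. \<Sum>j<d. X \<tau> i j) = (\<Sum>j<d. \<Sum>k<d. \<Sum>i<d. R \<sigma> i j * R \<tau> i k)"
      unfolding X_def by (subst sum.swap) (intro sum.cong refl sum.swap)
    also have "\<dots> = (\<Sum>j<d. \<Sum>k<d. mm d (tp (R \<sigma>)) (R \<tau>) j k)" by (simp add: mm_def tp_def)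
    also have "\<dots> \<le> (\<Sum>j<d. \<Sum>k<d. (mm d (tp (R \<sigma>)) (R \<tau>) j k)\<^sup>2)"
      using natmat_mm[OF natmat_tp[OF n(1)] n(2)] by (intro sum_mono nat_le_square) (simp add: natmat_def)
    finally show "(\<Sum>i<d. \<Sum>j<d. X \<tau> i j) \<le> (\<Sum>i<d. \<Sum>j<d. (mm d (tp (R \<sigma>)) (R \<tau>) i j)\<^sup>2)" .
    have "(\<Sum>i<d. \<Sum>j<d. Y \<tau> i j) = (\<Sum>i<d. \<Sum>k<d. \<Sum>j<d. R \<sigma> i j * R \<tau> k j)"
      unfolding Y_def by (intro sum.cong refl sum.swap)
    also have "\<dots> = (\<Sum>i<d. \<Sum>k<d. mm d (R \<sigma>) (tp (R \<tau>)) i k)" by (simp add: mm_def tp_def)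
    also have "\<dots> \<le> (\<Sum>i<d. \<Sum>k<d. (mm d (R \<sigma>) (tp (R \<tau>)) i k)\<^sup>2)"
      using natmat_mm[OF n(1) natmat_tp[OF n(2)]] by (intro sum_mono nat_le_square) (simp add: natmat_def)
    finally show "(\<Sum>i<d. \<Sum>j<d. Y \<tau> i j) \<le> (\<Sum>i<d. \<Sum>j<d. (mm d (R \<sigma>) (tp (R \<tau>)) i j)\<^sup>2)" .
  qed
  finally have "(\<Sum>i<d. \<Sum>j<d. (separate d R Q \<sigma> i j - R \<sigma> i j)\<^sup>2) / real d
      \<le> (\<Sum>\<tau>\<in>Q. (\<Sum>i<d. \<Sum>j<d. (mm d (tp (R \<sigma>)) (R \<tau>) i j)\<^sup>2) + (\<Sum>i<d. \<Sum>j<d. (mm d (R \<sigma>) (tp (R \<tau>)) i j)\<^sup>2)) / real d"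
    by (rule divide_right_mono) simp
  then show ?thesis by (simp add: nrm_def sum_nonneg sum_divide_distrib add_divide_distrib)
qed

lemma ppm_sum_separate:
  assumes S: "finite S" and R: "\<And>\<sigma>. \<sigma> \<in> S \<Longrightarrow> ppm d (R \<sigma>)"
    and Q: "\<And>\<sigma> \<tau>. \<sigma> \<in> S \<Longrightarrow> \<tau> \<in> S \<Longrightarrow> \<sigma> \<noteq> \<tau> \<Longrightarrow> \<tau> \<in> Q \<sigma>"
  shows "ppm d (\<lambda>i j. \<Sum>\<sigma>\<in>S. separate d R (Q \<sigma>) \<sigma> i j)"
proof -
  define A where "A = (\<lambda>\<sigma>. separate d R (Q \<sigma>) \<sigma>)"
  have A1: "A \<sigma> i j = 1 \<or> A \<sigma> i j = 0" "A \<sigma> i j = 1 \<Longrightarrow> R \<sigma> i j = 1" for \<sigma> i j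
    by (auto simp: A_def separate_def split: if_splits)
  have row: "\<sigma> = \<tau>" if "A \<sigma> i j = 1" "A \<tau> i k = 1" "\<sigma> \<in> S" "\<tau> \<in> S" "i < d" "j < d" "k < d" for \<sigma> \<tau> i j k
  proof (rule ccontr)
    assume "\<sigma> \<noteq> \<tau>"
    then have "\<tau> \<in> Q \<sigma>" using Q that by blast
    then have "R \<tau> i k = 0" using that(1,7) by (auto simp: A_def separate_def split: if_splits)
    then show False using A1(2)[OF that(2)] by simp
  qed
  have col: "\<sigma> = \<tau>" if "A \<sigma> i j = 1" "A \<tau> k j = 1" "\<sigma> \<in> S" "\<tau> \<in> S" "i < d" "j < d" "k < d" for \<sigma> \<tau> i j k
  proof (rule ccontr)
    assume "\<sigma> \<noteq> \<tau>"
    then have "\<tau> \<in> Q \<sigma>" using Q that by blast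
    then have "R \<tau> k j = 0" using that(1,7) by (auto simp: A_def separate_def split: if_splits)
    then show False using A1(2)[OF that(2)] by simp
  qed
  have one: "(\<exists>\<sigma>\<in>S. A \<sigma> i j = 1) \<and> (\<Sum>\<sigma>\<in>S. A \<sigma> i j) = 1 \<or> (\<Sum>\<sigma>\<in>S. A \<sigma> i j) = 0" if ij: "i < d" "j < d" for i j
  proof (cases "\<exists>\<sigma>\<in>S. A \<sigma> i j = 1")
    case True
    then obtain \<sigma> where \<sigma>: "\<sigma> \<in> S" "A \<sigma> i j = 1" by blast
    have "(\<Sum>\<tau>\<in>S. A \<tau> i j) = (\<Sum>\<tau>\<in>S. if \<tau> = \<sigma> then 1 else 0)"
      using row[OF \<sigma>(2) _ \<sigma>(1) _ ij ij(2)] \<sigma>(2) A1(1) by (intro sum.cong refl) fastforce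
    then show ?thesis using \<sigma> S True by simp
  next
    case False
    then have "\<forall>\<sigma>\<in>S. A \<sigma> i j = 0" using A1(1) by blast
    then show ?thesis by simp
  qed
  have "ppm d (\<lambda>i j. \<Sum>\<sigma>\<in>S. A \<sigma> i j)"
    unfolding ppm_def
  proof (intro conjI allI impI)
    show "(\<Sum>\<sigma>\<in>S. A \<sigma> i j) = 0 \<or> (\<Sum>\<sigma>\<in>S. A \<sigma> i j) = 1" if "i < d" "j < d" for i j using one[OF that] by auto
    fix i j k assume i: "i < d" and j: "j < d" and k: "k < d"
    show "j = k" if H: "(\<Sum>\<sigma>\<in>S. A \<sigma> i j) = 1 \<and> (\<Sum>\<sigma>\<in>S. A \<sigma> i k) = 1"
    proof -
      obtain \<sigma> \<tau> where st: "\<sigma> \<in> S" "A \<sigma> i j = 1" "\<tau> \<in> S" "A \<tau> i k = 1" using one[OF i j] one[OF i k] H by auto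
      then have "\<sigma> = \<tau>" using row i j k by blast
      then show ?thesis using ppmD(2)[OF R[OF st(1)] i j k] A1(2) st by blast
    qed
    show "i = k" if H: "(\<Sum>\<sigma>\<in>S. A \<sigma> i j) = 1 \<and> (\<Sum>\<sigma>\<in>S. A \<sigma> k j) = 1"
    proof -
      obtain \<sigma> \<tau> where st: "\<sigma> \<in> S" "A \<sigma> i j = 1" "\<tau> \<in> S" "A \<tau> k j = 1" using one[OF i j] one[OF k j] H by auto
      then have "\<sigma> = \<tau>" using col i j k by blast
      then show ?thesis using ppmD(3)[OF R[OF st(1)] i j k] A1(2) st by blast
    qed
  qed
  then show ?thesis by (simp add: A_def)
qed

lemma card_small_subsets_le:
  assumes "finite S" shows "card {T. T \<subseteq> S \<and> card T \<le> m} \<le> (card S + 1) ^ m"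
proof -
  let ?F = "{..<m} \<rightarrow>\<^sub>E insert None (Some ` S)"
  have "{T. T \<subseteq> S \<and> card T \<le> m} \<subseteq> (\<lambda>f. {x. Some x \<in> f ` {..<m}}) ` ?F"
  proof
    fix T assume "T \<in> {T. T \<subseteq> S \<and> card T \<le> m}"
    then have T: "T \<subseteq> S" "card T \<le> m" "finite T" using assms finite_subset by auto
    obtain h where h: "bij_betw h {..<card T} T" using ex_bij_betw_nat_finite[OF T(3)] by (auto simp: atLeast0LessThan)
    define f where "f = (\<lambda>i\<in>{..<m}. if i < card T then Some (h i) else None)"
    have "{x. Some x \<in> f ` {..<m}} = h ` {..<card T}"
    proof (intro equalityI subsetI)
      fix x assume "x \<in> {x. Some x \<in> f ` {..<m}}"
      then obtain i where "i < m" "f i = Some x" by auto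
      then show "x \<in> h ` {..<card T}" by (auto simp: f_def split: if_splits)
    next
      fix x assume "x \<in> h ` {..<card T}"
      then obtain i where "i < card T" "x = h i" by auto
      then show "x \<in> {x. Some x \<in> f ` {..<m}}" using T(2) by (auto simp: f_def intro!: image_eqI[of _ _ i])
    qed
    then have 1: "{x. Some x \<in> f ` {..<m}} = T" using h by (simp add: bij_betw_def)
    have "f i \<in> insert None (Some ` S)" if "i < m" for i
      using that T(1) bij_betwE[OF h] by (auto simp: f_def)
    then have "f \<in> ?F" by (auto simp: f_def PiE_def)
    then show "T \<in> (\<lambda>f. {x. Some x \<in> f ` {..<m}}) ` ?F" using 1 by blast
  qed
  then have "card {T. T \<subseteq> S \<and> card T \<le> m} \<le> card ?F"
    by (rule surj_card_le[rotated]) (use assms in \<open>auto intro!: finite_PiE\<close>)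
  also have "\<dots> = (card S + 1) ^ m"
    using assms by (simp add: card_PiE card_image)
  finally show ?thesis .
qed

section \<open>Complex matrices with real entries and the counting of partial permutations\<close>

definition rent :: "complex mat \<Rightarrow> nat \<Rightarrow> nat \<Rightarrow> real" where "rent A i j = Re (A $$ (i, j))"

definition real_mat :: "nat \<Rightarrow> complex mat \<Rightarrow> bool" where
  "real_mat d A \<longleftrightarrow> A \<in> carrier_mat d d \<and> (\<forall>i<d. \<forall>j<d. A $$ (i, j) = complex_of_real (rent A i j))"

lemma real_matD: "real_mat d A \<Longrightarrow> A \<in> carrier_mat d d"
  "real_mat d A \<Longrightarrow> i < d \<Longrightarrow> j < d \<Longrightarrow> A $$ (i, j) = complex_of_real (rent A i j)"
  by (auto simp: real_mat_def)

lemma real_matI: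
  assumes "A \<in> carrier_mat d d" "\<And>i j. i < d \<Longrightarrow> j < d \<Longrightarrow> A $$ (i, j) = complex_of_real (f i j)"
  shows "real_mat d A" "\<And>i j. i < d \<Longrightarrow> j < d \<Longrightarrow> rent A i j = f i j"
  using assms by (auto simp: real_mat_def rent_def)

lemma mat_adjoint_carrier: "A \<in> carrier_mat d d \<Longrightarrow> mat_adjoint A \<in> carrier_mat d d"
  by (auto simp: mat_adjoint_def)

lemma mat_adjoint_entry:
  fixes A :: "complex mat"
  assumes "A \<in> carrier_mat d d" "i < d" "j < d" shows "mat_adjoint A $$ (i, j) = cnj (A $$ (j, i))"
  using assms by (simp add: mat_adjoint_def mat_of_rows_def cols_def)

lemma mult_entry:
  fixes A B :: "complex mat"
  assumes "A \<in> carrier_mat d d" "B \<in> carrier_mat d d" "i < d" "j < d"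
  shows "(A * B) $$ (i, j) = (\<Sum>k<d. A $$ (i, k) * B $$ (k, j))"
  using assms by (simp add: scalar_prod_def atLeast0LessThan)

lemma mat_norm2_eq:
  assumes A: "A \<in> carrier_mat d d"
  shows "mat_norm2 A = sqrt ((\<Sum>i<d. \<Sum>j<d. (cmod (A $$ (i, j)))\<^sup>2) / real d)"
proof -
  note A' = mat_adjoint_carrier[OF A]
  have "(\<Sum>i<d. (mat_adjoint A * A) $$ (i, i)) = (\<Sum>i<d. \<Sum>k<d. complex_of_real ((cmod (A $$ (k, i)))\<^sup>2))"
  proof (intro sum.cong refl)
    fix i assume "i \<in> {..<d}"
    then have i: "i < d" by simp
    show "(mat_adjoint A * A) $$ (i, i) = (\<Sum>k<d. complex_of_real ((cmod (A $$ (k, i)))\<^sup>2))"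
      unfolding mult_entry[OF A' A i i]
    proof (intro sum.cong refl)
      fix k assume "k \<in> {..<d}"
      then have k: "k < d" by simp
      show "mat_adjoint A $$ (i, k) * A $$ (k, i) = complex_of_real ((cmod (A $$ (k, i)))\<^sup>2)"
        unfolding mat_adjoint_entry[OF A i k] complex_norm_square by (rule mult.commute)
    qed
  qed
  also have "\<dots> = complex_of_real (\<Sum>i<d. \<Sum>k<d. (cmod (A $$ (k, i)))\<^sup>2)" by simp
  also have "(\<Sum>i<d. \<Sum>k<d. (cmod (A $$ (k, i)))\<^sup>2) = (\<Sum>i<d. \<Sum>k<d. (cmod (A $$ (i, k)))\<^sup>2)" by (rule sum.swap)
  finally have s: "(\<Sum>i<d. (mat_adjoint A * A) $$ (i, i)) = complex_of_real (\<Sum>i<d. \<Sum>k<d. (cmod (A $$ (i, k)))\<^sup>2)" .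
  have dim: "dim_row (mat_adjoint A * A) = d" using A' by simp
  have "ntr (mat_adjoint A * A) = complex_of_real ((\<Sum>i<d. \<Sum>k<d. (cmod (A $$ (i, k)))\<^sup>2) / real d)"
    unfolding ntr_def dim s by simp
  then show ?thesis by (simp add: mat_norm2_def)
qed

lemma mat_norm2_real: assumes A: "real_mat d A" shows "mat_norm2 A = nrm d (rent A)"
  unfolding mat_norm2_eq[OF real_matD(1)[OF A]] nrm_def
proof (intro arg_cong[where f = sqrt] arg_cong2[where f = "(/)"] sum.cong refl)
  fix i j assume "i \<in> {..<d}" "j \<in> {..<d}"
  then have "A $$ (i, j) = complex_of_real (rent A i j)" using real_matD(2)[OF A] by simp
  then show "(cmod (A $$ (i, j)))\<^sup>2 = (rent A i j)\<^sup>2" by simp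
qed

lemma real_mat_mult:
  assumes A: "real_mat d A" and B: "real_mat d B"
  shows "real_mat d (A * B)" "\<And>i j. i < d \<Longrightarrow> j < d \<Longrightarrow> rent (A * B) i j = mm d (rent A) (rent B) i j"
proof -
  note c = real_matD(1)[OF A] real_matD(1)[OF B]
  have e: "(A * B) $$ (i, j) = complex_of_real (mm d (rent A) (rent B) i j)" if "i < d" "j < d" for i j
    unfolding mult_entry[OF c that] mm_def of_real_sum
    by (intro sum.cong refl) (use that in \<open>simp add: real_matD(2)[OF A] real_matD(2)[OF B]\<close>)
  have AB: "A * B \<in> carrier_mat d d" using c by simp
  show "real_mat d (A * B)" by (rule real_matI(1)[OF AB e])
  show "rent (A * B) i j = mm d (rent A) (rent B) i j" if "i < d" "j < d" for i j by (rule real_matI(2)[OF AB e that])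
qed

lemma real_mat_minus:
  assumes A: "real_mat d A" and B: "real_mat d B"
  shows "real_mat d (A - B)" "\<And>i j. i < d \<Longrightarrow> j < d \<Longrightarrow> rent (A - B) i j = rent A i j - rent B i j"
proof -
  note c = real_matD(1)[OF A] real_matD(1)[OF B]
  have e: "(A - B) $$ (i, j) = complex_of_real (rent A i j - rent B i j)" if "i < d" "j < d" for i j
    using that c by (simp add: real_matD(2)[OF A] real_matD(2)[OF B])
  have AB: "A - B \<in> carrier_mat d d" by (rule minus_carrier_mat[OF c(2)])
  show "real_mat d (A - B)" by (rule real_matI(1)[OF AB e])
  show "rent (A - B) i j = rent A i j - rent B i j" if "i < d" "j < d" for i j by (rule real_matI(2)[OF AB e that])
qed

lemma real_mat_adjoint:
  assumes A: "real_mat d A"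
  shows "real_mat d (mat_adjoint A)" "\<And>i j. i < d \<Longrightarrow> j < d \<Longrightarrow> rent (mat_adjoint A) i j = tp (rent A) i j"
proof -
  note c = real_matD(1)[OF A]
  have e: "mat_adjoint A $$ (i, j) = complex_of_real (tp (rent A) i j)" if "i < d" "j < d" for i j
    using that by (simp add: mat_adjoint_entry[OF c] real_matD(2)[OF A] tp_def)
  show "real_mat d (mat_adjoint A)" by (rule real_matI(1)[OF mat_adjoint_carrier[OF c] e])
  show "rent (mat_adjoint A) i j = tp (rent A) i j" if "i < d" "j < d" for i j
    by (rule real_matI(2)[OF mat_adjoint_carrier[OF c] e that])
qed

lemma ntr_real: assumes A: "real_mat d A" shows "ntr A = complex_of_real (tr d (rent A))"
proof -
  have "dim_row A = d" using real_matD(1)[OF A] by simp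
  moreover have "(\<Sum>i<d. A $$ (i, i)) = (\<Sum>i<d. complex_of_real (rent A i i))"
    by (intro sum.cong refl) (simp add: real_matD(2)[OF A])
  ultimately show ?thesis by (simp add: ntr_def tr_def)
qed

lemma partial_perm_matsD:
  assumes A: "A \<in> partial_perm_mats d" shows "real_mat d A" "ppm d (rent A)"
proof -
  have c: "A \<in> carrier_mat d d" and t: "A * mat_adjoint A * A = A"
    and e: "\<And>i j. i < d \<Longrightarrow> j < d \<Longrightarrow> A $$ (i, j) = 0 \<or> A $$ (i, j) = 1"
    using A by (auto simp: partial_perm_mats_def)
  show r: "real_mat d A"
    by (rule real_matI(1)[OF c, of "rent A"]) (use e in \<open>force simp: rent_def\<close>)
  note m = real_mat_mult[OF r real_mat_adjoint(1)[OF r]]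
  show "ppm d (rent A)"
  proof (rule ppm_iff_triple)
    show "rent A i j = 0 \<or> rent A i j = 1" if "i < d" "j < d" for i j using e[OF that] by (auto simp: rent_def)
    fix i j assume ij: "i < d" "j < d"
    have "rent A i j = rent (A * mat_adjoint A * A) i j" by (simp only: t)
    also have "\<dots> = mm d (rent (A * mat_adjoint A)) (rent A) i j" by (rule real_mat_mult(2)[OF m(1) r ij])
    also have "\<dots> = mm d (mm d (rent A) (tp (rent A))) (rent A) i j"
    proof (rule mm_cong)
      fix k assume k: "k < d"
      show "rent (A * mat_adjoint A) i k = mm d (rent A) (tp (rent A)) i k"
        unfolding m(2)[OF ij(1) k] by (rule mm_cong) (simp_all add: real_mat_adjoint(2)[OF r] k)
    qed simp
    finally show "mm d (mm d (rent A) (tp (rent A))) (rent A) i j = rent A i j" by simp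
  qed
qed

lemma real_mat_eqI:
  assumes A: "real_mat d A" and B: "real_mat d B" and e: "\<And>i j. i < d \<Longrightarrow> j < d \<Longrightarrow> rent A i j = rent B i j"
  shows "A = B"
proof (rule eq_matI)
  show "dim_row A = dim_row B" "dim_col A = dim_col B" using real_matD(1)[OF A] real_matD(1)[OF B] by auto
  fix i j assume "i < dim_row B" "j < dim_col B"
  then have "i < d" "j < d" using real_matD(1)[OF B] by auto
  then show "A $$ (i, j) = B $$ (i, j)" by (simp add: real_matD(2)[OF A] real_matD(2)[OF B] e)
qed

lemma partial_perm_matsI:
  assumes r: "real_mat d A" and p: "ppm d (rent A)" shows "A \<in> partial_perm_mats d"
proof -
  note m = real_mat_mult[OF r real_mat_adjoint(1)[OF r]]
  have "A * mat_adjoint A * A = A"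
  proof (rule real_mat_eqI[OF real_mat_mult(1)[OF m(1) r] r])
    fix i j assume ij: "i < d" "j < d"
    have "rent (A * mat_adjoint A * A) i j = mm d (rent (A * mat_adjoint A)) (rent A) i j" by (rule real_mat_mult(2)[OF m(1) r ij])
    also have "\<dots> = mm d (mm d (rent A) (tp (rent A))) (rent A) i j"
    proof (rule mm_cong)
      fix k assume k: "k < d"
      show "rent (A * mat_adjoint A) i k = mm d (rent A) (tp (rent A)) i k"
        unfolding m(2)[OF ij(1) k] by (rule mm_cong) (simp_all add: real_mat_adjoint(2)[OF r] k)
    qed simp
    also have "\<dots> = rent A i j" by (rule ppm_triple[OF p ij])
    finally show "rent (A * mat_adjoint A * A) i j = rent A i j" .
  qed
  moreover have "A $$ (i, j) \<in> {0, 1}" if "i < d" "j < d" for i j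
    using ppmD(1)[OF p that] real_matD(2)[OF r that] by auto
  ultimately show ?thesis using real_matD(1)[OF r] by (simp add: partial_perm_mats_def)
qed

definition idm :: "nat \<Rightarrow> nat \<Rightarrow> real" where "idm i j = (if i = j then 1 else 0)"

definition mlist :: "nat \<Rightarrow> (nat \<Rightarrow> nat \<Rightarrow> real) list \<Rightarrow> nat \<Rightarrow> nat \<Rightarrow> real" where
  "mlist d fs = foldr (mm d) fs idm"

lemma mlist_simps [simp]: "mlist d [] = idm" "mlist d (f # fs) = mm d f (mlist d fs)"
  by (simp_all add: mlist_def)

lemma ppm_idm: "ppm d idm"
  by (auto simp: ppm_def idm_def)

lemma mm_idm_left: "i < d \<Longrightarrow> mm d idm f i j = f i j"
  by (simp add: mm_def idm_def if_distrib[of "\<lambda>x. x * _"] cong: if_cong)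

lemma mm_idm_right: "j < d \<Longrightarrow> mm d f idm i j = f i j"
  by (simp add: mm_def idm_def if_distrib[of "\<lambda>x. _ * x"] cong: if_cong)

lemma ppm_mlist: "(\<And>f. f \<in> set fs \<Longrightarrow> ppm d f) \<Longrightarrow> ppm d (mlist d fs)"
  by (induction fs) (auto intro: ppm_mm ppm_idm)

lemma mlist_append: "i < d \<Longrightarrow> mlist d (fs @ gs) i j = mm d (mlist d fs) (mlist d gs) i j"
proof (induction fs arbitrary: i)
  case Nil then show ?case by (simp add: mm_idm_left)
next
  case (Cons f fs)
  have "mm d f (mlist d (fs @ gs)) i j = mm d f (mm d (mlist d fs) (mlist d gs)) i j"
    by (rule mm_cong) (simp_all add: Cons.IH)
  then show ?case by (simp add: mm_assoc)
qed

lemma real_mat_prod: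
  assumes "\<And>A. A \<in> set As \<Longrightarrow> real_mat d A"
  shows "real_mat d (mat_prod d As) \<and> (\<forall>i<d. \<forall>j<d. rent (mat_prod d As) i j = mlist d (map rent As) i j)"
  using assms
proof (induction As)
  case Nil
  then show ?case by (auto simp: mat_prod_def real_mat_def rent_def idm_def)
next
  case (Cons A As)
  then have r: "real_mat d A" and IH: "real_mat d (mat_prod d As)"
    "\<And>i j. i < d \<Longrightarrow> j < d \<Longrightarrow> rent (mat_prod d As) i j = mlist d (map rent As) i j" by auto
  have e: "mat_prod d (A # As) = A * mat_prod d As" by (simp add: mat_prod_def)
  have "rent (A * mat_prod d As) i j = mm d (rent A) (mlist d (map rent As)) i j" if "i < d" "j < d" for i j
    unfolding real_mat_mult(2)[OF r IH(1) that] by (rule mm_cong) (simp_all add: IH(2) that)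
  then show ?case using real_mat_mult(1)[OF r IH(1)] by (simp add: e)
qed

text \<open>
  Two partial permutation matrices in the ball differ in at most \<open>4 \<kappa>\<^sup>2 d\<close> of the \<open>d\<^sup>2\<close> entries, so the
  sets of these differences from one fixed matrix number at most \<open>(d\<^sup>2 + 1)\<close> to this power. The constant 12 comes from
  \<open>d\<^sup>2 + 1 \<le> d\<^sup>3\<close>.
\<close>
lemma partial_perm_ball:
  assumes d: "2 \<le> d" and \<kappa>: "0 < \<kappa>"
  shows "finite {A \<in> partial_perm_mats d. nrm d (\<lambda>i j. rent A i j - f i j) < \<kappa>}" (is "finite ?X")
    and "real (card {A \<in> partial_perm_mats d. nrm d (\<lambda>i j. rent A i j - f i j) < \<kappa>}) \<le> exp (12 * \<kappa>\<^sup>2 * (real d * ln (real d)))"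
proof -
  have "finite ?X \<and> real (card ?X) \<le> exp (12 * \<kappa>\<^sup>2 * (real d * ln (real d)))"
  proof (cases "?X = {}")
    case True
    show ?thesis unfolding True by simp
  next
    case False
    then obtain A0 where A0: "A0 \<in> partial_perm_mats d" "nrm d (\<lambda>i j. rent A0 i j - f i j) < \<kappa>" by blast
    let ?P = "{..<d} \<times> {..<d}"
    define h where "h = (\<lambda>A. {p \<in> ?P. rent A (fst p) (snd p) \<noteq> rent A0 (fst p) (snd p)})"
    define m where "m = nat \<lfloor>4 * \<kappa>\<^sup>2 * real d\<rfloor>"
    define T where "T = {T. T \<subseteq> ?P \<and> card T \<le> m}"
    have rm: "rent A i j = 0 \<or> rent A i j = 1" if "A \<in> partial_perm_mats d" "i < d" "j < d" for A i j
      using ppmD(1)[OF partial_perm_matsD(2)[OF that(1)] that(2,3)] .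
    have hT: "h A \<in> T" if A: "A \<in> ?X" for A
    proof -
      have "nrm d (\<lambda>i j. rent A i j - rent A0 i j) \<le> nrm d (\<lambda>i j. rent A i j - f i j) + nrm d (\<lambda>i j. f i j - rent A0 i j)"
        by (rule nrm_dist_triangle)
      also have "\<dots> < \<kappa> + \<kappa>" using A A0(2) by (intro add_strict_mono) (simp_all add: nrm_minus[of d f])
      finally have l: "nrm d (\<lambda>i j. rent A i j - rent A0 i j) < 2 * \<kappa>" by simp
      then have "(nrm d (\<lambda>i j. rent A i j - rent A0 i j))\<^sup>2 \<le> (2 * \<kappa>)\<^sup>2" by (intro power_mono) simp_all
      moreover have "(nrm d (\<lambda>i j. rent A i j - rent A0 i j))\<^sup>2 = real (card (h A)) / real d"
      proof -
        have "(\<Sum>i<d. \<Sum>j<d. (rent A i j - rent A0 i j)\<^sup>2) = (\<Sum>p\<in>?P. (rent A (fst p) (snd p) - rent A0 (fst p) (snd p))\<^sup>2)"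
          by (simp add: sum.cartesian_product case_prod_beta)
        also have "\<dots> = (\<Sum>p\<in>?P. if p \<in> h A then 1 else 0)"
        proof (intro sum.cong refl)
          fix p assume p: "p \<in> ?P"
          then have "fst p < d" "snd p < d" by auto
          with A A0 p show "(rent A (fst p) (snd p) - rent A0 (fst p) (snd p))\<^sup>2 = (if p \<in> h A then 1 else 0)"
            using rm[of A "fst p" "snd p"] rm[of A0 "fst p" "snd p"] by (auto simp: h_def)
        qed
        also have "\<dots> = real (card (h A))" by (subst sum.inter_restrict[symmetric]) (simp_all add: h_def Int_absorb1 Collect_conj_eq Int_ac)
        finally show ?thesis by (simp add: nrm_def)
      qed
      ultimately have "real (card (h A)) / real d \<le> (2 * \<kappa>)\<^sup>2" by simp
      then have "real (card (h A)) \<le> 4 * \<kappa>\<^sup>2 * real d" using d by (simp add: divide_le_eq power2_eq_square)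
      then have "card (h A) \<le> m" by (simp add: m_def le_nat_floor)
      then show ?thesis by (auto simp: T_def h_def)
    qed
    have inj: "inj_on h ?X"
    proof (rule inj_onI)
      fix A B assume A: "A \<in> ?X" and B: "B \<in> ?X" and e: "h A = h B"
      have pA: "A \<in> partial_perm_mats d" and pB: "B \<in> partial_perm_mats d" using A B by auto
      show "A = B"
      proof (rule real_mat_eqI[OF partial_perm_matsD(1)[OF pA] partial_perm_matsD(1)[OF pB]])
        fix i j assume ij: "i < d" "j < d"
        have "(i, j) \<in> h A \<longleftrightarrow> (i, j) \<in> h B" using e by simp
        then have "rent A i j = rent A0 i j \<longleftrightarrow> rent B i j = rent A0 i j" using ij by (simp add: h_def)
        then show "rent A i j = rent B i j" using rm[OF pA ij] rm[OF pB ij] rm[OF A0(1) ij] by auto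
      qed
    qed
    have fT: "finite T" unfolding T_def by (rule finite_subset[of _ "Pow ?P"]) auto
    have fX: "finite ?X" by (rule inj_on_finite[OF inj _ fT]) (use hT in blast)
    have "card ?X \<le> card T" by (rule card_inj_on_le[OF inj _ fT]) (use hT in blast)
    also have "\<dots> \<le> (card ?P + 1) ^ m" unfolding T_def by (rule card_small_subsets_le) simp
    finally have "real (card ?X) \<le> real ((card ?P + 1) ^ m)" by linarith
    also have "\<dots> = (real (d * d) + 1) ^ m" by (simp add: add.commute)
    also have "\<dots> \<le> (real d ^ 3) ^ m"
    proof (rule power_mono)
      have "real (d * d) + 1 \<le> real (d * d) + real (d * d)" using d by (simp flip: of_nat_mult)
      also have "\<dots> = 2 * real (d * d)" by simp
      also have "\<dots> \<le> real d * real (d * d)" using d by (intro mult_right_mono) auto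
      finally show "real (d * d) + 1 \<le> real d ^ 3" by (simp add: power3_eq_cube mult.assoc)
    qed simp
    also have "\<dots> = exp (ln (real d) * real (3 * m))"
    proof -
      have "exp (ln (real d) * real (3 * m)) = exp (ln (real d)) ^ (3 * m)" by (subst exp_of_nat2_mult) simp
      also have "\<dots> = (real d ^ 3) ^ m" using d by (simp add: power_mult)
      finally show ?thesis by simp
    qed
    also have "\<dots> \<le> exp (12 * \<kappa>\<^sup>2 * (real d * ln (real d)))"
    proof -
      have "real m \<le> 4 * \<kappa>\<^sup>2 * real d" unfolding m_def by (rule of_nat_floor) simp
      then have "ln (real d) * (3 * real m) \<le> ln (real d) * (3 * (4 * \<kappa>\<^sup>2 * real d))" using d by (intro mult_left_mono) auto
      then show ?thesis by (simp add: mult_ac)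
    qed
    finally show ?thesis using fX by blast
  qed
  then show "finite ?X" "real (card ?X) \<le> exp (12 * \<kappa>\<^sup>2 * (real d * ln (real d)))" by auto
qed

section \<open>Sofic approximations as a filter\<close>

definition aeq :: "(nat \<times> 'x) filter \<Rightarrow> (nat \<times> 'x \<Rightarrow> nat \<Rightarrow> nat \<Rightarrow> real) \<Rightarrow> (nat \<times> 'x \<Rightarrow> nat \<Rightarrow> nat \<Rightarrow> real) \<Rightarrow> bool" where
  "aeq F X Y \<longleftrightarrow> ((\<lambda>p. nrm (fst p) (\<lambda>i j. X p i j - Y p i j)) \<longlongrightarrow> 0) F"

text \<open>
  Uniform boundedness of the multiplication operators. It replaces submultiplicativity, which \<open>nrm\<close> does not
  have, and holds for sums of boundedly many partial permutation matrices.
\<close>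
definition mbd :: "(nat \<times> 'x) filter \<Rightarrow> (nat \<times> 'x \<Rightarrow> nat \<Rightarrow> nat \<Rightarrow> real) \<Rightarrow> bool" where
  "mbd F X \<longleftrightarrow> (\<exists>C\<ge>0. \<forall>\<^sub>F p in F. \<forall>Z. nrm (fst p) (mm (fst p) (X p) Z) \<le> C * nrm (fst p) Z \<and>
     nrm (fst p) (mm (fst p) Z (X p)) \<le> C * nrm (fst p) Z)"

lemma null_le:
  fixes f g :: "'b \<Rightarrow> real"
  assumes "(g \<longlongrightarrow> 0) F" "\<forall>\<^sub>F p in F. 0 \<le> f p \<and> f p \<le> g p" shows "(f \<longlongrightarrow> 0) F"
proof (rule tendsto_sandwich[OF _ _ tendsto_const assms(1)])
  show "\<forall>\<^sub>F p in F. 0 \<le> f p" "\<forall>\<^sub>F p in F. f p \<le> g p" using assms(2) by (auto elim: eventually_mono)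
qed

lemma aeqD: "aeq F X Y \<Longrightarrow> ((\<lambda>p. nrm (fst p) (\<lambda>i j. X p i j - Y p i j)) \<longlongrightarrow> 0) F"
  by (simp add: aeq_def)

lemma aeq_eventually:
  assumes "\<forall>\<^sub>F p in F. \<forall>i<fst p. \<forall>j<fst p. X p i j = Y p i j" shows "aeq F X Y"
  unfolding aeq_def
proof (rule null_le[OF tendsto_const])
  show "\<forall>\<^sub>F p in F. 0 \<le> nrm (fst p) (\<lambda>i j. X p i j - Y p i j) \<and> nrm (fst p) (\<lambda>i j. X p i j - Y p i j) \<le> 0"
    using assms
  proof eventually_elim
    case (elim p)
    have "nrm (fst p) (\<lambda>i j. X p i j - Y p i j) = nrm (fst p) (\<lambda>i j. 0)" by (rule nrm_cong) (use elim in simp)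
    then show ?case by simp
  qed
qed

lemma aeq_refl: "aeq F X X"
  by (rule aeq_eventually) simp

lemma aeq_sym: "aeq F X Y \<Longrightarrow> aeq F Y X"
  unfolding aeq_def by (subst nrm_minus)

lemma aeq_trans [trans]: assumes "aeq F X Y" "aeq F Y Z" shows "aeq F X Z"
  unfolding aeq_def
proof (rule null_le)
  show "((\<lambda>p. nrm (fst p) (\<lambda>i j. X p i j - Y p i j) + nrm (fst p) (\<lambda>i j. Y p i j - Z p i j)) \<longlongrightarrow> 0) F"
    using tendsto_add[OF aeqD[OF assms(1)] aeqD[OF assms(2)]] by simp
qed (intro always_eventually allI conjI nrm_nonneg nrm_dist_triangle)

lemma aeq_sum:
  assumes A: "finite A" and e: "\<And>a. a \<in> A \<Longrightarrow> aeq F (X a) (Y a)"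
  shows "aeq F (\<lambda>p i j. \<Sum>a\<in>A. X a p i j) (\<lambda>p i j. \<Sum>a\<in>A. Y a p i j)"
  unfolding aeq_def
proof (rule null_le)
  show "((\<lambda>p. \<Sum>a\<in>A. nrm (fst p) (\<lambda>i j. X a p i j - Y a p i j)) \<longlongrightarrow> 0) F"
    using tendsto_sum[of A "\<lambda>a p. nrm (fst p) (\<lambda>i j. X a p i j - Y a p i j)" "\<lambda>_. 0" F] e by (simp add: aeq_def)
  show "\<forall>\<^sub>F p in F. 0 \<le> nrm (fst p) (\<lambda>i j. (\<Sum>a\<in>A. X a p i j) - (\<Sum>a\<in>A. Y a p i j)) \<and>
    nrm (fst p) (\<lambda>i j. (\<Sum>a\<in>A. X a p i j) - (\<Sum>a\<in>A. Y a p i j)) \<le> (\<Sum>a\<in>A. nrm (fst p) (\<lambda>i j. X a p i j - Y a p i j))"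
    unfolding sum_subtractf[symmetric] by (intro always_eventually allI conjI nrm_nonneg nrm_sum A)
qed

lemma aeq_scale: assumes "aeq F X Y" shows "aeq F (\<lambda>p i j. c * X p i j) (\<lambda>p i j. c * Y p i j)"
  using tendsto_mult_right_zero[OF aeqD[OF assms], of "\<bar>c\<bar>"]
  unfolding aeq_def right_diff_distrib[symmetric] nrm_scale .

lemma aeq_tp: "aeq F X Y \<Longrightarrow> aeq F (\<lambda>p. tp (X p)) (\<lambda>p. tp (Y p))"
proof -
  have "nrm d (\<lambda>i j. tp f i j - tp g i j) = nrm d (\<lambda>i j. f i j - g i j)" for d f g
    using nrm_tp[of d "\<lambda>i j. f i j - g i j"] unfolding tp_def[abs_def] by simp
  then show "aeq F X Y \<Longrightarrow> aeq F (\<lambda>p. tp (X p)) (\<lambda>p. tp (Y p))" by (simp add: aeq_def)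
qed

lemma mbd_ppm: assumes "\<forall>\<^sub>F p in F. ppm (fst p) (X p)" shows "mbd F X"
  unfolding mbd_def
proof (intro exI[of _ 1] conjI)
  show "\<forall>\<^sub>F p in F. \<forall>Z. nrm (fst p) (mm (fst p) (X p) Z) \<le> 1 * nrm (fst p) Z \<and> nrm (fst p) (mm (fst p) Z (X p)) \<le> 1 * nrm (fst p) Z"
    using assms by eventually_elim (simp add: nrm_mm_ppm nrm_mm_ppm_right)
qed simp

lemma mbd_cong: assumes e: "\<forall>\<^sub>F p in F. \<forall>i<fst p. \<forall>j<fst p. X p i j = Y p i j" and X: "mbd F X" shows "mbd F Y"
proof -
  obtain C where C: "C \<ge> 0" "\<forall>\<^sub>F p in F. \<forall>Z. nrm (fst p) (mm (fst p) (X p) Z) \<le> C * nrm (fst p) Z \<and>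
     nrm (fst p) (mm (fst p) Z (X p)) \<le> C * nrm (fst p) Z" using X unfolding mbd_def by blast
  have "\<forall>\<^sub>F p in F. \<forall>Z. nrm (fst p) (mm (fst p) (Y p) Z) \<le> C * nrm (fst p) Z \<and>
     nrm (fst p) (mm (fst p) Z (Y p)) \<le> C * nrm (fst p) Z"
    using C(2) e
  proof eventually_elim
    case (elim p)
    have "nrm (fst p) (mm (fst p) (Y p) Z) = nrm (fst p) (mm (fst p) (X p) Z)"
      "nrm (fst p) (mm (fst p) Z (Y p)) = nrm (fst p) (mm (fst p) Z (X p))" for Z
      by (intro nrm_cong mm_cong; use elim(2) in simp)+
    then show ?case using elim(1) by simp
  qed
  then show ?thesis unfolding mbd_def using C(1) by blast
qed

lemma mbd_sum:
  assumes A: "finite A" and e: "\<And>a. a \<in> A \<Longrightarrow> mbd F (X a)"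
  shows "mbd F (\<lambda>p i j. \<Sum>a\<in>A. X a p i j)"
proof -
  have "\<forall>a\<in>A. \<exists>C\<ge>0. \<forall>\<^sub>F p in F. \<forall>Z. nrm (fst p) (mm (fst p) (X a p) Z) \<le> C * nrm (fst p) Z \<and>
     nrm (fst p) (mm (fst p) Z (X a p)) \<le> C * nrm (fst p) Z" using e unfolding mbd_def by blast
  from bchoice[OF this] obtain C where C: "\<And>a. a \<in> A \<Longrightarrow> C a \<ge> 0"
    "\<And>a. a \<in> A \<Longrightarrow> \<forall>\<^sub>F p in F. \<forall>Z. nrm (fst p) (mm (fst p) (X a p) Z) \<le> C a * nrm (fst p) Z \<and>
     nrm (fst p) (mm (fst p) Z (X a p)) \<le> C a * nrm (fst p) Z" by blast
  have "\<forall>\<^sub>F p in F. \<forall>a\<in>A. \<forall>Z. nrm (fst p) (mm (fst p) (X a p) Z) \<le> C a * nrm (fst p) Z \<and>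
     nrm (fst p) (mm (fst p) Z (X a p)) \<le> C a * nrm (fst p) Z"
    using A C(2) by (intro eventually_ball_finite) auto
  then have "\<forall>\<^sub>F p in F. \<forall>Z. nrm (fst p) (mm (fst p) (\<lambda>i j. \<Sum>a\<in>A. X a p i j) Z) \<le> (\<Sum>a\<in>A. C a) * nrm (fst p) Z \<and>
     nrm (fst p) (mm (fst p) Z (\<lambda>i j. \<Sum>a\<in>A. X a p i j)) \<le> (\<Sum>a\<in>A. C a) * nrm (fst p) Z"
  proof eventually_elim
    case (elim p)
    have "nrm (fst p) (mm (fst p) (\<lambda>i j. \<Sum>a\<in>A. X a p i j) Z) \<le> (\<Sum>a\<in>A. C a * nrm (fst p) Z)" for Z
      unfolding mm_sum_left using elim by (intro order_trans[OF nrm_sum[OF A]] sum_mono) blast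
    moreover have "nrm (fst p) (mm (fst p) Z (\<lambda>i j. \<Sum>a\<in>A. X a p i j)) \<le> (\<Sum>a\<in>A. C a * nrm (fst p) Z)" for Z
      unfolding mm_sum_right using elim by (intro order_trans[OF nrm_sum[OF A]] sum_mono) blast
    ultimately show ?case by (simp add: sum_distrib_right)
  qed
  moreover have "(\<Sum>a\<in>A. C a) \<ge> 0" using C(1) by (rule sum_nonneg)
  ultimately show ?thesis unfolding mbd_def by blast
qed

lemma mbd_tp: assumes "mbd F X" shows "mbd F (\<lambda>p. tp (X p))"
proof -
  obtain C where C: "C \<ge> 0" "\<forall>\<^sub>F p in F. \<forall>Z. nrm (fst p) (mm (fst p) (X p) Z) \<le> C * nrm (fst p) Z \<and>
     nrm (fst p) (mm (fst p) Z (X p)) \<le> C * nrm (fst p) Z" using assms unfolding mbd_def by blast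
  have "\<forall>\<^sub>F p in F. \<forall>Z. nrm (fst p) (mm (fst p) (tp (X p)) Z) \<le> C * nrm (fst p) Z \<and>
     nrm (fst p) (mm (fst p) Z (tp (X p))) \<le> C * nrm (fst p) Z"
    using C(2)
  proof eventually_elim
    case (elim p)
    have "nrm (fst p) (mm (fst p) (tp (X p)) Z) = nrm (fst p) (mm (fst p) (tp Z) (X p))"
      "nrm (fst p) (mm (fst p) Z (tp (X p))) = nrm (fst p) (mm (fst p) (X p) (tp Z))" "nrm (fst p) (tp Z) = nrm (fst p) Z" for Z
      using nrm_tp[of "fst p" "mm (fst p) (tp Z) (X p)"] nrm_tp[of "fst p" "mm (fst p) (X p) (tp Z)"] by (simp_all add: tp_mm nrm_tp)
    then show ?case using elim by metis
  qed
  then show ?thesis unfolding mbd_def using C(1) by blast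
qed

lemma mbd_mm: assumes "mbd F X" "mbd F Y" shows "mbd F (\<lambda>p. mm (fst p) (X p) (Y p))"
proof -
  obtain C where C: "C \<ge> 0" "\<forall>\<^sub>F p in F. \<forall>Z. nrm (fst p) (mm (fst p) (X p) Z) \<le> C * nrm (fst p) Z \<and>
     nrm (fst p) (mm (fst p) Z (X p)) \<le> C * nrm (fst p) Z" using assms unfolding mbd_def by blast
  obtain D where D: "D \<ge> 0" "\<forall>\<^sub>F p in F. \<forall>Z. nrm (fst p) (mm (fst p) (Y p) Z) \<le> D * nrm (fst p) Z \<and>
     nrm (fst p) (mm (fst p) Z (Y p)) \<le> D * nrm (fst p) Z" using assms unfolding mbd_def by blast
  have "\<forall>\<^sub>F p in F. \<forall>Z. nrm (fst p) (mm (fst p) (mm (fst p) (X p) (Y p)) Z) \<le> C * D * nrm (fst p) Z \<and>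
     nrm (fst p) (mm (fst p) Z (mm (fst p) (X p) (Y p))) \<le> C * D * nrm (fst p) Z"
    using C(2) D(2)
  proof eventually_elim
    case (elim p)
    show ?case
    proof (intro allI conjI)
      fix Z
      have "nrm (fst p) (mm (fst p) (X p) (mm (fst p) (Y p) Z)) \<le> C * nrm (fst p) (mm (fst p) (Y p) Z)" using elim(1) by blast
      also have "\<dots> \<le> C * (D * nrm (fst p) Z)" using elim(2) C(1) by (intro mult_left_mono) auto
      finally show "nrm (fst p) (mm (fst p) (mm (fst p) (X p) (Y p)) Z) \<le> C * D * nrm (fst p) Z" by (simp add: mm_assoc mult.assoc)
      have "nrm (fst p) (mm (fst p) (mm (fst p) Z (X p)) (Y p)) \<le> D * nrm (fst p) (mm (fst p) Z (X p))" using elim(2) by blast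
      also have "\<dots> \<le> D * (C * nrm (fst p) Z)" using elim(1) D(1) by (intro mult_left_mono) auto
      finally show "nrm (fst p) (mm (fst p) Z (mm (fst p) (X p) (Y p))) \<le> C * D * nrm (fst p) Z" by (simp add: mm_assoc mult_ac)
    qed
  qed
  then show ?thesis unfolding mbd_def using mult_nonneg_nonneg[OF C(1) D(1)] by blast
qed

lemma aeq_mm:
  assumes X: "aeq F X X'" and Y: "aeq F Y Y'" and bX: "mbd F X'" and bY: "mbd F Y"
  shows "aeq F (\<lambda>p. mm (fst p) (X p) (Y p)) (\<lambda>p. mm (fst p) (X' p) (Y' p))"
proof -
  obtain C where C: "C \<ge> 0" "\<forall>\<^sub>F p in F. \<forall>Z. nrm (fst p) (mm (fst p) (X' p) Z) \<le> C * nrm (fst p) Z \<and>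
     nrm (fst p) (mm (fst p) Z (X' p)) \<le> C * nrm (fst p) Z" using bX unfolding mbd_def by blast
  obtain D where D: "D \<ge> 0" "\<forall>\<^sub>F p in F. \<forall>Z. nrm (fst p) (mm (fst p) (Y p) Z) \<le> D * nrm (fst p) Z \<and>
     nrm (fst p) (mm (fst p) Z (Y p)) \<le> D * nrm (fst p) Z" using bY unfolding mbd_def by blast
  show ?thesis
    unfolding aeq_def
  proof (rule null_le)
    show "((\<lambda>p. D * nrm (fst p) (\<lambda>i j. X p i j - X' p i j) + C * nrm (fst p) (\<lambda>i j. Y p i j - Y' p i j)) \<longlongrightarrow> 0) F"
      using tendsto_add[OF tendsto_mult_right_zero[OF aeqD[OF X], of D] tendsto_mult_right_zero[OF aeqD[OF Y], of C]] by simp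
    show "\<forall>\<^sub>F p in F. 0 \<le> nrm (fst p) (\<lambda>i j. mm (fst p) (X p) (Y p) i j - mm (fst p) (X' p) (Y' p) i j) \<and>
      nrm (fst p) (\<lambda>i j. mm (fst p) (X p) (Y p) i j - mm (fst p) (X' p) (Y' p) i j) \<le>
        D * nrm (fst p) (\<lambda>i j. X p i j - X' p i j) + C * nrm (fst p) (\<lambda>i j. Y p i j - Y' p i j)"
      using C(2) D(2)
    proof eventually_elim
      case (elim p)
      have "nrm (fst p) (\<lambda>i j. mm (fst p) (X p) (Y p) i j - mm (fst p) (X' p) (Y' p) i j)
        \<le> nrm (fst p) (\<lambda>i j. mm (fst p) (X p) (Y p) i j - mm (fst p) (X' p) (Y p) i j)
          + nrm (fst p) (\<lambda>i j. mm (fst p) (X' p) (Y p) i j - mm (fst p) (X' p) (Y' p) i j)"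
        by (rule nrm_dist_triangle)
      also have "\<dots> \<le> D * nrm (fst p) (\<lambda>i j. X p i j - X' p i j) + C * nrm (fst p) (\<lambda>i j. Y p i j - Y' p i j)"
        unfolding mm_diff_left[symmetric] mm_diff_right[symmetric] using elim by (intro add_mono) blast+
      finally show ?case by simp
    qed
  qed
qed

lemma tr_diff: "tr d f - tr d g = tr d (\<lambda>i j. f i j - g i j)"
  by (simp add: tr_def sum_subtractf diff_divide_distrib)

lemma aeq_tr:
  assumes e: "aeq F X Y" and l: "((\<lambda>p. tr (fst p) (Y p)) \<longlongrightarrow> l) F"
  shows "((\<lambda>p. tr (fst p) (X p)) \<longlongrightarrow> l) F"
proof -
  have "((\<lambda>p. tr (fst p) (X p) - tr (fst p) (Y p)) \<longlongrightarrow> 0) F"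
  proof (rule tendsto_rabs_zero_cancel, rule null_le[OF aeqD[OF e]])
    show "\<forall>\<^sub>F p in F. 0 \<le> \<bar>tr (fst p) (X p) - tr (fst p) (Y p)\<bar> \<and>
      \<bar>tr (fst p) (X p) - tr (fst p) (Y p)\<bar> \<le> nrm (fst p) (\<lambda>i j. X p i j - Y p i j)"
      unfolding tr_diff by (intro always_eventually allI conjI tr_le_nrm abs_ge_zero)
  qed
  from tendsto_add[OF this l] show ?thesis by simp
qed

lemma nrm_abs_diff: "\<bar>nrm d f - nrm d g\<bar> \<le> nrm d (\<lambda>i j. f i j - g i j)"
  using nrm_triangle[of d "\<lambda>i j. f i j - g i j" g] nrm_triangle[of d "\<lambda>i j. g i j - f i j" f] nrm_minus[of d f g] by simp

lemma aeq_nrm_sq: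
  assumes e: "aeq F X Y" and l: "((\<lambda>p. (nrm (fst p) (Y p))\<^sup>2) \<longlongrightarrow> l) F"
  shows "((\<lambda>p. (nrm (fst p) (X p))\<^sup>2) \<longlongrightarrow> l) F"
proof -
  have "((\<lambda>p. nrm (fst p) (Y p)) \<longlongrightarrow> sqrt l) F" using tendsto_real_sqrt[OF l] by simp
  moreover have "((\<lambda>p. nrm (fst p) (X p) - nrm (fst p) (Y p)) \<longlongrightarrow> 0) F"
  proof (rule tendsto_rabs_zero_cancel, rule null_le[OF aeqD[OF e]])
    show "\<forall>\<^sub>F p in F. 0 \<le> \<bar>nrm (fst p) (X p) - nrm (fst p) (Y p)\<bar> \<and>
      \<bar>nrm (fst p) (X p) - nrm (fst p) (Y p)\<bar> \<le> nrm (fst p) (\<lambda>i j. X p i j - Y p i j)"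
      by (intro always_eventually allI conjI nrm_abs_diff abs_ge_zero)
  qed
  ultimately have X: "((\<lambda>p. nrm (fst p) (X p)) \<longlongrightarrow> sqrt l) F"
    using tendsto_add[of "\<lambda>p. nrm (fst p) (X p) - nrm (fst p) (Y p)" 0 F "\<lambda>p. nrm (fst p) (Y p)"] by simp
  show ?thesis
  proof (cases "F = bot")
    case False
    have "0 \<le> l" by (rule tendsto_lowerbound[OF l _ False]) simp
    then show ?thesis using tendsto_power[OF X, of 2] by simp
  qed simp
qed

lemma sum_swap3: "(\<Sum>a\<in>A. \<Sum>i\<in>I. \<Sum>k\<in>K. f a i k) = (\<Sum>i\<in>I. \<Sum>k\<in>K. \<Sum>a\<in>A. f a i k)"
  by (subst sum.swap) (intro sum.cong refl sum.swap)

lemma sum_swap4: "(\<Sum>a\<in>A. \<Sum>b\<in>B. \<Sum>i\<in>I. \<Sum>k\<in>K. f a b i k) = (\<Sum>i\<in>I. \<Sum>k\<in>K. \<Sum>a\<in>A. \<Sum>b\<in>B. f a b i k)"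
proof -
  have "(\<Sum>a\<in>A. \<Sum>b\<in>B. \<Sum>i\<in>I. \<Sum>k\<in>K. f a b i k) = (\<Sum>a\<in>A. \<Sum>i\<in>I. \<Sum>k\<in>K. \<Sum>b\<in>B. f a b i k)"
    by (intro sum.cong refl sum_swap3)
  also have "\<dots> = (\<Sum>i\<in>I. \<Sum>k\<in>K. \<Sum>a\<in>A. \<Sum>b\<in>B. f a b i k)" by (rule sum_swap3)
  finally show ?thesis .
qed

definition val :: "'a \<Rightarrow> nat \<times> ('a \<Rightarrow> complex mat) \<Rightarrow> nat \<Rightarrow> nat \<Rightarrow> real" where
  "val a p = rent (snd p a)"

context pmp_groupoid
begin

text \<open>
  A property holds eventually if it holds for all maps in \<open>SA G \<mu> F n \<delta> d\<close> and all \<open>d\<close>, for some fixed \<open>F\<close>,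
  \<open>n\<close> and \<open>\<delta>\<close>; see \<open>eventually_SAf\<close>. In this way the infima over these parameters are dealt with by the limit calculus.
\<close>
definition SAf :: "'g l2_op set \<Rightarrow> (nat \<times> ('g l2_op \<Rightarrow> complex mat)) filter" where
  "SAf \<Omega> = (INF (F, n, \<delta>)\<in>{(F, n, \<delta>). finite F \<and> F \<subseteq> \<Omega> \<and> 1 \<le> n \<and> (0::real) < \<delta>}. principal {p. snd p \<in> SA G \<mu> F n \<delta> (fst p)})"

lemma set_pow_upto_mono: "F \<subseteq> F' \<Longrightarrow> n \<le> n' \<Longrightarrow> set_pow_upto G \<mu> F n \<subseteq> set_pow_upto G \<mu> F' n'"
  unfolding set_pow_upto_def set_pow_def by fastforce

lemma SA_mono:
  assumes "F \<subseteq> F'" "n \<le> n'" "\<delta>' \<le> \<delta>" shows "SA G \<mu> F' n' \<delta>' d \<subseteq> SA G \<mu> F n \<delta> d"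
proof
  fix \<phi> assume \<phi>: "\<phi> \<in> SA G \<mu> F' n' \<delta>' d"
  have sub: "sym_set G \<mu> F \<subseteq> sym_set G \<mu> F'" by (rule sym_set_mono[OF assms(1)])
  have sub2: "set_pow_upto G \<mu> (sym_set G \<mu> F) n \<subseteq> set_pow_upto G \<mu> (sym_set G \<mu> F') n'"
    by (rule set_pow_upto_mono[OF sub assms(2)])
  show "\<phi> \<in> SA G \<mu> F n \<delta> d"
    unfolding SA_def
  proof (intro CollectI conjI allI impI ballI)
    show "\<phi> \<in> linear_maps G \<mu> d" using \<phi> unfolding SA_def by blast
    show "mat_norm2 (\<phi> (op_prod N ss) - mat_prod d (map \<phi> ss)) < \<delta>"
      if "length ss \<in> {1..n} \<and> set ss \<subseteq> sym_set G \<mu> F" for ss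
    proof -
      have "length ss \<in> {1..n'} \<and> set ss \<subseteq> sym_set G \<mu> F'" using that sub assms(2) by auto
      then have "mat_norm2 (\<phi> (op_prod N ss) - mat_prod d (map \<phi> ss)) < \<delta>'" using \<phi> unfolding SA_def by blast
      then show ?thesis using assms(3) by simp
    qed
    show "\<phi> ` set_pow_upto G \<mu> (sym_set G \<mu> F) n \<subseteq> partial_perm_mats d" using \<phi> sub2 unfolding SA_def by blast
    show "cmod (ntr (\<phi> s) - vn_trace G \<mu> s) < \<delta>" if "s \<in> set_pow_upto G \<mu> (sym_set G \<mu> F) n" for s
    proof -
      have "s \<in> set_pow_upto G \<mu> (sym_set G \<mu> F') n'" using that sub2 by blast
      then have "cmod (ntr (\<phi> s) - vn_trace G \<mu> s) < \<delta>'" using \<phi> unfolding SA_def by blast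
      then show ?thesis using assms(3) by simp
    qed
  qed
qed

lemma eventually_SAf:
  "eventually P (SAf \<Omega>) \<longleftrightarrow> (\<exists>F n \<delta>. finite F \<and> F \<subseteq> \<Omega> \<and> 1 \<le> n \<and> 0 < \<delta> \<and> (\<forall>d. \<forall>\<phi>\<in>SA G \<mu> F n \<delta> d. P (d, \<phi>)))"
proof -
  define I where "I = {(F, n, \<delta>). finite F \<and> F \<subseteq> \<Omega> \<and> (1::nat) \<le> n \<and> (0::real) < \<delta>}"
  define q where "q = (\<lambda>(F, n, \<delta>). principal {p. snd p \<in> SA G \<mu> F n \<delta> (fst p)})"
  have I: "(F, n, \<delta>) \<in> I \<longleftrightarrow> finite F \<and> F \<subseteq> \<Omega> \<and> 1 \<le> n \<and> 0 < \<delta>" for F n \<delta> by (simp add: I_def)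
  have q: "q (F, n, \<delta>) = principal {p. snd p \<in> SA G \<mu> F n \<delta> (fst p)}" for F n \<delta> by (simp add: q_def)
  have "({}, 1, 1) \<in> I" by (simp add: I)
  then have ne: "I \<noteq> {}" by auto
  have dir: "\<exists>x\<in>I. q x \<le> inf (q a) (q b)" if ab: "a \<in> I" "b \<in> I" for a b
  proof -
    obtain F n \<delta> where a: "a = (F, n, \<delta>)" by (cases a) auto
    obtain F' n' \<delta>' where b: "b = (F', n', \<delta>')" by (cases b) auto
    define c where "c = (F \<union> F', max n n', min \<delta> \<delta>')"
    have mem: "c \<in> I" using ab by (simp add: a b I c_def le_max_iff_disj)
    have "SA G \<mu> (F \<union> F') (max n n') (min \<delta> \<delta>') d \<subseteq> SA G \<mu> F n \<delta> d \<inter> SA G \<mu> F' n' \<delta>' d" for d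
      using SA_mono[of F "F \<union> F'" n "max n n'" "min \<delta> \<delta>'" \<delta> d] SA_mono[of F' "F \<union> F'" n' "max n n'" "min \<delta> \<delta>'" \<delta>' d] by simp
    then have "q c \<le> inf (q a) (q b)" by (auto simp: a b c_def q)
    with mem show ?thesis by (rule rev_bexI)
  qed
  have "eventually P (SAf \<Omega>) \<longleftrightarrow> (\<exists>x\<in>I. eventually P (q x))"
    unfolding SAf_def I_def[symmetric] q_def[symmetric] by (rule eventually_INF_base[OF ne dir])
  also have "\<dots> \<longleftrightarrow> (\<exists>F n \<delta>. (F, n, \<delta>) \<in> I \<and> eventually P (q (F, n, \<delta>)))"
    unfolding Bex_def by (simp only: split_paired_Ex)
  also have "\<dots> \<longleftrightarrow> (\<exists>F n \<delta>. finite F \<and> F \<subseteq> \<Omega> \<and> 1 \<le> n \<and> 0 < \<delta> \<and> (\<forall>d. \<forall>\<phi>\<in>SA G \<mu> F n \<delta> d. P (d, \<phi>)))"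
    by (simp add: I q eventually_principal conj_assoc split_paired_All Ball_def)
  finally show ?thesis .
qed

lemma eventually_SA:
  assumes "finite F" "F \<subseteq> \<Omega>" "1 \<le> n" "0 < \<delta>" shows "\<forall>\<^sub>F p in SAf \<Omega>. snd p \<in> SA G \<mu> F n \<delta> (fst p)"
  unfolding eventually_SAf using assms by (intro exI[of _ F] exI[of _ n] exI[of _ \<delta>]) simp

lemma eventually_linear: "\<forall>\<^sub>F p in SAf \<Omega>. snd p \<in> linear_maps G \<mu> (fst p)"
  using eventually_SA[of "{}" \<Omega> 1 1] by (auto simp: SA_def elim: eventually_mono)

lemma finite_letters:
  assumes "finite A" "A \<subseteq> sym_set G \<mu> \<Omega>" shows "\<exists>F. finite F \<and> F \<subseteq> \<Omega> \<and> A \<subseteq> sym_set G \<mu> F"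
  using assms
proof (induction A rule: finite_induct)
  case empty then show ?case by blast
next
  case (insert a A)
  then obtain F where F: "finite F" "F \<subseteq> \<Omega>" "A \<subseteq> sym_set G \<mu> F" by blast
  obtain s where s: "s \<in> \<Omega>" "a = s \<or> a = op_adj N s" using insert.prems unfolding sym_set_def by blast
  then have "insert a A \<subseteq> sym_set G \<mu> (insert s F)" using F(3) unfolding sym_set_def by blast
  then show ?case using F s by (intro exI[of _ "insert s F"]) simp
qed

lemma word_SA:
  assumes ss: "ss \<noteq> []" "set ss \<subseteq> sym_set G \<mu> \<Omega>"
  shows "\<forall>\<^sub>F p in SAf \<Omega>. snd p (op_prod N ss) \<in> partial_perm_mats (fst p)"
    and "0 < \<delta> \<Longrightarrow> \<forall>\<^sub>F p in SAf \<Omega>. mat_norm2 (snd p (op_prod N ss) - mat_prod (fst p) (map (snd p) ss)) < \<delta>"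
    and "0 < \<delta> \<Longrightarrow> \<forall>\<^sub>F p in SAf \<Omega>. cmod (ntr (snd p (op_prod N ss)) - vn_trace G \<mu> (op_prod N ss)) < \<delta>"
proof -
  obtain F where F: "finite F" "F \<subseteq> \<Omega>" "set ss \<subseteq> sym_set G \<mu> F" using finite_letters[OF _ ss(2)] by auto
  have len: "length ss \<in> {1..length ss}" "1 \<le> length ss" using ss(1) by (auto simp: Suc_le_eq)
  have w: "op_prod N ss \<in> set_pow_upto G \<mu> (sym_set G \<mu> F) (length ss)"
    unfolding set_pow_upto_def set_pow_def using F(3) len(1) by blast
  note ev = eventually_SA[OF F(1,2) len(2)]
  show "\<forall>\<^sub>F p in SAf \<Omega>. snd p (op_prod N ss) \<in> partial_perm_mats (fst p)"
    by (rule eventually_mono[OF ev[of 1]]) (use w in \<open>auto simp: SA_def\<close>)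
  show "\<forall>\<^sub>F p in SAf \<Omega>. mat_norm2 (snd p (op_prod N ss) - mat_prod (fst p) (map (snd p) ss)) < \<delta>" if "0 < \<delta>"
    by (rule eventually_mono[OF ev[OF that]]) (use F(3) len(1) in \<open>auto simp: SA_def\<close>)
  show "\<forall>\<^sub>F p in SAf \<Omega>. cmod (ntr (snd p (op_prod N ss)) - vn_trace G \<mu> (op_prod N ss)) < \<delta>" if "0 < \<delta>"
    by (rule eventually_mono[OF ev[OF that]]) (use w in \<open>auto simp: SA_def\<close>)
qed

context
  fixes \<Omega> assumes \<Omega>: "\<Omega> \<subseteq> IG"
begin

lemma word_ppm: assumes "t \<in> words \<Omega>"
  shows "\<forall>\<^sub>F p in SAf \<Omega>. snd p t \<in> partial_perm_mats (fst p)" "\<forall>\<^sub>F p in SAf \<Omega>. ppm (fst p) (val t p)"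
proof -
  show 1: "\<forall>\<^sub>F p in SAf \<Omega>. snd p t \<in> partial_perm_mats (fst p)"
    using assms word_SA(1) unfolding words_def by blast
  show "\<forall>\<^sub>F p in SAf \<Omega>. ppm (fst p) (val t p)"
    using 1 by eventually_elim (simp add: val_def partial_perm_matsD)
qed

lemma letter_word: "s \<in> sym_set G \<mu> \<Omega> \<Longrightarrow> s \<in> words \<Omega>"
  unfolding words_def using sym_set_IG[OF \<Omega>] op_prod_single[of s] by (intro CollectI exI[of _ "[s]"]) auto

lemma word_mlist:
  assumes ss: "ss \<noteq> []" "set ss \<subseteq> sym_set G \<mu> \<Omega>"
  shows "aeq (SAf \<Omega>) (val (op_prod N ss)) (\<lambda>p. mlist (fst p) (map (\<lambda>s. val s p) ss))"
  unfolding aeq_def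
proof (rule tendstoI)
  fix e :: real assume "e > 0"
  have "\<forall>\<^sub>F p in SAf \<Omega>. \<forall>s\<in>set ss. snd p s \<in> partial_perm_mats (fst p)"
    by (intro eventually_ball_finite ballI word_ppm letter_word) (use ss in auto)
  with word_SA(2)[OF ss \<open>e > 0\<close>] word_SA(1)[OF ss]
  show "\<forall>\<^sub>F p in SAf \<Omega>. dist (nrm (fst p) (\<lambda>i j. val (op_prod N ss) p i j - mlist (fst p) (map (\<lambda>s. val s p) ss) i j)) 0 < e"
  proof eventually_elim
    case (elim p)
    note r = partial_perm_matsD(1)[OF elim(2)]
    have "\<And>A. A \<in> set (map (snd p) ss) \<Longrightarrow> real_mat (fst p) A" using elim(3) partial_perm_matsD(1) by auto
    then have "real_mat (fst p) (mat_prod (fst p) (map (snd p) ss)) \<and> (\<forall>i<fst p. \<forall>j<fst p.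
      rent (mat_prod (fst p) (map (snd p) ss)) i j = mlist (fst p) (map rent (map (snd p) ss)) i j)" by (rule real_mat_prod)
    then have m: "real_mat (fst p) (mat_prod (fst p) (map (snd p) ss))"
      "\<And>i j. i < fst p \<Longrightarrow> j < fst p \<Longrightarrow> rent (mat_prod (fst p) (map (snd p) ss)) i j = mlist (fst p) (map (\<lambda>s. val s p) ss) i j"
      by (auto simp: val_def[abs_def] o_def)
    have "mat_norm2 (snd p (op_prod N ss) - mat_prod (fst p) (map (snd p) ss)) =
      nrm (fst p) (rent (snd p (op_prod N ss) - mat_prod (fst p) (map (snd p) ss)))"
      by (rule mat_norm2_real[OF real_mat_minus(1)[OF r m(1)]])
    also have "\<dots> = nrm (fst p) (\<lambda>i j. val (op_prod N ss) p i j - mlist (fst p) (map (\<lambda>s. val s p) ss) i j)"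
      by (rule nrm_cong) (simp add: real_mat_minus(2)[OF r m(1)] m(2) val_def)
    finally show ?case using elim(1) by simp
  qed
qed

lemma word_mult:
  assumes s: "s \<in> words \<Omega>" and t: "t \<in> words \<Omega>"
  shows "aeq (SAf \<Omega>) (val (op_mult N s t)) (\<lambda>p. mm (fst p) (val s p) (val t p))"
proof -
  obtain ss where ss: "s = op_prod N ss" "ss \<noteq> []" "set ss \<subseteq> sym_set G \<mu> \<Omega>" using s unfolding words_def by blast
  obtain ts where ts: "t = op_prod N ts" "ts \<noteq> []" "set ts \<subseteq> sym_set G \<mu> \<Omega>" using t unfolding words_def by blast
  have m: "sym_set G \<mu> \<Omega> \<subseteq> L2 N \<rightarrow>\<^sub>E L2 N" using IG_maps sym_set_IG[OF \<Omega>] by blast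
  have e: "op_mult N s t = op_prod N (ss @ ts)"
    unfolding ss(1) ts(1) by (rule op_prod_append[symmetric]) (use ss ts m in auto)
  let ?l = "\<lambda>ss p. mlist (fst p) (map (\<lambda>s. val s p) ss)"
  have "aeq (SAf \<Omega>) (val (op_mult N s t)) (?l (ss @ ts))"
    unfolding e by (rule word_mlist) (use ss ts in auto)
  also have "aeq (SAf \<Omega>) (?l (ss @ ts)) (\<lambda>p. mm (fst p) (?l ss p) (?l ts p))"
    by (rule aeq_eventually) (simp add: mlist_append)
  finally have 1: "aeq (SAf \<Omega>) (val (op_mult N s t)) (\<lambda>p. mm (fst p) (?l ss p) (?l ts p))" .
  have "aeq (SAf \<Omega>) (\<lambda>p. mm (fst p) (?l ss p) (?l ts p)) (\<lambda>p. mm (fst p) (val s p) (val t p))"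
  proof (rule aeq_mm)
    show "aeq (SAf \<Omega>) (?l ss) (val s)" unfolding ss(1) by (rule aeq_sym[OF word_mlist[OF ss(2,3)]])
    show "aeq (SAf \<Omega>) (?l ts) (val t)" unfolding ts(1) by (rule aeq_sym[OF word_mlist[OF ts(2,3)]])
    show "mbd (SAf \<Omega>) (val s)" by (rule mbd_ppm[OF word_ppm(2)[OF s]])
    have "\<forall>\<^sub>F p in SAf \<Omega>. \<forall>s\<in>set ts. ppm (fst p) (val s p)"
      by (intro eventually_ball_finite ballI word_ppm letter_word) (use ts in auto)
    then have "\<forall>\<^sub>F p in SAf \<Omega>. ppm (fst p) (?l ts p)" by eventually_elim (auto intro!: ppm_mlist)
    then show "mbd (SAf \<Omega>) (?l ts)" by (rule mbd_ppm)
  qed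
  with 1 show ?thesis by (rule aeq_trans)
qed

lemma word_triple:
  assumes s: "s \<in> words \<Omega>" and t: "t \<in> words \<Omega>" and r: "r \<in> words \<Omega>"
  shows "aeq (SAf \<Omega>) (val (op_mult N s (op_mult N t r))) (\<lambda>p. mm (fst p) (mm (fst p) (val s p) (val t p)) (val r p))"
proof -
  have tr: "op_mult N t r \<in> words \<Omega>" by (rule words_mult[OF \<Omega> t r])
  have "aeq (SAf \<Omega>) (\<lambda>p. mm (fst p) (val s p) (val (op_mult N t r) p)) (\<lambda>p. mm (fst p) (val s p) (mm (fst p) (val t p) (val r p)))"
    by (intro aeq_mm aeq_refl word_mult t r mbd_ppm word_ppm s tr)
  with word_mult[OF s tr] show ?thesis unfolding mm_assoc by (rule aeq_trans)
qed

text \<open>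
  The images of \<open>t\<close> and its adjoint are asymptotically quasi-inverse to each other because the words \<open>t\<close> and
  \<open>op_adj N t\<close> are, so that \<open>ppm_quasi_inverse\<close> applies.
\<close>
lemma word_adj:
  assumes t: "t \<in> words \<Omega>" shows "aeq (SAf \<Omega>) (val (op_adj N t)) (\<lambda>p. tp (val t p))"
proof -
  have t': "op_adj N t \<in> words \<Omega>" by (rule words_adj[OF \<Omega> t])
  have i: "t \<in> IG" "op_adj N t \<in> IG" using words_IG[OF \<Omega>] t t' by auto
  let ?A = "val t" and ?B = "val (op_adj N t)"
  have "aeq (SAf \<Omega>) ?A (\<lambda>p. mm (fst p) (mm (fst p) (?A p) (?B p)) (?A p))"
    using word_triple[OF t t' t] IG_triple[OF i(1)] by simp
  then have A: "((\<lambda>p. nrm (fst p) (\<lambda>i j. mm (fst p) (mm (fst p) (?A p) (?B p)) (?A p) i j - ?A p i j)) \<longlongrightarrow> 0) (SAf \<Omega>)"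
    by (rule aeqD[OF aeq_sym])
  have "aeq (SAf \<Omega>) ?B (\<lambda>p. mm (fst p) (mm (fst p) (?B p) (?A p)) (?B p))"
    using word_triple[OF t' t t'] IG_triple[OF i(2)] adj_adj[OF i(1)] by simp
  then have B: "((\<lambda>p. nrm (fst p) (\<lambda>i j. mm (fst p) (mm (fst p) (?B p) (?A p)) (?B p) i j - ?B p i j)) \<longlongrightarrow> 0) (SAf \<Omega>)"
    by (rule aeqD[OF aeq_sym])
  have "((\<lambda>p. (nrm (fst p) (\<lambda>i j. ?B p i j - tp (?A p) i j))\<^sup>2) \<longlongrightarrow> 0) (SAf \<Omega>)"
  proof (rule null_le)
    show "((\<lambda>p. nrm (fst p) (\<lambda>i j. mm (fst p) (mm (fst p) (?A p) (?B p)) (?A p) i j - ?A p i j) +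
      nrm (fst p) (\<lambda>i j. mm (fst p) (mm (fst p) (?B p) (?A p)) (?B p) i j - ?B p i j)) \<longlongrightarrow> 0) (SAf \<Omega>)"
      using tendsto_add[OF A B] by simp
    show "\<forall>\<^sub>F p in SAf \<Omega>. 0 \<le> (nrm (fst p) (\<lambda>i j. ?B p i j - tp (?A p) i j))\<^sup>2 \<and>
      (nrm (fst p) (\<lambda>i j. ?B p i j - tp (?A p) i j))\<^sup>2 \<le>
      nrm (fst p) (\<lambda>i j. mm (fst p) (mm (fst p) (?A p) (?B p)) (?A p) i j - ?A p i j) +
      nrm (fst p) (\<lambda>i j. mm (fst p) (mm (fst p) (?B p) (?A p)) (?B p) i j - ?B p i j)"
      using word_ppm(2)[OF t] word_ppm(2)[OF t'] by eventually_elim (simp add: ppm_quasi_inverse)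
  qed
  from tendsto_real_sqrt[OF this] show ?thesis by (simp add: aeq_def)
qed

lemma word_tr:
  assumes t: "t \<in> words \<Omega>" shows "((\<lambda>p. tr (fst p) (val t p)) \<longlongrightarrow> Re (vn_trace G \<mu> t)) (SAf \<Omega>)"
proof (rule tendstoI)
  fix e :: real assume "e > 0"
  obtain ss where ss: "t = op_prod N ss" "ss \<noteq> []" "set ss \<subseteq> sym_set G \<mu> \<Omega>" using t unfolding words_def by blast
  from word_SA(3)[OF ss(2,3) \<open>e > 0\<close>] word_ppm(1)[OF t]
  show "\<forall>\<^sub>F p in SAf \<Omega>. dist (tr (fst p) (val t p)) (Re (vn_trace G \<mu> t)) < e"
  proof eventually_elim
    case (elim p)
    have "tr (fst p) (val t p) - Re (vn_trace G \<mu> t) = Re (ntr (snd p t) - vn_trace G \<mu> t)"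
      using ntr_real[OF partial_perm_matsD(1)[OF elim(2)]] by (simp add: val_def)
    also have "\<bar>\<dots>\<bar> \<le> cmod (ntr (snd p t) - vn_trace G \<mu> t)" by (rule abs_Re_le_cmod)
    finally show ?case using elim(1) by (simp add: ss(1) dist_real_def)
  qed
qed

lemma val_op_sum:
  assumes ts: "set ts \<subseteq> words \<Omega>"
  shows "\<forall>\<^sub>F p in SAf \<Omega>. real_mat (fst p) (snd p (op_sum N ts)) \<and>
    (\<forall>i<fst p. \<forall>j<fst p. val (op_sum N ts) p i j = (\<Sum>k<length ts. val (ts ! k) p i j))"
proof -
  have IG: "set ts \<subseteq> IG" using ts words_IG[OF \<Omega>] by blast
  have "\<forall>\<^sub>F p in SAf \<Omega>. \<forall>t\<in>set ts. snd p t \<in> partial_perm_mats (fst p)"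
    by (intro eventually_ball_finite ballI word_ppm) (use ts in auto)
  with eventually_linear show ?thesis
  proof eventually_elim
    case (elim p)
    have c: "snd p (op_sum N ts) \<in> carrier_mat (fst p) (fst p)" by (rule linear_mapsD(1)[OF elim(1) op_sum_V[OF IG]])
    have e: "snd p (op_sum N ts) $$ (i, j) = complex_of_real (\<Sum>k<length ts. val (ts ! k) p i j)"
      if ij: "i < fst p" "j < fst p" for i j
    proof -
      have "snd p (op_sum N ts) $$ (i, j) = (\<Sum>k<length ts. snd p (ts ! k) $$ (i, j))"
        unfolding linear_map_sum[OF elim(1) IG ij] by (simp add: sum_list_sum_nth atLeast0LessThan)
      also have "\<dots> = (\<Sum>k<length ts. complex_of_real (val (ts ! k) p i j))"
      proof (rule sum.cong[OF refl])
        fix k assume "k \<in> {..<length ts}"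
        then have "snd p (ts ! k) \<in> partial_perm_mats (fst p)" using elim(2) by simp
        from real_matD(2)[OF partial_perm_matsD(1)[OF this] ij]
        show "snd p (ts ! k) $$ (i, j) = complex_of_real (val (ts ! k) p i j)" by (simp add: val_def)
      qed
      finally show ?thesis by simp
    qed
    show ?case using real_matI[OF c e] by (simp add: val_def)
  qed
qed

lemma wsum_natmat: assumes "D \<in> wsums \<Omega>" shows "\<forall>\<^sub>F p in SAf \<Omega>. natmat (fst p) (val D p)"
proof -
  obtain ts where ts: "D = op_sum N ts" "set ts \<subseteq> words \<Omega>" by (rule wsumsE[OF assms])
  have "\<forall>\<^sub>F p in SAf \<Omega>. \<forall>t\<in>set ts. ppm (fst p) (val t p)"
    by (intro eventually_ball_finite ballI word_ppm) (use ts in auto)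
  with val_op_sum[OF ts(2)] show ?thesis unfolding ts(1)
  proof eventually_elim
    case (elim p)
    show ?case
      unfolding natmat_def
    proof (intro allI impI)
      fix i j assume ij: "i < fst p" "j < fst p"
      have "(\<Sum>k<length ts. val (ts ! k) p i j) \<in> \<nat>"
      proof (rule sum_in_Nats)
        fix k assume "k < length ts"
        then have "ppm (fst p) (val (ts ! k) p)" using elim(2) by simp
        from natmat_ppm[OF this] show "val (ts ! k) p i j \<in> \<nat>" using ij by (simp add: natmat_def)
      qed
      then show "val (op_sum N ts) p i j \<in> \<nat>" using elim(1) ij by simp
    qed
  qed
qed

lemma op_sum_mbd:
  assumes ts: "set ts \<subseteq> words \<Omega>" shows "mbd (SAf \<Omega>) (val (op_sum N ts))"
proof (rule mbd_cong)
  show "mbd (SAf \<Omega>) (\<lambda>p i j. \<Sum>k<length ts. val (ts ! k) p i j)"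
  proof (rule mbd_sum)
    fix k assume "k \<in> {..<length ts}"
    then have "ts ! k \<in> words \<Omega>" using ts by auto
    then show "mbd (SAf \<Omega>) (val (ts ! k))" by (intro mbd_ppm word_ppm)
  qed simp
  show "\<forall>\<^sub>F p in SAf \<Omega>. \<forall>i<fst p. \<forall>j<fst p. (\<Sum>k<length ts. val (ts ! k) p i j) = val (op_sum N ts) p i j"
    using val_op_sum[OF ts] by eventually_elim simp
qed

lemma wsum_mbd: assumes "D \<in> wsums \<Omega>" shows "mbd (SAf \<Omega>) (val D)"
proof -
  obtain ts where ts: "D = op_sum N ts" "set ts \<subseteq> words \<Omega>" by (rule wsumsE[OF assms])
  show ?thesis unfolding ts(1) by (rule op_sum_mbd[OF ts(2)])
qed

lemma val_op_sum_aeq: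
  assumes ts: "set ts \<subseteq> words \<Omega>" shows "aeq (SAf \<Omega>) (val (op_sum N ts)) (\<lambda>p i j. \<Sum>k<length ts. val (ts ! k) p i j)"
  by (rule aeq_eventually, rule eventually_mono[OF val_op_sum[OF ts]]) simp

lemma wsum_mult:
  assumes D: "D \<in> wsums \<Omega>" and E: "E \<in> wsums \<Omega>"
  shows "aeq (SAf \<Omega>) (val (op_mult N D E)) (\<lambda>p. mm (fst p) (val D p) (val E p))"
proof -
  obtain ss where ss: "D = op_sum N ss" "set ss \<subseteq> words \<Omega>" by (rule wsumsE[OF D])
  obtain ts where ts: "E = op_sum N ts" "set ts \<subseteq> words \<Omega>" by (rule wsumsE[OF E])
  have IG: "set ss \<subseteq> IG" "set ts \<subseteq> IG" using ss ts words_IG[OF \<Omega>] by auto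
  let ?w = "map (\<lambda>p. op_mult N (fst p) (snd p)) (List.product ss ts)"
  have w: "op_mult N D E = op_sum N ?w" unfolding ss(1) ts(1) by (rule op_mult_sums[OF IG])
  have wW: "set ?w \<subseteq> words \<Omega>" by (auto dest!: subsetD[OF ss(2)] subsetD[OF ts(2)] intro: words_mult[OF \<Omega>])
  have pm: "(\<Sum>k<length ?w. f (?w ! k)) = (\<Sum>k<length ss. \<Sum>l<length ts. f (op_mult N (ss ! k) (ts ! l)))" for f :: "'g l2_op \<Rightarrow> real"
  proof -
    have "(\<Sum>k<length ?w. f (?w ! k)) = (\<Sum>t\<leftarrow>?w. f t)" by (simp add: sum_list_sum_nth atLeast0LessThan)
    also have "\<dots> = (\<Sum>p\<leftarrow>List.product ss ts. f (op_mult N (fst p) (snd p)))" by (simp add: o_def)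
    also have "\<dots> = (\<Sum>s\<leftarrow>ss. \<Sum>t\<leftarrow>ts. f (op_mult N s t))" by (rule sum_list_product)
    also have "\<dots> = (\<Sum>k<length ss. \<Sum>l<length ts. f (op_mult N (ss ! k) (ts ! l)))"
      by (simp add: sum_list_sum_nth atLeast0LessThan)
    finally show ?thesis .
  qed
  have pm': "(\<Sum>k<length ?w. val (?w ! k) p i j) = (\<Sum>k<length ss. \<Sum>l<length ts. val (op_mult N (ss ! k) (ts ! l)) p i j)"
    for p :: "nat \<times> ('g l2_op \<Rightarrow> complex mat)" and i j by (rule pm)
  have 1: "aeq (SAf \<Omega>) (val (op_mult N D E)) (\<lambda>p i j. \<Sum>k<length ss. \<Sum>l<length ts. val (op_mult N (ss ! k) (ts ! l)) p i j)"
    using val_op_sum_aeq[OF wW] unfolding w pm' .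
  have 2: "aeq (SAf \<Omega>) (\<lambda>p i j. \<Sum>k<length ss. \<Sum>l<length ts. val (op_mult N (ss ! k) (ts ! l)) p i j)
    (\<lambda>p i j. \<Sum>k<length ss. \<Sum>l<length ts. mm (fst p) (val (ss ! k) p) (val (ts ! l) p) i j)"
    by (intro aeq_sum word_mult) (use ss ts in auto)
  have e: "(\<lambda>i j. \<Sum>k<length ss. \<Sum>l<length ts. mm (fst p) (val (ss ! k) p) (val (ts ! l) p) i j) =
    mm (fst p) (\<lambda>i j. \<Sum>k<length ss. val (ss ! k) p i j) (\<lambda>i j. \<Sum>l<length ts. val (ts ! l) p i j)" for p :: "nat \<times> ('g l2_op \<Rightarrow> complex mat)"
    unfolding mm_sum_left mm_sum_right ..
  have 3: "aeq (SAf \<Omega>) (\<lambda>p. mm (fst p) (\<lambda>i j. \<Sum>k<length ss. val (ss ! k) p i j) (\<lambda>i j. \<Sum>l<length ts. val (ts ! l) p i j))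
    (\<lambda>p. mm (fst p) (val D p) (val E p))"
  proof (rule aeq_mm)
    show "aeq (SAf \<Omega>) (\<lambda>p i j. \<Sum>k<length ss. val (ss ! k) p i j) (val D)" unfolding ss(1) by (rule aeq_sym[OF val_op_sum_aeq[OF ss(2)]])
    show "aeq (SAf \<Omega>) (\<lambda>p i j. \<Sum>k<length ts. val (ts ! k) p i j) (val E)" unfolding ts(1) by (rule aeq_sym[OF val_op_sum_aeq[OF ts(2)]])
    show "mbd (SAf \<Omega>) (val D)" by (rule wsum_mbd[OF D])
    show "mbd (SAf \<Omega>) (\<lambda>p i j. \<Sum>k<length ts. val (ts ! k) p i j)"
      by (intro mbd_sum mbd_ppm word_ppm) (use ts in auto)
  qed
  show ?thesis by (rule aeq_trans[OF 1 aeq_trans[OF 2]]) (use 3 e in simp)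
qed

lemma wsum_adj:
  assumes D: "D \<in> wsums \<Omega>" shows "aeq (SAf \<Omega>) (val (op_adj N D)) (\<lambda>p. tp (val D p))"
proof -
  obtain ss where ss: "D = op_sum N ss" "set ss \<subseteq> words \<Omega>" by (rule wsumsE[OF D])
  have IG: "set ss \<subseteq> IG" using ss words_IG[OF \<Omega>] by auto
  have a: "op_adj N D = op_sum N (map (op_adj N) ss)" unfolding ss(1) by (rule op_adj_sum[OF IG])
  have aW: "set (map (op_adj N) ss) \<subseteq> words \<Omega>" by (auto dest!: subsetD[OF ss(2)] intro: words_adj[OF \<Omega>])
  have 1: "aeq (SAf \<Omega>) (val (op_adj N D)) (\<lambda>p i j. \<Sum>k<length ss. val (op_adj N (ss ! k)) p i j)"
  proof -
    have e: "(\<Sum>k<length (map (op_adj N) ss). val (map (op_adj N) ss ! k) p i j) = (\<Sum>k<length ss. val (op_adj N (ss ! k)) p i j)"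
      for p :: "nat \<times> ('g l2_op \<Rightarrow> complex mat)" and i j by (intro sum.cong) simp_all
    show ?thesis using val_op_sum_aeq[OF aW] unfolding a e .
  qed
  have 2: "aeq (SAf \<Omega>) (\<lambda>p i j. \<Sum>k<length ss. val (op_adj N (ss ! k)) p i j) (\<lambda>p i j. \<Sum>k<length ss. tp (val (ss ! k) p) i j)"
    by (intro aeq_sum word_adj) (use ss in auto)
  have 3: "aeq (SAf \<Omega>) (\<lambda>p. tp (\<lambda>i j. \<Sum>k<length ss. val (ss ! k) p i j)) (\<lambda>p. tp (val D p))"
    unfolding ss(1) by (rule aeq_tp[OF aeq_sym[OF val_op_sum_aeq[OF ss(2)]]])
  show ?thesis by (rule aeq_trans[OF 1 aeq_trans[OF 2]]) (use 3 in \<open>simp add: tp_sum\<close>)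
qed

lemma wsum_tr:
  assumes D: "D \<in> wsums \<Omega>" shows "((\<lambda>p. tr (fst p) (val D p)) \<longlongrightarrow> Re (vn_trace G \<mu> D)) (SAf \<Omega>)"
proof -
  obtain ss where ss: "D = op_sum N ss" "set ss \<subseteq> words \<Omega>" by (rule wsumsE[OF D])
  have IG: "set ss \<subseteq> IG" using ss words_IG[OF \<Omega>] by auto
  have r: "Re (\<Sum>s\<leftarrow>ss. f s) = (\<Sum>k<length ss. Re (f (ss ! k)))" for f
    by (simp add: sum_list_sum_nth atLeast0LessThan)
  have e: "tr (fst p) (\<lambda>i j. \<Sum>k<length ss. val (ss ! k) p i j) = (\<Sum>k<length ss. tr (fst p) (val (ss ! k) p))"
    for p :: "nat \<times> ('g l2_op \<Rightarrow> complex mat)"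
    unfolding tr_def by (subst sum.swap) (simp add: sum_divide_distrib)
  have "((\<lambda>p. tr (fst p) (\<lambda>i j. \<Sum>k<length ss. val (ss ! k) p i j)) \<longlongrightarrow> Re (vn_trace G \<mu> D)) (SAf \<Omega>)"
    unfolding e ss(1) trace_sum[OF IG] r by (intro tendsto_sum word_tr) (use ss in auto)
  then show ?thesis using aeq_tr[OF val_op_sum_aeq[OF ss(2)]] by (simp add: ss(1))
qed

lemma wsum_inner:
  assumes D: "D \<in> wsums \<Omega>" and E: "E \<in> wsums \<Omega>"
  shows "((\<lambda>p. ip (fst p) (val E p) (val D p)) \<longlongrightarrow> measure N (bis D \<inter> bis E)) (SAf \<Omega>)"
proof -
  have i: "D \<in> IG" "E \<in> IG" using D E by (auto elim: wsumsE)
  note E' = wsums_adj[OF \<Omega> E]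
  have "aeq (SAf \<Omega>) (\<lambda>p. mm (fst p) (tp (val E p)) (val D p)) (\<lambda>p. mm (fst p) (val (op_adj N E) p) (val D p))"
    by (intro aeq_mm aeq_sym[OF wsum_adj] E aeq_refl wsum_mbd E' D)
  from aeq_trans[OF this aeq_sym[OF wsum_mult[OF E' D]]]
  have "((\<lambda>p. tr (fst p) (mm (fst p) (tp (val E p)) (val D p))) \<longlongrightarrow> Re (vn_trace G \<mu> (op_mult N (op_adj N E) D))) (SAf \<Omega>)"
    by (rule aeq_tr) (rule wsum_tr[OF wsums_mult[OF \<Omega> E' D]])
  then show ?thesis by (simp add: tr_tp_mm trace_adj_mult[OF i])
qed

text \<open>
  The squared norm expands into the inner products of \<open>wsum_inner\<close>, whose limits are the measures of the
  pairwise intersections of the bisections.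
\<close>
lemma wsum_nrm_sq:
  assumes I: "finite I" and D: "\<And>i. i \<in> I \<Longrightarrow> D i \<in> wsums \<Omega>" and X: "\<And>i. i \<in> I \<Longrightarrow> aeq (SAf \<Omega>) (X i) (val (D i))"
  shows "((\<lambda>p. (nrm (fst p) (\<lambda>a b. \<Sum>i\<in>I. c i * X i p a b))\<^sup>2) \<longlongrightarrow>
    (\<integral>x. (\<Sum>i\<in>I. c i * indicator (bis (D i)) x)\<^sup>2 \<partial>N)) (SAf \<Omega>)"
proof (rule aeq_nrm_sq)
  show "aeq (SAf \<Omega>) (\<lambda>p a b. \<Sum>i\<in>I. c i * X i p a b) (\<lambda>p a b. \<Sum>i\<in>I. c i * val (D i) p a b)"
    by (intro aeq_sum I aeq_scale X)
  have b: "bisection G (bis (D i))" if "i \<in> I" for i using D[OF that] by (auto elim: wsumsE intro: bis)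
  have m: "bis (D i) \<inter> bis (D k) \<in> fmeasurable N" if "i \<in> I" "k \<in> I" for i k
    using fmeasurable_bisection[OF b[OF that(1)]] fmeasurable_bisection[OF b[OF that(2)]] by (intro fmeasurable.Int) (auto simp: fmeasurable_def)
  have "(\<integral>x. (\<Sum>i\<in>I. c i * indicator (bis (D i)) x)\<^sup>2 \<partial>N) = (\<integral>x. (\<Sum>i\<in>I. \<Sum>k\<in>I. c i * c k * indicator (bis (D i) \<inter> bis (D k)) x) \<partial>N)"
    by (intro Bochner_Integration.integral_cong refl) (simp add: power2_eq_square sum_product indicator_inter_arith mult_ac)
  also have "\<dots> = (\<Sum>i\<in>I. \<Sum>k\<in>I. c i * c k * measure N (bis (D i) \<inter> bis (D k)))"
  proof (subst Bochner_Integration.integral_sum)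
    show "integrable N (\<lambda>x. \<Sum>k\<in>I. c i * c k * indicator (bis (D i) \<inter> bis (D k)) x)" if "i \<in> I" for i
      using m[OF that] by (intro Bochner_Integration.integrable_sum integrable_mult_right) (simp add: fmeasurable_def integrable_indicator_iff)
    show "(\<Sum>i\<in>I. \<integral>x. (\<Sum>k\<in>I. c i * c k * indicator (bis (D i) \<inter> bis (D k)) x) \<partial>N) =
      (\<Sum>i\<in>I. \<Sum>k\<in>I. c i * c k * measure N (bis (D i) \<inter> bis (D k)))"
    proof (rule sum.cong[OF refl])
      fix i assume i: "i \<in> I"
      have "(\<integral>x. (\<Sum>k\<in>I. c i * c k * indicator (bis (D i) \<inter> bis (D k)) x) \<partial>N) =
        (\<Sum>k\<in>I. \<integral>x. c i * c k * indicator (bis (D i) \<inter> bis (D k)) x \<partial>N)"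
        using m[OF i] by (intro Bochner_Integration.integral_sum integrable_mult_right) (simp add: fmeasurable_def integrable_indicator_iff)
      also have "\<dots> = (\<Sum>k\<in>I. c i * c k * measure N (bis (D i) \<inter> bis (D k)))"
      proof (rule sum.cong[OF refl])
        fix k assume "k \<in> I"
        from m[OF i this] have "bis (D i) \<inter> bis (D k) \<in> sets N" by (simp add: fmeasurable_def)
        then have "space N \<inter> (bis (D i) \<inter> bis (D k)) = bis (D i) \<inter> bis (D k)" using sets.sets_into_space by blast
        then show "(\<integral>x. c i * c k * indicator (bis (D i) \<inter> bis (D k)) x \<partial>N) = c i * c k * measure N (bis (D i) \<inter> bis (D k))"
          by (simp add: Int_commute)
      qed
      finally show "(\<integral>x. (\<Sum>k\<in>I. c i * c k * indicator (bis (D i) \<inter> bis (D k)) x) \<partial>N) =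
        (\<Sum>k\<in>I. c i * c k * measure N (bis (D i) \<inter> bis (D k)))" .
    qed
  qed
  finally have R: "(\<integral>x. (\<Sum>i\<in>I. c i * indicator (bis (D i)) x)\<^sup>2 \<partial>N) = (\<Sum>i\<in>I. \<Sum>k\<in>I. c i * c k * measure N (bis (D i) \<inter> bis (D k)))" .
  have L: "(nrm (fst p) (\<lambda>a b. \<Sum>i\<in>I. c i * val (D i) p a b))\<^sup>2 = (\<Sum>i\<in>I. \<Sum>k\<in>I. c i * c k * ip (fst p) (val (D k) p) (val (D i) p))"
    for p :: "nat \<times> ('g l2_op \<Rightarrow> complex mat)"
  proof -
    have "(\<Sum>a<fst p. \<Sum>b<fst p. (\<Sum>i\<in>I. c i * val (D i) p a b) * (\<Sum>i\<in>I. c i * val (D i) p a b)) =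
      (\<Sum>a<fst p. \<Sum>b<fst p. \<Sum>i\<in>I. \<Sum>k\<in>I. c i * c k * (val (D k) p a b * val (D i) p a b))"
      by (simp add: sum_product mult_ac)
    also have "\<dots> = (\<Sum>i\<in>I. \<Sum>k\<in>I. \<Sum>a<fst p. \<Sum>b<fst p. c i * c k * (val (D k) p a b * val (D i) p a b))"
      by (rule sum_swap4)
    finally show ?thesis unfolding nrm_sq ip_def by (simp add: sum_divide_distrib sum_distrib_left)
  qed
  show "((\<lambda>p. (nrm (fst p) (\<lambda>a b. \<Sum>i\<in>I. c i * val (D i) p a b))\<^sup>2) \<longlongrightarrow> (\<integral>x. (\<Sum>i\<in>I. c i * indicator (bis (D i)) x)\<^sup>2 \<partial>N)) (SAf \<Omega>)"
    unfolding R L by (intro tendsto_sum tendsto_mult_left wsum_inner D)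
qed

text \<open>
  The element \<open>D\<close> is a partial isometry, so its image satisfies \<open>M M\<^sup>T M = M\<close> asymptotically, and the bound of
  \<open>nrm_rnd\<close> tends to zero.
\<close>
lemma wsum_round:
  assumes D: "D \<in> wsums \<Omega>" shows "aeq (SAf \<Omega>) (\<lambda>p. rnd (fst p) (val D p)) (val D)"
proof -
  have i: "D \<in> IG" using D by (auto elim: wsumsE)
  note D' = wsums_adj[OF \<Omega> D]
  note DD = wsums_mult[OF \<Omega> D' D]
  have "aeq (SAf \<Omega>) (val D) (\<lambda>p. mm (fst p) (val D p) (val (op_mult N (op_adj N D) D) p))"
    using wsum_mult[OF D DD] IG_triple[OF i] by simp
  also have "aeq (SAf \<Omega>) \<dots> (\<lambda>p. mm (fst p) (val D p) (mm (fst p) (val (op_adj N D) p) (val D p)))"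
    by (intro aeq_mm aeq_refl wsum_mult wsum_mbd D D' DD)
  also have "aeq (SAf \<Omega>) \<dots> (\<lambda>p. mm (fst p) (val D p) (mm (fst p) (tp (val D p)) (val D p)))"
    by (intro aeq_mm aeq_refl wsum_adj mbd_mm wsum_mbd mbd_tp D D')
  finally have "aeq (SAf \<Omega>) (val D) (\<lambda>p. mm (fst p) (val D p) (mm (fst p) (tp (val D p)) (val D p)))" .
  then have 1: "((\<lambda>p. nrm (fst p) (\<lambda>i j. mm (fst p) (mm (fst p) (val D p) (tp (val D p))) (val D p) i j - val D p i j)) \<longlongrightarrow> 0) (SAf \<Omega>)"
    unfolding mm_assoc by (rule aeqD[OF aeq_sym])
  show ?thesis
    unfolding aeq_def
    by (rule null_le[OF 1], rule eventually_mono[OF wsum_natmat[OF D]]) (simp add: nrm_rnd)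
qed

end

end

section \<open>Comparison of sofic dimensions; density bounds the full dimension\<close>

lemma log_card_le:
  fixes R1 :: "'a set" and R2 :: "'b set"
  assumes ne: "R1 \<noteq> {} \<Longrightarrow> R2 \<noteq> {}" and c: "finite R2 \<Longrightarrow> finite R1 \<and> real (card R1) \<le> real (card R2) * exp b"
  shows "log_card R1 \<le> log_card R2 + ereal b"
proof (cases "finite R2 \<and> R1 \<noteq> {}")
  case True
  then have f: "finite R1" "R2 \<noteq> {}" and le: "real (card R1) \<le> real (card R2) * exp b" using ne c by auto
  have p: "0 < real (card R1)" "0 < real (card R2)" using f True by (auto simp: card_gt_0_iff)
  have "ln (real (card R1)) \<le> ln (real (card R2) * exp b)" using p le by simp
  also have "\<dots> = ln (real (card R2)) + b" using p by (simp add: ln_mult)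
  finally show ?thesis using f True by (simp add: log_card_def)
next
  case False
  then show ?thesis by (auto simp: log_card_def)
qed

lemma card_UN_le':
  assumes I: "finite I" and A: "\<And>i. i \<in> I \<Longrightarrow> finite (A i) \<and> real (card (A i)) \<le> c"
  shows "finite (\<Union>i\<in>I. A i) \<and> real (card (\<Union>i\<in>I. A i)) \<le> real (card I) * c"
proof
  show "finite (\<Union>i\<in>I. A i)" using I A by blast
  have "real (card (\<Union>i\<in>I. A i)) \<le> real (\<Sum>i\<in>I. card (A i))" using card_UN_le[OF I, of A] by (simp only: of_nat_le_iff)
  also have "\<dots> \<le> (\<Sum>i\<in>I. c)" unfolding of_nat_sum using A by (intro sum_mono) blast
  finally show "real (card (\<Union>i\<in>I. A i)) \<le> real (card I) * c" by simp
qed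

lemma sum_bool: "(\<Sum>b\<in>(UNIV :: bool set). f b) = f True + (f False :: real)"
  by (simp add: UNIV_bool)

text \<open>
  The bound is required only from \<open>d = 2\<close> on, since \<open>d ln d\<close> vanishes for smaller \<open>d\<close>.
\<close>
lemma limsup_liminf_shift:
  assumes L: "L = limsup \<or> L = liminf" and le: "\<And>d. 2 \<le> d \<Longrightarrow> f d \<le> g d + ereal c"
  shows "L f \<le> L g + ereal c"
proof -
  have ev: "\<forall>\<^sub>F d in sequentially. f d \<le> g d + ereal c" using le by (intro eventually_sequentiallyI[of 2]) auto
  from L show ?thesis
  proof
    assume "L = limsup"
    then show ?thesis using Limsup_mono[OF ev] by (simp add: Limsup_add_ereal_right)
  next
    assume "L = liminf"
    then show ?thesis using Liminf_mono[OF ev] by (simp add: Liminf_add_ereal_right)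
  qed
qed

context pmp_groupoid
begin

text \<open>
  The restriction of \<open>\<phi>\<close> to \<open>E1\<close> lies in a product of balls whose centres are determined by the
  restriction of \<open>\<psi>\<close> to \<open>E2\<close>. Hence the number of the former is at most the number of the latter times the number of
  partial permutation matrices in the product of the balls.
\<close>
lemma sdim_E_le:
  fixes \<Theta> :: "'g l2_op \<Rightarrow> nat \<Rightarrow> ('g l2_op \<Rightarrow> complex mat) \<Rightarrow> nat \<Rightarrow> nat \<Rightarrow> real"
  assumes L: "L = limsup \<or> L = liminf" and E1: "finite E1" and \<kappa>: "0 < \<kappa>"
    and model: "\<And>F n \<delta>. finite F \<Longrightarrow> F \<subseteq> \<Omega>2 \<Longrightarrow> 1 \<le> n \<Longrightarrow> 0 < \<delta> \<Longrightarrow>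
      \<forall>\<^sub>F p in SAf \<Omega>1. \<exists>\<psi>\<in>SA G \<mu> F n \<delta> (fst p). \<forall>e\<in>E1. snd p e \<in> partial_perm_mats (fst p) \<and>
        nrm (fst p) (\<lambda>i j. val e p i j - \<Theta> e (fst p) (restrict \<psi> E2) i j) < \<kappa>"
  shows "sdim_E L G \<mu> E1 \<Omega>1 \<le> sdim_E L G \<mu> E2 \<Omega>2 + ereal (12 * \<kappa>\<^sup>2 * card E1)"
proof -
  let ?c = "12 * \<kappa>\<^sup>2 * card E1"
  have main: "sdim_E L G \<mu> E1 \<Omega>1 \<le> sdim_E_F_n_delta L G \<mu> E2 F n \<delta> + ereal ?c"
    if v: "finite F" "F \<subseteq> \<Omega>2" "1 \<le> n" "0 < \<delta>" for F n \<delta>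
  proof -
    obtain F1 n1 \<delta>1 where v1: "finite F1" "F1 \<subseteq> \<Omega>1" "1 \<le> n1" "0 < \<delta>1"
      and m: "\<And>d \<phi>. \<phi> \<in> SA G \<mu> F1 n1 \<delta>1 d \<Longrightarrow> \<exists>\<psi>\<in>SA G \<mu> F n \<delta> d. \<forall>e\<in>E1. \<phi> e \<in> partial_perm_mats d \<and>
        nrm d (\<lambda>i j. rent (\<phi> e) i j - \<Theta> e d (restrict \<psi> E2) i j) < \<kappa>"
      using model[OF v] unfolding eventually_SAf val_def by auto
    have cnt: "log_card (restrictions (SA G \<mu> F1 n1 \<delta>1 d) E1) \<le> log_card (restrictions (SA G \<mu> F n \<delta> d) E2) + ereal (?c * (real d * ln (real d)))"
      if d: "2 \<le> d" for d
    proof (rule log_card_le)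
      let ?R1 = "restrictions (SA G \<mu> F1 n1 \<delta>1 d) E1" and ?R2 = "restrictions (SA G \<mu> F n \<delta> d) E2"
      show "?R2 \<noteq> {}" if ne: "?R1 \<noteq> {}"
      proof -
        obtain \<phi> where "\<phi> \<in> SA G \<mu> F1 n1 \<delta>1 d" using ne unfolding restrictions_def by blast
        from m[OF this] show ?thesis unfolding restrictions_def by blast
      qed
      assume fin: "finite ?R2"
      define B where "B = (\<lambda>r e. {A \<in> partial_perm_mats d. nrm d (\<lambda>i j. rent A i j - \<Theta> e d r i j) < \<kappa>})"
      have sub: "?R1 \<subseteq> (\<Union>r\<in>?R2. PiE E1 (B r))"
      proof
        fix f assume "f \<in> ?R1"
        then obtain \<phi> where \<phi>: "\<phi> \<in> SA G \<mu> F1 n1 \<delta>1 d" "f = restrict \<phi> E1" unfolding restrictions_def by blast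
        from m[OF \<phi>(1)] obtain \<psi> where \<psi>: "\<psi> \<in> SA G \<mu> F n \<delta> d" "\<And>e. e \<in> E1 \<Longrightarrow> \<phi> e \<in> B (restrict \<psi> E2) e"
          unfolding B_def by blast
        have "f \<in> PiE E1 (B (restrict \<psi> E2))" unfolding \<phi>(2) using \<psi>(2) by simp
        moreover have "restrict \<psi> E2 \<in> ?R2" unfolding restrictions_def using \<psi>(1) by blast
        ultimately show "f \<in> (\<Union>r\<in>?R2. PiE E1 (B r))" by blast
      qed
      have "finite (PiE E1 (B r)) \<and> real (card (PiE E1 (B r))) \<le> exp (?c * (real d * ln (real d)))" for r
      proof
        have b: "finite (B r e)" "real (card (B r e)) \<le> exp (12 * \<kappa>\<^sup>2 * (real d * ln (real d)))" for e
          unfolding B_def by (rule partial_perm_ball[OF d \<kappa>])+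
        show "finite (PiE E1 (B r))" using b by (intro finite_PiE E1)
        have "real (card (PiE E1 (B r))) = (\<Prod>e\<in>E1. real (card (B r e)))" by (simp add: card_PiE[OF E1])
        also have "\<dots> \<le> (\<Prod>e\<in>E1. exp (12 * \<kappa>\<^sup>2 * (real d * ln (real d))))" using b by (intro prod_mono) auto
        also have "\<dots> = exp (?c * (real d * ln (real d)))" by (simp add: exp_of_nat_mult[symmetric] mult_ac)
        finally show "real (card (PiE E1 (B r))) \<le> exp (?c * (real d * ln (real d)))" .
      qed
      then have U: "finite (\<Union>r\<in>?R2. PiE E1 (B r)) \<and> real (card (\<Union>r\<in>?R2. PiE E1 (B r))) \<le> real (card ?R2) * exp (?c * (real d * ln (real d)))"
        by (intro card_UN_le' fin)
      have "card ?R1 \<le> card (\<Union>r\<in>?R2. PiE E1 (B r))" using U sub by (intro card_mono) auto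
      then show "finite ?R1 \<and> real (card ?R1) \<le> real (card ?R2) * exp (?c * (real d * ln (real d)))"
        using U finite_subset[OF sub] by auto
    qed
    have "sdim_E L G \<mu> E1 \<Omega>1 \<le> sdim_E_F L G \<mu> E1 F1"
      unfolding sdim_E_def using v1 by (intro INF_lower) simp
    also have "\<dots> \<le> sdim_E_F_n L G \<mu> E1 F1 n1"
      unfolding sdim_E_F_def using v1 by (intro INF_lower) simp
    also have "\<dots> \<le> sdim_E_F_n_delta L G \<mu> E1 F1 n1 \<delta>1"
      unfolding sdim_E_F_n_def using v1 by (intro INF_lower) simp
    also have "\<dots> \<le> sdim_E_F_n_delta L G \<mu> E2 F n \<delta> + ereal ?c"
      unfolding sdim_E_F_n_delta_def
    proof (rule limsup_liminf_shift[OF L])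
      fix d :: nat assume d: "2 \<le> d"
      define x where "x = real d * ln (real d)"
      have x: "0 < x" using d by (simp add: x_def)
      have "log_card (restrictions (SA G \<mu> F1 n1 \<delta>1 d) E1) / ereal x \<le>
        (log_card (restrictions (SA G \<mu> F n \<delta> d) E2) + ereal (?c * x)) / ereal x"
        using cnt[OF d] x by (intro ereal_divide_right_mono) (simp_all add: x_def)
      also have "\<dots> = log_card (restrictions (SA G \<mu> F n \<delta> d) E2) / ereal x + ereal ?c"
        using x by (cases "log_card (restrictions (SA G \<mu> F n \<delta> d) E2)") (simp_all add: add_divide_distrib)
      finally show "log_card (restrictions (SA G \<mu> F1 n1 \<delta>1 d) E1) / ereal (real d * ln (real d)) \<le>
        log_card (restrictions (SA G \<mu> F n \<delta> d) E2) / ereal (real d * ln (real d)) + ereal ?c" by (simp add: x_def)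
    qed
    finally show ?thesis .
  qed
  have "sdim_E L G \<mu> E1 \<Omega>1 - ereal ?c \<le> sdim_E L G \<mu> E2 \<Omega>2"
    unfolding sdim_E_def[of L G \<mu> E2] sdim_E_F_def sdim_E_F_n_def
  proof (intro INF_greatest)
    fix F and n :: nat and \<delta> :: real assume "F \<in> {F. finite F \<and> F \<subseteq> \<Omega>2}" "n \<in> {1..}" "\<delta> \<in> {0<..}"
    then show "sdim_E L G \<mu> E1 \<Omega>1 - ereal ?c \<le> sdim_E_F_n_delta L G \<mu> E2 F n \<delta>"
      using main[of F n \<delta>] by (simp add: ereal_minus_le)
  qed
  then show ?thesis by (simp add: ereal_minus_le)
qed

lemma integral_indicator_diff_sq:
  assumes B: "bisection G B" and C: "bisection G C"
  shows "(\<integral>x. (indicator B x - indicator C x)\<^sup>2 \<partial>N) = bdist B C"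
proof -
  have "(\<integral>x. (indicator B x - indicator C x)\<^sup>2 \<partial>N) = (\<integral>x. (indicator ((B - C) \<union> (C - B)) x :: real) \<partial>N)"
  proof (intro Bochner_Integration.integral_cong refl)
    fix x show "(indicator B x - indicator C x :: real)\<^sup>2 = indicator ((B - C) \<union> (C - B)) x"
      by (cases "x \<in> B"; cases "x \<in> C"; simp)
  qed
  also have "\<dots> = bdist B C"
    using sets.sets_into_space[OF measurable_diff_sets[OF B C]] measurable_diff_sets[OF B C]
    by (simp add: bdist_def Int_absorb2)
  finally show ?thesis .
qed

lemma wsum_diff_limit:
  assumes \<Omega>: "\<Omega> \<subseteq> IG" and D: "D \<in> wsums \<Omega>" and E: "E \<in> wsums \<Omega>"
  shows "((\<lambda>p. (nrm (fst p) (\<lambda>i j. val D p i j - val E p i j))\<^sup>2) \<longlongrightarrow> bdist (bis D) (bis E)) (SAf \<Omega>)"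
proof -
  define Di where "Di = (\<lambda>b. if b then D else E)"
  define c :: "bool \<Rightarrow> real" where "c = (\<lambda>b. if b then 1 else - 1)"
  have b: "bisection G (bis D)" "bisection G (bis E)" using D E by (auto elim: wsumsE intro: bis)
  have lim: "((\<lambda>p. (nrm (fst p) (\<lambda>i j. \<Sum>b\<in>UNIV. c b * val (Di b) p i j))\<^sup>2) \<longlongrightarrow>
    (\<integral>x. (\<Sum>b\<in>UNIV. c b * indicator (bis (Di b)) x)\<^sup>2 \<partial>N)) (SAf \<Omega>)"
    by (rule wsum_nrm_sq[OF \<Omega>]) (auto simp: Di_def D E aeq_refl)
  have e1: "(\<Sum>b\<in>UNIV. c b * val (Di b) p i j) = val D p i j - val E p i j" for p :: "nat \<times> ('g l2_op \<Rightarrow> complex mat)" and i j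
    unfolding sum_bool by (simp add: Di_def c_def)
  have e2: "(\<Sum>b\<in>UNIV. c b * indicator (bis (Di b)) x) = indicator (bis D) x - indicator (bis E) x" for x
    unfolding sum_bool by (simp add: Di_def c_def)
  show ?thesis using lim unfolding e1 e2 integral_indicator_diff_sq[OF b] .
qed

lemma square_limit_less:
  fixes f :: "'b \<Rightarrow> real"
  assumes "((\<lambda>p. (f p)\<^sup>2) \<longlongrightarrow> l) F" "l < e\<^sup>2" "0 < e" shows "\<forall>\<^sub>F p in F. f p < e"
proof -
  have "\<forall>\<^sub>F p in F. (f p)\<^sup>2 < e\<^sup>2" by (rule order_tendstoD(2)[OF assms(1,2)])
  then show ?thesis by eventually_elim (use assms(3) in \<open>auto intro: power2_less_imp_less\<close>)
qed

lemma aeq_mlist: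
  assumes "\<And>s. s \<in> set ss \<Longrightarrow> aeq F (X s) (Y s)" "\<And>s. s \<in> set ss \<Longrightarrow> \<forall>\<^sub>F p in F. ppm (fst p) (X s p)"
    "\<And>s. s \<in> set ss \<Longrightarrow> \<forall>\<^sub>F p in F. ppm (fst p) (Y s p)"
  shows "aeq F (\<lambda>p. mlist (fst p) (map (\<lambda>s. X s p) ss)) (\<lambda>p. mlist (fst p) (map (\<lambda>s. Y s p) ss))"
  using assms
proof (induction ss)
  case (Cons s ss)
  have "\<forall>\<^sub>F p in F. \<forall>s\<in>set ss. ppm (fst p) (X s p)"
    by (intro eventually_ball_finite ballI Cons.prems) auto
  then have p: "\<forall>\<^sub>F p in F. ppm (fst p) (mlist (fst p) (map (\<lambda>s. X s p) ss))"
    by eventually_elim (auto intro!: ppm_mlist)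
  show ?case
    unfolding list.map mlist_simps
    by (intro aeq_mm Cons.prems Cons.IH mbd_ppm p) auto
qed (simp add: aeq_refl)

definition dense :: "'g l2_op set \<Rightarrow> bool" where
  "dense \<Omega> \<longleftrightarrow> (\<forall>s\<in>IG. \<forall>\<epsilon>>0. \<exists>D\<in>wsums \<Omega>. vn_norm2 G \<mu> (op_diff N s D) < \<epsilon>)"

lemma generating_dense: "generating G \<mu> \<Omega> \<Longrightarrow> \<Omega> \<subseteq> IG \<and> dense \<Omega>"
  unfolding generating_def Let_def words_eq dense_def by blast

lemma dense_approx:
  assumes \<Omega>: "dense \<Omega>" and C: "bisection G C" and \<epsilon>: "0 < \<epsilon>"
  shows "\<exists>D\<in>wsums \<Omega>. bdist C (bis D) < \<epsilon>"
proof -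
  obtain D where D: "D \<in> wsums \<Omega>" "vn_norm2 G \<mu> (op_diff N (pis C) D) < sqrt \<epsilon>"
    using \<Omega> IG_I[OF C] \<epsilon> unfolding dense_def by (meson real_sqrt_gt_zero)
  then have i: "D \<in> IG" by (auto elim: wsumsE)
  have "sqrt (bdist C (bis D)) < sqrt \<epsilon>" using norm2_diff[OF C bis(1)[OF i]] bis(2)[OF i] D(2) by simp
  then show ?thesis using D(1) by auto
qed

text \<open>
  The map \<open>\<Theta>\<close> evaluates, on the images of finitely many letters, the sums of words that approximate the elements of
  \<open>E1\<close>.
\<close>
lemma sofic_le_generating:
  assumes L: "L = limsup \<or> L = liminf" and \<Omega>: "\<Omega> \<subseteq> IG" "dense \<Omega>"
  shows "sdim L G \<mu> IG \<le> sdim L G \<mu> \<Omega>"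
  unfolding sdim_def[of L G \<mu> IG]
proof (rule SUP_least)
  fix E1 assume "E1 \<in> {E. finite E \<and> E \<subseteq> IG}"
  then have E1: "finite E1" "E1 \<subseteq> IG" by auto
  show "sdim_E L G \<mu> E1 IG \<le> sdim L G \<mu> \<Omega>"
  proof (rule ereal_le_epsilon2)
    fix \<epsilon> :: real assume \<epsilon>: "0 < \<epsilon>"
    \<comment> \<open>with this radius the error term of the counting is at most \<open>\<epsilon>\<close>\<close>
    define \<kappa> where "\<kappa> = sqrt (\<epsilon> / (12 * (real (card E1) + 1)))"
    have pos: "0 < 12 * (real (card E1) + 1)" by (rule mult_pos_pos) (simp_all add: add_nonneg_pos)
    have \<kappa>: "0 < \<kappa>" using \<epsilon> pos by (simp add: \<kappa>_def)
    have "12 * \<kappa>\<^sup>2 * card E1 = \<epsilon> * (card E1 / (real (card E1) + 1))" using \<epsilon> pos by (simp add: \<kappa>_def field_simps)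
    also have "\<dots> \<le> \<epsilon> * 1" using \<epsilon> by (intro mult_left_mono) (simp_all add: divide_le_eq)
    finally have small: "12 * \<kappa>\<^sup>2 * card E1 \<le> \<epsilon>" by simp
    have "\<forall>e\<in>E1. \<exists>D. D \<in> wsums \<Omega> \<and> bdist (bis e) (bis D) < (\<kappa> / 2)\<^sup>2"
    proof
      fix e assume "e \<in> E1"
      then have "bisection G (bis e)" using E1 bis by blast
      from dense_approx[OF \<Omega>(2) this, of "(\<kappa> / 2)\<^sup>2"] \<kappa> show "\<exists>D. D \<in> wsums \<Omega> \<and> bdist (bis e) (bis D) < (\<kappa> / 2)\<^sup>2" by auto
    qed
    from bchoice[OF this] obtain D where D: "\<And>e. e \<in> E1 \<Longrightarrow> D e \<in> wsums \<Omega>" "\<And>e. e \<in> E1 \<Longrightarrow> bdist (bis e) (bis (D e)) < (\<kappa> / 2)\<^sup>2" by blast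
    have "\<forall>e\<in>E1. \<exists>ts. D e = op_sum N ts \<and> set ts \<subseteq> words \<Omega>"
    proof
      fix e assume "e \<in> E1"
      from D(1)[OF this] obtain ts where "D e = op_sum N ts" "set ts \<subseteq> words \<Omega>" by (rule wsumsE)
      then show "\<exists>ts. D e = op_sum N ts \<and> set ts \<subseteq> words \<Omega>" by (intro exI conjI)
    qed
    from bchoice[OF this] obtain ts where ts: "\<And>e. e \<in> E1 \<Longrightarrow> D e = op_sum N (ts e)" "\<And>e. e \<in> E1 \<Longrightarrow> set (ts e) \<subseteq> words \<Omega>" by blast
    have ex: "\<exists>ss. t = op_prod N ss \<and> ss \<noteq> [] \<and> set ss \<subseteq> sym_set G \<mu> \<Omega>" if "t \<in> words \<Omega>" for t
      using that unfolding words_def by (rule CollectD)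
    define lt where "lt = (\<lambda>t. SOME ss. t = op_prod N ss \<and> ss \<noteq> [] \<and> set ss \<subseteq> sym_set G \<mu> \<Omega>)"
    have lt_props: "t = op_prod N (lt t) \<and> lt t \<noteq> [] \<and> set (lt t) \<subseteq> sym_set G \<mu> \<Omega>" if "t \<in> words \<Omega>" for t
      unfolding lt_def by (rule someI_ex[OF ex[OF that]])
    have lt1: "t = op_prod N (lt t)" if "t \<in> words \<Omega>" for t by (rule conjunct1[OF lt_props[OF that]])
    have lt2: "lt t \<noteq> []" if "t \<in> words \<Omega>" for t by (rule conjunct1[OF conjunct2[OF lt_props[OF that]]])
    have lt3: "set (lt t) \<subseteq> sym_set G \<mu> \<Omega>" if "t \<in> words \<Omega>" for t by (rule conjunct2[OF conjunct2[OF lt_props[OF that]]])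
    note lt = lt1 lt2 lt3
    define A where "A = (\<Union>e\<in>E1. \<Union>t\<in>set (ts e). set (lt t))"
    have finA: "finite A" unfolding A_def by (intro finite_UN_I E1(1) finite_set)
    have subA: "A \<subseteq> sym_set G \<mu> \<Omega>"
      unfolding A_def by (intro UN_least lt(3)) (rule subsetD[OF ts(2)])
    from finite_letters[OF finA subA] obtain E2 where E2: "finite E2" "E2 \<subseteq> \<Omega>" "A \<subseteq> sym_set G \<mu> E2"
      by (elim exE conjE) (rule that)
    define lv where "lv = (\<lambda>(r :: 'g l2_op \<Rightarrow> complex mat) a. if a \<in> E2 then rent (r a) else tp (rent (r (op_adj N a))))"
    define \<Theta> where "\<Theta> = (\<lambda>e d r i j. \<Sum>k<length (ts e). mlist d (map (lv r) (lt (ts e ! k))) i j)"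
    have IGs: "\<Omega> \<subseteq> IG" "E2 \<subseteq> IG" using \<Omega> E2 by auto
    have sub_words: "words \<Omega> \<subseteq> words IG" unfolding words_def using sym_set_mono[OF \<Omega>(1)] by blast
    have IGw: "s \<in> wsums IG" if "s \<in> IG" for s by (rule words_wsums[OF subset_refl IG_words[OF that]])
    have letter: "aeq (SAf IG) (val a) (\<lambda>p. lv (restrict (snd p) E2) a)"
      and letter_ppm: "\<forall>\<^sub>F p in SAf IG. ppm (fst p) (lv (restrict (snd p) E2) a)" if a: "a \<in> A" for a
    proof -
      have "aeq (SAf IG) (val a) (\<lambda>p. lv (restrict (snd p) E2) a) \<and> (\<forall>\<^sub>F p in SAf IG. ppm (fst p) (lv (restrict (snd p) E2) a))"
      proof (cases "a \<in> E2")
        case True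
        then have e: "lv (restrict (snd p) E2) a = val a p" for p :: "nat \<times> ('g l2_op \<Rightarrow> complex mat)"
          by (intro ext) (simp add: lv_def val_def)
        have "a \<in> IG" using True IGs by auto
        then show ?thesis unfolding e using word_ppm(2)[OF subset_refl IG_words] by (simp add: aeq_refl)
      next
        case False
        then obtain s where s: "s \<in> E2" "a = op_adj N s" using a E2(3) unfolding sym_set_def by blast
        then have sI: "s \<in> IG" using IGs by auto
        then have "op_adj N a = s" using s adj_adj by simp
        then have e: "lv (restrict (snd p) E2) a = tp (val s p)" for p :: "nat \<times> ('g l2_op \<Rightarrow> complex mat)" using False s by (intro ext) (simp add: lv_def val_def)
        have "\<forall>\<^sub>F p in SAf IG. ppm (fst p) (tp (val s p))"
          using word_ppm(2)[OF subset_refl IG_words[OF sI]] by eventually_elim (rule ppm_tp)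
        then show ?thesis unfolding e using word_adj[OF subset_refl IG_words[OF sI]] s(2) by simp
      qed
      then show "aeq (SAf IG) (val a) (\<lambda>p. lv (restrict (snd p) E2) a)"
        "\<forall>\<^sub>F p in SAf IG. ppm (fst p) (lv (restrict (snd p) E2) a)" by auto
    qed
    have close: "\<forall>\<^sub>F p in SAf IG. snd p e \<in> partial_perm_mats (fst p) \<and>
        nrm (fst p) (\<lambda>i j. val e p i j - \<Theta> e (fst p) (restrict (snd p) E2) i j) < \<kappa>" if e: "e \<in> E1" for e
    proof -
      have eI: "e \<in> IG" using e E1 by auto
      have DI: "D e \<in> IG" using D(1)[OF e] by (auto elim: wsumsE)
      have tsI: "set (ts e) \<subseteq> words IG" using ts(2)[OF e] sub_words by blast
      have "aeq (SAf IG) (val (D e)) (\<lambda>p i j. \<Sum>k<length (ts e). val (ts e ! k) p i j)"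
        unfolding ts(1)[OF e] by (rule val_op_sum_aeq[OF subset_refl tsI])
      also have "aeq (SAf IG) (\<lambda>p i j. \<Sum>k<length (ts e). val (ts e ! k) p i j) (\<lambda>p. \<Theta> e (fst p) (restrict (snd p) E2))"
        unfolding \<Theta>_def
      proof (rule aeq_sum)
        fix k assume "k \<in> {..<length (ts e)}"
        then have k: "ts e ! k \<in> set (ts e)" by simp
        then have w: "ts e ! k \<in> words \<Omega>" using ts(2)[OF e] by blast
        let ?ss = "lt (ts e ! k)"
        have sA: "set ?ss \<subseteq> A" unfolding A_def using k e by blast
        have sI: "set ?ss \<subseteq> sym_set G \<mu> IG" using lt(3)[OF w] sym_set_mono[OF \<Omega>(1)] by blast
        have "aeq (SAf IG) (val (ts e ! k)) (\<lambda>p. mlist (fst p) (map (\<lambda>s. val s p) ?ss))"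
          using word_mlist[OF subset_refl lt(2)[OF w] sI] lt(1)[OF w] by simp
        also have "aeq (SAf IG) (\<lambda>p. mlist (fst p) (map (\<lambda>s. val s p) ?ss)) (\<lambda>p. mlist (fst p) (map (lv (restrict (snd p) E2)) ?ss))"
        proof (rule aeq_mlist)
          fix s assume s: "s \<in> set ?ss"
          show "aeq (SAf IG) (val s) (\<lambda>p. lv (restrict (snd p) E2) s)"
            "\<forall>\<^sub>F p in SAf IG. ppm (fst p) (lv (restrict (snd p) E2) s)" using s sA letter letter_ppm by auto
          show "\<forall>\<^sub>F p in SAf IG. ppm (fst p) (val s p)"
            by (rule word_ppm(2)[OF subset_refl letter_word[OF subset_refl]]) (use s sI in auto)
        qed
        finally show "aeq (SAf IG) (val (ts e ! k)) (\<lambda>p i j. mlist (fst p) (map (lv (restrict (snd p) E2)) (lt (ts e ! k))) i j)" .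
      qed simp
      finally have "aeq (SAf IG) (val (D e)) (\<lambda>p. \<Theta> e (fst p) (restrict (snd p) E2))" .
      from order_tendstoD(2)[OF aeqD[OF this], of "\<kappa> / 2"] \<kappa>
      have 1: "\<forall>\<^sub>F p in SAf IG. nrm (fst p) (\<lambda>i j. val (D e) p i j - \<Theta> e (fst p) (restrict (snd p) E2) i j) < \<kappa> / 2" by simp
      have 2: "\<forall>\<^sub>F p in SAf IG. nrm (fst p) (\<lambda>i j. val e p i j - val (D e) p i j) < \<kappa> / 2"
        by (rule square_limit_less[OF wsum_diff_limit[OF subset_refl IGw[OF eI] IGw[OF DI]] D(2)[OF e]]) (use \<kappa> in simp)
      show ?thesis using 1 2 word_ppm(1)[OF subset_refl IG_words[OF eI]]
      proof eventually_elim
        case (elim p)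
        have "nrm (fst p) (\<lambda>i j. val e p i j - \<Theta> e (fst p) (restrict (snd p) E2) i j) \<le>
          nrm (fst p) (\<lambda>i j. val e p i j - val (D e) p i j) + nrm (fst p) (\<lambda>i j. val (D e) p i j - \<Theta> e (fst p) (restrict (snd p) E2) i j)"
          by (rule nrm_dist_triangle)
        then show ?case using elim by simp
      qed
    qed
    have "sdim_E L G \<mu> E1 IG \<le> sdim_E L G \<mu> E2 \<Omega> + ereal (12 * \<kappa>\<^sup>2 * card E1)"
    proof (rule sdim_E_le[OF L E1(1) \<kappa>, where \<Theta> = \<Theta>])
      fix F and n :: nat and \<delta> :: real assume v: "finite F" "F \<subseteq> \<Omega>" "1 \<le> n" "0 < \<delta>"
      have "\<forall>\<^sub>F p in SAf IG. snd p \<in> SA G \<mu> F n \<delta> (fst p)" by (rule eventually_SA) (use v \<Omega> in auto)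
      moreover have "\<forall>\<^sub>F p in SAf IG. \<forall>e\<in>E1. snd p e \<in> partial_perm_mats (fst p) \<and>
        nrm (fst p) (\<lambda>i j. val e p i j - \<Theta> e (fst p) (restrict (snd p) E2) i j) < \<kappa>"
        by (intro eventually_ball_finite E1(1) ballI close)
      ultimately show "\<forall>\<^sub>F p in SAf IG. \<exists>\<psi>\<in>SA G \<mu> F n \<delta> (fst p). \<forall>e\<in>E1. snd p e \<in> partial_perm_mats (fst p) \<and>
        nrm (fst p) (\<lambda>i j. val e p i j - \<Theta> e (fst p) (restrict \<psi> E2) i j) < \<kappa>"
        by eventually_elim (rule rev_bexI)
    qed
    also have "\<dots> \<le> sdim L G \<mu> \<Omega> + ereal \<epsilon>"
    proof (rule add_mono)
      show "sdim_E L G \<mu> E2 \<Omega> \<le> sdim L G \<mu> \<Omega>" unfolding sdim_def using E2 by (intro SUP_upper) simp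
    qed (use small in simp)
    finally show "sdim_E L G \<mu> E1 IG \<le> sdim L G \<mu> \<Omega> + ereal \<epsilon>" .
  qed
qed

end

section \<open>Cells of a finite set of bisections\<close>

context pmp_groupoid
begin

lemma bdist_nonneg: "0 \<le> bdist B C"
  by (simp add: bdist_def)

lemma bdist_self [simp]: "bdist B B = 0"
  by (simp add: bdist_def)

lemma bdist_commute: "bdist B C = bdist C B"
  by (simp add: bdist_def Un_commute)

lemma fmeasurable_sym_diff: "bisection G B \<Longrightarrow> bisection G C \<Longrightarrow> (B - C) \<union> (C - B) \<in> fmeasurable N"
  by (intro fmeasurable.Un fmeasurable_bisection bisection_diff)

lemma bdist_triangle:
  assumes A: "bisection G A" and B: "bisection G B" and C: "bisection G C"
  shows "bdist A C \<le> bdist A B + bdist B C"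
proof -
  have "bdist A C \<le> measure N (((A - B) \<union> (B - A)) \<union> ((B - C) \<union> (C - B)))"
    unfolding bdist_def
    by (rule measure_mono_fmeasurable[OF _ measurable_diff_sets[OF A C] fmeasurable.Un[OF fmeasurable_sym_diff[OF A B] fmeasurable_sym_diff[OF B C]]]) blast
  also have "\<dots> \<le> bdist A B + bdist B C"
    unfolding bdist_def by (rule measure_Un_le[OF measurable_diff_sets[OF A B] measurable_diff_sets[OF B C]])
  finally show ?thesis .
qed

lemma measure_inter_bdist:
  assumes B: "bisection G B" and C: "bisection G C" and U: "U \<in> sets N"
  shows "\<bar>measure N (B \<inter> U) - measure N (C \<inter> U)\<bar> \<le> bdist B C"
proof -
  have *: "measure N (B \<inter> U) \<le> measure N (C \<inter> U) + bdist B C" if B: "bisection G B" and C: "bisection G C" for B C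
  proof -
    have s: "B \<inter> U \<in> sets N" "C \<inter> U \<in> sets N" using U bisection_sets[OF B] bisection_sets[OF C] by auto
    have f: "C \<inter> U \<in> fmeasurable N"
      using s by (intro fmeasurable_bisection bisection_subset[OF C]) auto
    have "measure N (B \<inter> U) \<le> measure N ((C \<inter> U) \<union> ((B - C) \<union> (C - B)))"
      by (rule measure_mono_fmeasurable[OF _ s(1) fmeasurable.Un[OF f fmeasurable_sym_diff[OF B C]]]) blast
    also have "\<dots> \<le> measure N (C \<inter> U) + bdist B C"
      unfolding bdist_def by (rule measure_Un_le[OF s(2) measurable_diff_sets[OF B C]])
    finally show ?thesis .
  qed
  show ?thesis using *[OF B C] *[OF C B] bdist_commute[of B C] by linarith
qed

lemma bis_pis: assumes B: "bisection G B" shows "bdist (bis (pis B)) B = 0"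
proof -
  note b = bis[OF IG_I[OF B]]
  have "sqrt (bdist (bis (pis B)) B) = sqrt (bdist B B)"
    using norm2_diff[OF b(1) B] norm2_diff[OF B B] b(2) by simp
  then show ?thesis by simp
qed

lemma bisection_empty: "bisection G {}"
  by (simp add: bisection_def)

lemma pis_empty: "pis {} = op_zero N"
  by (rule lifts_eqI[OF lifts_pis[OF bisection_empty] lifts_zero], rule AE_I2)
    (simp add: partial_iso_fun_eq[OF bisection_empty] bdom_def)

lemma zero_wsums: "op_zero N \<in> wsums \<Omega>"
  using IG_I[OF bisection_empty] by (intro wsumsI[of _ "[]"]) (simp_all add: pis_empty)

lemma integral_sq_bound:
  assumes I: "finite I" and B: "\<And>i. i \<in> I \<Longrightarrow> bisection G (B i)" and C: "\<And>i. i \<in> I \<Longrightarrow> bisection G (C i)"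
    and c: "\<And>i. i \<in> I \<Longrightarrow> \<bar>c i\<bar> \<le> 1"
    and f: "\<And>x. x \<in> arrows G \<Longrightarrow> f x = (\<Sum>i\<in>I. c i * (indicator (B i) x - indicator (C i) x))"
  shows "(\<integral>x. (f x)\<^sup>2 \<partial>N) \<le> real (card I) * (\<Sum>i\<in>I. bdist (B i) (C i))"
proof -
  let ?S = "\<lambda>i. (B i - C i) \<union> (C i - B i)"
  have i: "integrable N (indicator (?S i) :: 'g \<Rightarrow> real)" if "i \<in> I" for i
    using fmeasurable_sym_diff[OF B[OF that] C[OF that]] by (simp add: fmeasurable_def integrable_indicator_iff)
  have "(\<integral>x. (f x)\<^sup>2 \<partial>N) \<le> (\<integral>x. real (card I) * (\<Sum>i\<in>I. indicat_real (?S i) x) \<partial>N)"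
  proof (rule integral_mono')
    show "integrable N (\<lambda>x. real (card I) * (\<Sum>i\<in>I. indicat_real (?S i) x))"
      by (intro integrable_mult_right Bochner_Integration.integrable_sum i)
    fix x assume "x \<in> space N"
    then have x: "x \<in> arrows G" by simp
    have "(f x)\<^sup>2 \<le> (\<Sum>i\<in>I. (c i * (indicator (B i) x - indicator (C i) x))\<^sup>2) * card I"
      unfolding f[OF x] by (rule sum_squared_le_sum_of_squares)
    also have "\<dots> \<le> (\<Sum>i\<in>I. indicat_real (?S i) x) * card I"
    proof (intro mult_right_mono sum_mono)
      fix i assume i: "i \<in> I"
      have "(c i)\<^sup>2 \<le> 1" using c[OF i] by (simp add: abs_square_le_1)
      then show "(c i * (indicator (B i) x - indicator (C i) x))\<^sup>2 \<le> indicat_real (?S i) x"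
        by (cases "x \<in> B i"; cases "x \<in> C i"; simp)
    qed simp
    finally show "(f x)\<^sup>2 \<le> real (card I) * (\<Sum>i\<in>I. indicat_real (?S i) x)" by (simp add: mult.commute)
  qed (simp add: sum_nonneg)
  also have "\<dots> = real (card I) * (\<Sum>i\<in>I. \<integral>x. indicat_real (?S i) x \<partial>N)"
    using i by (simp add: Bochner_Integration.integral_sum)
  also have "(\<Sum>i\<in>I. \<integral>x. indicat_real (?S i) x \<partial>N) = (\<Sum>i\<in>I. bdist (B i) (C i))"
  proof (rule sum.cong[OF refl])
    fix i assume i: "i \<in> I"
    have "?S i \<subseteq> arrows G" using sets.sets_into_space[OF measurable_diff_sets[OF B[OF i] C[OF i]]] by simp
    then show "(\<integral>x. indicat_real (?S i) x \<partial>N) = bdist (B i) (C i)"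
      using measurable_diff_sets[OF B[OF i] C[OF i]] by (simp add: bdist_def Int_absorb2)
  qed
  finally show ?thesis .
qed

text \<open>
  If the combination of the sets \<open>C i\<close> cancels up to a null set, then a combination of matrices that model
  nearby sets is small. The Cauchy-Schwarz inequality accounts for the factor \<open>card I + 1\<close>; the additional term
  is the null set between \<open>S0\<close> and \<open>S1\<close>.
\<close>
lemma asymptotic_bound:
  assumes \<Omega>: "\<Omega> \<subseteq> IG" and I: "finite I" and D: "\<And>i. i \<in> I \<Longrightarrow> D i \<in> wsums \<Omega>"
    and X: "\<And>i. i \<in> I \<Longrightarrow> aeq (SAf \<Omega>) (X i) (val (D i))"
    and c: "\<And>i. i \<in> I \<Longrightarrow> \<bar>c i\<bar> \<le> 1" and C: "\<And>i. i \<in> I \<Longrightarrow> bisection G (C i)"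
    and S: "bisection G S0" "bisection G S1" "bdist S0 S1 = 0"
    and eq: "\<And>x. x \<in> arrows G \<Longrightarrow> (\<Sum>i\<in>I. c i * indicator (C i) x) = indicator S0 x - indicator S1 x"
    and small: "(real (card I) + 1) * (\<Sum>i\<in>I. bdist (bis (D i)) (C i)) < \<eta>\<^sup>2" and \<eta>: "0 < \<eta>"
  shows "\<forall>\<^sub>F p in SAf \<Omega>. nrm (fst p) (\<lambda>a b. \<Sum>i\<in>I. c i * X i p a b) < \<eta>"
proof (rule square_limit_less[OF wsum_nrm_sq[OF \<Omega> I D X] _ \<eta>])
  define B' where "B' = (\<lambda>i. case i of None \<Rightarrow> S0 | Some i \<Rightarrow> bis (D i))"
  define C' where "C' = (\<lambda>i. case i of None \<Rightarrow> S1 | Some i \<Rightarrow> C i)"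
  define c' where "c' = (\<lambda>i. case i of None \<Rightarrow> 1 | Some i \<Rightarrow> c i)"
  let ?I = "insert None (Some ` I)"
  have b: "bisection G (bis (D i))" if "i \<in> I" for i using D[OF that] by (auto elim: wsumsE intro: bis)
  have sum': "(\<Sum>i\<in>?I. h i) = h None + (\<Sum>i\<in>I. h (Some i))" for h :: "_ \<Rightarrow> real"
    using I by (simp add: sum.reindex)
  have "(\<integral>x. (\<Sum>i\<in>I. c i * indicator (bis (D i)) x)\<^sup>2 \<partial>N) \<le> real (card ?I) * (\<Sum>i\<in>?I. bdist (B' i) (C' i))"
  proof (rule integral_sq_bound)
    show "finite ?I" using I by simp
    show "bisection G (B' i)" if "i \<in> ?I" for i using that S b by (auto simp: B'_def)
    show "bisection G (C' i)" if "i \<in> ?I" for i using that S C by (auto simp: C'_def)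
    show "\<bar>c' i\<bar> \<le> 1" if "i \<in> ?I" for i using that c by (auto simp: c'_def)
    show "(\<Sum>i\<in>I. c i * indicator (bis (D i)) x) = (\<Sum>i\<in>?I. c' i * (indicator (B' i) x - indicator (C' i) x))"
      if "x \<in> arrows G" for x
      unfolding sum' using eq[OF that] by (simp add: B'_def C'_def c'_def right_diff_distrib sum_subtractf)
  qed
  also have "\<dots> = (real (card I) + 1) * (\<Sum>i\<in>I. bdist (bis (D i)) (C i))"
    unfolding sum' using I S(3) by (simp add: B'_def C'_def card_image add.commute)
  also have "\<dots> < \<eta>\<^sup>2" by (rule small)
  finally show "(\<integral>x. (\<Sum>i\<in>I. c i * indicator (bis (D i)) x)\<^sup>2 \<partial>N) < \<eta>\<^sup>2" .
qed

definition cells :: "'g l2_op set \<Rightarrow> 'g l2_op set set" where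
  "cells K = {\<sigma>. \<sigma> \<subseteq> K \<and> \<sigma> \<noteq> {}}"

text \<open>
  The cell of the arrows that lie in exactly those bisections of \<open>K\<close> that belong to \<open>\<sigma>\<close>.
\<close>
definition atom :: "'g l2_op set \<Rightarrow> 'g l2_op set \<Rightarrow> 'g set" where
  "atom K \<sigma> = (\<Inter>s\<in>\<sigma>. bis s) - (\<Union>s\<in>K - \<sigma>. bis s)"

definition cells_of :: "'g l2_op set \<Rightarrow> 'g l2_op \<Rightarrow> 'g l2_op set set" where
  "cells_of K s = {\<sigma> \<in> cells K. s \<in> \<sigma>}"

lemma atom_iff: "\<sigma> \<in> cells K \<Longrightarrow> x \<in> atom K \<sigma> \<longleftrightarrow> {s \<in> K. x \<in> bis s} = \<sigma>"
  unfolding atom_def cells_def by blast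

lemma finite_cells: "finite K \<Longrightarrow> finite (cells K)"
  unfolding cells_def by simp

lemma finite_cells_of: "finite K \<Longrightarrow> finite (cells_of K s)"
  unfolding cells_of_def by (simp add: finite_cells)

lemma atom_bisection:
  assumes K: "finite K" "K \<subseteq> IG" and \<sigma>: "\<sigma> \<in> cells K" shows "bisection G (atom K \<sigma>)"
proof -
  obtain s where s: "s \<in> \<sigma>" using \<sigma> unfolding cells_def by blast
  have sub: "\<sigma> \<subseteq> K" using \<sigma> unfolding cells_def by simp
  have f: "finite \<sigma>" using sub K finite_subset by blast
  have m: "bis t \<in> sets (gbor G)" if "t \<in> K" for t
    by (rule bisection_sets[OF bis(1)]) (rule subsetD[OF K(2) that])
  have "(\<Inter>s\<in>\<sigma>. bis s) \<in> sets (gbor G)" by (rule sets.finite_INT[OF f]) (use s sub m in auto)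
  moreover have "(\<Union>s\<in>K - \<sigma>. bis s) \<in> sets (gbor G)" by (rule sets.finite_UN) (use K m in auto)
  ultimately have m: "atom K \<sigma> \<in> sets (gbor G)" unfolding atom_def by (rule sets.Diff)
  have l: "atom K \<sigma> \<subseteq> bis s" using s unfolding atom_def by blast
  have b: "bisection G (bis s)" using s sub K bis(1) by blast
  show ?thesis by (rule bisection_subset[OF b]) (use m l in simp_all)
qed

lemma atom_sum:
  assumes K: "finite K" and s: "s \<in> K"
  shows "(\<Sum>\<sigma>\<in>cells_of K s. indicator (atom K \<sigma>) x) = (indicator (bis s) x :: real)"
proof -
  let ?z = "{t \<in> K. x \<in> bis t}"
  have "(\<Sum>\<sigma>\<in>cells_of K s. indicator (atom K \<sigma>) x) = (\<Sum>\<sigma>\<in>cells_of K s. if \<sigma> = ?z then 1 else 0 :: real)"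
    by (intro sum.cong refl) (auto simp: cells_of_def atom_iff indicator_def)
  also have "\<dots> = (if ?z \<in> cells_of K s then 1 else 0)" by (simp add: sum.delta' finite_cells_of[OF K])
  also have "\<dots> = indicator (bis s) x" using s by (auto simp: cells_of_def cells_def indicator_def)
  finally show ?thesis .
qed

text \<open>
  An element of a product of two bisections has a unique factorization, since its range determines the left and
  its source the right factor.
\<close>
lemma atom_bprod_sum:
  assumes K: "finite K" "K \<subseteq> IG" and s: "s \<in> K" and t: "t \<in> K"
  shows "(\<Sum>\<sigma>\<in>cells_of K s. \<Sum>\<tau>\<in>cells_of K t. indicator (bprod G (atom K \<sigma>) (atom K \<tau>)) x) = (indicator (bprod G (bis s) (bis t)) x :: real)"
proof -
  have sub: "atom K \<sigma> \<subseteq> bis u" if "\<sigma> \<in> cells_of K u" for \<sigma> u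
    using that unfolding atom_def cells_of_def by blast
  have b: "bisection G (bis s)" "bisection G (bis t)" using K s t bis(1) by auto
  show ?thesis
  proof (cases "x \<in> bprod G (bis s) (bis t)")
    case False
    have "x \<notin> bprod G (atom K \<sigma>) (atom K \<tau>)" if "\<sigma> \<in> cells_of K s" "\<tau> \<in> cells_of K t" for \<sigma> \<tau>
      using False sub[OF that(1)] sub[OF that(2)] unfolding bprod_def by blast
    then show ?thesis using False by simp
  next
    case True
    then obtain y z where yz: "y \<in> bis s" "z \<in> bis t" "gsrc G y = grng G z" "x = gmult G y z" unfolding bprod_def by blast
    let ?y = "{r \<in> K. y \<in> bis r}" and ?z = "{r \<in> K. z \<in> bis r}"
    have yzc: "?y \<in> cells_of K s" "?z \<in> cells_of K t" using s t yz by (auto simp: cells_of_def cells_def)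
    have comp: "grng G (gmult G y z) = grng G y" "gsrc G (gmult G y z) = gsrc G z"
      if "y \<in> bis s" "z \<in> bis t" "gsrc G y = grng G z" for y z
    proof -
      have "(y, z) \<in> composable G" using that bisection_arrows[OF b(1)] bisection_arrows[OF b(2)] by (intro composableI) auto
      then show "grng G (gmult G y z) = grng G y" "gsrc G (gmult G y z) = gsrc G z" by (simp_all add: rng_mult src_mult)
    qed
    have iff: "x \<in> bprod G (atom K \<sigma>) (atom K \<tau>) \<longleftrightarrow> \<sigma> = ?y \<and> \<tau> = ?z"
      if st: "\<sigma> \<in> cells_of K s" "\<tau> \<in> cells_of K t" for \<sigma> \<tau>
    proof
      assume "x \<in> bprod G (atom K \<sigma>) (atom K \<tau>)"
      then obtain y' z' where h: "y' \<in> atom K \<sigma>" "z' \<in> atom K \<tau>" "gsrc G y' = grng G z'" "x = gmult G y' z'" unfolding bprod_def by blast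
      have h': "y' \<in> bis s" "z' \<in> bis t" using h sub[OF st(1)] sub[OF st(2)] by auto
      have "grng G y' = grng G y" "gsrc G z' = gsrc G z" using comp[OF h' h(3)] comp[OF yz(1,2,3)] h(4) yz(4) by simp_all
      then have "y' = y" "z' = z" using b h' yz by (simp_all add: bisection_def inj_on_def)
      then show "\<sigma> = ?y \<and> \<tau> = ?z" using h st atom_iff unfolding cells_of_def by blast
    next
      assume e: "\<sigma> = ?y \<and> \<tau> = ?z"
      then have "y \<in> atom K \<sigma>" "z \<in> atom K \<tau>" using st atom_iff unfolding cells_of_def by blast+
      then show "x \<in> bprod G (atom K \<sigma>) (atom K \<tau>)" using yz unfolding bprod_def by blast
    qed
    have "(\<Sum>\<sigma>\<in>cells_of K s. \<Sum>\<tau>\<in>cells_of K t. indicator (bprod G (atom K \<sigma>) (atom K \<tau>)) x)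
      = (\<Sum>\<sigma>\<in>cells_of K s. \<Sum>\<tau>\<in>cells_of K t. (if \<sigma> = ?y then 1 else 0) * (if \<tau> = ?z then 1 else 0 :: real))"
      by (intro sum.cong refl) (simp add: indicator_def iff)
    also have "\<dots> = (\<Sum>\<sigma>\<in>cells_of K s. if \<sigma> = ?y then 1 else 0) * (\<Sum>\<tau>\<in>cells_of K t. if \<tau> = ?z then 1 else 0)"
      by (rule sum_product[symmetric])
    also have "\<dots> = 1" using yzc by (simp only: sum.delta finite_cells_of[OF K(1)] if_True mult_1)
    finally show ?thesis using True by simp
  qed
qed

text \<open>
  Two disjoint subsets of one bisection have disjoint sets of ranges and disjoint sets of sources.
\<close>
lemma atom_clash:
  assumes K: "finite K" "K \<subseteq> IG" and \<sigma>: "\<sigma> \<in> cells K" and \<tau>: "\<tau> \<in> cells K" and ne: "\<sigma> \<noteq> \<tau>" "\<sigma> \<inter> \<tau> \<noteq> {}"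
  shows "bprod G (binv G (atom K \<sigma>)) (atom K \<tau>) = {}" "bprod G (atom K \<sigma>) (binv G (atom K \<tau>)) = {}"
proof -
  obtain s where s: "s \<in> \<sigma>" "s \<in> \<tau>" using ne by blast
  then have "s \<in> K" using \<sigma> unfolding cells_def by blast
  then have b: "bisection G (bis s)" using K bis(1) by blast
  have dis: "x \<noteq> y" if "x \<in> atom K \<sigma>" "y \<in> atom K \<tau>" for x y
    using that atom_iff[OF \<sigma>] atom_iff[OF \<tau>] ne(1) by auto
  have sub: "x \<in> bis s" "y \<in> bis s" if "x \<in> atom K \<sigma>" "y \<in> atom K \<tau>" for x y
    using that s unfolding atom_def by auto
  have False if z: "z \<in> bprod G (binv G (atom K \<sigma>)) (atom K \<tau>)" for z
  proof -
    obtain x y where xy: "x \<in> atom K \<sigma>" "y \<in> atom K \<tau>" "gsrc G (ginv G x) = grng G y"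
      using z unfolding bprod_def binv_def by blast
    have "grng G x = grng G y" using xy(3) sub[OF xy(1,2)] bisection_arrows[OF b] by (simp add: src_inv)
    then show False using sub[OF xy(1,2)] dis[OF xy(1,2)] b by (simp add: bisection_def inj_on_def)
  qed
  then show "bprod G (binv G (atom K \<sigma>)) (atom K \<tau>) = {}" by blast
  have False if z: "z \<in> bprod G (atom K \<sigma>) (binv G (atom K \<tau>))" for z
  proof -
    obtain x y where xy: "x \<in> atom K \<sigma>" "y \<in> atom K \<tau>" "gsrc G x = grng G (ginv G y)"
      using z unfolding bprod_def binv_def by blast
    have "gsrc G x = gsrc G y" using xy(3) sub[OF xy(1,2)] bisection_arrows[OF b] by (simp add: rng_inv)
    then show False using sub[OF xy(1,2)] dis[OF xy(1,2)] b by (simp add: bisection_def inj_on_def)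
  qed
  then show "bprod G (atom K \<sigma>) (binv G (atom K \<tau>)) = {}" by blast
qed

lemma V_repr:
  assumes "a \<in> V"
  obtains cs where "a = op_sum N (map (\<lambda>(c, s). op_scale N c s) cs)" "snd ` set cs \<subseteq> IG"
    "lifts N a (\<lambda>f x. \<Sum>p\<leftarrow>cs. fst p * partial_iso_fun G (bis (snd p)) f x)"
proof -
  obtain cs where a: "a = op_sum N (map (\<lambda>(c, s). op_scale N c s) cs)" and cs: "snd ` set cs \<subseteq> IG"
    using assms unfolding lin_span_def Let_def by blast
  have "lifts N a (\<lambda>f x. \<Sum>p\<leftarrow>cs. fst p * partial_iso_fun G (bis (snd p)) f x)"
    unfolding a by (rule lifts_sum) (use cs in \<open>auto intro!: lifts_scale IG_lifts split: prod.split\<close>)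
  with a cs show ?thesis by (rule that)
qed

lemma V_I: "snd ` set cs \<subseteq> IG \<Longrightarrow> op_sum N (map (\<lambda>(c, s). op_scale N c s) cs) \<in> V"
  unfolding lin_span_def Let_def by blast

lemma lifts_combination: "snd ` set cs \<subseteq> IG \<Longrightarrow>
    lifts N (op_sum N (map (\<lambda>(c, s). op_scale N c s) cs)) (\<lambda>f x. \<Sum>p\<leftarrow>cs. fst p * partial_iso_fun G (bis (snd p)) f x)"
  by (rule lifts_sum) (auto intro!: lifts_scale IG_lifts split: prod.split)

lemma V_add: assumes "a \<in> V" "b \<in> V" shows "op_add N a b \<in> V"
proof -
  obtain cs where cs: "snd ` set cs \<subseteq> IG" "lifts N a (\<lambda>f x. \<Sum>p\<leftarrow>cs. fst p * partial_iso_fun G (bis (snd p)) f x)"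
    by (rule V_repr[OF assms(1)])
  obtain ds where ds: "snd ` set ds \<subseteq> IG" "lifts N b (\<lambda>f x. \<Sum>p\<leftarrow>ds. fst p * partial_iso_fun G (bis (snd p)) f x)"
    by (rule V_repr[OF assms(2)])
  have u: "snd ` set (cs @ ds) \<subseteq> IG" using cs(1) ds(1) by auto
  have "op_add N a b = op_sum N (map (\<lambda>(c, s). op_scale N c s) (cs @ ds))"
    by (rule lifts_eqI[OF lifts_add[OF cs(2) ds(2)] lifts_combination[OF u]]) simp
  then show ?thesis using V_I[OF u] by simp
qed

lemma V_scale: assumes "a \<in> V" shows "op_scale N c a \<in> V"
proof -
  obtain cs where cs: "snd ` set cs \<subseteq> IG" "lifts N a (\<lambda>f x. \<Sum>p\<leftarrow>cs. fst p * partial_iso_fun G (bis (snd p)) f x)"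
    by (rule V_repr[OF assms])
  let ?ds = "map (\<lambda>p. (c * fst p, snd p)) cs"
  have u: "snd ` set ?ds \<subseteq> IG" using cs(1) by auto
  have "op_scale N c a = op_sum N (map (\<lambda>(c, s). op_scale N c s) ?ds)"
    by (rule lifts_eqI[OF lifts_scale[OF cs(2)] lifts_combination[OF u]])
      (simp add: o_def sum_list_const_mult mult.assoc)
  then show ?thesis using V_I[OF u] by simp
qed

abbreviation coeff_on :: "'g set \<Rightarrow> 'g l2_op \<Rightarrow> complex" where
  "coeff_on C a \<equiv> l2_inner N (a (unit_vec G \<mu>)) (l2_class N (indicator C)) / complex_of_real (measure N C)"

lemma coeff_on_add:
  assumes a: "a \<in> V" and b: "b \<in> V" and C: "bisection G C"
  shows "coeff_on C (op_add N a b) = coeff_on C a + coeff_on C b"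
proof -
  let ?u = "indicator (gunits G) :: 'g \<Rightarrow> complex"
  obtain F where F: "lifts N a F" using V_lifts[OF a] by blast
  obtain F' where F': "lifts N b F'" using V_lifts[OF b] by blast
  have u: "?u \<in> l2_fun N" "(indicator C :: 'g \<Rightarrow> complex) \<in> l2_fun N" using l2_indicator C bisection_units by auto
  have i: "integrable N (\<lambda>x. F ?u x * cnj (indicator C x))" "integrable N (\<lambda>x. F' ?u x * cnj (indicator C x))"
    by (intro integrable_l2_mult liftsD(1)[OF F] liftsD(1)[OF F'] u)+
  have "(\<integral>x. (F ?u x + F' ?u x) * cnj (indicator C x) \<partial>N) = (\<integral>x. F ?u x * cnj (indicator C x) + F' ?u x * cnj (indicator C x) \<partial>N)"
    by (simp only: distrib_right)
  also have "\<dots> = (\<integral>x. F ?u x * cnj (indicator C x) \<partial>N) + (\<integral>x. F' ?u x * cnj (indicator C x) \<partial>N)"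
    by (rule Bochner_Integration.integral_add[OF i])
  finally show ?thesis unfolding inner_lift[OF lifts_add[OF F F'] C] inner_lift[OF F C] inner_lift[OF F' C]
    by (simp only: add_divide_distrib)
qed

lemma coeff_on_scale:
  assumes a: "a \<in> V" and C: "bisection G C" shows "coeff_on C (op_scale N c a) = c * coeff_on C a"
proof -
  obtain F where F: "lifts N a F" using V_lifts[OF a] by blast
  show ?thesis unfolding inner_lift[OF lifts_scale[OF F] C] inner_lift[OF F C] mult.assoc by simp
qed

text \<open>
  The coefficient at a cell is the mean value over it of the function \<open>a 1\<close>, where \<open>1\<close> is the indicator
  function of the units. This is linear in \<open>a\<close> for every operator in the span of the semigroup and yields the value 1 or 0
  for an element of \<open>K\<close>. For null cells the division makes the coefficient 0.
\<close>
definition psi :: "'g l2_op set \<Rightarrow> ('g l2_op set \<Rightarrow> nat \<Rightarrow> nat \<Rightarrow> real) \<Rightarrow> nat \<Rightarrow> 'g l2_op \<Rightarrow> complex mat" where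
  "psi K A d = (\<lambda>a\<in>V. mat d d (\<lambda>(i, j). \<Sum>\<sigma>\<in>cells K. coeff_on (atom K \<sigma>) a * complex_of_real (A \<sigma> i j)))"

lemma psi_linear: assumes K: "finite K" "K \<subseteq> IG" shows "psi K A d \<in> linear_maps G \<mu> d"
proof -
  have e: "psi K A d a = mat d d (\<lambda>(i, j). \<Sum>\<sigma>\<in>cells K. coeff_on (atom K \<sigma>) a * complex_of_real (A \<sigma> i j))" if "a \<in> V" for a
    using that by (simp add: psi_def)
  have 1: "psi K A d \<in> V \<rightarrow>\<^sub>E carrier_mat d d" by (rule PiE_I) (simp_all add: psi_def)
  have 2: "psi K A d (op_add N a b) = psi K A d a + psi K A d b" if ab: "a \<in> V" "b \<in> V" for a b
  proof (rule eq_matI)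
    fix i j assume "i < dim_row (psi K A d a + psi K A d b)" "j < dim_col (psi K A d a + psi K A d b)"
    then have ij: "i < d" "j < d" by (simp_all add: e ab)
    have "(\<Sum>\<sigma>\<in>cells K. coeff_on (atom K \<sigma>) (op_add N a b) * complex_of_real (A \<sigma> i j)) =
      (\<Sum>\<sigma>\<in>cells K. coeff_on (atom K \<sigma>) a * complex_of_real (A \<sigma> i j) + coeff_on (atom K \<sigma>) b * complex_of_real (A \<sigma> i j))"
    proof (rule sum.cong[OF refl])
      fix \<sigma> assume "\<sigma> \<in> cells K"
      from coeff_on_add[OF ab atom_bisection[OF K this]]
      show "coeff_on (atom K \<sigma>) (op_add N a b) * complex_of_real (A \<sigma> i j) =
        coeff_on (atom K \<sigma>) a * complex_of_real (A \<sigma> i j) + coeff_on (atom K \<sigma>) b * complex_of_real (A \<sigma> i j)"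
        by (simp only: distrib_right)
    qed
    then show "psi K A d (op_add N a b) $$ (i, j) = (psi K A d a + psi K A d b) $$ (i, j)"
      using ij by (simp add: e ab V_add sum.distrib)
  qed (simp_all add: e ab V_add)
  have 3: "psi K A d (op_scale N c a) = c \<cdot>\<^sub>m psi K A d a" if a: "a \<in> V" for c a
  proof (rule eq_matI)
    fix i j assume "i < dim_row (c \<cdot>\<^sub>m psi K A d a)" "j < dim_col (c \<cdot>\<^sub>m psi K A d a)"
    then have ij: "i < d" "j < d" by (simp_all add: e a)
    have "(\<Sum>\<sigma>\<in>cells K. coeff_on (atom K \<sigma>) (op_scale N c a) * complex_of_real (A \<sigma> i j)) =
      (\<Sum>\<sigma>\<in>cells K. c * (coeff_on (atom K \<sigma>) a * complex_of_real (A \<sigma> i j)))"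
    proof (rule sum.cong[OF refl])
      fix \<sigma> assume "\<sigma> \<in> cells K"
      from coeff_on_scale[OF a atom_bisection[OF K this]]
      show "coeff_on (atom K \<sigma>) (op_scale N c a) * complex_of_real (A \<sigma> i j) = c * (coeff_on (atom K \<sigma>) a * complex_of_real (A \<sigma> i j))"
        by (simp only: mult.assoc)
    qed
    then show "psi K A d (op_scale N c a) $$ (i, j) = (c \<cdot>\<^sub>m psi K A d a) $$ (i, j)"
      using ij by (simp add: e a V_scale sum_distrib_left)
  qed (simp_all add: e a V_scale)
  show ?thesis unfolding linear_maps_def Let_def using 1 2 3 by blast
qed

text \<open>
  The function \<open>s 1\<close> is the indicator function of the bisection of \<open>s\<close>, which contains a cell or is
  disjoint from it.
\<close>
lemma psi_value:
  assumes K: "finite K" "K \<subseteq> IG" and s: "s \<in> K"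
    and null: "\<And>\<sigma> i j. \<sigma> \<in> cells K \<Longrightarrow> measure N (atom K \<sigma>) = 0 \<Longrightarrow> i < d \<Longrightarrow> j < d \<Longrightarrow> A \<sigma> i j = 0"
  shows "real_mat d (psi K A d s)" "\<And>i j. i < d \<Longrightarrow> j < d \<Longrightarrow> rent (psi K A d s) i j = (\<Sum>\<sigma>\<in>cells_of K s. A \<sigma> i j)"
proof -
  have sI: "s \<in> IG" using s K by auto
  have coeff: "coeff_on (atom K \<sigma>) s * complex_of_real (A \<sigma> i j) = complex_of_real (if s \<in> \<sigma> then A \<sigma> i j else 0)"
    if \<sigma>: "\<sigma> \<in> cells K" and ij: "i < d" "j < d" for \<sigma> i j
  proof -
    have "bis s \<inter> atom K \<sigma> = (if s \<in> \<sigma> then atom K \<sigma> else {})" using s unfolding atom_def by auto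
    moreover have "l2_inner N (s (unit_vec G \<mu>)) (l2_class N (indicator (atom K \<sigma>))) = complex_of_real (measure N (bis s \<inter> atom K \<sigma>))"
      using inner_pis[OF bis(1)[OF sI] atom_bisection[OF K \<sigma>]] bis(2)[OF sI] by simp
    ultimately show ?thesis using null[OF \<sigma> _ ij] by (cases "measure N (atom K \<sigma>) = 0") auto
  qed
  have e: "psi K A d s $$ (i, j) = complex_of_real (\<Sum>\<sigma>\<in>cells_of K s. A \<sigma> i j)" if ij: "i < d" "j < d" for i j
  proof -
    have "psi K A d s $$ (i, j) = (\<Sum>\<sigma>\<in>cells K. coeff_on (atom K \<sigma>) s * complex_of_real (A \<sigma> i j))"
      using ij IG_V[OF sI] by (simp add: psi_def)
    also have "\<dots> = (\<Sum>\<sigma>\<in>cells K. complex_of_real (if s \<in> \<sigma> then A \<sigma> i j else 0))"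
      by (intro sum.cong refl coeff ij)
    also have "\<dots> = complex_of_real (\<Sum>\<sigma>\<in>cells K. if s \<in> \<sigma> then A \<sigma> i j else 0)" by simp
    also have "(\<Sum>\<sigma>\<in>cells K. if s \<in> \<sigma> then A \<sigma> i j else 0) = (\<Sum>\<sigma>\<in>cells_of K s. A \<sigma> i j)"
      unfolding cells_of_def using finite_cells[OF K(1)] by (simp add: sum.inter_filter)
    finally show ?thesis .
  qed
  have c: "psi K A d s \<in> carrier_mat d d" using IG_V[OF sI] by (simp add: psi_def)
  show "real_mat d (psi K A d s)" by (rule real_matI(1)[OF c e])
  show "rent (psi K A d s) i j = (\<Sum>\<sigma>\<in>cells_of K s. A \<sigma> i j)" if "i < d" "j < d" for i j by (rule real_matI(2)[OF c e that])
qed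

lemma set_pow_upto_facts:
  assumes F: "finite F" "F \<subseteq> IG" and n: "1 \<le> n"
  defines "K \<equiv> set_pow_upto G \<mu> (sym_set G \<mu> F) n"
  shows "finite K" "K \<subseteq> IG" "sym_set G \<mu> F \<subseteq> K"
    and "\<And>ss. length ss \<in> {1..n} \<Longrightarrow> set ss \<subseteq> sym_set G \<mu> F \<Longrightarrow> op_prod N ss \<in> K"
proof -
  have fs: "finite (sym_set G \<mu> F)" using F unfolding sym_set_def by simp
  have IG: "sym_set G \<mu> F \<subseteq> IG" by (rule sym_set_IG[OF F(2)])
  have "K = (\<Union>k\<in>{1..n}. op_prod N ` {ss. set ss \<subseteq> sym_set G \<mu> F \<and> length ss = k})"
    unfolding K_def set_pow_upto_def set_pow_def by blast
  then show "finite K" using fs by (simp add: finite_lists_length_eq)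
  show "K \<subseteq> IG"
  proof
    fix t assume "t \<in> K"
    then obtain k ss where "k \<in> {1..n}" "t = op_prod N ss" "length ss = k" "set ss \<subseteq> sym_set G \<mu> F"
      unfolding K_def set_pow_upto_def set_pow_def by blast
    then show "t \<in> IG" using IG by (auto intro!: op_prod_IG)
  qed
  show K: "op_prod N ss \<in> K" if "length ss \<in> {1..n}" "set ss \<subseteq> sym_set G \<mu> F" for ss
    unfolding K_def set_pow_upto_def set_pow_def using that by blast
  show "sym_set G \<mu> F \<subseteq> K"
  proof
    fix s assume s: "s \<in> sym_set G \<mu> F"
    then have "op_prod N [s] \<in> K" using n by (intro K) auto
    then show "s \<in> K" using op_prod_single[of s] s IG by auto
  qed
qed

text \<open>
  Approximate multiplicativity on pairs suffices, since each factor that is split off a product of length at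
  most \<open>n\<close> costs the same error \<open>\<theta>\<close>.
\<close>
lemma psi_SA:
  assumes F: "finite F" "F \<subseteq> IG" and n: "1 \<le> n" and \<delta>: "0 < \<delta>" and K_def: "K = set_pow_upto G \<mu> (sym_set G \<mu> F) n"
    and null: "\<And>\<sigma> i j. \<sigma> \<in> cells K \<Longrightarrow> measure N (atom K \<sigma>) = 0 \<Longrightarrow> i < d \<Longrightarrow> j < d \<Longrightarrow> A \<sigma> i j = 0"
    and S_def: "\<And>s. S s = (\<lambda>i j. \<Sum>\<sigma>\<in>cells_of K s. A \<sigma> i j)"
    and S: "\<And>s. s \<in> K \<Longrightarrow> ppm d (S s)"
    and mult: "\<And>s t. s \<in> K \<Longrightarrow> t \<in> K \<Longrightarrow> op_mult N s t \<in> K \<Longrightarrow> nrm d (\<lambda>i j. S (op_mult N s t) i j - mm d (S s) (S t) i j) \<le> \<theta>"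
    and \<theta>: "0 \<le> \<theta>" "real n * \<theta> < \<delta>"
    and trace: "\<And>s. s \<in> K \<Longrightarrow> \<bar>tr d (S s) - measure N (bis s \<inter> gunits G)\<bar> < \<delta>"
  shows "psi K A d \<in> SA G \<mu> F n \<delta> d"
proof -
  note K = set_pow_upto_facts[OF F n, folded K_def]
  let ?\<psi> = "psi K A d"
  have r: "real_mat d (?\<psi> s)" and v: "\<And>i j. i < d \<Longrightarrow> j < d \<Longrightarrow> rent (?\<psi> s) i j = S s i j" if "s \<in> K" for s
    unfolding S_def by (rule psi_value[OF K(1,2) that null]; assumption)+
  have sI: "sym_set G \<mu> F \<subseteq> IG" using K(2,3) by blast
  have prod: "nrm d (\<lambda>i j. S (op_prod N ss) i j - mlist d (map S ss) i j) \<le> real (length ss) * \<theta>"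
    if "length ss \<in> {1..n}" "set ss \<subseteq> sym_set G \<mu> F" for ss
    using that
  proof (induction ss)
    case (Cons s ss)
    have s: "s \<in> K" "s \<in> IG" using Cons.prems K(3) sI by auto
    show ?case
    proof (cases "ss = []")
      case True
      have "nrm d (\<lambda>i j. S s i j - mm d (S s) idm i j) = nrm d (\<lambda>i j. 0)"
        by (rule nrm_cong) (simp add: mm_idm_right)
      then show ?thesis using True \<theta>(1) op_prod_single[OF s(2)] by simp
    next
      case False
      then have len: "length ss \<in> {1..n}" "set ss \<subseteq> sym_set G \<mu> F" using Cons.prems by (auto simp: Suc_le_eq)
      let ?t = "op_prod N ss"
      have t: "?t \<in> K" by (rule K(4)[OF len])
      have st: "op_mult N s ?t \<in> K" using K(4)[OF Cons.prems] by simp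
      have "nrm d (\<lambda>i j. S (op_mult N s ?t) i j - mm d (S s) (mlist d (map S ss)) i j) \<le>
        nrm d (\<lambda>i j. S (op_mult N s ?t) i j - mm d (S s) (S ?t) i j) + nrm d (\<lambda>i j. mm d (S s) (S ?t) i j - mm d (S s) (mlist d (map S ss)) i j)"
        by (rule nrm_dist_triangle)
      also have "\<dots> \<le> \<theta> + nrm d (\<lambda>i j. S ?t i j - mlist d (map S ss) i j)"
        unfolding mm_diff_right[symmetric] by (intro add_mono mult s t st nrm_mm_ppm S)
      also have "\<dots> \<le> \<theta> + real (length ss) * \<theta>" using Cons.IH[OF len] by simp
      finally show ?thesis by (simp add: algebra_simps)
    qed
  qed simp
  show ?thesis
    unfolding SA_def
  proof (intro CollectI conjI allI impI ballI)
    show "?\<psi> \<in> linear_maps G \<mu> d" by (rule psi_linear[OF K(1,2)])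
    show "?\<psi> ` set_pow_upto G \<mu> (sym_set G \<mu> F) n \<subseteq> partial_perm_mats d"
      unfolding K_def[symmetric]
    proof (rule image_subsetI)
      fix s assume s: "s \<in> K"
      have "ppm d (rent (?\<psi> s))" using S[OF s] v[OF s] unfolding ppm_def by simp
      then show "?\<psi> s \<in> partial_perm_mats d" by (rule partial_perm_matsI[OF r[OF s]])
    qed
    show "cmod (ntr (?\<psi> s) - vn_trace G \<mu> s) < \<delta>" if "s \<in> set_pow_upto G \<mu> (sym_set G \<mu> F) n" for s
    proof -
      have s: "s \<in> K" using that K_def by simp
      then have "s \<in> IG" using K(2) by blast
      then have t: "vn_trace G \<mu> s = complex_of_real (measure N (bis s \<inter> gunits G))" using trace_pis[OF bis(1)] bis(2) by metis
      have "tr d (rent (?\<psi> s)) = tr d (S s)" by (rule tr_cong) (simp add: v[OF s])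
      then have "ntr (?\<psi> s) - vn_trace G \<mu> s = complex_of_real (tr d (S s) - measure N (bis s \<inter> gunits G))"
        unfolding t ntr_real[OF r[OF s]] by simp
      then show ?thesis using trace[OF s] by (simp only: norm_of_real)
    qed
    show "mat_norm2 (?\<psi> (op_prod N ss) - mat_prod d (map ?\<psi> ss)) < \<delta>"
      if ss: "length ss \<in> {1..n} \<and> set ss \<subseteq> sym_set G \<mu> F" for ss
    proof -
      have w: "op_prod N ss \<in> K" using ss K(4) by blast
      have sK: "set ss \<subseteq> K" using ss K(3) by blast
      have "\<And>B. B \<in> set (map ?\<psi> ss) \<Longrightarrow> real_mat d B" using sK r by auto
      then have mp: "real_mat d (mat_prod d (map ?\<psi> ss)) \<and> (\<forall>i<d. \<forall>j<d. rent (mat_prod d (map ?\<psi> ss)) i j = mlist d (map rent (map ?\<psi> ss)) i j)"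
        by (rule real_mat_prod)
      have ml: "mlist d (map rent (map ?\<psi> ss)) i j = mlist d (map S ss) i j" if "i < d" "j < d" for i j
        using sK that
      proof (induction ss arbitrary: i j)
        case (Cons s ss)
        have sK': "s \<in> K" "set ss \<subseteq> K" using Cons.prems(1) by auto
        show ?case unfolding list.map mlist_simps
          by (rule mm_cong) (use v[OF sK'(1)] Cons.IH[OF sK'(2)] Cons.prems in auto)
      qed simp
      have "mat_norm2 (?\<psi> (op_prod N ss) - mat_prod d (map ?\<psi> ss)) = nrm d (rent (?\<psi> (op_prod N ss) - mat_prod d (map ?\<psi> ss)))"
        by (rule mat_norm2_real[OF real_mat_minus(1)[OF r[OF w] conjunct1[OF mp]]])
      also have "\<dots> = nrm d (\<lambda>i j. S (op_prod N ss) i j - mlist d (map S ss) i j)"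
        by (rule nrm_cong) (use mp in \<open>simp add: real_mat_minus(2)[OF r[OF w] conjunct1[OF mp]] v[OF w] ml[simplified]\<close>)
      also have "\<dots> \<le> real (length ss) * \<theta>" using prod ss by blast
      also have "\<dots> \<le> real n * \<theta>" using ss \<theta>(1) by (intro mult_right_mono) auto
      also have "\<dots> < \<delta>" by (rule \<theta>(2))
      finally show ?thesis .
    qed
  qed
qed

end

section \<open>Sofic approximations of the semigroup built from those of a generating set\<close>

lemma tr_sum: "tr d (\<lambda>i j. \<Sum>a\<in>A. f a i j) = (\<Sum>a\<in>A. tr d (f a))"
  unfolding tr_def sum_divide_distrib[symmetric] by (subst sum.swap) (rule refl)

context pmp_groupoid
begin

lemma bdist_bis_mult:
  assumes D: "D \<in> IG" "E \<in> IG" and B: "bisection G B" "bisection G C"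
  shows "bdist (bis (op_mult N D E)) (bprod G B C) \<le> bdist (bis D) B + bdist (bis E) C"
proof -
  note b = bis[OF D(1)] bis[OF D(2)]
  have P: "bisection G (bprod G (bis D) (bis E))" "bisection G (bprod G B C)" using b B bprod_bisection by auto
  have e: "op_mult N D E = pis (bprod G (bis D) (bis E))" using pis_mult[OF b(1,3)] b(2,4) by simp
  have "bdist (bis (op_mult N D E)) (bprod G B C) \<le>
    bdist (bis (op_mult N D E)) (bprod G (bis D) (bis E)) + bdist (bprod G (bis D) (bis E)) (bprod G B C)"
    unfolding e by (rule bdist_triangle[OF bis(1)[OF IG_I[OF P(1)]] P])
  then show ?thesis using bis_pis[OF P(1)] bdist_bprod[OF b(1,3) B] by (simp add: e)
qed

lemma bdist_bis_adj:
  assumes D: "D \<in> IG" and B: "bisection G B"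
  shows "bdist (bis (op_adj N D)) (binv G B) \<le> bdist (bis D) B"
proof -
  note b = bis[OF D]
  have P: "bisection G (binv G (bis D))" "bisection G (binv G B)" using b B bisection_binv by auto
  have e: "op_adj N D = pis (binv G (bis D))" using pis_adj[OF b(1)] b(2) by simp
  have "bdist (bis (op_adj N D)) (binv G B) \<le> bdist (bis (op_adj N D)) (binv G (bis D)) + bdist (binv G (bis D)) (binv G B)"
    unfolding e by (rule bdist_triangle[OF bis(1)[OF IG_I[OF P(1)]] P])
  then show ?thesis using bis_pis[OF P(1)] bdist_binv[OF b(1) B] by (simp add: e)
qed

text \<open>
  For a null cell the zero operator is chosen. Its matrix vanishes, in agreement with the coefficient that \<open>psi\<close>
  assigns to this cell.
\<close>
lemma cell_approx:
  assumes \<Omega>: "dense \<Omega>" and K: "finite K" "K \<subseteq> IG" and \<epsilon>: "0 < \<epsilon>"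
  shows "\<exists>D. \<forall>\<sigma>\<in>cells K. D \<sigma> \<in> wsums \<Omega> \<and> bdist (bis (D \<sigma>)) (atom K \<sigma>) \<le> \<epsilon> \<and> (measure N (atom K \<sigma>) = 0 \<longrightarrow> D \<sigma> = op_zero N)"
proof (rule bchoice, rule ballI)
  fix \<sigma> assume \<sigma>: "\<sigma> \<in> cells K"
  have b: "bisection G (atom K \<sigma>)" by (rule atom_bisection[OF K \<sigma>])
  show "\<exists>D. D \<in> wsums \<Omega> \<and> bdist (bis D) (atom K \<sigma>) \<le> \<epsilon> \<and> (measure N (atom K \<sigma>) = 0 \<longrightarrow> D = op_zero N)"
  proof (cases "measure N (atom K \<sigma>) = 0")
    case True
    have "bdist (bis (op_zero N)) (atom K \<sigma>) \<le> bdist (bis (op_zero N)) {} + bdist {} (atom K \<sigma>)"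
      using IG_I[OF bisection_empty] by (intro bdist_triangle bisection_empty b bis) (simp add: pis_empty)
    also have "bdist (bis (op_zero N)) {} = 0" using bis_pis[OF bisection_empty] by (simp add: pis_empty)
    also have "bdist {} (atom K \<sigma>) = 0" using True by (simp add: bdist_def)
    finally show ?thesis using zero_wsums \<epsilon> by (intro exI[of _ "op_zero N"]) simp
  next
    case False
    obtain D where "D \<in> wsums \<Omega>" "bdist (atom K \<sigma>) (bis D) < \<epsilon>" using dense_approx[OF \<Omega> b \<epsilon>] by blast
    then show ?thesis using False by (intro exI[of _ D]) (simp add: bdist_commute)
  qed
qed

lemma measure_inter_atom_sum:
  assumes K: "finite K" "K \<subseteq> IG" and s: "s \<in> K" and U: "U \<in> sets N"
  shows "measure N (bis s \<inter> U) = (\<Sum>\<sigma>\<in>cells_of K s. measure N (atom K \<sigma> \<inter> U))"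
proof -
  have m: "measure N (B \<inter> U) = (\<integral>x. indicat_real B x * indicator U x \<partial>N)" and i: "integrable N (\<lambda>x. indicat_real B x * indicator U x)"
    if B: "bisection G B" for B
  proof -
    have s: "B \<inter> U \<in> sets N" using U bisection_sets[OF B] by auto
    have f: "B \<inter> U \<in> fmeasurable N" using s by (intro fmeasurable_bisection bisection_subset[OF B]) auto
    have "B \<inter> U \<inter> space N = B \<inter> U" using sets.sets_into_space[OF s] by blast
    then show "measure N (B \<inter> U) = (\<integral>x. indicat_real B x * indicator U x \<partial>N)"
      unfolding indicator_inter_arith[symmetric] by simp
    show "integrable N (\<lambda>x. indicat_real B x * indicator U x)"
      unfolding indicator_inter_arith[symmetric] using f by (simp add: fmeasurable_def integrable_indicator_iff)
  qed
  have "bisection G (bis s)" using s K bis(1) by blast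
  note ms = m[OF this]
  have at: "bisection G (atom K \<sigma>)" if "\<sigma> \<in> cells_of K s" for \<sigma> using that atom_bisection[OF K] by (simp add: cells_of_def)
  have "(\<integral>x. indicat_real (bis s) x * indicator U x \<partial>N) = (\<integral>x. (\<Sum>\<sigma>\<in>cells_of K s. indicat_real (atom K \<sigma>) x * indicator U x) \<partial>N)"
    unfolding sum_distrib_right[symmetric] atom_sum[OF K(1) s] by (rule refl)
  also have "\<dots> = (\<Sum>\<sigma>\<in>cells_of K s. \<integral>x. indicat_real (atom K \<sigma>) x * indicator U x \<partial>N)"
    by (rule Bochner_Integration.integral_sum) (rule i[OF at])
  finally show ?thesis unfolding ms using m[OF at] by simp
qed

text \<open>
  \<open>D\<close> assigns to each cell its model, a sum of words. The matrices of a sofic approximation are evaluated on these models.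
\<close>
definition near :: "'g l2_op set \<Rightarrow> ('g l2_op set \<Rightarrow> 'g l2_op) \<Rightarrow> 'g l2_op set \<Rightarrow> real \<Rightarrow> bool" where
  "near \<Omega> D K \<epsilon> \<longleftrightarrow> \<Omega> \<subseteq> IG \<and> finite K \<and> K \<subseteq> IG \<and> (\<forall>\<sigma>\<in>cells K. D \<sigma> \<in> wsums \<Omega> \<and> bdist (bis (D \<sigma>)) (atom K \<sigma>) \<le> \<epsilon>)"

definition rcell :: "('g l2_op set \<Rightarrow> 'g l2_op) \<Rightarrow> nat \<times> ('g l2_op \<Rightarrow> complex mat) \<Rightarrow> 'g l2_op set \<Rightarrow> nat \<Rightarrow> nat \<Rightarrow> real" where
  "rcell D p \<sigma> = rnd (fst p) (val (D \<sigma>) p)"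

text \<open>
  The other cells that share a bisection with \<open>\<sigma>\<close>; sources and ranges of these must not be met by \<open>\<sigma>\<close>.
\<close>
definition clash :: "'g l2_op set \<Rightarrow> 'g l2_op set \<Rightarrow> 'g l2_op set set" where
  "clash K \<sigma> = {\<tau> \<in> cells K. \<tau> \<noteq> \<sigma> \<and> \<sigma> \<inter> \<tau> \<noteq> {}}"

definition scell :: "'g l2_op set \<Rightarrow> ('g l2_op set \<Rightarrow> 'g l2_op) \<Rightarrow> nat \<times> ('g l2_op \<Rightarrow> complex mat) \<Rightarrow> 'g l2_op set \<Rightarrow> nat \<Rightarrow> nat \<Rightarrow> real" where
  "scell K D p \<sigma> = separate (fst p) (rcell D p) (clash K \<sigma>) \<sigma>"

lemma ppm_rcell: "ppm (fst p) (rcell D p \<sigma>)"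
  unfolding rcell_def by (rule ppm_rnd)

lemma nearD:
  assumes "near \<Omega> D K \<epsilon>"
  shows "\<Omega> \<subseteq> IG" "finite K" "K \<subseteq> IG" "\<And>\<sigma>. \<sigma> \<in> cells K \<Longrightarrow> D \<sigma> \<in> wsums \<Omega>" "\<And>\<sigma>. \<sigma> \<in> cells K \<Longrightarrow> D \<sigma> \<in> IG"
    "\<And>\<sigma>. \<sigma> \<in> cells K \<Longrightarrow> bdist (bis (D \<sigma>)) (atom K \<sigma>) \<le> \<epsilon>"
    "\<And>\<sigma>. \<sigma> \<in> cells K \<Longrightarrow> aeq (SAf \<Omega>) (\<lambda>p. rcell D p \<sigma>) (val (D \<sigma>))" "\<And>\<sigma>. mbd (SAf \<Omega>) (\<lambda>p. rcell D p \<sigma>)"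
proof -
  show 1: "\<Omega> \<subseteq> IG" "finite K" "K \<subseteq> IG" and 2: "\<And>\<sigma>. \<sigma> \<in> cells K \<Longrightarrow> D \<sigma> \<in> wsums \<Omega>"
    and "\<And>\<sigma>. \<sigma> \<in> cells K \<Longrightarrow> bdist (bis (D \<sigma>)) (atom K \<sigma>) \<le> \<epsilon>"
    using assms unfolding near_def by blast+
  show "D \<sigma> \<in> IG" if "\<sigma> \<in> cells K" for \<sigma> using 2[OF that] by (auto elim: wsumsE)
  show "aeq (SAf \<Omega>) (\<lambda>p. rcell D p \<sigma>) (val (D \<sigma>))" if "\<sigma> \<in> cells K" for \<sigma>
    unfolding rcell_def by (rule wsum_round[OF 1(1) 2[OF that]])
  show "mbd (SAf \<Omega>) (\<lambda>p. rcell D p \<sigma>)" for \<sigma> by (rule mbd_ppm) (simp add: ppm_rcell)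
qed

lemma rcell_mult_aeq:
  assumes n: "near \<Omega> D K \<epsilon>" and c: "\<sigma> \<in> cells K" "\<tau> \<in> cells K"
  shows "aeq (SAf \<Omega>) (\<lambda>p. mm (fst p) (rcell D p \<sigma>) (rcell D p \<tau>)) (val (op_mult N (D \<sigma>) (D \<tau>)))"
    "aeq (SAf \<Omega>) (\<lambda>p. mm (fst p) (tp (rcell D p \<sigma>)) (rcell D p \<tau>)) (val (op_mult N (op_adj N (D \<sigma>)) (D \<tau>)))"
    "aeq (SAf \<Omega>) (\<lambda>p. mm (fst p) (rcell D p \<sigma>) (tp (rcell D p \<tau>))) (val (op_mult N (D \<sigma>) (op_adj N (D \<tau>))))"
proof -
  note n = nearD[OF n]
  have *: "aeq (SAf \<Omega>) (\<lambda>p. mm (fst p) (X p) (Y p)) (val (op_mult N D' E'))"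
    if "aeq (SAf \<Omega>) X (val D')" "aeq (SAf \<Omega>) Y (val E')" "mbd (SAf \<Omega>) Y" "D' \<in> wsums \<Omega>" "E' \<in> wsums \<Omega>" for X Y D' E'
    by (rule aeq_trans[OF aeq_mm[OF that(1,2) wsum_mbd[OF n(1) that(4)] that(3)] aeq_sym[OF wsum_mult[OF n(1) that(4,5)]]])
  have a: "aeq (SAf \<Omega>) (\<lambda>p. tp (rcell D p \<sigma>)) (val (op_adj N (D \<sigma>)))" if "\<sigma> \<in> cells K" for \<sigma>
    by (rule aeq_trans[OF aeq_tp[OF n(7)[OF that]] aeq_sym[OF wsum_adj[OF n(1) n(4)[OF that]]]])
  note w = wsums_adj[OF n(1) n(4)]
  show "aeq (SAf \<Omega>) (\<lambda>p. mm (fst p) (rcell D p \<sigma>) (rcell D p \<tau>)) (val (op_mult N (D \<sigma>) (D \<tau>)))"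
    by (intro * n c)
  show "aeq (SAf \<Omega>) (\<lambda>p. mm (fst p) (tp (rcell D p \<sigma>)) (rcell D p \<tau>)) (val (op_mult N (op_adj N (D \<sigma>)) (D \<tau>)))"
    by (intro * n c a w)
  show "aeq (SAf \<Omega>) (\<lambda>p. mm (fst p) (rcell D p \<sigma>) (tp (rcell D p \<tau>))) (val (op_mult N (D \<sigma>) (op_adj N (D \<tau>))))"
    by (intro * n c a w mbd_tp)
qed

text \<open>
  By \<open>atom_clash\<close> the products that measure the clash of two models are models of the empty set, hence
  small. At most \<open>2 card (cells K)\<close> of them enter into \<open>nrm_separate\<close>, which leads to the bound for \<open>\<epsilon>\<close>.
\<close>
lemma scell_close:
  assumes near: "near \<Omega> D K \<epsilon>" and \<eta>: "0 < \<eta>" and small: "4 * \<epsilon> < (\<eta> / (2 * (real (card (cells K)) + 1)))\<^sup>2"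
  shows "\<forall>\<^sub>F p in SAf \<Omega>. \<forall>\<sigma>\<in>cells K. nrm (fst p) (\<lambda>i j. scell K D p \<sigma> i j - rcell D p \<sigma> i j) < \<eta>"
proof (rule eventually_ball_finite)
  note n = nearD[OF near]
  show fin: "finite (cells K)" by (rule finite_cells[OF n(2)])
  define q where "q = real (card (cells K))"
  define h where "h = \<eta> / (2 * (q + 1))"
  have q: "0 \<le> q" by (simp add: q_def)
  have h: "0 < h" using \<eta> q by (simp add: h_def)
  have hs: "4 * \<epsilon> < h\<^sup>2" using small by (simp add: h_def q_def)
  have bound: "\<forall>\<^sub>F p in SAf \<Omega>. nrm (fst p) (X p) < h"
    if X: "aeq (SAf \<Omega>) X (val E)" and E: "E \<in> wsums \<Omega>" and d: "bdist (bis E) {} \<le> 2 * \<epsilon>" for X E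
  proof -
    have "\<forall>\<^sub>F p in SAf \<Omega>. nrm (fst p) (\<lambda>a b. \<Sum>i\<in>{()}. 1 * X p a b) < h"
      by (rule asymptotic_bound[OF n(1), where D = "\<lambda>_. E" and C = "\<lambda>_. {}", OF _ _ _ _ _ bisection_empty bisection_empty])
        (use X E d h hs in \<open>auto intro: bisection_empty\<close>)
    then show ?thesis by simp
  qed
  show "\<forall>\<sigma>\<in>cells K. \<forall>\<^sub>F p in SAf \<Omega>. nrm (fst p) (\<lambda>i j. scell K D p \<sigma> i j - rcell D p \<sigma> i j) < \<eta>"
  proof
    fix \<sigma> assume \<sigma>: "\<sigma> \<in> cells K"
    have fc: "finite (clash K \<sigma>)" using fin by (simp add: clash_def)
    have cc: "card (clash K \<sigma>) \<le> card (cells K)" by (rule card_mono[OF fin]) (auto simp: clash_def)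
    have "\<forall>\<^sub>F p in SAf \<Omega>. \<forall>\<tau>\<in>clash K \<sigma>. nrm (fst p) (mm (fst p) (tp (rcell D p \<sigma>)) (rcell D p \<tau>)) < h
        \<and> nrm (fst p) (mm (fst p) (rcell D p \<sigma>) (tp (rcell D p \<tau>))) < h"
    proof (rule eventually_ball_finite[OF fc], rule ballI)
      fix \<tau> assume "\<tau> \<in> clash K \<sigma>"
      then have \<tau>: "\<tau> \<in> cells K" "\<sigma> \<noteq> \<tau>" "\<sigma> \<inter> \<tau> \<noteq> {}" by (auto simp: clash_def)
      note clash = atom_clash[OF n(2,3) \<sigma> \<tau>]
      note b = atom_bisection[OF n(2,3)]
      note w = wsums_adj[OF n(1) n(4)]
      have wI: "op_adj N (D \<rho>) \<in> IG" if "\<rho> \<in> cells K" for \<rho> using w[OF that] by (auto elim: wsumsE)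
      have "bdist (bis (op_mult N (op_adj N (D \<sigma>)) (D \<tau>))) {} \<le> bdist (bis (op_adj N (D \<sigma>))) (binv G (atom K \<sigma>)) + bdist (bis (D \<tau>)) (atom K \<tau>)"
        using bdist_bis_mult[OF wI[OF \<sigma>] n(5)[OF \<tau>(1)] bisection_binv[OF b[OF \<sigma>]] b[OF \<tau>(1)]] clash(1) by simp
      also have "\<dots> \<le> 2 * \<epsilon>" using bdist_bis_adj[OF n(5)[OF \<sigma>] b[OF \<sigma>]] n(6)[OF \<sigma>] n(6)[OF \<tau>(1)] by simp
      finally have 1: "bdist (bis (op_mult N (op_adj N (D \<sigma>)) (D \<tau>))) {} \<le> 2 * \<epsilon>" .
      have "bdist (bis (op_mult N (D \<sigma>) (op_adj N (D \<tau>)))) {} \<le> bdist (bis (D \<sigma>)) (atom K \<sigma>) + bdist (bis (op_adj N (D \<tau>))) (binv G (atom K \<tau>))"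
        using bdist_bis_mult[OF n(5)[OF \<sigma>] wI[OF \<tau>(1)] b[OF \<sigma>] bisection_binv[OF b[OF \<tau>(1)]]] clash(2) by simp
      also have "\<dots> \<le> 2 * \<epsilon>" using bdist_bis_adj[OF n(5)[OF \<tau>(1)] b[OF \<tau>(1)]] n(6)[OF \<sigma>] n(6)[OF \<tau>(1)] by simp
      finally have 2: "bdist (bis (op_mult N (D \<sigma>) (op_adj N (D \<tau>)))) {} \<le> 2 * \<epsilon>" .
      show "\<forall>\<^sub>F p in SAf \<Omega>. nrm (fst p) (mm (fst p) (tp (rcell D p \<sigma>)) (rcell D p \<tau>)) < h
        \<and> nrm (fst p) (mm (fst p) (rcell D p \<sigma>) (tp (rcell D p \<tau>))) < h"
        using bound[OF rcell_mult_aeq(2)[OF near \<sigma> \<tau>(1)] wsums_mult[OF n(1) w[OF \<sigma>] n(4)[OF \<tau>(1)]] 1]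
          bound[OF rcell_mult_aeq(3)[OF near \<sigma> \<tau>(1)] wsums_mult[OF n(1) n(4)[OF \<sigma>] w[OF \<tau>(1)]] 2]
        by (rule eventually_conj)
    qed
    then show "\<forall>\<^sub>F p in SAf \<Omega>. nrm (fst p) (\<lambda>i j. scell K D p \<sigma> i j - rcell D p \<sigma> i j) < \<eta>"
    proof eventually_elim
      case (elim p)
      have sq: "x\<^sup>2 \<le> h\<^sup>2" if "x < h" "0 \<le> x" for x :: real using that by (intro power_mono) auto
      have "(nrm (fst p) (\<lambda>i j. scell K D p \<sigma> i j - rcell D p \<sigma> i j))\<^sup>2 \<le>
        (\<Sum>\<tau>\<in>clash K \<sigma>. (nrm (fst p) (mm (fst p) (tp (rcell D p \<sigma>)) (rcell D p \<tau>)))\<^sup>2 + (nrm (fst p) (mm (fst p) (rcell D p \<sigma>) (tp (rcell D p \<tau>))))\<^sup>2)"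
        unfolding scell_def by (rule nrm_separate[OF fc]) (rule ppm_rcell)+
      also have "\<dots> \<le> (\<Sum>\<tau>\<in>clash K \<sigma>. h\<^sup>2 + h\<^sup>2)"
        by (intro sum_mono add_mono sq nrm_nonneg; use elim in blast)
      also have "\<dots> = real (card (clash K \<sigma>)) * (2 * h\<^sup>2)" by simp
      also have "\<dots> \<le> q * (2 * h\<^sup>2)" using cc unfolding q_def by (intro mult_right_mono) auto
      also have "\<dots> < (2 * (q + 1) * h)\<^sup>2"
      proof -
        have "q * 2 < (2 * (q + 1))\<^sup>2" using q by (simp add: power2_eq_square algebra_simps add_pos_nonneg)
        then have "q * 2 * h\<^sup>2 < (2 * (q + 1))\<^sup>2 * h\<^sup>2" using h by (intro mult_strict_right_mono) simp_all
        then show ?thesis by (simp only: power_mult_distrib mult.assoc)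
      qed
      also have "2 * (q + 1) * h = \<eta>" using q by (simp add: h_def)
      finally show ?case by (rule power2_less_imp_less) (use \<eta> in simp)
    qed
  qed
qed

abbreviation rsum :: "'g l2_op set \<Rightarrow> ('g l2_op set \<Rightarrow> 'g l2_op) \<Rightarrow> nat \<times> ('g l2_op \<Rightarrow> complex mat) \<Rightarrow> 'g l2_op \<Rightarrow> nat \<Rightarrow> nat \<Rightarrow> real" where
  "rsum K D p s i j \<equiv> \<Sum>\<sigma>\<in>cells_of K s. rcell D p \<sigma> i j"

abbreviation ssum :: "'g l2_op set \<Rightarrow> ('g l2_op set \<Rightarrow> 'g l2_op) \<Rightarrow> nat \<times> ('g l2_op \<Rightarrow> complex mat) \<Rightarrow> 'g l2_op \<Rightarrow> nat \<Rightarrow> nat \<Rightarrow> real" where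
  "ssum K D p s i j \<equiv> \<Sum>\<sigma>\<in>cells_of K s. scell K D p \<sigma> i j"

lemma cells_ofD: "\<sigma> \<in> cells_of K s \<Longrightarrow> \<sigma> \<in> cells K"
  by (simp add: cells_of_def)

lemma card_cells_of_le: "finite K \<Longrightarrow> card (cells_of K s) \<le> card (cells K)"
  by (rule card_mono[OF finite_cells]) (auto simp: cells_of_def)

lemma rsum_mult_close:
  assumes near: "near \<Omega> D K \<epsilon>" and s: "s \<in> K" and t: "t \<in> K" and st: "op_mult N s t \<in> K"
    and \<epsilon>: "0 \<le> \<epsilon>" and \<eta>: "0 < \<eta>" and small: "4 * (real (card (cells K)) + 1) ^ 4 * \<epsilon> < \<eta>\<^sup>2"
  shows "\<forall>\<^sub>F p in SAf \<Omega>. nrm (fst p) (\<lambda>i j. rsum K D p (op_mult N s t) i j - mm (fst p) (rsum K D p s) (rsum K D p t) i j) < \<eta>"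
proof -
  note n = nearD[OF near]
  note b = atom_bisection[OF n(2,3) cells_ofD]
  define q where "q = real (card (cells K))"
  have q: "0 \<le> q" by (simp add: q_def)
  let ?st = "op_mult N s t"
  \<comment> \<open>the cells of the product enter with coefficient \<open>1\<close>, the pairs of cells of the factors with \<open>-1\<close>\<close>
  let ?I = "Inl ` cells_of K ?st \<union> Inr ` (cells_of K s \<times> cells_of K t)"
  define E where "E = case_sum D (\<lambda>z. op_mult N (D (fst z)) (D (snd z)))"
  define C where "C = case_sum (atom K) (\<lambda>z. bprod G (atom K (fst z)) (atom K (snd z)))"
  define X where "X = case_sum (\<lambda>\<sigma> p. rcell D p \<sigma>) (\<lambda>z p. mm (fst p) (rcell D p (fst z)) (rcell D p (snd z)))"
  define c :: "'g l2_op set + 'g l2_op set \<times> 'g l2_op set \<Rightarrow> real" where "c = case_sum (\<lambda>_. 1) (\<lambda>_. - 1)"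
  note f = finite_cells_of[OF n(2)]
  have split: "(\<Sum>i\<in>?I. g i) = (\<Sum>\<sigma>\<in>cells_of K ?st. g (Inl \<sigma>)) + (\<Sum>z\<in>cells_of K s \<times> cells_of K t. g (Inr z))" for g :: "_ \<Rightarrow> real"
    by (subst sum.union_disjoint) (auto simp: f sum.reindex inj_on_def)
  have sI: "s \<in> IG" "t \<in> IG" using s t n(3) by auto
  have bst: "bisection G (bprod G (bis s) (bis t))" by (rule bprod_bisection[OF bis(1)[OF sI(1)] bis(1)[OF sI(2)]])
  have est: "?st = pis (bprod G (bis s) (bis t))" using pis_mult[OF bis(1)[OF sI(1)] bis(1)[OF sI(2)]] bis(2) sI by simp
  have card1: "real (card ?I) \<le> q + q * q"
  proof -
    have "card ?I \<le> card (cells_of K ?st) + card (cells_of K s \<times> cells_of K t)"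
      by (rule order_trans[OF card_Un_le]) (intro add_mono card_image_le finite_cartesian_product f)
    also have "\<dots> \<le> card (cells K) + card (cells K) * card (cells K)"
      unfolding card_cartesian_product by (intro add_mono mult_mono card_cells_of_le n(2)) simp_all
    finally have "real (card ?I) \<le> real (card (cells K) + card (cells K) * card (cells K))" by (rule of_nat_mono)
    then show ?thesis by (simp add: q_def)
  qed
  have "\<forall>\<^sub>F p in SAf \<Omega>. nrm (fst p) (\<lambda>a b. \<Sum>i\<in>?I. c i * X i p a b) < \<eta>"
  proof (rule asymptotic_bound[OF n(1), where D = E and C = C, OF _ _ _ _ _ _ bst])
    show "finite ?I" by (simp add: f)
    show "E i \<in> wsums \<Omega>" if "i \<in> ?I" for i
      using that by (auto simp: E_def intro!: wsums_mult[OF n(1)] n(4) cells_ofD)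
    show "aeq (SAf \<Omega>) (X i) (val (E i))" if "i \<in> ?I" for i
      using that by (auto simp: E_def X_def intro!: n(7) rcell_mult_aeq(1)[OF near] cells_ofD)
    show "\<bar>c i\<bar> \<le> 1" if "i \<in> ?I" for i using that by (auto simp: c_def)
    show "bisection G (C i)" if "i \<in> ?I" for i
      using that by (auto simp: C_def intro!: b bprod_bisection)
    show "bisection G (bis ?st)" using st n(3) by (intro bis(1)) auto
    show "bdist (bis ?st) (bprod G (bis s) (bis t)) = 0" unfolding est by (rule bis_pis[OF bst])
    show "(\<Sum>i\<in>?I. c i * indicator (C i) x) = indicator (bis ?st) x - indicator (bprod G (bis s) (bis t)) x" if "x \<in> arrows G" for x
      unfolding split using atom_sum[OF n(2) st, of x] atom_bprod_sum[OF n(2,3) s t, of x]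
      by (simp add: c_def C_def sum.cartesian_product' sum_negf)
    show "(real (card ?I) + 1) * (\<Sum>i\<in>?I. bdist (bis (E i)) (C i)) < \<eta>\<^sup>2"
    proof -
      have le: "bdist (bis (E i)) (C i) \<le> 2 * \<epsilon>" if "i \<in> ?I" for i
        using that
      proof
        assume "i \<in> Inl ` cells_of K ?st"
        then obtain \<sigma> where i: "i = Inl \<sigma>" "\<sigma> \<in> cells_of K ?st" by blast
        show ?thesis using n(6)[OF cells_ofD[OF i(2)]] \<epsilon> by (simp add: i(1) E_def C_def)
      next
        assume "i \<in> Inr ` (cells_of K s \<times> cells_of K t)"
        then obtain \<sigma> \<tau> where i: "i = Inr (\<sigma>, \<tau>)" "\<sigma> \<in> cells_of K s" "\<tau> \<in> cells_of K t" by blast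
        note st = cells_ofD[OF i(2)] cells_ofD[OF i(3)]
        show ?thesis using bdist_bis_mult[OF n(5)[OF st(1)] n(5)[OF st(2)] b[OF i(2)] b[OF i(3)]] n(6)[OF st(1)] n(6)[OF st(2)]
          by (simp add: i(1) E_def C_def)
      qed
      have "(\<Sum>i\<in>?I. bdist (bis (E i)) (C i)) \<le> real (card ?I) * (2 * \<epsilon>)" by (rule sum_bounded_above[OF le])
      then have "(real (card ?I) + 1) * (\<Sum>i\<in>?I. bdist (bis (E i)) (C i)) \<le> (real (card ?I) + 1) * (real (card ?I) * (2 * \<epsilon>))"
        by (intro mult_left_mono) simp_all
      also have "\<dots> \<le> (q + 1)\<^sup>2 * ((q + 1)\<^sup>2 * (2 * \<epsilon>))"
        using card1 q \<epsilon> by (intro mult_mono mult_right_mono mult_nonneg_nonneg) (simp_all add: power2_eq_square algebra_simps)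
      also have "\<dots> = 2 * ((q + 1) ^ 4 * \<epsilon>)" by (simp add: power4_eq_xxxx power2_eq_square)
      also have "\<dots> \<le> 4 * ((q + 1) ^ 4 * \<epsilon>)" using q \<epsilon> by (intro mult_right_mono mult_nonneg_nonneg) simp_all
      also have "\<dots> < \<eta>\<^sup>2" using small by (simp add: q_def)
      finally show ?thesis .
    qed
  qed (rule \<eta>)
  moreover have "(\<Sum>i\<in>?I. c i * X i p a b) = rsum K D p ?st a b - mm (fst p) (rsum K D p s) (rsum K D p t) a b" for p a b
    unfolding split mm_sum_left mm_sum_right
    by (simp add: c_def X_def sum.cartesian_product' sum_negf)
  ultimately show ?thesis by simp
qed

lemma rsum_word_close:
  assumes near: "near \<Omega> D K \<epsilon>" and e: "e \<in> K" "e \<in> \<Omega>"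
    and \<epsilon>: "0 \<le> \<epsilon>" and \<eta>: "0 < \<eta>" and small: "4 * (real (card (cells K)) + 1) ^ 4 * \<epsilon> < \<eta>\<^sup>2"
  shows "\<forall>\<^sub>F p in SAf \<Omega>. nrm (fst p) (\<lambda>i j. rsum K D p e i j - val e p i j) < \<eta>"
proof -
  note n = nearD[OF near]
  note b = atom_bisection[OF n(2,3) cells_ofD]
  define q where "q = real (card (cells K))"
  have q: "0 \<le> q" by (simp add: q_def)
  \<comment> \<open>\<open>None\<close> stands for \<open>e\<close> itself, with coefficient \<open>-1\<close>\<close>
  let ?I = "insert None (Some ` cells_of K e)"
  define E where "E = case_option e D"
  define C where "C = case_option (bis e) (atom K)"
  define X where "X = case_option (val e) (\<lambda>\<sigma> p. rcell D p \<sigma>)"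
  define c :: "'g l2_op set option \<Rightarrow> real" where "c = case_option (- 1) (\<lambda>_. 1)"
  note f = finite_cells_of[OF n(2)]
  have split: "(\<Sum>i\<in>?I. g i) = g None + (\<Sum>\<sigma>\<in>cells_of K e. g (Some \<sigma>))" for g :: "_ \<Rightarrow> real"
    using f by (simp add: sum.reindex)
  have ew: "e \<in> wsums \<Omega>" by (rule words_wsums[OF n(1) subset_words[OF n(1) e(2)]])
  have eI: "bisection G (bis e)" using e n(3) by (intro bis(1)) auto
  have card1: "real (card ?I) = real (card (cells_of K e)) + 1" using f by (simp add: card_image)
  have card2: "real (card (cells_of K e)) \<le> q" using card_cells_of_le[OF n(2)] by (simp add: q_def)
  have "\<forall>\<^sub>F p in SAf \<Omega>. nrm (fst p) (\<lambda>a b. \<Sum>i\<in>?I. c i * X i p a b) < \<eta>"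
  proof (rule asymptotic_bound[OF n(1), where D = E and C = C, OF _ _ _ _ _ bisection_empty bisection_empty])
    show "finite ?I" by (simp add: f)
    show "E i \<in> wsums \<Omega>" if "i \<in> ?I" for i using that ew by (auto simp: E_def intro!: n(4) cells_ofD)
    show "aeq (SAf \<Omega>) (X i) (val (E i))" if "i \<in> ?I" for i
      using that by (auto simp: E_def X_def intro!: n(7) aeq_refl cells_ofD)
    show "\<bar>c i\<bar> \<le> 1" if "i \<in> ?I" for i using that by (auto simp: c_def)
    show "bisection G (C i)" if "i \<in> ?I" for i using that eI by (auto simp: C_def intro!: b)
    show "(\<Sum>i\<in>?I. c i * indicator (C i) x) = indicator {} x - indicator {} x" if "x \<in> arrows G" for x
      unfolding split using atom_sum[OF n(2) e(1), of x] by (simp add: c_def C_def)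
    show "(real (card ?I) + 1) * (\<Sum>i\<in>?I. bdist (bis (E i)) (C i)) < \<eta>\<^sup>2"
    proof -
      have "(\<Sum>i\<in>?I. bdist (bis (E i)) (C i)) = (\<Sum>\<sigma>\<in>cells_of K e. bdist (bis (D \<sigma>)) (atom K \<sigma>))"
        unfolding split by (simp add: E_def C_def)
      also have "\<dots> \<le> real (card (cells_of K e)) * \<epsilon>" by (rule sum_bounded_above) (rule n(6)[OF cells_ofD])
      also have "\<dots> \<le> q * \<epsilon>" by (rule mult_right_mono[OF card2 \<epsilon>])
      finally have "(real (card ?I) + 1) * (\<Sum>i\<in>?I. bdist (bis (E i)) (C i)) \<le> (q + 2) * (q * \<epsilon>)"
        using card1 card2 q \<epsilon> by (intro mult_mono sum_nonneg) (simp_all add: bdist_nonneg)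
      also have "\<dots> \<le> (2 * (q + 1)\<^sup>2) * ((q + 1)\<^sup>2 * \<epsilon>)"
        using q \<epsilon> by (intro mult_mono mult_right_mono mult_nonneg_nonneg) (simp_all add: power2_eq_square algebra_simps)
      also have "\<dots> = 2 * ((q + 1) ^ 4 * \<epsilon>)" by (simp add: power4_eq_xxxx power2_eq_square)
      also have "\<dots> \<le> 4 * ((q + 1) ^ 4 * \<epsilon>)" using q \<epsilon> by (intro mult_right_mono mult_nonneg_nonneg) simp_all
      also have "\<dots> < \<eta>\<^sup>2" using small by (simp add: q_def)
      finally show ?thesis .
    qed
  qed (simp_all add: \<eta>)
  moreover have "(\<Sum>i\<in>?I. c i * X i p a b) = rsum K D p e a b - val e p a b" for p a b
    unfolding split by (simp add: c_def X_def)
  ultimately show ?thesis by simp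
qed

lemma rsum_trace_close:
  assumes near: "near \<Omega> D K \<epsilon>" and s: "s \<in> K" and \<eta>: "0 < \<eta>" and small: "real (card (cells K)) * \<epsilon> \<le> \<eta>" and \<epsilon>: "0 \<le> \<epsilon>"
  shows "\<forall>\<^sub>F p in SAf \<Omega>. \<bar>tr (fst p) (rsum K D p s) - measure N (bis s \<inter> gunits G)\<bar> < 2 * \<eta>"
proof -
  note n = nearD[OF near]
  define l where "l = (\<Sum>\<sigma>\<in>cells_of K s. measure N (bis (D \<sigma>) \<inter> gunits G))"
  have u: "gunits G \<in> sets N" using bisection_sets[OF bisection_units] by simp
  have "((\<lambda>p. \<Sum>\<sigma>\<in>cells_of K s. tr (fst p) (val (D \<sigma>) p)) \<longlongrightarrow> l) (SAf \<Omega>)"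
    unfolding l_def
  proof (rule tendsto_sum)
    fix \<sigma> assume "\<sigma> \<in> cells_of K s"
    note c = cells_ofD[OF this]
    have "Re (vn_trace G \<mu> (D \<sigma>)) = measure N (bis (D \<sigma>) \<inter> gunits G)"
      using trace_pis[OF bis(1)[OF n(5)[OF c]]] bis(2)[OF n(5)[OF c]] by simp
    then show "((\<lambda>p. tr (fst p) (val (D \<sigma>) p)) \<longlongrightarrow> measure N (bis (D \<sigma>) \<inter> gunits G)) (SAf \<Omega>)"
      using wsum_tr[OF n(1) n(4)[OF c]] by simp
  qed
  then have "((\<lambda>p. tr (fst p) (\<lambda>i j. \<Sum>\<sigma>\<in>cells_of K s. val (D \<sigma>) p i j)) \<longlongrightarrow> l) (SAf \<Omega>)" by (simp only: tr_sum)
  then have "((\<lambda>p. tr (fst p) (rsum K D p s)) \<longlongrightarrow> l) (SAf \<Omega>)"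
    by (rule aeq_tr[rotated]) (intro aeq_sum finite_cells_of n(2) n(7) cells_ofD)
  then have ev: "\<forall>\<^sub>F p in SAf \<Omega>. dist (tr (fst p) (rsum K D p s)) l < \<eta>" using \<eta> by (rule tendstoD)
  have lim: "\<bar>l - measure N (bis s \<inter> gunits G)\<bar> \<le> \<eta>"
  proof -
    have "\<bar>l - measure N (bis s \<inter> gunits G)\<bar> = \<bar>\<Sum>\<sigma>\<in>cells_of K s. measure N (bis (D \<sigma>) \<inter> gunits G) - measure N (atom K \<sigma> \<inter> gunits G)\<bar>"
      unfolding l_def measure_inter_atom_sum[OF n(2,3) s u] sum_subtractf by (rule refl)
    also have "\<dots> \<le> (\<Sum>\<sigma>\<in>cells_of K s. \<epsilon>)"
      by (rule order_trans[OF sum_abs sum_mono])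
        (rule order_trans[OF measure_inter_bdist[OF bis(1)[OF n(5)[OF cells_ofD]] atom_bisection[OF n(2,3) cells_ofD] u] n(6)[OF cells_ofD]])
    also have "\<dots> \<le> real (card (cells K)) * \<epsilon>"
      unfolding sum_constant using card_cells_of_le[OF n(2)] \<epsilon> by (intro mult_right_mono) simp_all
    finally show ?thesis using small by simp
  qed
  from ev show ?thesis
  proof eventually_elim
    case (elim p)
    then show ?case using lim unfolding dist_real_def by linarith
  qed
qed

lemma scell_null:
  assumes \<Omega>: "\<Omega> \<subseteq> IG" and null: "D \<sigma> = op_zero N"
  shows "\<forall>\<^sub>F p in SAf \<Omega>. \<forall>i<fst p. \<forall>j<fst p. scell K D p \<sigma> i j = 0"
proof -
  have s: "set [] \<subseteq> words \<Omega>" by simp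
  from val_op_sum[OF \<Omega> s] show ?thesis
  proof eventually_elim
    case (elim p)
    then have z: "val (op_zero N) p i j = 0" if "i < fst p" "j < fst p" for i j using that by simp
    have "rcell D p \<sigma> i j \<noteq> 1" if "i < fst p" "j < fst p" for i j
      using z[OF that] by (simp add: rcell_def rnd_def isolated_def null)
    then show ?case by (simp add: scell_def separate_def)
  qed
qed

text \<open>
  \<open>S - S1 S2 = (S - T) + (T - T1 T2) + T1 (T2 - S2) + (T1 - S1) S2\<close>, where multiplication by \<open>T1\<close> costs a
  factor \<open>q\<close> and multiplication by \<open>S2\<close> does not increase the norm.
\<close>
lemma product_perturbation:
  assumes S: "nrm d (\<lambda>i j. S i j - T i j) \<le> q * \<eta>" "nrm d (\<lambda>i j. S1 i j - T1 i j) \<le> q * \<eta>" "nrm d (\<lambda>i j. S2 i j - T2 i j) \<le> q * \<eta>"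
    and m: "nrm d (\<lambda>i j. T i j - mm d T1 T2 i j) \<le> \<eta>" and p: "ppm d S2"
    and T1: "\<And>Z. nrm d (mm d T1 Z) \<le> q * nrm d Z" and q: "0 \<le> q"
  shows "nrm d (\<lambda>i j. S i j - mm d S1 S2 i j) \<le> (q + 1)\<^sup>2 * \<eta>"
proof -
  have 1: "nrm d (\<lambda>i j. mm d T1 T2 i j - mm d T1 S2 i j) \<le> q * (q * \<eta>)"
  proof -
    have "nrm d (\<lambda>i j. mm d T1 T2 i j - mm d T1 S2 i j) \<le> q * nrm d (\<lambda>i j. T2 i j - S2 i j)"
      using T1[of "\<lambda>i j. T2 i j - S2 i j"] by (simp only: mm_diff_right)
    also have "\<dots> \<le> q * (q * \<eta>)" using S(3) nrm_minus[of d T2 S2] q by (intro mult_left_mono) simp_all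
    finally show ?thesis .
  qed
  have 2: "nrm d (\<lambda>i j. mm d T1 S2 i j - mm d S1 S2 i j) \<le> q * \<eta>"
    using nrm_mm_ppm_right[OF p, of "\<lambda>i j. T1 i j - S1 i j"] S(2) nrm_minus[of d T1 S1] by (simp add: mm_diff_left)
  have "nrm d (\<lambda>i j. S i j - mm d S1 S2 i j) \<le> nrm d (\<lambda>i j. S i j - T i j) + nrm d (\<lambda>i j. T i j - mm d S1 S2 i j)"
    by (rule nrm_dist_triangle)
  also have "nrm d (\<lambda>i j. T i j - mm d S1 S2 i j) \<le> nrm d (\<lambda>i j. T i j - mm d T1 T2 i j) + nrm d (\<lambda>i j. mm d T1 T2 i j - mm d S1 S2 i j)"
    by (rule nrm_dist_triangle)
  also have "nrm d (\<lambda>i j. mm d T1 T2 i j - mm d S1 S2 i j) \<le>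
    nrm d (\<lambda>i j. mm d T1 T2 i j - mm d T1 S2 i j) + nrm d (\<lambda>i j. mm d T1 S2 i j - mm d S1 S2 i j)"
    by (rule nrm_dist_triangle)
  finally have "nrm d (\<lambda>i j. S i j - mm d S1 S2 i j) \<le> q * \<eta> + (\<eta> + (q * (q * \<eta>) + q * \<eta>))" using S m 1 2 by linarith
  also have "\<dots> = (q + 1)\<^sup>2 * \<eta>" by (simp add: power2_eq_square algebra_simps)
  finally show ?thesis .
qed

text \<open>
  The matrices \<open>scell\<close>, one for each cell, give the linear map \<open>psi\<close>; its values on \<open>K\<close> are the
  sums \<open>ssum\<close>, which differ little from the sums \<open>rsum\<close> of models, for which multiplicativity and trace are limits of
  identities between indicator functions.
\<close>
lemma sofic_model:
  assumes \<Omega>: "\<Omega> \<subseteq> IG" "dense \<Omega>" and F: "finite F" "F \<subseteq> IG" and n: "1 \<le> n" and \<delta>: "0 < \<delta>" and \<kappa>: "0 < \<kappa>"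
  shows "\<forall>\<^sub>F p in SAf \<Omega>. \<exists>\<psi>\<in>SA G \<mu> F n \<delta> (fst p). \<forall>e\<in>F \<inter> \<Omega>. nrm (fst p) (\<lambda>i j. val e p i j - rent (\<psi> e) i j) < \<kappa>"
proof -
  define K where "K = set_pow_upto G \<mu> (sym_set G \<mu> F) n"
  note K = set_pow_upto_facts[OF F n, folded K_def]
  define q where "q = real (card (cells K))"
  define m where "m = min (\<delta> / real n) (min \<delta> (min \<kappa> 1))"
  \<comment> \<open>at most \<open>(q + 1)\<^sup>2\<close> errors of size \<open>\<eta>\<close> add up in \<open>product_perturbation\<close>, and at most twice as many elsewhere\<close>
  define \<eta> where "\<eta> = m / (2 * (q + 1)\<^sup>2)"
  define w where "w = 4 * (q + 1) ^ 4"
  define h where "h = \<eta> / (2 * (q + 1))"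
  \<comment> \<open>\<open>w \<epsilon>\<close> bounds the squared norms of the combinations of at most \<open>q + q\<^sup>2\<close> models\<close>
  define \<epsilon> where "\<epsilon> = min (h\<^sup>2) (\<eta>\<^sup>2) / (2 * w)"
  have n0: "0 < real n" using n by simp
  have q: "0 \<le> q" by (simp add: q_def)
  have m: "0 < m" "m \<le> \<delta>" "m \<le> \<kappa>" "m \<le> 1" "m \<le> \<delta> / real n" using n0 \<delta> \<kappa> by (simp_all add: m_def)
  have sq: "0 < (q + 1)\<^sup>2" "q + 1 \<le> (q + 1)\<^sup>2" using q by (simp_all add: power2_eq_square)
  have \<eta>: "0 < \<eta>" using m sq by (simp add: \<eta>_def)
  have total: "(q + 1)\<^sup>2 * \<eta> = m / 2" using sq by (simp add: \<eta>_def)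
  have "(q + 1) * \<eta> \<le> (q + 1)\<^sup>2 * \<eta>" using sq \<eta> by (intro mult_right_mono) simp_all
  then have lin: "2 * (q * \<eta>) + 2 * \<eta> \<le> m" using total by (simp add: algebra_simps)
  have h: "0 < h" using \<eta> q by (simp add: h_def)
  have w: "4 \<le> w" using q one_le_power[of "q + 1" 4] by (simp add: w_def)
  have mn: "0 < min (h\<^sup>2) (\<eta>\<^sup>2)" using h \<eta> by simp
  then have \<epsilon>: "0 < \<epsilon>" using w by (simp add: \<epsilon>_def)
  have we: "w * \<epsilon> = min (h\<^sup>2) (\<eta>\<^sup>2) / 2" using w by (simp add: \<epsilon>_def)
  have small: "w * \<epsilon> < \<eta>\<^sup>2" "w * \<epsilon> < h\<^sup>2" using we mn by linarith+
  have "4 * \<epsilon> \<le> w * \<epsilon>" using w \<epsilon> by (intro mult_right_mono) simp_all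
  then have small1: "4 * \<epsilon> < h\<^sup>2" using small(2) by linarith
  have small2: "q * \<epsilon> \<le> \<eta>"
  proof -
    have "q * \<epsilon> \<le> (q + 1) ^ 4 * \<epsilon>"
      using q \<epsilon> self_le_power[of "q + 1" 4] by (intro mult_right_mono) simp_all
    also have "\<dots> \<le> w * \<epsilon>" unfolding w_def using q \<epsilon> by (intro mult_right_mono) simp_all
    also have "\<dots> \<le> \<eta>\<^sup>2" using small(1) by simp
    finally have le: "q * \<epsilon> \<le> \<eta>\<^sup>2" .
    have "0 \<le> q * \<eta>" using q \<eta> by simp
    then have "\<eta> \<le> 1" using lin m(4) by linarith
    then have "\<eta>\<^sup>2 \<le> \<eta>" using \<eta> by (simp add: power2_eq_square mult_left_le)
    then show ?thesis using le by simp
  qed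
  obtain D where D: "\<And>\<sigma>. \<sigma> \<in> cells K \<Longrightarrow> D \<sigma> \<in> wsums \<Omega>" "\<And>\<sigma>. \<sigma> \<in> cells K \<Longrightarrow> bdist (bis (D \<sigma>)) (atom K \<sigma>) \<le> \<epsilon>"
    "\<And>\<sigma>. \<sigma> \<in> cells K \<Longrightarrow> measure N (atom K \<sigma>) = 0 \<Longrightarrow> D \<sigma> = op_zero N"
    using cell_approx[OF \<Omega>(2) K(1,2) \<epsilon>] by blast
  have near: "near \<Omega> D K \<epsilon>" using \<Omega>(1) K(1,2) D(1,2) unfolding near_def by blast
  have ev1: "\<forall>\<^sub>F p in SAf \<Omega>. \<forall>\<sigma>\<in>cells K. nrm (fst p) (\<lambda>i j. scell K D p \<sigma> i j - rcell D p \<sigma> i j) < \<eta>"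
    by (rule scell_close[OF near \<eta>]) (use small1 in \<open>simp add: h_def q_def\<close>)
  have ev2: "\<forall>\<^sub>F p in SAf \<Omega>. \<forall>s\<in>K. \<forall>t\<in>K. op_mult N s t \<in> K \<longrightarrow>
    nrm (fst p) (\<lambda>i j. rsum K D p (op_mult N s t) i j - mm (fst p) (rsum K D p s) (rsum K D p t) i j) < \<eta>"
  proof (rule eventually_ball_finite[OF K(1)], rule ballI, rule eventually_ball_finite[OF K(1)], rule ballI)
    fix s t assume st: "s \<in> K" "t \<in> K"
    show "\<forall>\<^sub>F p in SAf \<Omega>. op_mult N s t \<in> K \<longrightarrow>
      nrm (fst p) (\<lambda>i j. rsum K D p (op_mult N s t) i j - mm (fst p) (rsum K D p s) (rsum K D p t) i j) < \<eta>"
    proof (cases "op_mult N s t \<in> K")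
      case True
      from rsum_mult_close[OF near st True less_imp_le[OF \<epsilon>] \<eta>] small(1)
      have "\<forall>\<^sub>F p in SAf \<Omega>. nrm (fst p) (\<lambda>i j. rsum K D p (op_mult N s t) i j - mm (fst p) (rsum K D p s) (rsum K D p t) i j) < \<eta>"
        by (simp add: w_def q_def)
      then show ?thesis by eventually_elim (rule impI)
    qed simp
  qed
  have ev3: "\<forall>\<^sub>F p in SAf \<Omega>. \<forall>e\<in>F \<inter> \<Omega>. nrm (fst p) (\<lambda>i j. rsum K D p e i j - val e p i j) < \<eta>"
  proof (rule eventually_ball_finite, use F in simp, rule ballI)
    fix e assume e: "e \<in> F \<inter> \<Omega>"
    then have "e \<in> K" "e \<in> \<Omega>" using K(3) unfolding sym_set_def by auto
    from rsum_word_close[OF near this less_imp_le[OF \<epsilon>] \<eta>] small(1)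
    show "\<forall>\<^sub>F p in SAf \<Omega>. nrm (fst p) (\<lambda>i j. rsum K D p e i j - val e p i j) < \<eta>" by (simp add: w_def q_def)
  qed
  have ev4: "\<forall>\<^sub>F p in SAf \<Omega>. \<forall>s\<in>K. \<bar>tr (fst p) (rsum K D p s) - measure N (bis s \<inter> gunits G)\<bar> < 2 * \<eta>"
    by (rule eventually_ball_finite[OF K(1)], rule ballI, rule rsum_trace_close[OF near _ \<eta> _ less_imp_le[OF \<epsilon>]])
      (use small2 in \<open>simp_all add: q_def\<close>)
  have ev5: "\<forall>\<^sub>F p in SAf \<Omega>. \<forall>\<sigma>\<in>cells K. measure N (atom K \<sigma>) = 0 \<longrightarrow> (\<forall>i<fst p. \<forall>j<fst p. scell K D p \<sigma> i j = 0)"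
  proof (rule eventually_ball_finite[OF finite_cells[OF K(1)]], rule ballI)
    fix \<sigma> assume \<sigma>: "\<sigma> \<in> cells K"
    show "\<forall>\<^sub>F p in SAf \<Omega>. measure N (atom K \<sigma>) = 0 \<longrightarrow> (\<forall>i<fst p. \<forall>j<fst p. scell K D p \<sigma> i j = 0)"
    proof (cases "measure N (atom K \<sigma>) = 0")
      case True
      from scell_null[where D = D, OF \<Omega>(1) D(3)[OF \<sigma> this]] show ?thesis by eventually_elim (rule impI)
    qed simp
  qed
  from ev1 ev2 ev3 ev4 ev5 show ?thesis
  proof eventually_elim
    case (elim p)
    define d where "d = fst p"
    define A where "A = scell K D p"
    define S where "S = ssum K D p"
    define T where "T = rsum K D p"
    have card: "real (card (cells_of K s)) \<le> q" for s using card_cells_of_le[OF K(1)] by (simp add: q_def)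
    have SS: "S s = (\<lambda>i j. \<Sum>\<sigma>\<in>cells_of K s. A \<sigma> i j)" for s by (simp add: S_def A_def)
    have Sp: "ppm d (S s)" for s
      unfolding SS A_def scell_def d_def
      by (rule ppm_sum_separate[OF finite_cells_of[OF K(1)]]) (auto simp: ppm_rcell clash_def cells_of_def)
    have ST: "nrm d (\<lambda>i j. S s i j - T s i j) \<le> q * \<eta>" for s
    proof -
      have "nrm d (\<lambda>i j. S s i j - T s i j) \<le> (\<Sum>\<sigma>\<in>cells_of K s. nrm d (\<lambda>i j. A \<sigma> i j - rcell D p \<sigma> i j))"
        unfolding SS T_def sum_subtractf[symmetric] by (rule nrm_sum[OF finite_cells_of[OF K(1)]])
      also have "\<dots> \<le> real (card (cells_of K s)) * \<eta>"
        using elim(1) by (intro sum_bounded_above) (auto simp: A_def d_def less_imp_le dest: cells_ofD)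
      also have "\<dots> \<le> q * \<eta>" using card \<eta> by (intro mult_right_mono) simp_all
      finally show ?thesis .
    qed
    have Tb: "nrm d (mm d (T s) Z) \<le> q * nrm d Z" for s Z
    proof -
      have "nrm d (mm d (T s) Z) \<le> (\<Sum>\<sigma>\<in>cells_of K s. nrm d (mm d (rcell D p \<sigma>) Z))"
        unfolding T_def mm_sum_left by (rule nrm_sum[OF finite_cells_of[OF K(1)]])
      also have "\<dots> \<le> real (card (cells_of K s)) * nrm d Z"
        unfolding d_def by (intro sum_bounded_above nrm_mm_ppm ppm_rcell)
      also have "\<dots> \<le> q * nrm d Z" using card by (intro mult_right_mono) simp_all
      finally show ?thesis .
    qed
    have null: "A \<sigma> i j = 0" if "\<sigma> \<in> cells K" "measure N (atom K \<sigma>) = 0" "i < d" "j < d" for \<sigma> i j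
      using elim(5) that by (simp add: A_def d_def)
    have SA: "psi K A d \<in> SA G \<mu> F n \<delta> d"
    proof (rule psi_SA[OF F n \<delta> K_def null SS Sp])
      show "nrm d (\<lambda>i j. S (op_mult N s t) i j - mm d (S s) (S t) i j) \<le> (q + 1)\<^sup>2 * \<eta>"
        if "s \<in> K" "t \<in> K" "op_mult N s t \<in> K" for s t
        by (rule product_perturbation[OF ST ST ST _ Sp Tb q])
          (use elim(2) that in \<open>simp add: T_def d_def less_imp_le\<close>)
      show "0 \<le> (q + 1)\<^sup>2 * \<eta>" using total m by simp
      have "real n * m \<le> \<delta>" using m(5) n0 by (simp add: field_simps)
      then show "real n * ((q + 1)\<^sup>2 * \<eta>) < \<delta>" unfolding total using \<delta> m(1) n0 by simp
      show "\<bar>tr d (S s) - measure N (bis s \<inter> gunits G)\<bar> < \<delta>" if "s \<in> K" for s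
      proof -
        have "\<bar>tr d (S s) - tr d (T s)\<bar> \<le> q * \<eta>" unfolding tr_diff by (rule order_trans[OF tr_le_nrm ST])
        moreover have "\<bar>tr d (T s) - measure N (bis s \<inter> gunits G)\<bar> < 2 * \<eta>" using elim(4) that by (simp add: T_def d_def)
        moreover have "0 \<le> q * \<eta>" using q \<eta> by simp
        ultimately show ?thesis using lin m(2) \<eta> by linarith
      qed
    qed
    have close: "nrm d (\<lambda>i j. val e p i j - rent (psi K A d e) i j) < \<kappa>" if e: "e \<in> F \<inter> \<Omega>" for e
    proof -
      have eK: "e \<in> K" using e K(3) unfolding sym_set_def by auto
      have "nrm d (\<lambda>i j. val e p i j - rent (psi K A d e) i j) = nrm d (\<lambda>i j. val e p i j - S e i j)"
        unfolding SS by (rule nrm_cong) (simp add: psi_value(2)[OF K(1,2) eK null])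
      also have "\<dots> \<le> nrm d (\<lambda>i j. val e p i j - T e i j) + nrm d (\<lambda>i j. T e i j - S e i j)" by (rule nrm_dist_triangle)
      also have "nrm d (\<lambda>i j. val e p i j - T e i j) < \<eta>"
        using elim(3) e nrm_minus[of d "val e p" "T e"] by (simp add: T_def d_def)
      also have "nrm d (\<lambda>i j. T e i j - S e i j) \<le> q * \<eta>" using ST nrm_minus[of d "T e" "S e"] by simp
      finally have "nrm d (\<lambda>i j. val e p i j - rent (psi K A d e) i j) < \<eta> + q * \<eta>" by simp
      moreover have "0 \<le> q * \<eta>" using q \<eta> by simp
      ultimately show ?thesis using lin \<eta> m(3) by linarith
    qed
    show ?case using SA close unfolding d_def by (intro bexI[of _ "psi K A (fst p)"] ballI)
  qed
qed

text \<open>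
  The map of \<open>sofic_model\<close> for \<open>F \<union> E\<close> is itself close to \<open>\<phi>\<close> on \<open>E\<close>, so its
  restriction to \<open>E\<close> determines that of \<open>\<phi>\<close> up to the error \<open>\<kappa>\<close>.
\<close>
lemma generating_le_sofic:
  assumes L: "L = limsup \<or> L = liminf" and \<Omega>: "\<Omega> \<subseteq> IG" "dense \<Omega>"
  shows "sdim L G \<mu> \<Omega> \<le> sdim L G \<mu> IG"
  unfolding sdim_def[of L G \<mu> \<Omega>]
proof (rule SUP_least)
  fix E assume "E \<in> {E. finite E \<and> E \<subseteq> \<Omega>}"
  then have E: "finite E" "E \<subseteq> \<Omega>" by auto
  show "sdim_E L G \<mu> E \<Omega> \<le> sdim L G \<mu> IG"
  proof (rule ereal_le_epsilon2)
    fix \<epsilon> :: real assume \<epsilon>: "0 < \<epsilon>"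
    \<comment> \<open>with this radius the error term of the counting is at most \<open>\<epsilon>\<close>\<close>
    define \<kappa> where "\<kappa> = sqrt (\<epsilon> / (12 * (real (card E) + 1)))"
    have pos: "0 < 12 * (real (card E) + 1)" by (rule mult_pos_pos) (simp_all add: add_nonneg_pos)
    have \<kappa>: "0 < \<kappa>" using \<epsilon> pos by (simp add: \<kappa>_def)
    have "12 * \<kappa>\<^sup>2 * card E = \<epsilon> * (card E / (real (card E) + 1))" using \<epsilon> pos by (simp add: \<kappa>_def field_simps)
    also have "\<dots> \<le> \<epsilon> * 1" using \<epsilon> by (intro mult_left_mono) (simp_all add: divide_le_eq)
    finally have small: "12 * \<kappa>\<^sup>2 * card E \<le> \<epsilon>" by simp
    have "sdim_E L G \<mu> E \<Omega> \<le> sdim_E L G \<mu> E IG + ereal (12 * \<kappa>\<^sup>2 * card E)"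
    proof (rule sdim_E_le[OF L E(1) \<kappa>, where \<Theta> = "\<lambda>e d r. rent (r e)"])
      fix F and n :: nat and \<delta> :: real assume v: "finite F" "F \<subseteq> IG" "1 \<le> n" "0 < \<delta>"
      have EI: "E \<subseteq> IG" using E \<Omega> by blast
      have "\<forall>\<^sub>F p in SAf \<Omega>. \<exists>\<psi>\<in>SA G \<mu> (F \<union> E) n \<delta> (fst p). \<forall>e\<in>(F \<union> E) \<inter> \<Omega>. nrm (fst p) (\<lambda>i j. val e p i j - rent (\<psi> e) i j) < \<kappa>"
        by (rule sofic_model[OF \<Omega> _ _ v(3,4) \<kappa>]) (use v E EI in auto)
      moreover have "\<forall>\<^sub>F p in SAf \<Omega>. \<forall>e\<in>E. snd p e \<in> partial_perm_mats (fst p)"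
        by (rule eventually_ball_finite[OF E(1)], rule ballI, rule word_ppm(1)[OF \<Omega>(1) subset_words[OF \<Omega>(1)]], rule subsetD[OF E(2)])
      ultimately show "\<forall>\<^sub>F p in SAf \<Omega>. \<exists>\<psi>\<in>SA G \<mu> F n \<delta> (fst p). \<forall>e\<in>E. snd p e \<in> partial_perm_mats (fst p) \<and>
        nrm (fst p) (\<lambda>i j. val e p i j - rent (restrict \<psi> E e) i j) < \<kappa>"
      proof eventually_elim
        case (elim p)
        then obtain \<psi> where \<psi>: "\<psi> \<in> SA G \<mu> (F \<union> E) n \<delta> (fst p)"
          "\<forall>e\<in>(F \<union> E) \<inter> \<Omega>. nrm (fst p) (\<lambda>i j. val e p i j - rent (\<psi> e) i j) < \<kappa>" by blast
        have "\<psi> \<in> SA G \<mu> F n \<delta> (fst p)" by (rule subsetD[OF SA_mono \<psi>(1)]) simp_all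
        moreover have "\<forall>e\<in>E. nrm (fst p) (\<lambda>i j. val e p i j - rent (restrict \<psi> E e) i j) < \<kappa>"
          using \<psi>(2) E(2) by auto
        ultimately show ?case using elim(2) by (intro bexI[of _ \<psi>]) simp_all
      qed
    qed
    also have "\<dots> \<le> sdim L G \<mu> IG + ereal \<epsilon>"
    proof (rule add_mono)
      show "sdim_E L G \<mu> E IG \<le> sdim L G \<mu> IG" unfolding sdim_def using E \<Omega> by (intro SUP_upper) auto
    qed (use small in simp)
    finally show "sdim_E L G \<mu> E \<Omega> \<le> sdim L G \<mu> IG + ereal \<epsilon>" .
  qed
qed

end

theorem theorem2p11:
  fixes G :: "'g mgroupoid" and \<mu> :: "'g measure" and \<Omega> :: "'g l2_op set"
  assumes "pmp_groupoid G \<mu>"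
    and "generating G \<mu> \<Omega>"
  shows "sofic_dimension G \<mu> = upper_sdim G \<mu> \<Omega> \<and>
    lower_sofic_dimension G \<mu> = lower_sdim G \<mu> \<Omega>"
proof -
  interpret pmp_groupoid G \<mu> by (rule assms(1))
  have \<Omega>: "\<Omega> \<subseteq> IG" "dense \<Omega>" using generating_dense[OF assms(2)] by auto
  have "sdim L G \<mu> IG = sdim L G \<mu> \<Omega>" if L: "L = limsup \<or> L = liminf" for L
    by (rule antisym[OF sofic_le_generating[OF L \<Omega>] generating_le_sofic[OF L \<Omega>]])
  then show ?thesis
    unfolding sofic_dimension_def lower_sofic_dimension_def upper_sdim_def lower_sdim_def by simp
qed

end
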